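(* Let $p,q\in\mathbb Z$, $p,q\ge2$, $\frac{p-q}2\in\mathbb Z$, $\gcd(\frac{p-q}2,q)=1$, and $k+\frac32=\frac p{2q}$. (1) There exists a non-trivial vertex superalgebra homomorphism $$\overline\Phi:V_k(osp(1,2))\rightarrow L^{ns}(c_{p,q},0)\otimes F\otimes\Pi^{1/2}(0)$$ such that $$e\mapsto e^{c},\qquad h\mapsto2\mu(-1)\mathbf 1,\qquad f\mapsto\left[(k+2)\omega_{\frac{p+q}2,q}-\nu(-1)^2-(k+1)\nu(-2)\right]e^{-c},$$ $$x\mapsto\sqrt2\,\Psi(-\tfrac12)e^{c/2},$$ $$y\mapsto\sqrt2\left[-\tfrac{\sqrt{-2k-3}}2G(-\tfrac32)+\Psi(-\tfrac12)\nu(-1)+\tfrac{2k+1}2\Psi(-\tfrac32)\right]e^{-c/2}.$$ (2) $\omega_{p,\frac{p+q}2}\in\mathrm{Com}(V_k(sl(2)),V_k(osp(1,2)))$, where $V_k(osp(1,2))$ is identified with its image under $\overline\Phi$ and $V_k(sl(2))$ is the vertex subalgebra generated by $e,f,h$.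
   Context: $V_k(\mathfrak g)$ is the simple affine vertex superalgebra of level $k$. $osp(1,2)$ has even basis $e,f,h$, odd basis $x,y$, relations $[e,f]=h$, $[h,e]=2e$, $[h,f]=-2f$, $[h,x]=x$, $[e,x]=0$, $[f,x]=-y$, $[h,y]=-y$, $[e,y]=-x$, $[f,y]=0$, $\{x,x\}=2e$, $\{x,y\}=h$, $\{y,y\}=-2f$, and form with non-trivial products $(e,f)=(f,e)=1$, $(h,h)=2$, $(x,y)=-(y,x)=2$. $\mathrm{Com}(A,B)$ is the commutant of $A$ in $B$. $c_{p,q}=\frac32-\frac{3(p-q)^2}{pq}$; $L^{ns}(c_{p,q},0)$ is the simple $N=1$ Neveu-Schwarz vertex superalgebra with conformal vector $\omega_{p,q}$ and superconformal field $G(z)=\sum_{r\in\frac12+\mathbb Z}G(r)z^{-r-3/2}$, $\{G(r),G(s)\}=2L(r+s)+\frac{c_{p,q}}3(r^2-\frac14)\delta_{r+s,0}$. $F$ is the fermionic vertex superalgebra generated by $\Psi(z)=\sum_m\Psi(m+\frac12)z^{-m-1}$, $\{\Psi(r),\Psi(s)\}=\delta_{r+s,0}$, with $\omega_F=\frac12\Psi(-\frac32)\Psi(-\frac12)\mathbf 1$. In $L^{ns}(c_{p,q},0)\otimes F$ (odd fields of the two factors anticommute) put $$\omega_{\frac{p+q}2,q}=\frac p{p+q}\omega_{p,q}+i\frac{\sqrt{pq}}{p+q}G(-\tfrac32)\Psi(-\tfrac12)\mathbf 1+\frac{2q-p}{p+q}\omega_F,$$ $$\omega_{p,\frac{p+q}2}=\frac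 q{p+q}\omega_{p,q}-i\frac{\sqrt{pq}}{p+q}G(-\tfrac32)\Psi(-\tfrac12)\mathbf 1+\frac{2p-q}{p+q}\omega_F .$$ Here $\sqrt{pq}>0$ and $\sqrt{-2k-3}=i\sqrt{2k+3}$ with $\sqrt{2k+3}>0$. Let $\langle c,c\rangle=\langle d,d\rangle=0$, $\langle c,d\rangle=2$; $M(1)$ is the Heisenberg vertex algebra generated by $c(z),d(z)$ with $[a(m),b(n)]=m\langle a,b\rangle\delta_{m+n,0}$; $\Pi^{1/2}(0)=M(1)\otimes\mathbb C[\mathbb Z\frac c2]$ with the usual lattice vertex operators (trivial cocycle); $\mu=\frac d2+\frac k4c$, $\nu=\frac d2-\frac k4c$ (so $c=\frac2k(\mu-\nu)$). Tensor signs are suppressed. *)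

theory Defs
  imports Complex_Main "HOL-Library.Poly_Mapping" "HOL-Library.Groups_Big_Fun"
begin

section \<open>Complex vector spaces\<close>

class complex_vector = ab_group_add +
  fixes scaleC :: "complex \<Rightarrow> 'a \<Rightarrow> 'a"  (infixr \<open>*\<^sub>C\<close> 75)
  assumes scaleC_add_right: "a *\<^sub>C (x + y) = a *\<^sub>C x + a *\<^sub>C y"
    and scaleC_add_left: "(a + b) *\<^sub>C x = a *\<^sub>C x + b *\<^sub>C x"
    and scaleC_scaleC: "a *\<^sub>C (b *\<^sub>C x) = (a * b) *\<^sub>C x"
    and scaleC_one: "1 *\<^sub>C x = x"

global_interpretation complex_vector: vector_space "scaleC :: complex \<Rightarrow> 'a \<Rightarrow> 'a::complex_vector"
  by unfold_locales
    (simp_all add: scaleC_add_right scaleC_add_left scaleC_scaleC scaleC_one)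

abbreviation clinear :: "('a::complex_vector \<Rightarrow> 'b::complex_vector) \<Rightarrow> bool" where
  "clinear \<equiv> Vector_Spaces.linear scaleC scaleC"

definition cbilinear ::
  "('a::complex_vector \<Rightarrow> 'b::complex_vector \<Rightarrow> 'c::complex_vector) \<Rightarrow> bool" where
  "cbilinear f \<longleftrightarrow> (\<forall>x. clinear (f x)) \<and> (\<forall>y. clinear (\<lambda>x. f x y))"

instantiation complex :: complex_vector
begin

definition scaleC_complex :: "complex \<Rightarrow> complex \<Rightarrow> complex" where
  "scaleC_complex = (*)"

instance
  by standard (simp_all add: scaleC_complex_def algebra_simps)

end

instantiation poly_mapping :: (type, complex_vector) complex_vector
begin

lift_definition scaleC_poly_mapping :: "complex \<Rightarrow> ('a \<Rightarrow>\<^sub>0 'b) \<Rightarrow> 'a \<Rightarrow>\<^sub>0 'b"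
  is "\<lambda>c f x. c *\<^sub>C f x"
proof -
  fix c and f :: "'a \<Rightarrow> 'b"
  assume "finite {x. f x \<noteq> 0}"
  moreover have "{x. c *\<^sub>C f x \<noteq> 0} \<subseteq> {x. f x \<noteq> 0}" by auto
  ultimately show "finite {x. c *\<^sub>C f x \<noteq> 0}" by (rule finite_subset[rotated])
qed

instance
  by standard (transfer; simp add: fun_eq_iff scaleC_add_right scaleC_add_left scaleC_scaleC
      scaleC_one)+

end

subsection \<open>Tensor products\<close>

text \<open>The tensor product is the free vector space on pairs modulo the bilinearity relations.\<close>

definition tensor_null :: "(('a::complex_vector \<times> 'b::complex_vector) \<Rightarrow>\<^sub>0 complex) set" where
  "tensor_null = complex_vector.span
     ({Poly_Mapping.single (a + a', b) 1 - Poly_Mapping.single (a, b) 1 - Poly_Mapping.single (a', b) 1 |a a' b. True}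
    \<union> {Poly_Mapping.single (a, b + b') 1 - Poly_Mapping.single (a, b) 1 - Poly_Mapping.single (a, b') 1 |a b b'. True}
    \<union> {Poly_Mapping.single (r *\<^sub>C a, b) 1 - r *\<^sub>C Poly_Mapping.single (a, b) 1 |r a b. True}
    \<union> {Poly_Mapping.single (a, r *\<^sub>C b) 1 - r *\<^sub>C Poly_Mapping.single (a, b) 1 |r a b. True})"

lemma tensor_null_subspace: "complex_vector.subspace tensor_null"
  unfolding tensor_null_def by (rule complex_vector.subspace_span)

lemmas tensor_null_simps =
  complex_vector.subspace_0[OF tensor_null_subspace]
  complex_vector.subspace_add[OF tensor_null_subspace]
  complex_vector.subspace_diff[OF tensor_null_subspace]
  complex_vector.subspace_scale[OF tensor_null_subspace]
  complex_vector.subspace_neg[OF tensor_null_subspace]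

quotient_type (overloaded) ('a, 'b) tensor =
  "('a::complex_vector \<times> 'b::complex_vector) \<Rightarrow>\<^sub>0 complex" / "\<lambda>x y. x - y \<in> tensor_null"
proof (rule equivpI)
  show "reflp (\<lambda>x y :: ('a \<times> 'b) \<Rightarrow>\<^sub>0 complex. x - y \<in> tensor_null)"
    by (rule reflpI) (simp add: tensor_null_simps)
  show "symp (\<lambda>x y :: ('a \<times> 'b) \<Rightarrow>\<^sub>0 complex. x - y \<in> tensor_null)"
  proof (rule sympI)
    fix x y :: "('a \<times> 'b) \<Rightarrow>\<^sub>0 complex"
    assume "x - y \<in> tensor_null"
    from tensor_null_simps(5)[OF this] show "y - x \<in> tensor_null" by simp
  qed
  show "transp (\<lambda>x y :: ('a \<times> 'b) \<Rightarrow>\<^sub>0 complex. x - y \<in> tensor_null)"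
  proof (rule transpI)
    fix x y z :: "('a \<times> 'b) \<Rightarrow>\<^sub>0 complex"
    assume "x - y \<in> tensor_null" "y - z \<in> tensor_null"
    from tensor_null_simps(2)[OF this] show "x - z \<in> tensor_null" by simp
  qed
qed

instantiation tensor :: (complex_vector, complex_vector) complex_vector
begin

lift_definition zero_tensor :: "('a, 'b) tensor" is 0 .

lift_definition plus_tensor :: "('a, 'b) tensor \<Rightarrow> ('a, 'b) tensor \<Rightarrow> ('a, 'b) tensor" is "(+)"
proof -
  fix x x' y y' :: "('a \<times> 'b) \<Rightarrow>\<^sub>0 complex"
  assume "x - x' \<in> tensor_null" "y - y' \<in> tensor_null"
  from tensor_null_simps(2)[OF this] show "x + y - (x' + y') \<in> tensor_null"
    by (simp add: algebra_simps)
qed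

lift_definition minus_tensor :: "('a, 'b) tensor \<Rightarrow> ('a, 'b) tensor \<Rightarrow> ('a, 'b) tensor" is "(-)"
proof -
  fix x x' y y' :: "('a \<times> 'b) \<Rightarrow>\<^sub>0 complex"
  assume "x - x' \<in> tensor_null" "y - y' \<in> tensor_null"
  from tensor_null_simps(3)[OF this] show "x - y - (x' - y') \<in> tensor_null"
    by (simp add: algebra_simps)
qed

lift_definition uminus_tensor :: "('a, 'b) tensor \<Rightarrow> ('a, 'b) tensor" is uminus
proof -
  fix x x' :: "('a \<times> 'b) \<Rightarrow>\<^sub>0 complex"
  assume "x - x' \<in> tensor_null"
  from tensor_null_simps(5)[OF this] show "- x - (- x') \<in> tensor_null"
    by (simp add: algebra_simps)
qed

lift_definition scaleC_tensor :: "complex \<Rightarrow> ('a, 'b) tensor \<Rightarrow> ('a, 'b) tensor" is scaleC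
proof -
  fix c and x x' :: "('a \<times> 'b) \<Rightarrow>\<^sub>0 complex"
  assume "x - x' \<in> tensor_null"
  from tensor_null_simps(4)[OF this, of c] show "c *\<^sub>C x - c *\<^sub>C x' \<in> tensor_null"
    by (simp add: complex_vector.scale_right_diff_distrib)
qed

instance
  by standard (transfer; simp add: algebra_simps scaleC_add_right scaleC_add_left scaleC_scaleC
      scaleC_one tensor_null_simps(1))+

end

lift_definition tensor :: "'a::complex_vector \<Rightarrow> 'b::complex_vector \<Rightarrow> ('a, 'b) tensor"
  (infixr \<open>\<otimes>\<close> 72) is "\<lambda>a b. Poly_Mapping.single (a, b) 1" .

section \<open>Vertex superalgebras\<close>

text \<open>The underlying vector space is the whole type.  \<^term>\<open>part V i\<close> is the even subspace for
  \<open>i = False\<close> and the odd one for \<open>i = True\<close>, so that parities are added by \<open>\<noteq>\<close>.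
  \<^term>\<open>nprod V a n b\<close> is \<open>a\<^sub>(\<^sub>n\<^sub>) b\<close>, where \<open>Y(a, z) = \<Sum>n. a\<^sub>(\<^sub>n\<^sub>) z\<^bsup>-n-1\<^esup>\<close>.\<close>

record 'v vsa =
  part :: "bool \<Rightarrow> 'v set"
  vac :: 'v
  nprod :: "'v \<Rightarrow> int \<Rightarrow> 'v \<Rightarrow> 'v"

definition ksign :: "bool \<Rightarrow> bool \<Rightarrow> complex" where
  "ksign i j = (if i \<and> j then - 1 else 1)"

text \<open>The axioms are parity, truncation, vacuum and creation axioms and the Borcherds identity;
  the translation operator is \<open>v \<mapsto> v\<^sub>(\<^sub>-\<^sub>2\<^sub>) vac\<close> and its axioms are consequences.  By truncation
  all sums have finite support.\<close>

definition vertex_superalgebra :: "'v::complex_vector vsa \<Rightarrow> bool" where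
  "vertex_superalgebra V \<longleftrightarrow>
     complex_vector.subspace (part V False) \<and> complex_vector.subspace (part V True) \<and>
     part V False \<inter> part V True = {0} \<and>
     (\<forall>v. \<exists>v0 \<in> part V False. \<exists>v1 \<in> part V True. v = v0 + v1) \<and>
     vac V \<in> part V False \<and> vac V \<noteq> 0 \<and>
     (\<forall>n. cbilinear (\<lambda>a b. nprod V a n b)) \<and>
     (\<forall>i j. \<forall>a \<in> part V i. \<forall>b \<in> part V j. \<forall>n. nprod V a n b \<in> part V (i \<noteq> j)) \<and>
     (\<forall>a b. \<exists>N. \<forall>n \<ge> N. nprod V a n b = 0) \<and>
     (\<forall>a n. nprod V (vac V) n a = (if n = - 1 then a else 0)) \<and>
     (\<forall>a. nprod V a (- 1) (vac V) = a \<and> (\<forall>n \<ge> 0. nprod V a n (vac V) = 0)) \<and>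
     (\<forall>i j. \<forall>a \<in> part V i. \<forall>b \<in> part V j. \<forall>c l m n.
        Sum_any (\<lambda>r::nat. (of_int m gchoose r) *\<^sub>C
            nprod V (nprod V a (n + int r) b) (m + l - int r) c) =
        Sum_any (\<lambda>r::nat. ((- 1) ^ r * (of_int n gchoose r)) *\<^sub>C
            (nprod V a (m + n - int r) (nprod V b (l + int r) c)
             - ((- 1) powi n * ksign i j) *\<^sub>C
                 nprod V b (n + l - int r) (nprod V a (m + int r) c))))"

definition vertex_subalgebra :: "'v::complex_vector vsa \<Rightarrow> 'v set \<Rightarrow> bool" where
  "vertex_subalgebra V S \<longleftrightarrow> complex_vector.subspace S \<and> vac V \<in> S \<and>
     (\<forall>a \<in> S. \<forall>b \<in> S. \<forall>n. nprod V a n b \<in> S)"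

definition vsa_generated :: "'v::complex_vector vsa \<Rightarrow> 'v set \<Rightarrow> 'v set" where
  "vsa_generated V X = vertex_subalgebra V hull X"

definition vsa_ideal :: "'v::complex_vector vsa \<Rightarrow> 'v set \<Rightarrow> bool" where
  "vsa_ideal V I \<longleftrightarrow> complex_vector.subspace I \<and>
     (\<forall>v \<in> I. \<exists>v0 \<in> I \<inter> part V False. \<exists>v1 \<in> I \<inter> part V True. v = v0 + v1) \<and>
     (\<forall>a. \<forall>v \<in> I. \<forall>n. nprod V a n v \<in> I \<and> nprod V v n a \<in> I)"

definition simple_vsa :: "'v::complex_vector vsa \<Rightarrow> bool" where
  "simple_vsa V \<longleftrightarrow> vertex_superalgebra V \<and> (\<forall>I. vsa_ideal V I \<longrightarrow> I = {0} \<or> I = UNIV)"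

definition vsa_hom ::
  "'v::complex_vector vsa \<Rightarrow> 'w::complex_vector vsa \<Rightarrow> ('v \<Rightarrow> 'w) \<Rightarrow> bool" where
  "vsa_hom V W \<phi> \<longleftrightarrow> clinear \<phi> \<and> (\<forall>i. \<phi> ` part V i \<subseteq> part W i) \<and> \<phi> (vac V) = vac W \<and>
     (\<forall>a n b. \<phi> (nprod V a n b) = nprod W (\<phi> a) n (\<phi> b))"

text \<open>The condition \<open>a\<^sub>(\<^sub>n\<^sub>) b = 0\<close> for all \<open>n \<ge> 0\<close> says that the fields of \<open>a\<close> and \<open>b\<close>
  (super)commute.\<close>

definition commutant :: "'v::complex_vector vsa \<Rightarrow> 'v set \<Rightarrow> 'v set \<Rightarrow> 'v set" where
  "commutant V A B = {b \<in> B. \<forall>a \<in> A. \<forall>n \<ge> 0. nprod V a n b = 0}"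

text \<open>On parity-homogeneous pure tensors
  \<open>Y(a \<otimes> b, z)(c \<otimes> d) = (-1)\<^bsup>|b||c|\<^esup> Y(a, z) c \<otimes> Y(b, z) d\<close>;
  in particular odd fields of the two factors anticommute.\<close>

definition tensor_vsa ::
  "'v::complex_vector vsa \<Rightarrow> 'w::complex_vector vsa \<Rightarrow> ('v, 'w) tensor vsa" where
  "tensor_vsa V W =
     \<lparr>part = (\<lambda>i. complex_vector.span {a \<otimes> b |a b j. a \<in> part V j \<and> b \<in> part W (i \<noteq> j)}),
      vac = vac V \<otimes> vac W,
      nprod = (\<lambda>x n y. (THE P. cbilinear P \<and>
         (\<forall>a d i j. \<forall>b \<in> part W i. \<forall>c \<in> part V j.
            P (a \<otimes> b) (c \<otimes> d) = ksign i j *\<^sub>C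
              Sum_any (\<lambda>r::int. nprod V a r c \<otimes> nprod W b (n - 1 - r) d))) x y)\<rparr>"

text \<open>\<open>[a\<^sub>(\<^sub>m\<^sub>), b\<^sub>(\<^sub>n\<^sub>)] v\<close> for \<open>a\<close>, \<open>b\<close> of parities \<open>i\<close>, \<open>j\<close>.\<close>

definition scomm ::
  "'v::complex_vector vsa \<Rightarrow> bool \<Rightarrow> bool \<Rightarrow> 'v \<Rightarrow> int \<Rightarrow> 'v \<Rightarrow> int \<Rightarrow> 'v \<Rightarrow> 'v" where
  "scomm V i j a m b n v =
     nprod V a m (nprod V b n v) - ksign i j *\<^sub>C nprod V b n (nprod V a m v)"

section \<open>The simple affine vertex superalgebra of \<open>osp(1,2)\<close>\<close>

datatype osp12_basis = osp_e | osp_f | osp_h | osp_x | osp_y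

fun osp12_odd :: "osp12_basis \<Rightarrow> bool" where
  "osp12_odd osp_x = True"
| "osp12_odd osp_y = True"
| "osp12_odd _ = False"

fun osp12_bracket :: "osp12_basis \<Rightarrow> osp12_basis \<Rightarrow> (osp12_basis \<Rightarrow>\<^sub>0 complex)" where
  "osp12_bracket osp_e osp_f = Poly_Mapping.single osp_h 1"
| "osp12_bracket osp_f osp_e = Poly_Mapping.single osp_h (- 1)"
| "osp12_bracket osp_h osp_e = Poly_Mapping.single osp_e 2"
| "osp12_bracket osp_e osp_h = Poly_Mapping.single osp_e (- 2)"
| "osp12_bracket osp_h osp_f = Poly_Mapping.single osp_f (- 2)"
| "osp12_bracket osp_f osp_h = Poly_Mapping.single osp_f 2"
| "osp12_bracket osp_h osp_x = Poly_Mapping.single osp_x 1"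
| "osp12_bracket osp_x osp_h = Poly_Mapping.single osp_x (- 1)"
| "osp12_bracket osp_f osp_x = Poly_Mapping.single osp_y (- 1)"
| "osp12_bracket osp_x osp_f = Poly_Mapping.single osp_y 1"
| "osp12_bracket osp_h osp_y = Poly_Mapping.single osp_y (- 1)"
| "osp12_bracket osp_y osp_h = Poly_Mapping.single osp_y 1"
| "osp12_bracket osp_e osp_y = Poly_Mapping.single osp_x (- 1)"
| "osp12_bracket osp_y osp_e = Poly_Mapping.single osp_x 1"
| "osp12_bracket osp_x osp_x = Poly_Mapping.single osp_e 2"
| "osp12_bracket osp_x osp_y = Poly_Mapping.single osp_h 1"
| "osp12_bracket osp_y osp_x = Poly_Mapping.single osp_h 1"
| "osp12_bracket osp_y osp_y = Poly_Mapping.single osp_f (- 2)"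
| "osp12_bracket _ _ = 0"

fun osp12_form :: "osp12_basis \<Rightarrow> osp12_basis \<Rightarrow> complex" where
  "osp12_form osp_e osp_f = 1"
| "osp12_form osp_f osp_e = 1"
| "osp12_form osp_h osp_h = 2"
| "osp12_form osp_x osp_y = 2"
| "osp12_form osp_y osp_x = - 2"
| "osp12_form _ _ = 0"

text \<open>The vertex superalgebras generated by fields \<open>a(z) = \<Sum>n. a(n) z\<^bsup>-n-1\<^esup>\<close>, \<open>a \<in> osp(1,2)\<close>,
  satisfying the relations of the affinization at level \<open>k\<close> are exactly the quotients of the
  universal one; for \<open>k\<close> different from the critical level \<open>-3/2\<close> there is up to isomorphism
  exactly one simple one among them.\<close>

definition simple_affine_osp12 ::
  "complex \<Rightarrow> 'v::complex_vector vsa \<Rightarrow> (osp12_basis \<Rightarrow> 'v) \<Rightarrow> bool" where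
  "simple_affine_osp12 k V \<iota> \<longleftrightarrow> simple_vsa V \<and>
     (\<forall>a. \<iota> a \<in> part V (osp12_odd a)) \<and>
     (\<forall>a b m n v. scomm V (osp12_odd a) (osp12_odd b) (\<iota> a) m (\<iota> b) n v =
        Sum_any (\<lambda>g. Poly_Mapping.lookup (osp12_bracket a b) g *\<^sub>C nprod V (\<iota> g) (m + n) v)
        + (if m + n = 0 then (of_int m * osp12_form a b * k) *\<^sub>C v else 0)) \<and>
     vsa_generated V (range \<iota>) = UNIV"

section \<open>The simple Neveu-Schwarz vertex superalgebra and the free fermion\<close>

definition c_pq :: "int \<Rightarrow> int \<Rightarrow> complex" where
  "c_pq p q = 3 / 2 - 3 * (of_int p - of_int q)\<^sup>2 / (of_int p * of_int q)"

text \<open>Here \<open>L(n) = \<omega>\<^sub>(\<^sub>n\<^sub>+\<^sub>1\<^sub>)\<close> and \<open>G(n + 1/2) = G\<^sub>(\<^sub>n\<^sub>+\<^sub>1\<^sub>)\<close> for integers \<open>n\<close>.  The relations are, in order,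
  \<open>[L(m), L(n)] = (m - n) L(m + n) + c/12 (m\<^sup>3 - m) \<delta>\<^bsub>m+n,0\<^esub>\<close>,
  \<open>[L(m), G(r)] = (m/2 - r) G(m + r)\<close> with \<open>r = n + 1/2\<close>,
  \<open>{G(r), G(s)} = 2 L(r + s) + c/3 (r\<^sup>2 - 1/4) \<delta>\<^bsub>r+s,0\<^esub>\<close> with \<open>r = m + 1/2\<close>, \<open>s = n + 1/2\<close>,
  and \<open>L(-1)\<close> is the translation operator.\<close>

definition simple_neveu_schwarz ::
  "complex \<Rightarrow> 'v::complex_vector vsa \<Rightarrow> 'v \<Rightarrow> 'v \<Rightarrow> bool" where
  "simple_neveu_schwarz c V \<omega> G \<longleftrightarrow> simple_vsa V \<and>
     \<omega> \<in> part V False \<and> G \<in> part V True \<and>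
     (\<forall>m n v. scomm V False False \<omega> (m + 1) \<omega> (n + 1) v =
        of_int (m - n) *\<^sub>C nprod V \<omega> (m + n + 1) v
        + (if m + n = 0 then (c / 12 * of_int (m ^ 3 - m)) *\<^sub>C v else 0)) \<and>
     (\<forall>m n v. scomm V False True \<omega> (m + 1) G (n + 1) v =
        (of_int m / 2 - (of_int n + 1 / 2)) *\<^sub>C nprod V G (m + n + 1) v) \<and>
     (\<forall>m n v. scomm V True True G (m + 1) G (n + 1) v =
        2 *\<^sub>C nprod V \<omega> (m + n + 2) v
        + (if m + n + 1 = 0 then (c / 3 * ((of_int m + 1 / 2)\<^sup>2 - 1 / 4)) *\<^sub>C v else 0)) \<and>
     (\<forall>v. nprod V \<omega> 0 v = nprod V v (- 2) (vac V)) \<and>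
     vsa_generated V {\<omega>, G} = UNIV"

text \<open>Here \<open>\<Psi>(m + 1/2) = \<Psi>\<^sub>(\<^sub>m\<^sub>)\<close> for integers \<open>m\<close>.\<close>

definition free_fermion :: "'v::complex_vector vsa \<Rightarrow> 'v \<Rightarrow> bool" where
  "free_fermion V \<Psi> \<longleftrightarrow> vertex_superalgebra V \<and> \<Psi> \<in> part V True \<and>
     (\<forall>m n v. scomm V True True \<Psi> m \<Psi> n v = (if m + n + 1 = 0 then v else 0)) \<and>
     vsa_generated V {\<Psi>} = UNIV"

definition fermion_omega :: "'v::complex_vector vsa \<Rightarrow> 'v \<Rightarrow> 'v" where
  "fermion_omega F \<Psi> = (1 / 2) *\<^sub>C nprod F \<Psi> (- 2) (nprod F \<Psi> (- 1) (vac F))"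

text \<open>\<open>G(-3/2) \<Psi>(-1/2) vac\<close> in the tensor product.\<close>

definition G_Psi ::
  "'l::complex_vector vsa \<Rightarrow> 'l \<Rightarrow> 'f::complex_vector vsa \<Rightarrow> 'f \<Rightarrow> ('l, 'f) tensor" where
  "G_Psi L G F \<Psi> = nprod (tensor_vsa L F) (G \<otimes> vac F) (- 1)
     (nprod (tensor_vsa L F) (vac L \<otimes> \<Psi>) (- 1) (vac (tensor_vsa L F)))"

text \<open>The vectors \<open>\<omega>\<close> with indices \<open>((p + q)/2, q)\<close> and \<open>(p, (p + q)/2)\<close>.\<close>

definition omega_left :: "int \<Rightarrow> int \<Rightarrow> 'l::complex_vector vsa \<Rightarrow> 'l \<Rightarrow> 'l \<Rightarrow>
    'f::complex_vector vsa \<Rightarrow> 'f \<Rightarrow> ('l, 'f) tensor" where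
  "omega_left p q L \<omega> G F \<Psi> =
     (of_int p / of_int (p + q)) *\<^sub>C (\<omega> \<otimes> vac F)
     + (\<i> * of_real (sqrt (of_int (p * q))) / of_int (p + q)) *\<^sub>C G_Psi L G F \<Psi>
     + (of_int (2 * q - p) / of_int (p + q)) *\<^sub>C (vac L \<otimes> fermion_omega F \<Psi>)"

definition omega_right :: "int \<Rightarrow> int \<Rightarrow> 'l::complex_vector vsa \<Rightarrow> 'l \<Rightarrow> 'l \<Rightarrow>
    'f::complex_vector vsa \<Rightarrow> 'f \<Rightarrow> ('l, 'f) tensor" where
  "omega_right p q L \<omega> G F \<Psi> =
     (of_int q / of_int (p + q)) *\<^sub>C (\<omega> \<otimes> vac F)
     - (\<i> * of_real (sqrt (of_int (p * q))) / of_int (p + q)) *\<^sub>C G_Psi L G F \<Psi>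
     + (of_int (2 * p - q) / of_int (p + q)) *\<^sub>C (vac L \<otimes> fermion_omega F \<Psi>)"

section \<open>The Heisenberg vertex algebra and the half-lattice vertex algebra\<close>

text \<open>\<open>[a(m), b(n)] = m \<langle>a,b\<rangle> \<delta>\<^bsub>m+n,0\<^esub>\<close> with \<open>\<langle>c,c\<rangle> = \<langle>d,d\<rangle> = 0\<close> and \<open>\<langle>c,d\<rangle> = 2\<close>.\<close>

definition heisenberg_vsa :: "'m::complex_vector vsa \<Rightarrow> 'm \<Rightarrow> 'm \<Rightarrow> bool" where
  "heisenberg_vsa M c d \<longleftrightarrow> vertex_superalgebra M \<and> part M True = {0} \<and>
     (\<forall>m n v. scomm M False False c m c n v = 0) \<and>
     (\<forall>m n v. scomm M False False d m d n v = 0) \<and>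
     (\<forall>m n v. scomm M False False c m d n v = (if m + n = 0 then (2 * of_int m) *\<^sub>C v else 0)) \<and>
     vsa_generated M {c, d} = UNIV"

text \<open>For commuting operators \<open>x\<^sub>j\<close>, \<open>exp_coeff x n\<close> is the coefficient of \<open>t\<^sup>n\<close> in
  \<open>exp (\<Sum>j\<ge>1. x\<^sub>j t\<^sup>j / j)\<close>; the recursion comes from differentiating with respect to \<open>t\<close>.\<close>

fun exp_coeff :: "(nat \<Rightarrow> 'v \<Rightarrow> 'v) \<Rightarrow> nat \<Rightarrow> 'v \<Rightarrow> 'v::complex_vector" where
  "exp_coeff x 0 v = v"
| "exp_coeff x (Suc n) v =
     (1 / of_nat (Suc n)) *\<^sub>C (\<Sum>j \<in> {0..n}. x (Suc j) (exp_coeff x (n - j) v))"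

text \<open>The group algebra of \<open>\<int> c/2\<close> is \<^typ>\<open>int \<Rightarrow>\<^sub>0 complex\<close>, with \<open>e\<^bsup>sc/2\<^esup>\<close> written
  \<^term>\<open>Poly_Mapping.single s 1\<close>.  The structure on the tensor product with \<open>M(1)\<close> is the one in which
  \<open>h(n)\<close> acts for \<open>n \<noteq> 0\<close> on the first factor only, \<open>h(0)\<close> acts on \<open>e\<^sup>\<beta>\<close> by \<open>\<langle>h,\<beta>\<rangle>\<close> (which is \<open>0\<close> for
  \<open>h = c\<close> and \<open>s\<close> for \<open>h = d\<close>, \<open>\<beta> = sc/2\<close>), and, with \<open>\<alpha> = rc/2\<close>,
  \<open>Y(e\<^sup>\<alpha>, z) = exp(\<Sum>j\<ge>1. \<alpha>(-j) z\<^sup>j / j) exp(- \<Sum>j\<ge>1. \<alpha>(j) z\<^bsup>-j\<^esup> / j) e\<^sup>\<alpha> z\<^bsup>\<alpha>(0)\<^esup>\<close>;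
  here \<open>z\<^bsup>\<alpha>(0)\<^esup> = 1\<close>, because \<open>\<int> c/2\<close> is isotropic.  The term with index \<open>t\<close> below takes \<open>z\<^bsup>-t\<^esup>\<close> from
  the second exponential and \<open>z\<^bsup>t-N-1\<^esup>\<close> from the first.\<close>

definition half_lattice_vsa :: "'m::complex_vector vsa \<Rightarrow> 'm \<Rightarrow> 'm \<Rightarrow>
    ('m, int \<Rightarrow>\<^sub>0 complex) tensor vsa \<Rightarrow> bool" where
  "half_lattice_vsa M c d P \<longleftrightarrow> vertex_superalgebra P \<and> part P True = {0} \<and>
     vac P = vac M \<otimes> Poly_Mapping.single 0 1 \<and>
     (\<forall>n u s. nprod P (c \<otimes> Poly_Mapping.single 0 1) n (u \<otimes> Poly_Mapping.single s 1) =
        nprod M c n u \<otimes> Poly_Mapping.single s 1) \<and>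
     (\<forall>n u s. nprod P (d \<otimes> Poly_Mapping.single 0 1) n (u \<otimes> Poly_Mapping.single s 1) =
        nprod M d n u \<otimes> Poly_Mapping.single s 1
        + (if n = 0 then of_int s *\<^sub>C (u \<otimes> Poly_Mapping.single s 1) else 0)) \<and>
     (\<forall>r N u s. nprod P (vac M \<otimes> Poly_Mapping.single r 1) N (u \<otimes> Poly_Mapping.single s 1) =
        Sum_any (\<lambda>t::nat. if int t - N - 1 < 0 then 0 else
          exp_coeff (\<lambda>j v. nprod M ((of_int r / 2) *\<^sub>C c) (- int j) v) (nat (int t - N - 1))
            (exp_coeff (\<lambda>j v. - nprod M ((of_int r / 2) *\<^sub>C c) (int j) v) t u)
          \<otimes> Poly_Mapping.single (r + s) 1))"

end

(*
  The explicit vectors satisfy the relations of the affinization of osp(1,2); since e and f are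
  squares of x and y, it suffices to check the relations involving h, x and y, which follow from a
  finite table of n-th products.  Let D be the subalgebra of V x W generated by the pairs of
  corresponding generators.  It is bigraded by the Sugawara weight and the eigenvalue s of h(0).  If
  D contained some (0, u) with u nonzero, one of lowest weight and highest s would be annihilated by
  all positive modes and by e(0), x(0).  The half-lattice, fermion and Neveu-Schwarz factors have so
  few singular vectors that u = r e^(sc/2) follows; then f(1) u = 0 gives s = 0 or s = 2k + 2, and the
  second value is excluded by the parity of s and gcd((p-q)/2, q) = 1.  For s = 0, u is a multiple of
  the vacuum, which is impossible.  Hence D is the graph of the homomorphism.  Finally, the conformal
  vector with index (p, (p+q)/2) is the difference of the Sugawara vectors of osp(1,2) and sl(2).
*)
theory Submission
  imports Defs "HOL-Library.Product_Plus" "HOL-Computational_Algebra.Formal_Power_Series"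
begin

section \<open>Linear and bilinear maps\<close>

text \<open>The target is only given as a tensor product, so its Borcherds identity must be
  established before anything can be computed in it. The identity does not multiply under tensor
  products, but two special cases do: a high power of x - y makes the products in both orders agree
  (locality), and a high power of y + z turns a product into an iterated one (weak associativity).
  Each concerns a single large exponent, and the exponents of the two factors add; a recursion then
  recovers all other indices.

  The search for singular vectors in D replaces a direct study of the maximal ideal of the universal
  algebra: the second components u of the pairs (0, u) in D form a space stable under the explicit
  generators, and such a space is 0 once it has no extremal vector. Spans of raising monomials,
  together with an operator measuring the weight, take the place of bases of the modules.

  The parameter t = 2k + 3 = p/q makes all constants polynomial in t apart from the square root of
  -t. The exceptional eigenvalue 2k + 2 is t - 1; an even integer t - 1 would make (p - q)/2 a
  multiple of q.\<close>

lemma scaleC_complex: "r *\<^sub>C (x::complex) = r * x"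
  by (simp add: scaleC_complex_def)

lemma clinear_iff:
  "clinear f \<longleftrightarrow> (\<forall>x y. f (x + y) = f x + f y) \<and> (\<forall>r x. f (r *\<^sub>C x) = r *\<^sub>C f x)"
  by (simp add: Vector_Spaces.linear_iff complex_vector.vector_space_axioms)

lemma clinearI:
  assumes "\<And>x y. f (x + y) = f x + f y" "\<And>r x. f (r *\<^sub>C x) = r *\<^sub>C f x"
  shows "clinear f"
  using assms by (simp add: clinear_iff)

lemma clinear_add: "clinear f \<Longrightarrow> f (x + y) = f x + f y"
  and clinear_scale: "clinear f \<Longrightarrow> f (r *\<^sub>C x) = r *\<^sub>C f x"
  by (simp_all add: clinear_iff)

lemma clinear_0: "clinear f \<Longrightarrow> f 0 = 0"
  using clinear_add[of f 0 0] by simp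

lemma clinear_neg: "clinear f \<Longrightarrow> f (- x) = - f x"
  using clinear_add[of f x "- x"] by (simp add: clinear_0 eq_neg_iff_add_eq_0 add.commute)

lemma clinear_diff: "clinear f \<Longrightarrow> f (x - y) = f x - f y"
  using clinear_add[of f x "- y"] by (simp add: clinear_neg)

lemma clinear_sum: "clinear f \<Longrightarrow> f (sum g A) = (\<Sum>a\<in>A. f (g a))"
  by (induction A rule: infinite_finite_induct) (simp_all add: clinear_0 clinear_add)

lemmas clinear_simps = clinear_add clinear_scale clinear_0 clinear_neg clinear_diff clinear_sum

lemma clinear_id: "clinear (\<lambda>x. x)"
  by (simp add: clinear_iff)

lemma clinear_compose: "clinear f \<Longrightarrow> clinear g \<Longrightarrow> clinear (\<lambda>x. f (g x))"
  by (simp add: clinear_iff)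

lemma clinear_plus: "clinear f \<Longrightarrow> clinear g \<Longrightarrow> clinear (\<lambda>x. f x + g x)"
  by (simp add: clinear_iff scaleC_add_right ac_simps)

lemma clinear_cmul: "clinear f \<Longrightarrow> clinear (\<lambda>x. r *\<^sub>C f x)"
  by (simp add: clinear_iff scaleC_add_right scaleC_scaleC mult.commute)

lemma clinear_uminus: "clinear f \<Longrightarrow> clinear (\<lambda>x. - f x)"
  by (simp add: clinear_iff)

lemma clinear_minus: "clinear f \<Longrightarrow> clinear g \<Longrightarrow> clinear (\<lambda>x. f x - g x)"
  using clinear_plus[of f "\<lambda>x. - g x"] clinear_uminus[of g] by simp

lemma cbilinear_iff: "cbilinear f \<longleftrightarrow> (\<forall>x. clinear (f x)) \<and> (\<forall>y. clinear (\<lambda>x. f x y))"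
  by (simp add: cbilinear_def)

lemma cbilinearD: "cbilinear f \<Longrightarrow> clinear (f x)" "cbilinear f \<Longrightarrow> clinear (\<lambda>x. f x y)"
  by (simp_all add: cbilinear_iff)

lemma clinear_vanish_on_span:
  assumes "clinear f" "\<And>x. x \<in> S \<Longrightarrow> f x = 0" "x \<in> complex_vector.span S"
  shows "f x = 0"
  using assms(3)
  by (induction rule: complex_vector.span_induct_alt) (simp_all add: assms(1,2) clinear_simps)

lemma clinear_maps_span:
  assumes "clinear f" "\<And>x. x \<in> S \<Longrightarrow> f x \<in> complex_vector.span T" "x \<in> complex_vector.span S"
  shows "f x \<in> complex_vector.span T"
  using assms(3)
  by (induction rule: complex_vector.span_induct_alt)
    (simp_all add: assms(1,2) clinear_simps complex_vector.span_zero complex_vector.span_add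
      complex_vector.span_scale)

lemma clinear_maps_span_subspace:
  assumes "clinear f" "\<And>x. x \<in> S \<Longrightarrow> f x \<in> T" "complex_vector.subspace T"
    "x \<in> complex_vector.span S"
  shows "f x \<in> T"
  using clinear_maps_span[OF assms(1) _ assms(4), of T] assms(2,3)
  by (metis complex_vector.span_eq_iff)

lemma Sum_any_clinear:
  assumes "clinear f" "finite {x. g x \<noteq> 0}"
  shows "f (Sum_any g) = Sum_any (\<lambda>x. f (g x))"
proof -
  have "{x. f (g x) \<noteq> 0} \<subseteq> {x. g x \<noteq> 0}" using clinear_0[OF assms(1)] by auto
  then show ?thesis
    by (simp add: Sum_any.expand_superset[OF assms(2)] Sum_any.expand_set[of g] clinear_sum[OF assms(1)])
qed

section \<open>Tensor products\<close>

definition pm_lift :: "('a \<Rightarrow> 'c::complex_vector) \<Rightarrow> ('a \<Rightarrow>\<^sub>0 complex) \<Rightarrow> 'c" where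
  "pm_lift f x = (\<Sum>p\<in>Poly_Mapping.keys x. Poly_Mapping.lookup x p *\<^sub>C f p)"

lemma pm_lift_superset:
  "finite A \<Longrightarrow> Poly_Mapping.keys x \<subseteq> A \<Longrightarrow> pm_lift f x = (\<Sum>p\<in>A. Poly_Mapping.lookup x p *\<^sub>C f p)"
  unfolding pm_lift_def by (rule sum.mono_neutral_left) (auto simp: in_keys_iff)

lemma lookup_scaleC: "Poly_Mapping.lookup (r *\<^sub>C x) p = r *\<^sub>C Poly_Mapping.lookup x p"
  by transfer simp

lemma clinear_pm_lift: "clinear (pm_lift f)"
proof (rule clinearI)
  fix x y :: "'a \<Rightarrow>\<^sub>0 complex" and r
  let ?A = "Poly_Mapping.keys x \<union> Poly_Mapping.keys y"
  have "pm_lift f (x + y) = (\<Sum>p\<in>?A. Poly_Mapping.lookup (x + y) p *\<^sub>C f p)"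
    by (rule pm_lift_superset) (use keys_add[of x y] in auto)
  also have "\<dots> = pm_lift f x + pm_lift f y"
    by (simp add: lookup_add scaleC_add_left sum.distrib pm_lift_superset[of ?A x] pm_lift_superset[of ?A y])
  finally show "pm_lift f (x + y) = pm_lift f x + pm_lift f y" .
  have "pm_lift f (r *\<^sub>C x) = (\<Sum>p\<in>Poly_Mapping.keys x. Poly_Mapping.lookup (r *\<^sub>C x) p *\<^sub>C f p)"
    by (rule pm_lift_superset) (auto simp: in_keys_iff lookup_scaleC)
  also have "\<dots> = r *\<^sub>C pm_lift f x"
    by (simp add: pm_lift_def lookup_scaleC complex_vector.scale_sum_right scaleC_scaleC scaleC_complex)
  finally show "pm_lift f (r *\<^sub>C x) = r *\<^sub>C pm_lift f x" .
qed

lemma pm_lift_single: "pm_lift f (Poly_Mapping.single p c) = c *\<^sub>C f p"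
  by (subst pm_lift_superset[of "{p}"]) auto

text \<open>The universal property of the tensor product. The map is computed on a chosen
  representative; for bilinear \<open>f\<close> the choice is immaterial by
  \<open>tlift_abs\<close>.\<close>

definition tlift :: "('a::complex_vector \<Rightarrow> 'b::complex_vector \<Rightarrow> 'c::complex_vector) \<Rightarrow>
    ('a, 'b) tensor \<Rightarrow> 'c" where
  "tlift f t = pm_lift (\<lambda>(a, b). f a b) (rep_tensor t)"

text \<open>Bilinearity kills each of the four kinds of relators, so the linear extension vanishes
  on their span and descends to the quotient.\<close>

lemma pm_lift_tensor_null:
  assumes "cbilinear f" "x \<in> tensor_null"
  shows "pm_lift (\<lambda>(a, b). f a b) x = 0"
  by (rule clinear_vanish_on_span[OF clinear_pm_lift _ assms(2)[unfolded tensor_null_def]])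
    (auto simp: clinear_simps[OF clinear_pm_lift] pm_lift_single scaleC_one
      clinear_simps[OF cbilinearD(1)[OF assms(1)]] clinear_add[OF cbilinearD(2)[OF assms(1)]]
      clinear_scale[OF cbilinearD(2)[OF assms(1)]])

lemma tlift_abs:
  assumes "cbilinear f"
  shows "tlift f (abs_tensor x) = pm_lift (\<lambda>(a, b). f a b) x"
proof -
  have "rep_tensor (abs_tensor x) - x \<in> tensor_null"
    using rep_abs_rsp[OF Quotient3_tensor, of x x]
    by (metis Quotient3_rel_rep Quotient3_tensor Quotient3_abs_rep tensor.abs_eq_iff)
  from pm_lift_tensor_null[OF assms this] show ?thesis
    by (simp add: tlift_def clinear_diff[OF clinear_pm_lift])
qed

lemma clinear_tlift: "cbilinear f \<Longrightarrow> clinear (tlift f)"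
proof (rule clinearI)
  assume f: "cbilinear f"
  fix x y :: "('a, 'b) tensor" and r
  obtain x' y' where xy: "x = abs_tensor x'" "y = abs_tensor y'"
    by (metis Quotient3_abs_rep[OF Quotient3_tensor])
  show "tlift f (x + y) = tlift f x + tlift f y"
    by (simp add: xy plus_tensor.abs_eq tlift_abs[OF f] clinear_add[OF clinear_pm_lift])
  show "tlift f (r *\<^sub>C x) = r *\<^sub>C tlift f x"
    by (simp add: xy scaleC_tensor.abs_eq tlift_abs[OF f] clinear_scale[OF clinear_pm_lift])
qed

lemma tlift_tensor [simp]: "cbilinear f \<Longrightarrow> tlift f (a \<otimes> b) = f a b"
  by (simp add: tensor.abs_eq tlift_abs pm_lift_single scaleC_one)

lemma cbilinear_tensor: "cbilinear (\<otimes>)"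
proof -
  have eq: "abs_tensor x = abs_tensor y"
    if "x - y \<in> tensor_null" for x y :: "('a \<times> 'b) \<Rightarrow>\<^sub>0 complex"
    using that by (simp add: tensor.abs_eq_iff)
  have gen: "x \<in> tensor_null" if "x \<in> {Poly_Mapping.single (a + a', b) 1 - Poly_Mapping.single (a, b) 1 - Poly_Mapping.single (a', b) 1 |a a' b. True}
    \<union> {Poly_Mapping.single (a, b + b') 1 - Poly_Mapping.single (a, b) 1 - Poly_Mapping.single (a, b') 1 |a b b'. True}
    \<union> {Poly_Mapping.single (r *\<^sub>C a, b) 1 - r *\<^sub>C Poly_Mapping.single (a, b) 1 |r a b. True}
    \<union> {Poly_Mapping.single (a, r *\<^sub>C b) 1 - r *\<^sub>C Poly_Mapping.single (a, b) 1 |r a b. True}"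
    for x :: "('a \<times> 'b) \<Rightarrow>\<^sub>0 complex"
    unfolding tensor_null_def by (rule complex_vector.span_base) (use that in blast)
  have 1: "(a + a') \<otimes> b = a \<otimes> b + a' \<otimes> b" for a a' :: 'a and b :: 'b
    unfolding tensor.abs_eq plus_tensor.abs_eq
    by (rule eq, subst diff_diff_eq[symmetric], rule gen) blast
  have 2: "a \<otimes> (b + b') = a \<otimes> b + a \<otimes> b'" for a :: 'a and b b' :: 'b
    unfolding tensor.abs_eq plus_tensor.abs_eq
    by (rule eq, subst diff_diff_eq[symmetric], rule gen) blast
  have 3: "(r *\<^sub>C a) \<otimes> b = r *\<^sub>C (a \<otimes> b)" for r and a :: 'a and b :: 'b
    unfolding tensor.abs_eq scaleC_tensor.abs_eq
    by (rule eq, rule gen) blast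
  have 4: "a \<otimes> (r *\<^sub>C b) = r *\<^sub>C (a \<otimes> b)" for r and a :: 'a and b :: 'b
    unfolding tensor.abs_eq scaleC_tensor.abs_eq
    by (rule eq, rule gen) blast
  show ?thesis by (simp add: cbilinear_iff clinear_iff 1 2 3 4)
qed

lemmas clinear_tensor_right = cbilinearD(1)[OF cbilinear_tensor]
  and clinear_tensor_left = cbilinearD(2)[OF cbilinear_tensor]

lemmas tensor_simps = clinear_simps[OF clinear_tensor_right] clinear_simps[OF clinear_tensor_left]

text \<open>Remove one key at a time from a representative. The coefficient is absorbed into the
  left factor, and zero is \<open>0 \<otimes> 0\<close>, so sums and pure tensors are the only
  cases.\<close>

lemma tensor_induct [case_names add tensor, induct type: tensor]:
  assumes add: "\<And>x y. Q x \<Longrightarrow> Q y \<Longrightarrow> Q (x + y)" and tensor: "\<And>a b. Q (a \<otimes> b)"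
  shows "Q (t :: ('a::complex_vector, 'b::complex_vector) tensor)"
proof -
  have "Q (abs_tensor x)" if "finite A" "A = Poly_Mapping.keys x" for A and x :: "('a \<times> 'b) \<Rightarrow>\<^sub>0 complex"
    using that
  proof (induction A arbitrary: x rule: finite_induct)
    case empty
    then have "x = 0" using keys_eq_empty[of x] by simp
    then show ?case using tensor[of 0 0] by (simp add: tensor_simps zero_tensor.abs_eq)
  next
    case (insert p A)
    let ?s = "Poly_Mapping.single p (Poly_Mapping.lookup x p)"
    have "A = Poly_Mapping.keys (x - ?s)"
      using insert.hyps(2) insert.prems
      by (auto simp: in_keys_iff lookup_minus lookup_single when_def split: if_splits)
    then have 1: "Q (abs_tensor (x - ?s))" by (rule insert.IH)
    obtain a b where p: "p = (a, b)" by (cases p)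
    have "?s = Poly_Mapping.lookup x p *\<^sub>C Poly_Mapping.single (a, b) 1"
      by (rule poly_mapping_eqI) (simp add: lookup_scaleC p lookup_single when_def scaleC_complex)
    then have "abs_tensor ?s = (Poly_Mapping.lookup x p *\<^sub>C a) \<otimes> b"
      using clinear_scale[OF clinear_tensor_left, of "Poly_Mapping.lookup x p" a b]
      by (simp only: tensor.abs_eq[of a] scaleC_tensor.abs_eq)
    then have 2: "Q (abs_tensor ?s)" using tensor by simp
    have "abs_tensor x = abs_tensor (x - ?s) + abs_tensor ?s"
      by (simp add: plus_tensor.abs_eq)
    then show ?case using add[OF 1 2] by (simp only:)
  qed
  then show ?thesis by (metis Quotient3_abs_rep[OF Quotient3_tensor] finite_keys)
qed

lemma clinear_tensor_ext:
  assumes "clinear f" "clinear g" "\<And>a b. f (a \<otimes> b) = g (a \<otimes> b)"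
  shows "f t = g t"
  by (induction t) (simp_all add: assms clinear_add)

definition tensor_map :: "('a::complex_vector \<Rightarrow> 'c::complex_vector) \<Rightarrow>
    ('b::complex_vector \<Rightarrow> 'd::complex_vector) \<Rightarrow> ('a, 'b) tensor \<Rightarrow> ('c, 'd) tensor" where
  "tensor_map f g = tlift (\<lambda>a b. f a \<otimes> g b)"

lemma cbilinear_tensor_comp:
  "clinear f \<Longrightarrow> clinear g \<Longrightarrow> cbilinear (\<lambda>a b. f a \<otimes> g b)"
  by (simp add: cbilinear_iff clinear_iff tensor_simps)

lemma clinear_tensor_map: "clinear f \<Longrightarrow> clinear g \<Longrightarrow> clinear (tensor_map f g)"
  unfolding tensor_map_def by (rule clinear_tlift[OF cbilinear_tensor_comp])

lemma tensor_map_tensor: "clinear f \<Longrightarrow> clinear g \<Longrightarrow> tensor_map f g (a \<otimes> b) = f a \<otimes> g b"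
  by (simp add: tensor_map_def cbilinear_tensor_comp)

text \<open>The slice \<phi> \<otimes> id. Slices commute with operators on the right factor, which
  reduces questions about tensors to that factor.\<close>

definition contract_left :: "('a::complex_vector \<Rightarrow> complex) \<Rightarrow> ('a, 'b::complex_vector) tensor \<Rightarrow> 'b" where
  "contract_left \<phi> = tlift (\<lambda>a b. \<phi> a *\<^sub>C b)"

lemma cbilinear_contract: "clinear \<phi> \<Longrightarrow> cbilinear (\<lambda>a b. \<phi> a *\<^sub>C b)"
  by (simp add: cbilinear_iff clinear_iff scaleC_add_left scaleC_add_right scaleC_scaleC
      scaleC_complex mult.commute)

lemma clinear_contract_left: "clinear \<phi> \<Longrightarrow> clinear (contract_left \<phi>)"
  unfolding contract_left_def by (rule clinear_tlift[OF cbilinear_contract])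

lemma contract_left_tensor: "clinear \<phi> \<Longrightarrow> contract_left \<phi> (a \<otimes> b) = \<phi> a *\<^sub>C b"
  by (simp add: contract_left_def cbilinear_contract)

definition contract_right :: "('b::complex_vector \<Rightarrow> complex) \<Rightarrow> ('a::complex_vector, 'b) tensor \<Rightarrow> 'a" where
  "contract_right \<phi> = tlift (\<lambda>a b. \<phi> b *\<^sub>C a)"

lemma cbilinear_contract_right: "clinear \<phi> \<Longrightarrow> cbilinear (\<lambda>a b. \<phi> b *\<^sub>C a)"
  by (simp add: cbilinear_iff clinear_iff scaleC_add_left scaleC_add_right scaleC_scaleC
      scaleC_complex mult.commute)

lemma clinear_contract_right: "clinear \<phi> \<Longrightarrow> clinear (contract_right \<phi>)"
  unfolding contract_right_def by (rule clinear_tlift[OF cbilinear_contract_right])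

lemma contract_right_tensor: "clinear \<phi> \<Longrightarrow> contract_right \<phi> (a \<otimes> b) = \<phi> b *\<^sub>C a"
  by (simp add: contract_right_def cbilinear_contract_right)

lemma complex_functional_exists:
  fixes a :: "'a::complex_vector"
  assumes "a \<noteq> 0"
  obtains \<phi> :: "'a \<Rightarrow> complex" where "clinear \<phi>" "\<phi> a = 1"
proof -
  interpret vector_space_pair "scaleC :: complex \<Rightarrow> 'a \<Rightarrow> 'a" "scaleC :: complex \<Rightarrow> complex \<Rightarrow> complex" ..
  have "complex_vector.independent {a}" using assms by simp
  from linear_independent_extend[OF this, of "\<lambda>_. 1"] show ?thesis using that by auto
qed

text \<open>With a basis of the left factor and its coordinate functionals, a tensor is the sum of
  the basis vectors tensored with the corresponding slices.\<close>

lemma tensor_expand_basis: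
  fixes t :: "('a::complex_vector, 'b::complex_vector) tensor"
  shows "t \<in> complex_vector.span {a \<otimes> contract_left \<phi> t |a \<phi>. clinear \<phi>}"
proof -
  define B :: "'a set" where "B = complex_vector.extend_basis {}"
  have B: "complex_vector.independent B" "\<And>a. a \<in> complex_vector.span B"
    unfolding B_def using complex_vector.independent_extend_basis[OF complex_vector.independent_empty]
      complex_vector.span_extend_basis[OF complex_vector.independent_empty] by auto
  define \<phi> where "\<phi> = (\<lambda>b a. complex_vector.representation B a b)"
  have lin: "clinear (\<phi> b)" for b
    unfolding \<phi>_def using B
    by (intro clinearI) (auto simp: complex_vector.representation_add complex_vector.representation_scale scaleC_complex)
  have fin: "finite {b. \<phi> b a \<noteq> 0}" for a
    unfolding \<phi>_def by (rule complex_vector.finite_representation)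
  have exp: "a = (\<Sum>b | \<phi> b a \<noteq> 0. \<phi> b a *\<^sub>C b)" for a
    unfolding \<phi>_def using complex_vector.sum_nonzero_representation_eq[OF B(1,2)] by simp
  \<comment> \<open>The equation is claimed for all finite supersets, so that the index sets of two
    summands can be united.\<close>
  have "\<exists>A. finite A \<and> (\<forall>A'. finite A' \<and> A \<subseteq> A' \<longrightarrow> t = (\<Sum>b\<in>A'. b \<otimes> contract_left (\<phi> b) t))"
  proof (induction t)
    case (add x y)
    then obtain A B where "finite A" "finite B"
      "\<And>A'. finite A' \<Longrightarrow> A \<subseteq> A' \<Longrightarrow> x = (\<Sum>b\<in>A'. b \<otimes> contract_left (\<phi> b) x)"
      "\<And>A'. finite A' \<Longrightarrow> B \<subseteq> A' \<Longrightarrow> y = (\<Sum>b\<in>A'. b \<otimes> contract_left (\<phi> b) y)" by metis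
    note * = this
    show ?case
    proof (intro exI[of _ "A \<union> B"] conjI allI impI)
      fix A' assume A': "finite A' \<and> A \<union> B \<subseteq> A'"
      have "(\<Sum>b\<in>A'. b \<otimes> contract_left (\<phi> b) (x + y)) =
        (\<Sum>b\<in>A'. b \<otimes> contract_left (\<phi> b) x) + (\<Sum>b\<in>A'. b \<otimes> contract_left (\<phi> b) y)"
        by (simp add: clinear_add[OF clinear_contract_left[OF lin]] tensor_simps sum.distrib)
      also have "\<dots> = x + y" using *(3)[of A'] *(4)[of A'] A' by simp
      finally show "x + y = (\<Sum>b\<in>A'. b \<otimes> contract_left (\<phi> b) (x + y))" by simp
    qed (use * in simp)
  next
    case (tensor a b)
    show ?case
    proof (intro exI[of _ "{b. \<phi> b a \<noteq> 0}"] conjI allI impI)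
      fix A' assume A': "finite A' \<and> {b. \<phi> b a \<noteq> 0} \<subseteq> A'"
      have "(\<Sum>x\<in>A'. x \<otimes> contract_left (\<phi> x) (a \<otimes> b)) = (\<Sum>x\<in>A'. \<phi> x a *\<^sub>C x) \<otimes> b"
        by (simp add: contract_left_tensor[OF lin] tensor_simps)
      also have "(\<Sum>x\<in>A'. \<phi> x a *\<^sub>C x) = (\<Sum>b | \<phi> b a \<noteq> 0. \<phi> b a *\<^sub>C b)"
        using A' by (intro sum.mono_neutral_right) auto
      also have "\<dots> = a" by (rule exp[symmetric])
      finally show "a \<otimes> b = (\<Sum>x\<in>A'. x \<otimes> contract_left (\<phi> x) (a \<otimes> b))" by simp
    qed (rule fin)
  qed
  then obtain A where A: "t = (\<Sum>b\<in>A. b \<otimes> contract_left (\<phi> b) t)" by blast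
  have "(\<Sum>b\<in>A. b \<otimes> contract_left (\<phi> b) t) \<in> complex_vector.span {a \<otimes> contract_left \<phi> t |a \<phi>. clinear \<phi>}"
    by (rule complex_vector.span_sum, rule complex_vector.span_base) (use lin in blast)
  then show ?thesis by (simp only: A[symmetric])
qed

text \<open>This is how a singular vector of a tensor product gets factored: each slice is singular
  in the right factor, hence lies on a known line, and so the vector is a pure tensor.\<close>

lemma contract_left_line:
  fixes t :: "('a::complex_vector, 'b::complex_vector) tensor"
  assumes "\<And>\<phi> :: _ \<Rightarrow> complex. clinear \<phi> \<Longrightarrow> \<exists>r. contract_left \<phi> t = r *\<^sub>C w"
  obtains a where "t = a \<otimes> w"
proof -
  have "t \<in> range (\<lambda>a. a \<otimes> w)"
  proof -
    have "{a \<otimes> contract_left \<phi> t |a \<phi>. clinear \<phi>} \<subseteq> range (\<lambda>a. a \<otimes> w)"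
    proof safe
      fix a and \<phi> :: "'a \<Rightarrow> complex" assume "clinear \<phi>"
      then obtain r where "contract_left \<phi> t = r *\<^sub>C w" using assms by blast
      then have "a \<otimes> contract_left \<phi> t = (r *\<^sub>C a) \<otimes> w" by (simp add: tensor_simps)
      then show "a \<otimes> contract_left \<phi> t \<in> range (\<lambda>a. a \<otimes> w)" by blast
    qed
    moreover have "complex_vector.subspace (range (\<lambda>a. a \<otimes> w))"
      unfolding complex_vector.subspace_def
      by (auto simp: clinear_add[OF clinear_tensor_left, symmetric]
          clinear_scale[OF clinear_tensor_left, symmetric] image_iff
          intro: exI[of _ 0] clinear_0[OF clinear_tensor_left] clinear_0[OF clinear_tensor_left, symmetric])
    ultimately show ?thesis using tensor_expand_basis[of t] complex_vector.span_minimal by blast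
  qed
  then show ?thesis using that by blast
qed

lemma tensor_eq_0_iff: "a \<otimes> b = 0 \<longleftrightarrow> a = 0 \<or> b = 0"
proof
  assume ab: "a \<otimes> b = 0"
  show "a = 0 \<or> b = 0"
  proof (rule ccontr)
    assume n: "\<not> (a = 0 \<or> b = 0)"
    then obtain \<phi> :: "'a \<Rightarrow> complex" where \<phi>: "clinear \<phi>" "\<phi> a = 1" using complex_functional_exists by blast
    have "contract_left \<phi> (a \<otimes> b) = b" by (simp add: \<phi> contract_left_tensor scaleC_one)
    moreover have "contract_left \<phi> (a \<otimes> b) = 0"
      unfolding ab by (rule clinear_0[OF clinear_contract_left[OF \<phi>(1)]])
    ultimately show False using n by simp
  qed
qed (auto simp: tensor_simps)

section \<open>Consequences of the Borcherds identity\<close>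

text \<open>\<open>Sum_any\<close> is 0 by convention when the support is infinite, so sums over
  modes are first cut off at a truncation bound and then handled as finite sums.\<close>

lemma Sum_any_lessThan:
  fixes g :: "nat \<Rightarrow> 'a::comm_monoid_add"
  assumes "\<And>r. r \<ge> R \<Longrightarrow> g r = 0"
  shows "Sum_any g = (\<Sum>r<R. g r)"
  by (rule Sum_any.expand_superset) (use assms in \<open>auto simp: not_less[symmetric]\<close>)

lemma gchoose_minus_one: "((- 1 :: complex) gchoose r) = (- 1) ^ r"
  using gbinomial_minus[of "1::complex" r] by (simp add: gbinomial_pochhammer pochhammer_fact[symmetric] power_mult_distrib[symmetric])

lemma gchoose_minus_two: "((- 2 :: complex) gchoose r) = (- 1) ^ r * of_nat (Suc r)"
proof -
  have "((2 + of_nat r - 1 :: complex) gchoose r) = of_nat (Suc r choose r)"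
    by (metis add_diff_cancel_left' binomial_gbinomial diff_add_eq numeral_2_eq_2 of_nat_1 of_nat_Suc
        one_add_one add.commute plus_1_eq_Suc add_diff_eq of_nat_add)
  then show ?thesis by (subst gbinomial_minus) simp
qed

lemma ksign_simps [simp]:
  "ksign False j = 1" "ksign i False = 1" "ksign True True = - 1" "ksign i j * ksign i j = 1"
  by (simp_all add: ksign_def)

locale vsa =
  fixes V :: "'v::complex_vector vsa"
  assumes vsa: "vertex_superalgebra V"
begin

abbreviation np :: "'v \<Rightarrow> int \<Rightarrow> 'v \<Rightarrow> 'v" where "np \<equiv> nprod V"

lemma part_subspace: "complex_vector.subspace (part V i)"
  using vsa by (cases i) (simp_all add: vertex_superalgebra_def)

lemma part_inter: "v \<in> part V False \<Longrightarrow> v \<in> part V True \<Longrightarrow> v = 0"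
  using vsa by (auto simp: vertex_superalgebra_def)

lemma part_decomp:
  obtains v0 v1 where "v0 \<in> part V False" "v1 \<in> part V True" "v = v0 + v1"
proof -
  have "\<exists>v0 \<in> part V False. \<exists>v1 \<in> part V True. v = v0 + v1"
    using vsa by (simp add: vertex_superalgebra_def)
  then show ?thesis using that by blast
qed

lemma vac_even: "vac V \<in> part V False" and vac_nonzero: "vac V \<noteq> 0"
  using vsa by (simp_all add: vertex_superalgebra_def)

lemma cbilinear_np: "cbilinear (\<lambda>a b. np a n b)"
  using vsa by (simp add: vertex_superalgebra_def)

lemma lin_right: "clinear (np a n)" and lin_left: "clinear (\<lambda>a. np a n b)"
  using cbilinearD[OF cbilinear_np] by auto

lemmas np_simps = clinear_simps[OF lin_right] clinear_simps[OF lin_left]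

lemma np_part: "a \<in> part V i \<Longrightarrow> b \<in> part V j \<Longrightarrow> np a n b \<in> part V (i \<noteq> j)"
  using vsa unfolding vertex_superalgebra_def by blast

lemma truncation: obtains N :: int where "\<And>n. n \<ge> N \<Longrightarrow> np a n b = 0"
proof -
  have "\<exists>N. \<forall>n \<ge> N. np a n b = 0" using vsa by (simp add: vertex_superalgebra_def)
  then show ?thesis using that by blast
qed

lemma truncation_nat: obtains R :: nat where "\<And>r. r \<ge> R \<Longrightarrow> np a (n + int r) b = 0"
proof -
  obtain N where N: "\<And>m. m \<ge> N \<Longrightarrow> np a m b = 0" using truncation[of a b] by blast
  show ?thesis by (rule that[of "nat (N - n)"]) (use N in auto)
qed

lemma vac_np: "np (vac V) n a = (if n = - 1 then a else 0)"
  using vsa unfolding vertex_superalgebra_def by blast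

lemma np_vac: "np a (- 1) (vac V) = a" "n \<ge> 0 \<Longrightarrow> np a n (vac V) = 0"
  using vsa unfolding vertex_superalgebra_def by blast+

lemma borcherds:
  "a \<in> part V i \<Longrightarrow> b \<in> part V j \<Longrightarrow>
   Sum_any (\<lambda>r::nat. (of_int m gchoose r) *\<^sub>C np (np a (n + int r) b) (m + l - int r) c) =
   Sum_any (\<lambda>r::nat. ((- 1) ^ r * (of_int n gchoose r)) *\<^sub>C
      (np a (m + n - int r) (np b (l + int r) c)
        - ((- 1) powi n * ksign i j) *\<^sub>C np b (n + l - int r) (np a (m + int r) c)))"
  using vsa unfolding vertex_superalgebra_def by blast

text \<open>The case of the Borcherds identity in which the exponent of x - y is 0, so that only r =
  0 remains on its right-hand side.\<close>

lemma commutator: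
  assumes "a \<in> part V i" "b \<in> part V j" "\<And>r. r \<ge> R \<Longrightarrow> np a (int r) b = 0"
  shows "np a m (np b n c) - ksign i j *\<^sub>C np b n (np a m c) =
    (\<Sum>r<R. (of_int m gchoose r) *\<^sub>C np (np a (int r) b) (m + n - int r) c)"
proof -
  have "np a m (np b n c) - ksign i j *\<^sub>C np b n (np a m c) =
    Sum_any (\<lambda>r::nat. ((- 1) ^ r * (of_int 0 gchoose r)) *\<^sub>C
      (np a (m + 0 - int r) (np b (n + int r) c)
        - ((- 1) powi 0 * ksign i j) *\<^sub>C np b (0 + n - int r) (np a (m + int r) c)))"
    by (subst Sum_any_lessThan[of 1]) (auto simp: gbinomial_0_left scaleC_one)
  also have "\<dots> = Sum_any (\<lambda>r::nat. (of_int m gchoose r) *\<^sub>C np (np a (0 + int r) b) (m + n - int r) c)"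
    by (rule borcherds[OF assms(1,2), symmetric])
  also have "\<dots> = (\<Sum>r<R. (of_int m gchoose r) *\<^sub>C np (np a (int r) b) (m + n - int r) c)"
    by (subst Sum_any_lessThan[of R]) (auto simp: assms(3) np_simps)
  finally show ?thesis .
qed

text \<open>The case m = 0 of the Borcherds identity, in which the left-hand side is a single
  iterated product.\<close>

lemma associativity:
  assumes "a \<in> part V i" "b \<in> part V j"
    "\<And>r. r \<ge> R \<Longrightarrow> (of_int n gchoose r :: complex) = 0 \<or> np b (l + int r) c = 0 \<and> np a (int r) c = 0"
  shows "np (np a n b) l c = (\<Sum>r<R. ((- 1) ^ r * (of_int n gchoose r)) *\<^sub>C
      (np a (n - int r) (np b (l + int r) c)
        - ((- 1) powi n * ksign i j) *\<^sub>C np b (n + l - int r) (np a (int r) c)))"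
proof -
  have "np (np a n b) l c =
     Sum_any (\<lambda>r::nat. (of_int 0 gchoose r) *\<^sub>C np (np a (n + int r) b) (0 + l - int r) c)"
    by (subst Sum_any_lessThan[of 1]) (auto simp: gbinomial_0_left scaleC_one)
  also have "\<dots> = Sum_any (\<lambda>r::nat. ((- 1) ^ r * (of_int n gchoose r)) *\<^sub>C
      (np a (0 + n - int r) (np b (l + int r) c)
        - ((- 1) powi n * ksign i j) *\<^sub>C np b (n + l - int r) (np a (0 + int r) c)))"
    by (rule borcherds[OF assms(1,2)])
  also have "\<dots> = (\<Sum>r<R. ((- 1) ^ r * (of_int n gchoose r)) *\<^sub>C
      (np a (0 + n - int r) (np b (l + int r) c)
        - ((- 1) powi n * ksign i j) *\<^sub>C np b (n + l - int r) (np a (0 + int r) c)))"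
    by (rule Sum_any_lessThan) (use assms(3) in \<open>force simp: np_simps\<close>)
  finally show ?thesis by simp
qed

lemma normal_product:
  assumes "a \<in> part V i" "b \<in> part V j"
    "\<And>r. r \<ge> R \<Longrightarrow> np b (l + int r) c = 0 \<and> np a (int r) c = 0"
  shows "np (np a (- 1) b) l c = (\<Sum>r<R. np a (- 1 - int r) (np b (l + int r) c)
        + ksign i j *\<^sub>C np b (l - 1 - int r) (np a (int r) c))"
  by (subst associativity[OF assms(1,2), of R])
    (use assms(3) in \<open>auto simp: gchoose_minus_one scaleC_one power_mult_distrib[symmetric]
      algebra_simps intro!: sum.cong\<close>)

text \<open>Associativity with the vacuum as second vector. The vacuum has only its mode -1, so at
  most one term of each sum survives: r = -1 - n in the first if n < 0, and r = n - 1 in the second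
  if n > 0.\<close>

lemma derivative_np: "np (np a (- 2) (vac V)) n c = (- of_int n) *\<^sub>C np a (n - 1) c"
proof -
  have hom: "np (np a (- 2) (vac V)) n c = (- of_int n) *\<^sub>C np a (n - 1) c" if a: "a \<in> part V i" for a i
  proof -
    obtain R where R: "\<And>r. r \<ge> R \<Longrightarrow> np a (0 + int r) c = 0" using truncation_nat[of a 0 c] by blast
    \<comment> \<open>The cutoff has to cover the truncation bound as well as both surviving
      indices.\<close>
    define K where "K = R + nat \<bar>n\<bar> + 1"
    have less_K: "nat (- 1 - n) < K" "nat (n - 1) < K" by (auto simp: K_def)
    have eq: "np (np a (- 2) (vac V)) n c = (\<Sum>r<K. (of_nat (Suc r)) *\<^sub>C
      (np a (- 2 - int r) (np (vac V) (n + int r) c) - np (vac V) (- 2 + n - int r) (np a (int r) c)))"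
      by (subst associativity[OF a vac_even, of K])
        (use R in \<open>auto simp: gchoose_minus_two power_mult_distrib[symmetric] vac_np K_def
          scaleC_one intro!: sum.cong\<close>)
    have 1: "(\<Sum>r<K. of_nat (Suc r) *\<^sub>C np a (- 2 - int r) (np (vac V) (n + int r) c)) =
      (if n < 0 then (- of_int n) *\<^sub>C np a (n - 1) c else 0)"
    proof -
      have "(\<Sum>r<K. of_nat (Suc r) *\<^sub>C np a (- 2 - int r) (np (vac V) (n + int r) c)) =
        (\<Sum>r<K. if r = nat (- 1 - n) then (if n < 0 then (- of_int n) *\<^sub>C np a (n - 1) c else 0) else 0)"
        by (rule sum.cong) (auto simp: vac_np np_simps)
      also have "\<dots> = (if n < 0 then (- of_int n) *\<^sub>C np a (n - 1) c else 0)"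
        using less_K by simp
      finally show ?thesis .
    qed
    have 2: "(\<Sum>r<K. of_nat (Suc r) *\<^sub>C np (vac V) (- 2 + n - int r) (np a (int r) c)) =
      (if n > 0 then of_int n *\<^sub>C np a (n - 1) c else 0)"
    proof -
      have "(\<Sum>r<K. of_nat (Suc r) *\<^sub>C np (vac V) (- 2 + n - int r) (np a (int r) c)) =
        (\<Sum>r<K. if r = nat (n - 1) then (if n > 0 then of_int n *\<^sub>C np a (n - 1) c else 0) else 0)"
        by (rule sum.cong) (auto simp: vac_np np_simps)
      also have "\<dots> = (if n > 0 then of_int n *\<^sub>C np a (n - 1) c else 0)"
        using less_K by simp
      finally show ?thesis .
    qed
    show ?thesis
      unfolding eq complex_vector.scale_right_diff_distrib sum_subtractf 1 2
      by auto
  qed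
  obtain a0 a1 where "a0 \<in> part V False" "a1 \<in> part V True" "a = a0 + a1" using part_decomp[of a] by blast
  then show ?thesis by (simp add: np_simps hom scaleC_add_right)
qed

lemma derivative_power: "np (np a (- 2) (vac V)) (- 1 - int r) (vac V) =
    of_nat (Suc r) *\<^sub>C np a (- 1 - int (Suc r)) (vac V)"
  by (simp add: derivative_np algebra_simps)

text \<open>The Borcherds identity applied to the vacuum with m = -1 and l = 0. The creation axiom
  kills everything on the right except the product b_n a, and the modes -1 - r on the left are
  divided powers of the translation operator.\<close>

lemma skew_symmetry:
  assumes "a \<in> part V i" "b \<in> part V j" "\<And>r. r \<ge> R \<Longrightarrow> np a (n + int r) b = 0"
  shows "np b n a = (- ((- 1) powi n) * ksign i j) *\<^sub>C
    (\<Sum>r<R. (- 1) ^ r *\<^sub>C np (np a (n + int r) b) (- 1 - int r) (vac V))"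
proof -
  have "(\<Sum>r<R. (- 1) ^ r *\<^sub>C np (np a (n + int r) b) (- 1 - int r) (vac V)) =
    Sum_any (\<lambda>r::nat. (of_int (- 1) gchoose r) *\<^sub>C np (np a (n + int r) b) (- 1 + 0 - int r) (vac V))"
    by (subst Sum_any_lessThan[of R]) (auto simp: assms(3) np_simps gchoose_minus_one)
  also have "\<dots> = Sum_any (\<lambda>r::nat. ((- 1) ^ r * (of_int n gchoose r)) *\<^sub>C
      (np a (- 1 + n - int r) (np b (0 + int r) (vac V))
        - ((- 1) powi n * ksign i j) *\<^sub>C np b (n + 0 - int r) (np a (- 1 + int r) (vac V))))"
    by (rule borcherds[OF assms(1,2)])
  also have "\<dots> = - (((- 1) powi n * ksign i j) *\<^sub>C np b n a)"
    by (subst Sum_any_lessThan[of 1]) (auto simp: np_vac np_simps scaleC_one)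
  finally have eq: "(\<Sum>r<R. (- 1) ^ r *\<^sub>C np (np a (n + int r) b) (- 1 - int r) (vac V)) =
    - (((- 1) powi n * ksign i j) *\<^sub>C np b n a)" .
  have sq: "((- 1) powi n * ksign i j) * ((- 1) powi n * ksign i j) = (1::complex)"
    by (simp add: power_int_mult_distrib[symmetric] ksign_def)
  show ?thesis unfolding eq using sq by (simp add: scaleC_scaleC scaleC_one)
qed

subsection \<open>Generated subalgebras\<close>

lemma vertex_subalgebra_generated: "vertex_subalgebra V (vsa_generated V X)"
  unfolding vsa_generated_def hull_def
  by (auto simp: vertex_subalgebra_def complex_vector.subspace_def)

lemma generated_base: "x \<in> X \<Longrightarrow> x \<in> vsa_generated V X"
  unfolding vsa_generated_def by (rule hull_inc)

lemma vertex_subalgebraD: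
  assumes "vertex_subalgebra V S"
  shows "complex_vector.subspace S" "vac V \<in> S" "a \<in> S \<Longrightarrow> b \<in> S \<Longrightarrow> np a n b \<in> S"
  using assms by (auto simp: vertex_subalgebra_def)

lemmas generatedD = vertex_subalgebraD[OF vertex_subalgebra_generated]

lemma generated_minimal: "X \<subseteq> S \<Longrightarrow> vertex_subalgebra V S \<Longrightarrow> vsa_generated V X \<subseteq> S"
  unfolding vsa_generated_def by (rule hull_minimal)

text \<open>For a subspace Q this is its largest parity-graded subspace. The Borcherds identity is
  stated for homogeneous vectors, so closure under products is checked on these and then
  extended.\<close>

definition homog_closure :: "'v set \<Rightarrow> 'v set" where
  "homog_closure Q = {a. \<exists>a0 \<in> Q \<inter> part V False. \<exists>a1 \<in> Q \<inter> part V True. a = a0 + a1}"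

lemma homog_closure_subset: "complex_vector.subspace Q \<Longrightarrow> homog_closure Q \<subseteq> Q"
  by (auto simp: homog_closure_def complex_vector.subspace_add)

lemma homog_closure_homog: "complex_vector.subspace Q \<Longrightarrow> a \<in> Q \<Longrightarrow> a \<in> part V i \<Longrightarrow> a \<in> homog_closure Q"
  unfolding homog_closure_def
  using complex_vector.subspace_0[of Q] complex_vector.subspace_0[OF part_subspace]
  by (cases i) (force intro: bexI[of _ 0] bexI[of _ a])+

lemma homog_closure_subspace:
  assumes "complex_vector.subspace Q"
  shows "complex_vector.subspace (homog_closure Q)"
proof (rule complex_vector.subspaceI)
  note s = complex_vector.subspace_0 complex_vector.subspace_add complex_vector.subspace_scale
  show "0 \<in> homog_closure Q"
    using homog_closure_homog[OF assms, of 0 False] s(1)[OF assms] s(1)[OF part_subspace] by simp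
  fix x y c assume "x \<in> homog_closure Q"
  then obtain x0 x1 where x: "x0 \<in> Q" "x0 \<in> part V False" "x1 \<in> Q" "x1 \<in> part V True" "x = x0 + x1"
    by (auto simp: homog_closure_def)
  have "c *\<^sub>C x = c *\<^sub>C x0 + c *\<^sub>C x1" by (simp add: x(5) scaleC_add_right)
  then show "c *\<^sub>C x \<in> homog_closure Q" unfolding homog_closure_def
    using x s(3)[OF assms] s(3)[OF part_subspace] by blast
  assume "y \<in> homog_closure Q"
  then obtain y0 y1 where y: "y0 \<in> Q" "y0 \<in> part V False" "y1 \<in> Q" "y1 \<in> part V True" "y = y0 + y1"
    by (auto simp: homog_closure_def)
  have "x + y = (x0 + y0) + (x1 + y1)" by (simp add: x(5) y(5))
  then show "x + y \<in> homog_closure Q" unfolding homog_closure_def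
    using x y s(2)[OF assms] s(2)[OF part_subspace] by blast
qed

lemma homog_closure_subalgebra:
  assumes Q: "complex_vector.subspace Q" "vac V \<in> Q"
    and prod: "\<And>a b i j n. a \<in> Q \<Longrightarrow> b \<in> Q \<Longrightarrow> a \<in> part V i \<Longrightarrow> b \<in> part V j \<Longrightarrow> np a n b \<in> Q"
  shows "vertex_subalgebra V (homog_closure Q)"
  unfolding vertex_subalgebra_def
proof (intro conjI ballI allI)
  fix a b n assume "a \<in> homog_closure Q" "b \<in> homog_closure Q"
  then obtain a0 a1 b0 b1 where
    a: "a0 \<in> Q" "a0 \<in> part V False" "a1 \<in> Q" "a1 \<in> part V True" "a = a0 + a1" and
    b: "b0 \<in> Q" "b0 \<in> part V False" "b1 \<in> Q" "b1 \<in> part V True" "b = b0 + b1"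
    by (auto simp: homog_closure_def)
  have *: "np u n v \<in> homog_closure Q"
    if "u \<in> Q" "u \<in> part V i" "v \<in> Q" "v \<in> part V j" for u v i j
    using homog_closure_homog[OF Q(1) prod[OF that(1,3,2,4)] np_part[OF that(2,4)]] .
  show "np a n b \<in> homog_closure Q"
    unfolding a(5) b(5) np_simps
    by (intro complex_vector.subspace_add[OF homog_closure_subspace[OF Q(1)]] *[OF a(1,2) b(1,2)]
        *[OF a(1,2) b(3,4)] *[OF a(3,4) b(1,2)] *[OF a(3,4) b(3,4)])
qed (use Q homog_closure_subspace homog_closure_homog[OF Q vac_even] in auto)

text \<open>By associativity, the elements all of whose modes preserve a subspace form a subalgebra.\<close>

lemma generated_preserves:
  assumes X: "\<And>x. x \<in> X \<Longrightarrow> \<exists>i. x \<in> part V i" and S: "complex_vector.subspace S"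
    and XS: "\<And>x n v. x \<in> X \<Longrightarrow> v \<in> S \<Longrightarrow> np x n v \<in> S"
    and a: "a \<in> vsa_generated V X" and v: "v \<in> S"
  shows "np a n v \<in> S"
proof -
  define Q where "Q = {a. \<forall>n. \<forall>v \<in> S. np a n v \<in> S}"
  have Q: "complex_vector.subspace Q"
    unfolding Q_def complex_vector.subspace_def
    by (auto simp: np_simps complex_vector.subspace_0[OF S] complex_vector.subspace_add[OF S]
        complex_vector.subspace_scale[OF S])
  have "vac V \<in> Q" by (auto simp: Q_def vac_np complex_vector.subspace_0[OF S])
  moreover have "np a m b \<in> Q" if "a \<in> Q" "b \<in> Q" "a \<in> part V i" "b \<in> part V j" for a b i j m
    unfolding Q_def
  proof safe
    fix n v assume v: "v \<in> S"
    obtain R1 where R1: "\<And>r. r \<ge> R1 \<Longrightarrow> np b (n + int r) v = 0" using truncation_nat[of b n v] by blast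
    obtain R2 where R2: "\<And>r. r \<ge> R2 \<Longrightarrow> np a (0 + int r) v = 0" using truncation_nat[of a 0 v] by blast
    show "np (np a m b) n v \<in> S"
      by (subst associativity[OF that(3,4), of "max R1 R2"])
        (use R1 R2 v that(1,2) in \<open>auto simp: Q_def intro!: complex_vector.subspace_sum[OF S]
           complex_vector.subspace_scale[OF S] complex_vector.subspace_diff[OF S]\<close>)
  qed
  ultimately have sub: "vertex_subalgebra V (homog_closure Q)"
    by (rule homog_closure_subalgebra[OF Q])
  have "X \<subseteq> homog_closure Q"
  proof
    fix x assume x: "x \<in> X"
    then obtain i where "x \<in> part V i" using X by blast
    moreover have "x \<in> Q" using XS x by (auto simp: Q_def)
    ultimately show "x \<in> homog_closure Q" using homog_closure_homog[OF Q] by blast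
  qed
  then have "vsa_generated V X \<subseteq> Q"
    using generated_minimal[OF _ sub] homog_closure_subset[OF Q] by blast
  then show ?thesis using a v by (auto simp: Q_def)
qed

text \<open>A vector is recovered as its own mode -1 applied to the vacuum, so stability under the
  modes of the generators is enough.\<close>

lemma generated_induct_modes:
  assumes "\<And>x. x \<in> X \<Longrightarrow> \<exists>i. x \<in> part V i" and S: "complex_vector.subspace S" "vac V \<in> S"
    and "\<And>x n v. x \<in> X \<Longrightarrow> v \<in> S \<Longrightarrow> np x n v \<in> S"
  shows "vsa_generated V X \<subseteq> S"
proof
  fix a assume "a \<in> vsa_generated V X"
  from generated_preserves[OF assms(1) S(1) assms(4) this S(2), of "- 1"] show "a \<in> S"
    by (simp add: np_vac)
qed

text \<open>For a nonnegative mode every term of the associativity formula ends in a nonnegative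
  mode of one of the two factors applied to \<open>v\<close>. The sum can therefore be cut off at 0
  terms.\<close>

lemma generated_annihilates:
  assumes X: "\<And>x. x \<in> X \<Longrightarrow> x \<in> part V False"
    and XS: "\<And>x n. x \<in> X \<Longrightarrow> n \<ge> 0 \<Longrightarrow> np x n v = 0"
    and a: "a \<in> vsa_generated V X" and n: "n \<ge> 0"
  shows "np a n v = 0"
proof -
  define Q where "Q = {a \<in> part V False. \<forall>n \<ge> 0. np a n v = 0}"
  have Q: "vertex_subalgebra V Q"
    unfolding vertex_subalgebra_def
  proof (intro conjI ballI allI)
    show "complex_vector.subspace Q"
      unfolding Q_def complex_vector.subspace_def
      by (auto simp: np_simps complex_vector.subspace_0[OF part_subspace]
         complex_vector.subspace_add[OF part_subspace] complex_vector.subspace_scale[OF part_subspace])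
    show "vac V \<in> Q" by (auto simp: Q_def vac_np vac_even)
    fix a b m assume ab: "a \<in> Q" "b \<in> Q"
    then have 1: "a \<in> part V False" "b \<in> part V False" by (auto simp: Q_def)
    have "np (np a m b) n v = 0" if "n \<ge> 0" for n
      by (subst associativity[OF 1, of 0]) (use ab that in \<open>auto simp: Q_def\<close>)
    then show "np a m b \<in> Q" using np_part[OF 1, of m] by (auto simp: Q_def)
  qed
  have "X \<subseteq> Q" using X XS by (auto simp: Q_def)
  from generated_minimal[OF this Q] a n show ?thesis by (auto simp: Q_def)
qed

text \<open>The last hypothesis says that \<open>a\<close> is primary of weight 1 for \<open>\<Omega>/\<kappa>\<close>.\<close>

lemma weight_operator_commutator:
  assumes "a \<in> part V i" "\<Omega> \<in> part V False"
    and "\<And>n. n \<ge> 0 \<Longrightarrow> np a n \<Omega> = (if n = 1 then \<kappa> *\<^sub>C a else 0)"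
  shows "np \<Omega> 1 (np a m c) = np a m (np \<Omega> 1 c) - (\<kappa> * of_int m) *\<^sub>C np a m c"
proof -
  have "np a m (np \<Omega> 1 c) - np \<Omega> 1 (np a m c) =
    (\<Sum>r<2. (of_int m gchoose r) *\<^sub>C np (np a (int r) \<Omega>) (m + 1 - int r) c)"
    using commutator[OF assms(1,2), of 2 m 1 c] assms(3) by (simp add: scaleC_one)
  also have "\<dots> = (\<kappa> * of_int m) *\<^sub>C np a m c"
    by (simp add: assms(3) numeral_2_eq_2 np_simps scaleC_scaleC mult.commute)
  finally show ?thesis by (simp add: algebra_simps)
qed

end

section \<open>Direct products\<close>

instantiation prod :: (complex_vector, complex_vector) complex_vector
begin

definition scaleC_prod :: "complex \<Rightarrow> 'a \<times> 'b \<Rightarrow> 'a \<times> 'b" where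
  "scaleC_prod r x = (r *\<^sub>C fst x, r *\<^sub>C snd x)"

instance
  by standard (simp_all add: scaleC_prod_def scaleC_add_right scaleC_add_left scaleC_scaleC scaleC_one)

end

lemma fst_snd_scaleC [simp]: "fst (r *\<^sub>C x) = r *\<^sub>C fst x" "snd (r *\<^sub>C x) = r *\<^sub>C snd x"
  by (simp_all add: scaleC_prod_def)

lemma clinear_fst: "clinear fst" and clinear_snd: "clinear snd"
  by (simp_all add: clinear_iff)

definition prod_vsa :: "'v::complex_vector vsa \<Rightarrow> 'w::complex_vector vsa \<Rightarrow> ('v \<times> 'w) vsa" where
  "prod_vsa V W = \<lparr>part = (\<lambda>i. part V i \<times> part W i), vac = (vac V, vac W),
     nprod = (\<lambda>x n y. (nprod V (fst x) n (fst y), nprod W (snd x) n (snd y)))\<rparr>"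

lemma prod_vsa_simps [simp]:
  "part (prod_vsa V W) i = part V i \<times> part W i" "vac (prod_vsa V W) = (vac V, vac W)"
  "nprod (prod_vsa V W) x n y = (nprod V (fst x) n (fst y), nprod W (snd x) n (snd y))"
  by (simp_all add: prod_vsa_def)

text \<open>The common bound R makes the sums of pairs and the sums of components all genuinely
  finite, so that they can be compared.\<close>

lemma Sum_any_prod_eqI:
  fixes f g :: "nat \<Rightarrow> 'a::comm_monoid_add \<times> 'b::comm_monoid_add"
  assumes "Sum_any (\<lambda>r. fst (f r)) = Sum_any (\<lambda>r. fst (g r))"
    "Sum_any (\<lambda>r. snd (f r)) = Sum_any (\<lambda>r. snd (g r))"
    and R: "\<And>r. r \<ge> R \<Longrightarrow> f r = 0" "\<And>r. r \<ge> R \<Longrightarrow> g r = 0"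
  shows "Sum_any f = Sum_any g"
proof -
  have "Sum_any f = (\<Sum>r<R. f r)" "Sum_any g = (\<Sum>r<R. g r)"
    using R by (auto intro!: Sum_any_lessThan)
  moreover have "Sum_any (\<lambda>r. fst (f r)) = (\<Sum>r<R. fst (f r))" "Sum_any (\<lambda>r. fst (g r)) = (\<Sum>r<R. fst (g r))"
    "Sum_any (\<lambda>r. snd (f r)) = (\<Sum>r<R. snd (f r))" "Sum_any (\<lambda>r. snd (g r)) = (\<Sum>r<R. snd (g r))"
    using R by (auto intro!: Sum_any_lessThan)
  ultimately show ?thesis using assms(1,2) by (simp add: prod_eq_iff fst_sum snd_sum)
qed

lemma vertex_superalgebra_prod:
  assumes "vertex_superalgebra V" "vertex_superalgebra W"
  shows "vertex_superalgebra (prod_vsa V W)"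
proof -
  interpret V: vsa V by (rule vsa.intro) fact
  interpret W: vsa W by (rule vsa.intro) fact
  have sub: "complex_vector.subspace (part V i \<times> part W i)" for i
    using V.part_subspace[of i] W.part_subspace[of i]
    by (auto simp: complex_vector.subspace_def zero_prod_def scaleC_prod_def)
  have dec: "\<exists>v0\<in>part V False \<times> part W False. \<exists>v1\<in>part V True \<times> part W True. v = v0 + v1" for v
  proof -
    obtain a0 a1 b0 b1 where "a0 \<in> part V False" "a1 \<in> part V True" "fst v = a0 + a1"
      "b0 \<in> part W False" "b1 \<in> part W True" "snd v = b0 + b1"
      using V.part_decomp W.part_decomp by metis
    then show ?thesis by (intro bexI[of _ "(a0, b0)"] bexI[of _ "(a1, b1)"]) (auto simp: prod_eq_iff)
  qed
  have bil: "cbilinear (\<lambda>a b. nprod (prod_vsa V W) a n b)" for n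
    by (auto simp: cbilinear_iff clinear_iff V.np_simps W.np_simps prod_eq_iff)
  have trunc: "\<exists>N. \<forall>n\<ge>N. (nprod V (fst a) n (fst b), nprod W (snd a) n (snd b)) = 0" for a b
  proof -
    obtain N1 N2 where "\<And>n. n \<ge> N1 \<Longrightarrow> nprod V (fst a) n (fst b) = 0"
      "\<And>n. n \<ge> N2 \<Longrightarrow> nprod W (snd a) n (snd b) = 0"
      using V.truncation W.truncation by metis
    then show ?thesis by (intro exI[of _ "max N1 N2"]) (auto simp: prod_eq_iff)
  qed
  have tr: "\<exists>R. \<forall>r\<ge>R. nprod (prod_vsa V W) a (n + int r) b = 0" for a b n
  proof -
    obtain N where "\<forall>n\<ge>N. nprod (prod_vsa V W) a n b = 0" using trunc[of a b] by auto
    then show ?thesis by (intro exI[of _ "nat (N - n)"]) auto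
  qed
  show ?thesis
    unfolding vertex_superalgebra_def
  proof (intro conjI allI ballI impI)
    fix i j a b c l m n
    assume ab: "a \<in> part (prod_vsa V W) i" "b \<in> part (prod_vsa V W) j"
    obtain R1 where R1: "\<And>r. r \<ge> R1 \<Longrightarrow> nprod (prod_vsa V W) a (n + int r) b = 0" using tr by meson
    obtain R2 where R2: "\<And>r. r \<ge> R2 \<Longrightarrow> nprod (prod_vsa V W) b (l + int r) c = 0" using tr by meson
    obtain R3 where R3: "\<And>r. r \<ge> R3 \<Longrightarrow> nprod (prod_vsa V W) a (m + int r) c = 0" using tr by meson
    have f: "fst a \<in> part V i" "fst b \<in> part V j" and s: "snd a \<in> part W i" "snd b \<in> part W j"
      using ab by auto
    show "Sum_any (\<lambda>r::nat. (of_int m gchoose r) *\<^sub>C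
            nprod (prod_vsa V W) (nprod (prod_vsa V W) a (n + int r) b) (m + l - int r) c) =
        Sum_any (\<lambda>r::nat. ((- 1) ^ r * (of_int n gchoose r)) *\<^sub>C
            (nprod (prod_vsa V W) a (m + n - int r) (nprod (prod_vsa V W) b (l + int r) c)
             - ((- 1) powi n * ksign i j) *\<^sub>C
                 nprod (prod_vsa V W) b (n + l - int r) (nprod (prod_vsa V W) a (m + int r) c)))"
    proof (rule Sum_any_prod_eqI[where R = "max R1 (max R2 R3)"], goal_cases)
      case 1 show ?case using V.borcherds[OF f, of m n l "fst c"] by simp
    next
      case 2 show ?case using W.borcherds[OF s, of m n l "snd c"] by simp
    next
      case (3 r) then show ?case using R1[of r] by (simp add: prod_eq_iff V.np_simps W.np_simps)
    next
      case (4 r) then show ?case using R2[of r] R3[of r] by (simp add: prod_eq_iff V.np_simps W.np_simps)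
    qed
  next
    fix n show "cbilinear (\<lambda>a b. nprod (prod_vsa V W) a n b)" by (rule bil)
  qed (use sub dec trunc V.vac_even W.vac_even V.vac_nonzero V.part_inter W.part_inter V.np_part W.np_part
     V.vac_np W.vac_np V.np_vac W.np_vac in \<open>auto simp: zero_prod_def complex_vector.subspace_0 V.part_subspace W.part_subspace\<close>)
qed

section \<open>Borcherds identity for double sequences\<close>

text \<open>Models the support of \<open>a_r (b_s c)\<close>: \<open>b_s c\<close> vanishes for all
  large s, whereas the bound on r depends on s. The opposite order is handled through
  \<open>flip\<close>.\<close>

definition colbdd :: "(int \<Rightarrow> int \<Rightarrow> 'a::zero) \<Rightarrow> bool" where
  "colbdd A \<longleftrightarrow> (\<exists>s0. \<forall>r s. s \<ge> s0 \<longrightarrow> A r s = 0) \<and> (\<forall>s. \<exists>r0. \<forall>r \<ge> r0. A r s = 0)"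

definition flip :: "(int \<Rightarrow> int \<Rightarrow> 'a) \<Rightarrow> int \<Rightarrow> int \<Rightarrow> 'a" where
  "flip A r s = A s r"

text \<open>With \<open>A m l = a\<^sub>(\<^sub>m\<^sub>) b\<^sub>(\<^sub>l\<^sub>) c\<close>, \<open>B m l = \<plusminus> b\<^sub>(\<^sub>l\<^sub>) a\<^sub>(\<^sub>m\<^sub>) c\<close> and \<open>C n l = (a\<^sub>(\<^sub>n\<^sub>) b)\<^sub>(\<^sub>l\<^sub>) c\<close>
  the Borcherds identity is \<open>RC C = RA A - RB B\<close>.\<close>

definition RA :: "(int \<Rightarrow> int \<Rightarrow> 'a::complex_vector) \<Rightarrow> int \<Rightarrow> int \<Rightarrow> int \<Rightarrow> 'a" where
  "RA A m n l = Sum_any (\<lambda>r::nat. ((- 1) ^ r * (of_int n gchoose r)) *\<^sub>C A (m + n - int r) (l + int r))"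

definition RB :: "(int \<Rightarrow> int \<Rightarrow> 'a::complex_vector) \<Rightarrow> int \<Rightarrow> int \<Rightarrow> int \<Rightarrow> 'a" where
  "RB B m n l = (- 1) powi n *\<^sub>C RA (flip B) l n m"

definition RC :: "(int \<Rightarrow> int \<Rightarrow> 'a::complex_vector) \<Rightarrow> int \<Rightarrow> int \<Rightarrow> int \<Rightarrow> 'a" where
  "RC C m n l = Sum_any (\<lambda>r::nat. (of_int m gchoose r) *\<^sub>C C (n + int r) (m + l - int r))"

lemma RA_sum:
  assumes "\<And>r s. s \<ge> s0 \<Longrightarrow> A r s = 0" "s0 - l \<le> int R"
  shows "RA A m n l = (\<Sum>r<R. ((- 1) ^ r * (of_int n gchoose r)) *\<^sub>C A (m + n - int r) (l + int r))"
  unfolding RA_def by (rule Sum_any_lessThan) (use assms in auto)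

lemma RC_sum:
  assumes "\<And>r s. r \<ge> r0 \<Longrightarrow> C r s = 0" "r0 - n \<le> int R"
  shows "RC C m n l = (\<Sum>r<R. (of_int m gchoose r) *\<^sub>C C (n + int r) (m + l - int r))"
  unfolding RC_def by (rule Sum_any_lessThan) (use assms in auto)

lemma gchoose_Suc_Suc: "((of_int (n + 1) :: complex) gchoose Suc r) = (of_int n gchoose r) + (of_int n gchoose Suc r)"
  by (simp add: gbinomial_Suc_Suc)

lemma pascal_sum:
  assumes "\<And>r. c' (Suc r) = c r + c (Suc r)" "c' 0 = (c 0 :: complex)"
  shows "(\<Sum>r<Suc R. c' r *\<^sub>C X r) = (\<Sum>r<Suc R. c r *\<^sub>C X r) + (\<Sum>r<R. c r *\<^sub>C X (Suc r))"
  unfolding sum.lessThan_Suc_shift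
  by (simp add: assms scaleC_add_left sum.distrib ac_simps)

text \<open>\<open>RA A m n l\<close> is the residue of x^m y^l (x - y)^n A(x, y), expanded for |x|
  > |y|, and the recursion is multiplication by x - y. \<open>RB\<close> uses the expansion for |y|
  > |x|; in \<open>RC\<close> one has x = y + z, with z^n in place of (x - y)^n. Hence all three
  satisfy the same recursion.\<close>

lemma RA_rec:
  assumes "colbdd A"
  shows "RA A m (n + 1) l = RA A (m + 1) n l - RA A m n (l + 1)"
proof -
  obtain s0 where s0: "\<And>r s. s \<ge> s0 \<Longrightarrow> A r s = 0" using assms by (auto simp: colbdd_def)
  define R where "R = nat (s0 - l)"
  define X where "X r = (- 1) ^ r *\<^sub>C A (m + n + 1 - int r) (l + int r)" for r
  have 1: "RA A m (n + 1) l = (\<Sum>r<Suc R. (of_int (n + 1) gchoose r) *\<^sub>C X r)"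
    by (subst RA_sum[where A = A and ?s0.0 = s0 and R = "Suc R"])
      (auto simp: s0 R_def X_def scaleC_scaleC mult.commute algebra_simps simp del: sum.lessThan_Suc of_int_add)
  have 2: "RA A (m + 1) n l = (\<Sum>r<Suc R. (of_int n gchoose r) *\<^sub>C X r)"
    by (subst RA_sum[where A = A and ?s0.0 = s0 and R = "Suc R"])
      (auto simp: s0 R_def X_def scaleC_scaleC mult.commute algebra_simps simp del: sum.lessThan_Suc of_int_add)
  have 3: "- RA A m n (l + 1) = (\<Sum>r<R. (of_int n gchoose r) *\<^sub>C X (Suc r))"
    by (subst RA_sum[where A = A and ?s0.0 = s0 and R = R])
      (auto simp: s0 R_def X_def scaleC_scaleC mult.commute algebra_simps sum_negf[symmetric] simp del: sum.lessThan_Suc of_int_add)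
  have "RA A m (n + 1) l = RA A (m + 1) n l + (- RA A m n (l + 1))"
    unfolding 1 2 3 by (rule pascal_sum) (simp_all only: gchoose_Suc_Suc gbinomial_0)
  then show ?thesis by simp
qed

lemma RB_rec:
  assumes "colbdd (flip B)"
  shows "RB B m (n + 1) l = RB B (m + 1) n l - RB B m n (l + 1)"
proof -
  have "((- 1 :: complex) powi (n + 1)) = - ((- 1) powi n)" by (simp add: power_int_add)
  then show ?thesis
    unfolding RB_def RA_rec[OF assms] by (simp add: complex_vector.scale_right_diff_distrib)
qed

lemma RC_rec:
  assumes "colbdd (flip C)"
  shows "RC C m (n + 1) l = RC C (m + 1) n l - RC C m n (l + 1)"
proof -
  obtain s0 where s0: "\<And>r s. r \<ge> s0 \<Longrightarrow> C r s = 0" using assms unfolding colbdd_def flip_def by blast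
  define R where "R = nat (s0 - n)"
  define X where "X r = C (n + int r) (m + 1 + l - int r)" for r
  have 1: "RC C m (n + 1) l = (\<Sum>r<R. (of_int m gchoose r) *\<^sub>C X (Suc r))"
    by (subst RC_sum[where C = C and ?r0.0 = s0 and R = R]) (auto simp: s0 R_def X_def algebra_simps)
  have 2: "RC C (m + 1) n l = (\<Sum>r<Suc R. (of_int (m + 1) gchoose r) *\<^sub>C X r)"
    by (subst RC_sum[where C = C and ?r0.0 = s0 and R = "Suc R"]) (auto simp: s0 R_def X_def simp del: sum.lessThan_Suc of_int_add)
  have 3: "RC C m n (l + 1) = (\<Sum>r<Suc R. (of_int m gchoose r) *\<^sub>C X r)"
    by (subst RC_sum[where C = C and ?r0.0 = s0 and R = "Suc R"]) (auto simp: s0 R_def X_def algebra_simps simp del: sum.lessThan_Suc of_int_add)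
  have "RC C (m + 1) n l = RC C m n (l + 1) + RC C m (n + 1) l"
    unfolding 1 2 3 by (rule pascal_sum) (simp_all only: gchoose_Suc_Suc gbinomial_0)
  then show ?thesis by simp
qed

lemma RA_0 [simp]: "RA A m 0 l = A m l"
  unfolding RA_def by (subst Sum_any_lessThan[of 1]) (auto simp: gbinomial_0_left scaleC_one)

lemma RC_0 [simp]: "RC C 0 n l = C n l"
  unfolding RC_def by (subst Sum_any_lessThan[of 1]) (auto simp: gbinomial_0_left scaleC_one)

lemma RA_RC_0 [simp]: "(\<lambda>m. RA A m 0) = A" "RC C 0 = C"
  by (simp_all add: fun_eq_iff)

text \<open>Locality (\<open>RA = RB\<close> for one \<open>n\<close>) and weak associativity (\<open>RC = RA\<close> for one \<open>m\<close>) propagate to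
  all indices through the common recursion.\<close>

lemma borcherds_criterion:
  assumes A: "colbdd A" and B: "colbdd (flip B)" and C: "colbdd (flip C)"
    and N: "\<And>n l. n \<ge> N \<Longrightarrow> C n l = 0" and M: "\<And>m l. m \<ge> M \<Longrightarrow> B m l = 0"
    and loc: "\<And>m l. RA A m N l = RB B m N l" and ass: "\<And>n l. RC C M n l = RA A M n l"
  shows "RC C m n l = RA A m n l - RB B m n l"
proof -
  have 1: "RA A m (N + int i) l = RB B m (N + int i) l" for m l i
  proof (induction i arbitrary: m l)
    case (Suc i)
    have e: "N + int (Suc i) = N + int i + 1" by simp
    show ?case unfolding e RA_rec[OF A] RB_rec[OF B] by (simp only: Suc.IH)
  qed (simp add: loc)
  have 1: "RA A m n l = RB B m n l" if "n \<ge> N" for m n l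
    using 1[of m "nat (n - N)" l] that by simp
  have 2: "RC C m n l = 0" if "n \<ge> N" for m n l
    using RC_sum[of N C n 0 m l] N that by simp
  have 3: "RC C (M + int i) n l = RA A (M + int i) n l" for n l i
  proof (induction i arbitrary: n l)
    case (Suc i)
    have e: "M + int (Suc i) = M + int i + 1" by simp
    show ?case
      using Suc.IH[of "n + 1" l] Suc.IH[of n "l + 1"] RA_rec[OF A, of "M + int i" n l] RC_rec[OF C, of "M + int i" n l]
      unfolding e by simp
  qed (simp add: ass)
  have 3: "RC C m n l = RA A m n l" if "m \<ge> M" for m n l
    using 3[of "nat (m - M)" n l] that by simp
  have 4: "RB B m n l = 0" if "m \<ge> M" for m n l
    unfolding RB_def using RA_sum[of M "flip B" m 0 l n] M that by (simp add: flip_def)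
  \<comment> \<open>Outside the half planes m \<ge> M and n \<ge> N, induct on the distance to them:
    the recursion gives the entry at (m, n) and l + 1 from those at (m + 1, n) and (m, n +
    1).\<close>
  have "\<forall>l. RC C m n l = RA A m n l - RB B m n l" if "nat (M - m) + nat (N - n) = i" for m n i
    using that
  proof (induction i arbitrary: m n rule: less_induct)
    case (less i)
    show ?case
    proof (cases "m \<ge> M \<or> n \<ge> N")
      case True then show ?thesis using 1 2 3 4 by auto
    next
      case False
      then have "nat (M - (m + 1)) + nat (N - n) < i" "nat (M - m) + nat (N - (n + 1)) < i"
        using less.prems by auto
      from less.IH[OF this(1) refl] less.IH[OF this(2) refl]
      have IH: "\<And>l. RC C (m + 1) n l = RA A (m + 1) n l - RB B (m + 1) n l"
         "\<And>l. RC C m (n + 1) l = RA A m (n + 1) l - RB B m (n + 1) l" by auto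
      have "RC C m n (l + 1) = RA A m n (l + 1) - RB B m n (l + 1)" for l
        using IH(1)[of l] IH(2)[of l] unfolding RA_rec[OF A] RB_rec[OF B] RC_rec[OF C]
        by (simp add: algebra_simps)
      from this[of "l - 1" for l] show ?thesis by simp
    qed
  qed
  then show ?thesis by blast
qed

subsection \<open>Convolution\<close>

text \<open>The coefficients of a product of two series. The shift by 1 comes from a_n being the
  coefficient of z^(-n-1).\<close>

definition conv_term where
  "conv_term A A' m l = (\<lambda>(r, s). A r s \<otimes> A' (m - 1 - r :: int) (l - 1 - s :: int))"

definition conv :: "(int \<Rightarrow> int \<Rightarrow> 'a::complex_vector) \<Rightarrow> (int \<Rightarrow> int \<Rightarrow> 'b::complex_vector) \<Rightarrow>
    int \<Rightarrow> int \<Rightarrow> ('a, 'b) tensor" where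
  "conv A A' m l = Sum_any (conv_term A A' m l)"

lemma colbdd_uniform:
  assumes "colbdd A" "finite S"
  obtains r0 where "\<And>r s. s \<in> S \<Longrightarrow> r \<ge> r0 \<Longrightarrow> A r s = 0"
proof -
  have "\<forall>s. \<exists>r0. \<forall>r \<ge> r0. A r s = 0" using assms(1) by (simp add: colbdd_def)
  then obtain f where f: "\<And>s r. r \<ge> f s \<Longrightarrow> A r s = 0" by metis
  show ?thesis
  proof (rule that)
    fix r s assume s: "s \<in> S" and r: "r \<ge> Max (f ` S)"
    have "f s \<le> Max (f ` S)" using s assms(2) by simp
    then show "A r s = 0" using f r by simp
  qed
qed

text \<open>The uniform bounds in the second index confine s to a finite interval; only then do
  uniform bounds for r exist.\<close>

lemma conv_support:
  assumes "colbdd A" "colbdd A'"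
  shows "\<exists>R S. finite R \<and> finite S \<and> (\<forall>r s. conv_term A A' m l (r, s) \<noteq> 0 \<longrightarrow> r \<in> R \<and> s \<in> S)"
proof -
  obtain s0 where s0: "\<And>r s. s \<ge> s0 \<Longrightarrow> A r s = 0" using assms by (auto simp: colbdd_def)
  obtain s1 where s1: "\<And>r s. s \<ge> s1 \<Longrightarrow> A' r s = 0" using assms by (auto simp: colbdd_def)
  define S where "S = {l - 1 - s1..s0}"
  obtain r0 where r0: "\<And>r s. s \<in> S \<Longrightarrow> r \<ge> r0 \<Longrightarrow> A r s = 0"
    using colbdd_uniform[OF assms(1), of S] by (auto simp: S_def)
  obtain r1 where r1: "\<And>r s. s \<in> (\<lambda>s. l - 1 - s) ` S \<Longrightarrow> r \<ge> r1 \<Longrightarrow> A' r s = 0"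
    using colbdd_uniform[OF assms(2), of "(\<lambda>s. l - 1 - s) ` S"] by (auto simp: S_def)
  have "\<forall>r s. conv_term A A' m l (r, s) \<noteq> 0 \<longrightarrow> r \<in> {m - 1 - r1..r0} \<and> s \<in> S"
  proof (intro allI impI)
    fix r s assume "conv_term A A' m l (r, s) \<noteq> 0"
    then have nz: "A r s \<noteq> 0" "A' (m - 1 - r) (l - 1 - s) \<noteq> 0"
      by (auto simp: conv_term_def tensor_eq_0_iff)
    then have "s < s0" "l - 1 - s < s1"
      using s0[of s r] s1[of "l - 1 - s" "m - 1 - r"] by (auto simp: not_le[symmetric])
    then have s: "s \<in> S" by (auto simp: S_def)
    then have "r < r0" "m - 1 - r < r1"
      using r0[of s r] r1[of "l - 1 - s" "m - 1 - r"] nz by (auto simp: not_le[symmetric])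
    then show "r \<in> {m - 1 - r1..r0} \<and> s \<in> S" using s by auto
  qed
  moreover have "finite {m - 1 - r1..r0}" "finite S" by (simp_all add: S_def)
  ultimately show ?thesis by blast
qed

lemma conv_flip: "conv A A' m l = conv (flip A) (flip A') l m"
proof -
  have "bij (\<lambda>(r :: int, s :: int). (s, r))"
    by (rule bij_betw_byWitness[where f' = "\<lambda>(r, s). (s, r)"]) auto
  then show ?thesis
    unfolding conv_def
    by (rule Sum_any.reindex_cong) (simp add: conv_term_def flip_def fun_eq_iff)
qed

lemma finite_conv_term:
  assumes "colbdd A" "colbdd A'"
  shows "finite {x. conv_term A A' m l x \<noteq> 0}"
proof -
  obtain R S where RS: "finite R" "finite S"
    and *: "\<forall>r s. conv_term A A' m l (r, s) \<noteq> 0 \<longrightarrow> r \<in> R \<and> s \<in> S"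
    using conv_support[OF assms, of m l] by blast
  have "{x. conv_term A A' m l x \<noteq> 0} \<subseteq> R \<times> S" using * by (simp add: subset_eq split_paired_all)
  then show ?thesis using RS finite_subset by blast
qed

lemma conv_iterated:
  assumes "colbdd A" "colbdd A'"
  shows "conv A A' m l = Sum_any (\<lambda>s. Sum_any (\<lambda>r. A r s \<otimes> A' (m - 1 - r) (l - 1 - s)))"
    and "conv A A' m l = Sum_any (\<lambda>r. Sum_any (\<lambda>s. A r s \<otimes> A' (m - 1 - r) (l - 1 - s)))"
proof -
  obtain R S where RS: "finite R" "finite S"
    "\<forall>r s. A r s \<otimes> A' (m - 1 - r) (l - 1 - s) \<noteq> 0 \<longrightarrow> r \<in> R \<and> s \<in> S"
    using conv_support[OF assms, of m l] unfolding conv_term_def prod.case by blast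
  have fin: "finite (R \<times> S)" using RS by simp
  show 2: "conv A A' m l = Sum_any (\<lambda>r. Sum_any (\<lambda>s. A r s \<otimes> A' (m - 1 - r) (l - 1 - s)))"
    unfolding conv_def conv_term_def
    by (rule Sum_any.cartesian_product[OF fin, symmetric]) (use RS in blast)
  show "conv A A' m l = Sum_any (\<lambda>s. Sum_any (\<lambda>r. A r s \<otimes> A' (m - 1 - r) (l - 1 - s)))"
    unfolding 2 by (rule Sum_any.swap[OF fin]) (use RS in blast)
qed

lemma bij_translation: "bij (\<lambda>(r, s). (r + i :: int, s + j :: int))"
  by (rule bij_betw_byWitness[where f' = "\<lambda>(r, s). (r - i, s - j)"]) auto

lemma conv_shift_left: "conv (\<lambda>r s. A (r + i) (s + j)) A' m l = conv A A' (m + i) (l + j)"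
  unfolding conv_def
  by (rule Sum_any.reindex_cong[OF bij_translation[of i j], symmetric])
    (simp add: conv_term_def fun_eq_iff algebra_simps)

lemma conv_shift_right: "conv A (\<lambda>r s. A' (r + i) (s + j)) m l = conv A A' (m + i) (l + j)"
  by (simp add: conv_def conv_term_def algebra_simps)

lemma conv_add_left:
  assumes "colbdd A" "colbdd B" "colbdd A'"
  shows "conv (\<lambda>r s. A r s + B r s) A' m l = conv A A' m l + conv B A' m l"
  unfolding conv_def Sum_any.distrib[OF finite_conv_term[OF assms(1,3)] finite_conv_term[OF assms(2,3)], symmetric]
  by (rule arg_cong[of _ _ Sum_any]) (auto simp: conv_term_def tensor_simps)

lemma conv_add_right:
  assumes "colbdd A" "colbdd B" "colbdd A'"
  shows "conv A' (\<lambda>r s. A r s + B r s) m l = conv A' A m l + conv A' B m l"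
  unfolding conv_def Sum_any.distrib[OF finite_conv_term[OF assms(3,1)] finite_conv_term[OF assms(3,2)], symmetric]
  by (rule arg_cong[of _ _ Sum_any]) (auto simp: conv_term_def tensor_simps)

lemma conv_scale:
  assumes "colbdd A" "colbdd A'"
  shows "conv (\<lambda>r s. x *\<^sub>C A r s) A' m l = x *\<^sub>C conv A A' m l"
    "conv A (\<lambda>r s. x *\<^sub>C A' r s) m l = x *\<^sub>C conv A A' m l"
  unfolding conv_def Sum_any_clinear[OF clinear_cmul[OF clinear_id] finite_conv_term[OF assms]]
  by (rule arg_cong[of _ _ Sum_any]; auto simp: conv_term_def tensor_simps)+

lemma colbdd_shift: "colbdd A \<Longrightarrow> colbdd (\<lambda>r s. A (r + i) (s + j))"
  unfolding colbdd_def
proof (elim conjE exE, intro conjI allI)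
  fix s0 assume "\<forall>r s. s \<ge> s0 \<longrightarrow> A r s = 0"
  then show "\<exists>s0. \<forall>r s. s \<ge> s0 \<longrightarrow> A (r + i) (s + j) = 0" by (intro exI[of _ "s0 - j"]) auto
next
  fix s assume "\<forall>s. \<exists>r0. \<forall>r\<ge>r0. A r s = 0"
  then obtain r0 where "\<forall>r\<ge>r0. A r (s + j) = 0" by blast
  then show "\<exists>r0. \<forall>r\<ge>r0. A (r + i) (s + j) = 0" by (intro exI[of _ "r0 - i"]) auto
qed

lemma colbdd_map2:
  assumes "colbdd A" "colbdd B" "f 0 0 = 0"
  shows "colbdd (\<lambda>r s. f (A r s) (B r s))"
proof -
  have 1: "\<exists>s0. \<forall>r s. s \<ge> s0 \<longrightarrow> f (A r s) (B r s) = 0"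
  proof -
    obtain s0 s1 where "\<forall>r s. s \<ge> s0 \<longrightarrow> A r s = 0" "\<forall>r s. s \<ge> s1 \<longrightarrow> B r s = 0"
      using assms unfolding colbdd_def by blast
    then show ?thesis using assms(3) by (intro exI[of _ "max s0 s1"]) auto
  qed
  have 2: "\<exists>r0. \<forall>r\<ge>r0. f (A r s) (B r s) = 0" for s
  proof -
    obtain r0 r1 where "\<forall>r\<ge>r0. A r s = 0" "\<forall>r\<ge>r1. B r s = 0" using assms unfolding colbdd_def by blast
    then show ?thesis using assms(3) by (intro exI[of _ "max r0 r1"]) auto
  qed
  show ?thesis using 1 2 unfolding colbdd_def by blast
qed

lemma colbdd_shift1: "colbdd A \<Longrightarrow> colbdd (\<lambda>r s. A (r + i) s)" "colbdd A \<Longrightarrow> colbdd (\<lambda>r s. A r (s + i))"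
  using colbdd_shift[of A i 0] colbdd_shift[of A 0 i] by simp_all

lemma colbdd_diff: "colbdd A \<Longrightarrow> colbdd B \<Longrightarrow> colbdd (\<lambda>r s. A r s - B r s :: 'a::group_add)"
  and colbdd_add: "colbdd A \<Longrightarrow> colbdd B \<Longrightarrow> colbdd (\<lambda>r s. A r s + B r s :: 'a::group_add)"
  by (rule colbdd_map2; simp)+

lemma colbdd_scale: "colbdd A \<Longrightarrow> colbdd (\<lambda>r s. x *\<^sub>C A r s)"
  by (rule colbdd_map2[of A A "\<lambda>a b. x *\<^sub>C a"]) simp_all

lemma conv_shift1:
  "conv (\<lambda>r s. A (r + i) s) A' m l = conv A A' (m + i) l" "conv (\<lambda>r s. A r (s + i)) A' m l = conv A A' m (l + i)"
  "conv A (\<lambda>r s. A' (r + i) s) m l = conv A A' (m + i) l" "conv A (\<lambda>r s. A' r (s + i)) m l = conv A A' m (l + i)"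
  using conv_shift_left[of A i 0 A' m l] conv_shift_left[of A 0 i A' m l]
    conv_shift_right[of A A' i 0 m l] conv_shift_right[of A A' 0 i m l] by simp_all

lemma conv_diff_left:
  assumes "colbdd A" "colbdd B" "colbdd A'"
  shows "conv (\<lambda>r s. A r s - B r s) A' m l = conv A A' m l - conv B A' m l"
  using conv_add_left[OF assms(1) colbdd_scale[OF assms(2), of "- 1"] assms(3)] conv_scale[OF assms(2,3), of "-1"]
  by (simp add: scaleC_one)

lemma conv_diff_right:
  assumes "colbdd A" "colbdd B" "colbdd A'"
  shows "conv A' (\<lambda>r s. A r s - B r s) m l = conv A' A m l - conv A' B m l"
  using conv_add_right[OF assms(1) colbdd_scale[OF assms(2), of "- 1"] assms(3)] conv_scale[OF assms(3,2), of "-1"]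
  by (simp add: scaleC_one)

lemma colbdd_conv:
  assumes "colbdd A" "colbdd A'"
  shows "colbdd (conv A A')"
proof -
  obtain s0 where s0: "\<And>r s. s \<ge> s0 \<Longrightarrow> A r s = 0" using assms by (auto simp: colbdd_def)
  obtain s1 where s1: "\<And>r s. s \<ge> s1 \<Longrightarrow> A' r s = 0" using assms by (auto simp: colbdd_def)
  have zero: "conv A A' m l = 0" if "\<And>r s. A r s = 0 \<or> A' (m - 1 - r) (l - 1 - s) = 0" for m l
  proof -
    have "conv_term A A' m l = (\<lambda>_. 0)" using that by (auto simp: conv_term_def tensor_eq_0_iff)
    then show ?thesis by (simp add: conv_def)
  qed
  show ?thesis
    unfolding colbdd_def
  proof (intro conjI allI)
    show "\<exists>s0. \<forall>r s. s \<ge> s0 \<longrightarrow> conv A A' r s = 0"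
    proof (intro exI[of _ "s0 + s1"] allI impI zero)
      fix m l r s :: int assume "l \<ge> s0 + s1"
      then have "s \<ge> s0 \<or> l - 1 - s \<ge> s1" by linarith
      then show "A r s = 0 \<or> A' (m - 1 - r) (l - 1 - s) = 0" using s0 s1 by blast
    qed
    fix l
    define S where "S = {l - 1 - s1..s0}"
    obtain r0 where r0: "\<And>r s. s \<in> S \<Longrightarrow> r \<ge> r0 \<Longrightarrow> A r s = 0"
      using colbdd_uniform[OF assms(1), of S] by (auto simp: S_def)
    obtain r1 where r1: "\<And>r s. s \<in> (\<lambda>s. l - 1 - s) ` S \<Longrightarrow> r \<ge> r1 \<Longrightarrow> A' r s = 0"
      using colbdd_uniform[OF assms(2), of "(\<lambda>s. l - 1 - s) ` S"] by (auto simp: S_def)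
    show "\<exists>r0. \<forall>r\<ge>r0. conv A A' r l = 0"
    proof (intro exI[of _ "r0 + r1"] allI impI zero)
      fix m r s :: int assume m: "m \<ge> r0 + r1"
      show "A r s = 0 \<or> A' (m - 1 - r) (l - 1 - s) = 0"
      proof (cases "s \<in> S")
        case True
        have "r \<ge> r0 \<or> m - 1 - r \<ge> r1" using m by linarith
        then show ?thesis using r0[OF True] r1[OF imageI[OF True]] by blast
      next
        case False
        then have "s \<ge> s0 \<or> l - 1 - s \<ge> s1" by (auto simp: S_def)
        then show ?thesis using s0 s1 by blast
      qed
    qed
  qed
qed

text \<open>Multiplication of a product of series by x - y may be carried out in either factor.
  \<open>conv_E\<close> is the analogue for y + z.\<close>

lemma conv_D:
  assumes "colbdd A" "colbdd A'"
  shows "conv (\<lambda>m l. A (m + 1) l - A m (l + 1)) A' m l = conv A A' (m + 1) l - conv A A' m (l + 1)"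
    "conv A (\<lambda>m l. A' (m + 1) l - A' m (l + 1)) m l = conv A A' (m + 1) l - conv A A' m (l + 1)"
  using conv_diff_left[OF colbdd_shift1[OF assms(1)] assms(2), of 1 1 m l]
    conv_diff_right[OF colbdd_shift1[OF assms(2)] assms(1), of 1 1 m l]
  by (simp_all only: conv_shift1)

lemma conv_E:
  assumes "colbdd (flip C)" "colbdd (flip C')"
  shows "conv (\<lambda>n l. C (n + 1) l + C n (l + 1)) C' n l = conv C C' (n + 1) l + conv C C' n (l + 1)"
    "conv C (\<lambda>n l. C' (n + 1) l + C' n (l + 1)) n l = conv C C' (n + 1) l + conv C C' n (l + 1)"
proof -
  have f: "flip (\<lambda>n l. D (n + 1) l + D n (l + 1)) = (\<lambda>l n. flip D l (n + 1) + flip D (l + 1) n)"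
    for D :: "int \<Rightarrow> int \<Rightarrow> 'x::complex_vector"
    by (simp add: flip_def fun_eq_iff)
  show "conv (\<lambda>n l. C (n + 1) l + C n (l + 1)) C' n l = conv C C' (n + 1) l + conv C C' n (l + 1)"
    using conv_add_left[OF colbdd_shift1(2)[OF assms(1)] colbdd_shift1(1)[OF assms(1)] assms(2), of 1 1 l n]
    unfolding conv_flip[of _ C'] f by (simp only: conv_shift1)
  show "conv C (\<lambda>n l. C' (n + 1) l + C' n (l + 1)) n l = conv C C' (n + 1) l + conv C C' n (l + 1)"
    using conv_add_right[OF colbdd_shift1(2)[OF assms(2)] colbdd_shift1(1)[OF assms(2)] assms(1), of 1 1 l n]
    unfolding conv_flip[of C] f by (simp only: conv_shift1)
qed

lemma RA_Suc: "colbdd A \<Longrightarrow>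
    (\<lambda>m l. RA A m (int (Suc n)) l) = (\<lambda>m l. RA A (m + 1) (int n) l - RA A m (int n) (l + 1))"
  using RA_rec[of A _ "int n"] by (simp add: add.commute fun_eq_iff)

lemma RC_Suc: "colbdd (flip C) \<Longrightarrow>
    (\<lambda>n l. RC C (int (Suc m)) n l) = (\<lambda>n l. RC C (int m) (n + 1) l + RC C (int m) n (l + 1))"
  using RC_rec[of C "int m"] by (simp add: add.commute fun_eq_iff)

lemma colbdd_RA_nat: "colbdd A \<Longrightarrow> colbdd (\<lambda>m l. RA A m (int n) l)"
proof (induction n)
  case (Suc n)
  show ?case unfolding RA_Suc[OF Suc.prems]
    using Suc by (intro colbdd_diff colbdd_shift1(1)[of "\<lambda>m l. RA A m (int n) l"]
        colbdd_shift1(2)[of "\<lambda>m l. RA A m (int n) l"])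
qed simp

text \<open>The powers of x - y are distributed over the two factors one at a time. Natural
  exponents are considered because locality concerns a single large exponent.\<close>

lemma RA_conv_nat:
  assumes "colbdd A" "colbdd A'"
  shows "RA (conv A A') m (int n1 + int n2) l = conv (\<lambda>m l. RA A m (int n1) l) (\<lambda>m l. RA A' m (int n2) l) m l"
proof (induction n1 arbitrary: m l)
  case 0
  show ?case
  proof (induction n2 arbitrary: m l)
    case (Suc n)
    have "RA (conv A A') m (int 0 + int (Suc n)) l = RA (conv A A') (m + 1) (int 0 + int n) l - RA (conv A A') m (int 0 + int n) (l + 1)"
      using RA_rec[OF colbdd_conv[OF assms], of _ "int n"] by (simp add: add.commute)
    then show ?case
      unfolding RA_Suc[OF assms(2)] Suc.IH
        conv_D(2)[OF colbdd_RA_nat[OF assms(1)] colbdd_RA_nat[OF assms(2)]] .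
  qed simp
next
  case (Suc n)
  have "RA (conv A A') m (int (Suc n) + int n2) l =
      RA (conv A A') (m + 1) (int n + int n2) l - RA (conv A A') m (int n + int n2) (l + 1)"
    using RA_rec[OF colbdd_conv[OF assms], of m "int n + int n2" l] by (simp add: algebra_simps)
  then show ?case
    unfolding RA_Suc[OF assms(1)] Suc.IH
      conv_D(1)[OF colbdd_RA_nat[OF assms(1)] colbdd_RA_nat[OF assms(2)]] .
qed

lemma flip_conv: "flip (conv D D') = conv (flip D) (flip D')"
  by (simp add: fun_eq_iff flip_def[of "conv D D'"] conv_flip[of D D'])

lemma RB_conv_nat:
  assumes "colbdd (flip B)" "colbdd (flip B')"
  shows "RB (conv B B') m (int n1 + int n2) l = conv (\<lambda>m l. RB B m (int n1) l) (\<lambda>m l. RB B' m (int n2) l) m l"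
proof -
  have "conv (\<lambda>m l. RB B m (int n1) l) (\<lambda>m l. RB B' m (int n2) l) m l =
    conv (\<lambda>l m. RB B m (int n1) l) (\<lambda>l m. RB B' m (int n2) l) l m"
    by (subst conv_flip) (simp add: flip_def[abs_def])
  also have "\<dots> = ((- 1) powi int n1 * (- 1) powi int n2) *\<^sub>C RA (conv (flip B) (flip B')) l (int n1 + int n2) m"
    unfolding RB_def RA_conv_nat[OF assms]
      conv_scale(1)[OF colbdd_RA_nat[OF assms(1)] colbdd_scale[OF colbdd_RA_nat[OF assms(2)]]]
      conv_scale(2)[OF colbdd_RA_nat[OF assms(1)] colbdd_RA_nat[OF assms(2)]] scaleC_scaleC ..
  finally show ?thesis by (simp add: RB_def flip_conv power_int_add)
qed

lemma colbdd_RC_nat: "colbdd (flip C) \<Longrightarrow> colbdd (flip (\<lambda>n l. RC C (int m) n l))"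
proof (induction m)
  case (Suc m)
  have f: "flip (\<lambda>n l. RC C (int m) (n + 1) l + RC C (int m) n (l + 1)) =
    (\<lambda>l n. flip (\<lambda>n l. RC C (int m) n l) l (n + 1) + flip (\<lambda>n l. RC C (int m) n l) (l + 1) n)"
    by (simp add: flip_def fun_eq_iff)
  show ?case unfolding RC_Suc[OF Suc.prems] f
    using Suc by (intro colbdd_add colbdd_shift1(1)[of "flip (\<lambda>n l. RC C (int m) n l)"]
        colbdd_shift1(2)[of "flip (\<lambda>n l. RC C (int m) n l)"])
qed simp

lemma RC_conv_nat:
  assumes "colbdd (flip C)" "colbdd (flip C')"
  shows "RC (conv C C') (int m1 + int m2) n l = conv (\<lambda>n l. RC C (int m1) n l) (\<lambda>n l. RC C' (int m2) n l) n l"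
proof -
  have cc: "colbdd (flip (conv C C'))"
    using colbdd_conv[OF assms] by (simp add: flip_conv)
  show ?thesis
  proof (induction m1 arbitrary: n l)
    case 0
    show ?case
    proof (induction m2 arbitrary: n l)
      case (Suc m)
      have "RC (conv C C') (int 0 + int (Suc m)) n l = RC (conv C C') (int 0 + int m) (n + 1) l + RC (conv C C') (int 0 + int m) n (l + 1)"
        using RC_rec[OF cc, of "int m" n l] by (simp add: algebra_simps)
      then show ?case
        unfolding RC_Suc[OF assms(2)] Suc.IH
          conv_E(2)[OF colbdd_RC_nat[OF assms(1)] colbdd_RC_nat[OF assms(2)]] .
    qed simp
  next
    case (Suc m)
    have "RC (conv C C') (int (Suc m) + int m2) n l =
      RC (conv C C') (int m + int m2) (n + 1) l + RC (conv C C') (int m + int m2) n (l + 1)"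
      using RC_rec[OF cc, of "int m + int m2" n l] by (simp add: algebra_simps)
    then show ?case
      unfolding RC_Suc[OF assms(1)] Suc.IH
        conv_E(1)[OF colbdd_RC_nat[OF assms(1)] colbdd_RC_nat[OF assms(2)]] .
  qed
qed

lemma gchoose_neg_mode: "(- 1) ^ i * (of_int (r + int i) gchoose i) = ((of_int (- r - 1) :: complex) gchoose i)"
proof -
  have "(of_int (- r - 1) :: complex) = - (of_int r + 1)" by simp
  then show ?thesis by (simp only: gbinomial_minus) simp
qed

text \<open>The substitution \<open>x \<mapsto> x + y\<close> is multiplicative, by the Vandermonde convolution.\<close>

lemma RA_conv_subst0:
  assumes "colbdd A" "colbdd A'"
  shows "RA (conv A A') 0 n l = conv (\<lambda>n l. RA A 0 n l) (\<lambda>n l. RA A' 0 n l) n l"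
proof -
  obtain s0 where s0: "\<And>r s. s \<ge> s0 \<Longrightarrow> A r s = 0" using assms by (auto simp: colbdd_def)
  obtain s1 where s1: "\<And>r s. s \<ge> s1 \<Longrightarrow> A' r s = 0" using assms by (auto simp: colbdd_def)
  define K where "K = nat (s0 + s1 - l)"
  \<comment> \<open>The coefficient (-1)^i (r + i choose i) of \<open>A r s\<close> in the
    substitution, rewritten with upper argument -r - 1. In this form the upper arguments for the two
    factors have a sum independent of r, as the Vandermonde convolution requires.\<close>
  define ca where "ca = (\<lambda>(i::nat) (r::int). (of_int (- r - 1) :: complex) gchoose i)"
  have ca_shift: "ca i (r - int i) = (- 1) ^ i * (of_int r gchoose i)" for i r
    using gchoose_neg_mode[of i "r - int i"] by (simp add: ca_def)
  define T where "T = (\<lambda>i j (r, s). (ca i r * ca j (n - 1 - r - int i - int j)) *\<^sub>C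
    conv_term A A' (n - int (i + j)) (l + int (i + j)) (r, s))"
  have fin: "finite {x. T i j x \<noteq> 0}" for i j
    by (rule finite_subset[OF _ finite_conv_term[OF assms, of "n - int (i + j)" "l + int (i + j)"]])
      (auto simp: T_def)
  have expand: "RA A 0 r s \<otimes> RA A' 0 (n - 1 - r) (l - 1 - s) =
     (\<Sum>i<K. \<Sum>j<K. T i j (r - int i, s + int i))" for r s
  proof (cases "s \<ge> s0 \<or> l - 1 - s \<ge> s1")
    case True
    then have "RA A 0 r s = 0 \<or> RA A' 0 (n - 1 - r) (l - 1 - s) = 0"
      using RA_sum[of s0 A s 0 0 r] RA_sum[of s1 A' "l - 1 - s" 0 0 "n - 1 - r"] s0 s1 by auto
    moreover have "T i j (r - int i, s + int i) = 0" for i j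
      using True s0[of "s + int i"] s1[of "l - 1 - s + int j"] by (auto simp: T_def conv_term_def tensor_simps algebra_simps)
    ultimately show ?thesis by (auto simp: tensor_simps)
  next
    case False
    then have "RA A 0 r s = (\<Sum>i<K. ca i (r - int i) *\<^sub>C A (r - int i) (s + int i))"
      by (subst RA_sum[where A = A and ?s0.0 = s0 and R = K]) (auto simp: s0 s1 K_def ca_shift)
    moreover have "RA A' 0 (n - 1 - r) (l - 1 - s) =
      (\<Sum>j<K. ca j (n - 1 - r - int j) *\<^sub>C A' (n - 1 - r - int j) (l - 1 - s + int j))"
      using False by (subst RA_sum[where A = A' and ?s0.0 = s1 and R = K]) (auto simp: s0 s1 K_def ca_shift)
    ultimately show ?thesis
      by (simp add: tensor_simps T_def conv_term_def scaleC_scaleC complex_vector.scale_sum_right algebra_simps)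
        (subst sum.swap, simp)
  qed
  have big: "Sum_any (T i j) = 0" if "i + j \<ge> K" for i j
  proof -
    have "T i j (r, s) = 0" for r s
    proof -
      have "s \<ge> s0 \<or> l + int (i + j) - 1 - s \<ge> s1" using that by (auto simp: K_def)
      then show ?thesis using s0 s1 by (auto simp: T_def conv_term_def tensor_simps)
    qed
    then have "T i j = (\<lambda>_. 0)" by auto
    then show ?thesis by simp
  qed
  have reidx: "Sum_any (\<lambda>(r, s). T i j (r - int i, s + int i)) = Sum_any (T i j)" for i j
    by (rule Sum_any.reindex_cong[OF bij_translation[of "- int i" "int i"], symmetric])
      (simp add: fun_eq_iff)
  have fin': "finite {x. (case x of (r, s) \<Rightarrow> T i j (r - int i, s + int i)) \<noteq> 0}" for i j
  proof -
    have "{x. (case x of (r, s) \<Rightarrow> T i j (r - int i, s + int i)) \<noteq> 0} \<subseteq> (\<lambda>(r, s). (r + int i, s - int i)) ` {x. T i j x \<noteq> 0}"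
    proof
      fix x assume "x \<in> {x. (case x of (r, s) \<Rightarrow> T i j (r - int i, s + int i)) \<noteq> 0}"
      then show "x \<in> (\<lambda>(r, s). (r + int i, s - int i)) ` {x. T i j x \<noteq> 0}"
        by (intro image_eqI[of _ _ "(fst x - int i, snd x + int i)"]) (auto split: prod.splits)
    qed
    then show ?thesis using fin finite_subset by blast
  qed
  have Ssum: "Sum_any (\<lambda>x. \<Sum>i\<in>I. g i x) = (\<Sum>i\<in>I. Sum_any (g i)) \<and> finite {x. (\<Sum>i\<in>I. g i x) \<noteq> 0}"
    if "\<And>i. finite {x. g i x \<noteq> 0}" "finite I" for g :: "nat \<Rightarrow> int \<times> int \<Rightarrow> ('a, 'b) tensor" and I
    using that(2)
  proof (induction I rule: finite_induct)
    case (insert i I)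
    have "finite {x. g i x + (\<Sum>i\<in>I. g i x) \<noteq> 0}"
      by (rule finite_subset[of _ "{x. g i x \<noteq> 0} \<union> {x. (\<Sum>i\<in>I. g i x) \<noteq> 0}"]) (use insert that in auto)
    then show ?case using insert that by (simp add: Sum_any.distrib)
  qed simp
  have "conv (\<lambda>n l. RA A 0 n l) (\<lambda>n l. RA A' 0 n l) n l = Sum_any (\<lambda>x. \<Sum>i<K. \<Sum>j<K. case x of (r, s) \<Rightarrow> T i j (r - int i, s + int i))"
    unfolding conv_def conv_term_def by (rule arg_cong[of _ _ Sum_any]) (auto simp: expand)
  also have "\<dots> = (\<Sum>i<K. \<Sum>j<K. Sum_any (T i j))"
  proof -
    have inner: "Sum_any (\<lambda>x. \<Sum>j<K. case x of (r, s) \<Rightarrow> T i j (r - int i, s + int i)) = (\<Sum>j<K. Sum_any (T i j))"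
      "finite {x. (\<Sum>j<K. case x of (r, s) \<Rightarrow> T i j (r - int i, s + int i)) \<noteq> 0}" for i
      using Ssum[of "\<lambda>j x. case x of (r, s) \<Rightarrow> T i j (r - int i, s + int i)" "{..<K}"] fin'[of i]
      by (simp_all only: reidx finite_lessThan)
    show ?thesis
      using Ssum[of "\<lambda>i x. \<Sum>j<K. case x of (r, s) \<Rightarrow> T i j (r - int i, s + int i)" "{..<K}"] inner
      by (simp only: finite_lessThan)
  qed
  also have "\<dots> = (\<Sum>(i, j)\<in>{..<K} \<times> {..<K}. Sum_any (T i j))"
    by (simp add: sum.cartesian_product)
  \<comment> \<open>Terms with i + j \<ge> K vanish, so the square is replaced by a triangle, which
    is then summed along the diagonals i + j = k.\<close>
  also have "\<dots> = (\<Sum>(i, j)\<in>{(i, j). i + j < K}. Sum_any (T i j))"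
  proof (rule sum.mono_neutral_right)
    show "\<forall>x\<in>{..<K} \<times> {..<K} - {(i, j). i + j < K}. (case x of (i, j) \<Rightarrow> Sum_any (T i j)) = 0"
      by (auto simp del: Sum_any.cong simp: not_less intro!: big)
  qed auto
  also have "\<dots> = (\<Sum>k<K. \<Sum>i\<le>k. Sum_any (T i (k - i)))"
    by (rule sum.triangle_reindex)
  also have "\<dots> = (\<Sum>k<K. ((- 1) ^ k * (of_int n gchoose k)) *\<^sub>C conv A A' (n - int k) (l + int k))"
  proof (rule sum.cong[OF refl])
    fix k
    have coef: "(\<Sum>i\<le>k. ca i r * ca (k - i) (n - 1 - r - int i - int (k - i))) = (- 1) ^ k * (of_int n gchoose k)" for r
    proof -
      have "(\<Sum>i\<le>k. ca i r * ca (k - i) (n - 1 - r - int i - int (k - i))) =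
        (\<Sum>i = 0..k. (of_int (- r - 1) gchoose i) * (of_int (r + int k - n) gchoose (k - i)))"
        by (rule sum.cong) (auto simp: ca_def of_nat_diff algebra_simps)
      also have "\<dots> = ((of_int (- (n - int k) - 1)) gchoose k)"
        by (subst gbinomial_Vandermonde) (simp add: algebra_simps)
      also have "\<dots> = (- 1) ^ k * (of_int n gchoose k)"
        by (subst gchoose_neg_mode[symmetric]) simp
      finally show ?thesis .
    qed
    have "(\<Sum>i\<le>k. Sum_any (T i (k - i))) = Sum_any (\<lambda>x. \<Sum>i\<le>k. T i (k - i) x)"
      using Ssum[of "\<lambda>i. T i (k - i)" "{..k}"] fin by simp
    also have "\<dots> = Sum_any (\<lambda>x. ((- 1) ^ k * (of_int n gchoose k)) *\<^sub>C conv_term A A' (n - int k) (l + int k) x)"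
    proof -
      have "(\<Sum>i\<le>k. T i (k - i) (r, s)) = ((- 1) ^ k * (of_int n gchoose k)) *\<^sub>C conv_term A A' (n - int k) (l + int k) (r, s)" for r s
      proof -
        have "(\<Sum>i\<le>k. T i (k - i) (r, s)) = (\<Sum>i\<le>k. (ca i r * ca (k - i) (n - 1 - r - int i - int (k - i))) *\<^sub>C
            conv_term A A' (n - int k) (l + int k) (r, s))"
          by (rule sum.cong) (auto simp: T_def)
        then show ?thesis by (simp only: complex_vector.scale_sum_left[symmetric] coef)
      qed
      then show ?thesis by (intro arg_cong[of _ _ Sum_any]) (simp add: fun_eq_iff)
    qed
    also have "\<dots> = ((- 1) ^ k * (of_int n gchoose k)) *\<^sub>C conv A A' (n - int k) (l + int k)"
      unfolding conv_def by (rule Sum_any_clinear[OF clinear_cmul[OF clinear_id] finite_conv_term[OF assms], symmetric])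
    finally show "(\<Sum>i\<le>k. Sum_any (T i (k - i))) = ((- 1) ^ k * (of_int n gchoose k)) *\<^sub>C conv A A' (n - int k) (l + int k)" .
  qed
  also have "\<dots> = RA (conv A A') 0 n l"
  proof (subst RA_sum[of "s0 + s1" "conv A A'" l K])
    fix r s assume "s0 + s1 \<le> s"
    then have "A r' s' = 0 \<or> A' r'' (s - 1 - s') = 0" for r' r'' s'
      using s0[of s' r'] s1[of "s - 1 - s'" r''] by linarith
    then have "conv_term A A' r s = (\<lambda>_. 0)" by (auto simp: conv_term_def tensor_eq_0_iff)
    then show "conv A A' r s = 0" by (simp add: conv_def)
  qed (auto simp: K_def)
  finally show ?thesis by simp
qed

lemma RA_conv_subst:
  assumes "colbdd A" "colbdd A'"
  shows "RA (conv A A') (m1 + m2) n l = conv (\<lambda>n l. RA A m1 n l) (\<lambda>n l. RA A' m2 n l) n l"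
proof -
  have *: "RA B m n l = RA (\<lambda>r s. B (r + m) s) 0 n l" for B :: "int \<Rightarrow> int \<Rightarrow> 'x::complex_vector" and m n l
    by (simp add: RA_def algebra_simps)
  have "RA (conv A A') (m1 + m2) n l = RA (conv (\<lambda>r s. A (r + m1) s) (\<lambda>r s. A' (r + m2) s)) 0 n l"
  proof -
    have "conv (\<lambda>r s. A (r + m1) s) (\<lambda>r s. A' (r + m2) s) = (\<lambda>r s. conv A A' (r + (m1 + m2)) s)"
      unfolding fun_eq_iff conv_shift1(1)[of A] conv_shift1(3)[of A] by (simp add: algebra_simps)
    then show ?thesis by (simp only: *[of _ "m1 + m2"])
  qed
  also have "\<dots> = conv (\<lambda>n l. RA A m1 n l) (\<lambda>n l. RA A' m2 n l) n l"
    unfolding *[of A m1] *[of A' m2]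
    by (rule RA_conv_subst0[OF colbdd_shift1(1)[OF assms(1)] colbdd_shift1(1)[OF assms(2)]])
  finally show ?thesis .
qed

text \<open>For n so large that \<open>C\<close> vanishes, the identity becomes
  \<open>RA = RB\<close>; for m so large that \<open>B\<close> vanishes, it becomes
  \<open>RC = RA\<close>. Both multiply factor by factor, with exponents N1 + N2 and M1 + M2, and
  \<open>borcherds_criterion\<close> restores the full identity.\<close>

theorem borcherds_conv:
  assumes A: "colbdd A" "colbdd A'" and B: "colbdd (flip B)" "colbdd (flip B')"
    and C: "colbdd (flip C)" "colbdd (flip C')"
    and bo: "\<And>m n l. RC C m n l = RA A m n l - RB B m n l" "\<And>m n l. RC C' m n l = RA A' m n l - RB B' m n l"
  shows "RC (conv C C') m n l = RA (conv A A') m n l - RB (conv B B') m n l"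
proof -
  have colz: "\<exists>N::nat. \<forall>r s. r \<ge> int N \<longrightarrow> D r s = 0" if "colbdd (flip D)" for D :: "int \<Rightarrow> int \<Rightarrow> 'x::complex_vector"
  proof -
    have "\<exists>s0. \<forall>r s. s \<ge> s0 \<longrightarrow> flip D r s = 0" using that by (simp add: colbdd_def)
    then obtain s0 where "\<And>r s. s \<ge> s0 \<Longrightarrow> flip D r s = 0" by blast
    then show ?thesis by (intro exI[of _ "nat s0"]) (auto simp: flip_def)
  qed
  obtain N1 where N1: "\<And>r s. r \<ge> int N1 \<Longrightarrow> C r s = 0" using colz[OF C(1)] by blast
  obtain N2 where N2: "\<And>r s. r \<ge> int N2 \<Longrightarrow> C' r s = 0" using colz[OF C(2)] by blast
  obtain M1 where M1: "\<And>r s. r \<ge> int M1 \<Longrightarrow> B r s = 0" using colz[OF B(1)] by blast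
  obtain M2 where M2: "\<And>r s. r \<ge> int M2 \<Longrightarrow> B' r s = 0" using colz[OF B(2)] by blast
  have cz: "conv D D' r s = 0" if "\<And>r s. r \<ge> int i \<Longrightarrow> D r s = 0" "\<And>r s. r \<ge> int j \<Longrightarrow> D' r s = 0" "r \<ge> int i + int j"
    for D :: "int \<Rightarrow> int \<Rightarrow> 'x::complex_vector" and D' :: "int \<Rightarrow> int \<Rightarrow> 'y::complex_vector" and r s i j
  proof -
    have "D r' s' = 0 \<or> D' (r - 1 - r') s'' = 0" for r' s' s''
      using that(1)[of r' s'] that(2)[of "r - 1 - r'" s''] that(3) by linarith
    then have "conv_term D D' r s = (\<lambda>_. 0)" by (auto simp: conv_term_def tensor_eq_0_iff)
    then show ?thesis by (simp add: conv_def)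
  qed
  have loc: "RA A m (int N1) l = RB B m (int N1) l" "RA A' m (int N2) l = RB B' m (int N2) l" for m l
    using bo(1)[of m "int N1" l] RC_sum[of "int N1" C "int N1" 0 m l] N1
      bo(2)[of m "int N2" l] RC_sum[of "int N2" C' "int N2" 0 m l] N2 by auto
  have ass: "RC C (int M1) n l = RA A (int M1) n l" "RC C' (int M2) n l = RA A' (int M2) n l" for n l
    using bo(1)[of "int M1" n l] RA_sum[of "int M1" "flip B" "int M1" 0 l n] M1
      bo(2)[of "int M2" n l] RA_sum[of "int M2" "flip B'" "int M2" 0 l n] M2
    by (auto simp: RB_def flip_def)
  show ?thesis
  proof (rule borcherds_criterion[where N = "int N1 + int N2" and M = "int M1 + int M2"])
    fix m l
    show "RA (conv A A') m (int N1 + int N2) l = RB (conv B B') m (int N1 + int N2) l"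
      by (simp add: RA_conv_nat[OF A] RB_conv_nat[OF B] loc)
    show "RC (conv C C') (int M1 + int M2) m l = RA (conv A A') (int M1 + int M2) m l"
      by (simp add: RA_conv_subst[OF A] RC_conv_nat[OF C] ass)
  qed (use cz[OF N1 N2] cz[OF M1 M2] in \<open>auto simp: flip_conv colbdd_conv A B C\<close>)
qed

section \<open>Tensor products of vertex superalgebras\<close>

lemma colbdd_exD: "colbdd A \<Longrightarrow> \<exists>s0. \<forall>r s. s \<ge> s0 \<longrightarrow> A r s = 0"
  by (simp add: colbdd_def)

lemma RA_add:
  assumes "colbdd A" "colbdd B"
  shows "RA (\<lambda>r s. A r s + B r s) m n l = RA A m n l + RA B m n l"
proof -
  obtain s0 s1 where s: "\<And>r s. s \<ge> s0 \<Longrightarrow> A r s = 0" "\<And>r s. s \<ge> s1 \<Longrightarrow> B r s = 0"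
    using colbdd_exD[OF assms(1)] colbdd_exD[OF assms(2)] by blast
  define R where "R = nat (max s0 s1 - l)"
  have "s0 - l \<le> int R" "s1 - l \<le> int R" "max s0 s1 - l \<le> int R" by (auto simp: R_def)
  then show ?thesis
    using RA_sum[of s0 A l R m n] RA_sum[of s1 B l R m n] RA_sum[of "max s0 s1" "\<lambda>r s. A r s + B r s" l R m n] s
    by (simp add: scaleC_add_right sum.distrib)
qed

lemma RA_scale:
  assumes "colbdd A"
  shows "RA (\<lambda>r s. x *\<^sub>C A r s) m n l = x *\<^sub>C RA A m n l"
proof -
  obtain s0 where s: "\<And>r s. s \<ge> s0 \<Longrightarrow> A r s = 0" using colbdd_exD[OF assms(1)] by blast
  show ?thesis
    using RA_sum[of s0 A l "nat (s0 - l)" m n] RA_sum[of s0 "\<lambda>r s. x *\<^sub>C A r s" l "nat (s0 - l)" m n] s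
    by (simp add: complex_vector.scale_sum_right scaleC_scaleC mult.commute)
qed

lemma flip_add_scale:
  "flip (\<lambda>r s. A r s + B r s) = (\<lambda>r s. flip A r s + flip B r s)" "flip (\<lambda>r s. x *\<^sub>C A r s) = (\<lambda>r s. x *\<^sub>C flip A r s)"
  by (simp_all add: flip_def fun_eq_iff)

lemma RB_add: "colbdd (flip A) \<Longrightarrow> colbdd (flip B) \<Longrightarrow>
    RB (\<lambda>r s. A r s + B r s) m n l = RB A m n l + RB B m n l"
  by (simp add: RB_def flip_add_scale RA_add scaleC_add_right)

lemma RB_scale: "colbdd (flip A) \<Longrightarrow> RB (\<lambda>r s. x *\<^sub>C A r s) m n l = x *\<^sub>C RB A m n l"
  by (simp add: RB_def flip_add_scale RA_scale scaleC_scaleC mult.commute)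

lemma RC_add:
  assumes "colbdd (flip A)" "colbdd (flip B)"
  shows "RC (\<lambda>r s. A r s + B r s) m n l = RC A m n l + RC B m n l"
proof -
  obtain s0 s1 where s: "\<And>r s. s \<ge> s0 \<Longrightarrow> flip A r s = 0" "\<And>r s. s \<ge> s1 \<Longrightarrow> flip B r s = 0"
    using colbdd_exD[OF assms(1)] colbdd_exD[OF assms(2)] by blast
  define R where "R = nat (max s0 s1 - n)"
  have "s0 - n \<le> int R" "s1 - n \<le> int R" "max s0 s1 - n \<le> int R" by (auto simp: R_def)
  then show ?thesis
    using RC_sum[of s0 A n R m l] RC_sum[of s1 B n R m l] RC_sum[of "max s0 s1" "\<lambda>r s. A r s + B r s" n R m l] s
    by (simp add: scaleC_add_right sum.distrib flip_def)
qed

lemma RC_scale: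
  assumes "colbdd (flip A)"
  shows "RC (\<lambda>r s. x *\<^sub>C A r s) m n l = x *\<^sub>C RC A m n l"
proof -
  obtain s0 where s: "\<And>r s. s \<ge> s0 \<Longrightarrow> flip A r s = 0" using colbdd_exD[OF assms(1)] by blast
  show ?thesis
    using RC_sum[of s0 A n "nat (s0 - n)" m l] RC_sum[of s0 "\<lambda>r s. x *\<^sub>C A r s" n "nat (s0 - n)" m l] s
    by (simp add: complex_vector.scale_sum_right scaleC_scaleC mult.commute flip_def)
qed

lemma R_zero [simp]: "RA (\<lambda>r s. 0) m n l = 0" "RC (\<lambda>r s. 0) m n l = 0"
  "RB (\<lambda>r s. 0) m n l = 0"
  by (simp_all add: RA_def RC_def RB_def flip_def)

lemma conv_iterated_flip:
  assumes "colbdd (flip A)" "colbdd (flip A')"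
  shows "conv A A' m l = Sum_any (\<lambda>r. Sum_any (\<lambda>s. A r s \<otimes> A' (m - 1 - r) (l - 1 - s)))"
  unfolding conv_flip[of A] conv_iterated(1)[OF assms] by (simp add: flip_def)

text \<open>The part of the axioms that makes both sides of the Borcherds identity meaningful. It
  allows the identity to be treated for a tensor product before that is known to be a vertex
  superalgebra.\<close>

locale truncated_product =
  fixes np :: "'v::complex_vector \<Rightarrow> int \<Rightarrow> 'v \<Rightarrow> 'v"
  assumes bilinear: "cbilinear (\<lambda>a b. np a n b)"
    and trunc: "\<exists>N. \<forall>n\<ge>N. np a n b = 0"
begin

lemma lin_right: "clinear (np a n)" and lin_left: "clinear (\<lambda>a. np a n b)"
  using cbilinearD[OF bilinear] by auto

lemmas np_simps = clinear_simps[OF lin_right] clinear_simps[OF lin_left]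

definition prodA where "prodA a b c m l = np a m (np b l c)"
definition prodB where "prodB a b c m l = np b l (np a m c)"
definition prodC where "prodC a b c n l = np (np a n b) l c"

lemma colbdd_prod: "colbdd (prodA a b c)" "colbdd (flip (prodB a b c))" "colbdd (flip (prodC a b c))"
proof -
  show "colbdd (prodA a b c)"
  proof -
    obtain N where "\<forall>n\<ge>N. np b n c = 0" using trunc by blast
    then have "\<exists>s0. \<forall>r s. s0 \<le> s \<longrightarrow> prodA a b c r s = 0" by (auto simp: prodA_def np_simps intro!: exI[of _ N])
    then show ?thesis using trunc by (simp add: colbdd_def prodA_def)
  qed
  show "colbdd (flip (prodB a b c))"
  proof -
    obtain N where "\<forall>n\<ge>N. np a n c = 0" using trunc by blast
    then have "\<exists>s0. \<forall>r s. s0 \<le> s \<longrightarrow> flip (prodB a b c) r s = 0"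
      by (auto simp: flip_def prodB_def np_simps intro!: exI[of _ N])
    then show ?thesis using trunc by (simp add: colbdd_def prodB_def flip_def)
  qed
  show "colbdd (flip (prodC a b c))"
  proof -
    obtain N where "\<forall>n\<ge>N. np a n b = 0" using trunc by blast
    then have "\<exists>s0. \<forall>r s. s0 \<le> s \<longrightarrow> flip (prodC a b c) r s = 0"
      by (auto simp: flip_def prodC_def np_simps intro!: exI[of _ N])
    then show ?thesis using trunc by (simp add: colbdd_def prodC_def flip_def)
  qed
qed

definition borch :: "complex \<Rightarrow> 'v \<Rightarrow> 'v \<Rightarrow> 'v \<Rightarrow> bool" where
  "borch x a b c \<longleftrightarrow> (\<forall>m n l. RC (prodC a b c) m n l = RA (prodA a b c) m n l - x *\<^sub>C RB (prodB a b c) m n l)"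

lemma borch_iff:
  "borch x a b c \<longleftrightarrow> (\<forall>l m n.
        Sum_any (\<lambda>r::nat. (of_int m gchoose r) *\<^sub>C np (np a (n + int r) b) (m + l - int r) c) =
        Sum_any (\<lambda>r::nat. ((- 1) ^ r * (of_int n gchoose r)) *\<^sub>C
            (np a (m + n - int r) (np b (l + int r) c)
             - ((- 1) powi n * x) *\<^sub>C np b (n + l - int r) (np a (m + int r) c))))"
proof -
  have "Sum_any (\<lambda>r::nat. ((- 1) ^ r * (of_int n gchoose r)) *\<^sub>C
            (np a (m + n - int r) (np b (l + int r) c)
             - ((- 1) powi n * x) *\<^sub>C np b (n + l - int r) (np a (m + int r) c))) =
    RA (prodA a b c) m n l - x *\<^sub>C RB (prodB a b c) m n l" for m n l
  proof -
    obtain N1 where N1: "\<And>n. n \<ge> N1 \<Longrightarrow> np b n c = 0" using trunc by blast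
    obtain N2 where N2: "\<And>n. n \<ge> N2 \<Longrightarrow> np a n c = 0" using trunc by blast
    define R where "R = max (nat (N1 - l)) (nat (N2 - m))"
    have 1: "RA (prodA a b c) m n l = (\<Sum>r<R. ((- 1) ^ r * (of_int n gchoose r)) *\<^sub>C np a (m + n - int r) (np b (l + int r) c))"
      using RA_sum[of N1 "prodA a b c" l R m n] N1 by (simp add: prodA_def np_simps R_def)
    have 2: "RB (prodB a b c) m n l = (- 1) powi n *\<^sub>C (\<Sum>r<R. ((- 1) ^ r * (of_int n gchoose r)) *\<^sub>C np b (l + n - int r) (np a (m + int r) c))"
      unfolding RB_def using RA_sum[of N2 "flip (prodB a b c)" m R l n] N2
      by (simp add: prodB_def np_simps R_def flip_def)
    show ?thesis unfolding 1 2
      by (subst Sum_any_lessThan[of R])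
        (use N1 N2 in \<open>auto simp: np_simps R_def sum_subtractf complex_vector.scale_right_diff_distrib
          scaleC_scaleC complex_vector.scale_sum_right ac_simps\<close>)
  qed
  moreover have "Sum_any (\<lambda>r::nat. (of_int m gchoose r) *\<^sub>C np (np a (n + int r) b) (m + l - int r) c) =
      RC (prodC a b c) m n l" for m n l
    by (simp add: RC_def prodC_def)
  ultimately show ?thesis unfolding borch_def by auto
qed

lemma prod_linear:
  "prodA (r *\<^sub>C a + a') b c = (\<lambda>m l. r *\<^sub>C prodA a b c m l + prodA a' b c m l)"
  "prodB (r *\<^sub>C a + a') b c = (\<lambda>m l. r *\<^sub>C prodB a b c m l + prodB a' b c m l)"
  "prodC (r *\<^sub>C a + a') b c = (\<lambda>m l. r *\<^sub>C prodC a b c m l + prodC a' b c m l)"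
  "prodA a (r *\<^sub>C b + b') c = (\<lambda>m l. r *\<^sub>C prodA a b c m l + prodA a b' c m l)"
  "prodB a (r *\<^sub>C b + b') c = (\<lambda>m l. r *\<^sub>C prodB a b c m l + prodB a b' c m l)"
  "prodC a (r *\<^sub>C b + b') c = (\<lambda>m l. r *\<^sub>C prodC a b c m l + prodC a b' c m l)"
  "prodA a b (r *\<^sub>C c + c') = (\<lambda>m l. r *\<^sub>C prodA a b c m l + prodA a b c' m l)"
  "prodB a b (r *\<^sub>C c + c') = (\<lambda>m l. r *\<^sub>C prodB a b c m l + prodB a b c' m l)"
  "prodC a b (r *\<^sub>C c + c') = (\<lambda>m l. r *\<^sub>C prodC a b c m l + prodC a b c' m l)"
  by (simp_all add: fun_eq_iff prodA_def prodB_def prodC_def np_simps)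

lemma colbdd_scaled: "colbdd (flip A) \<Longrightarrow> colbdd (flip (\<lambda>r s. x *\<^sub>C A r s))"
  by (simp add: flip_add_scale colbdd_scale)

lemmas R_linear = RA_add RB_add RC_add RA_scale RB_scale RC_scale colbdd_prod colbdd_scale colbdd_scaled

lemma borch_linear:
  "borch x a b c \<Longrightarrow> borch x a' b c \<Longrightarrow> borch x (r *\<^sub>C a + a') b c"
  "borch x a b c \<Longrightarrow> borch x a b' c \<Longrightarrow> borch x a (r *\<^sub>C b + b') c"
  "borch x a b c \<Longrightarrow> borch x a b c' \<Longrightarrow> borch x a b (r *\<^sub>C c + c')"
  unfolding borch_def prod_linear
  by (simp_all add: R_linear complex_vector.scale_right_diff_distrib scaleC_add_right scaleC_scaleC mult.commute)

lemma borch_zero: "borch x 0 b c" "borch x a 0 c" "borch x a b 0"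
proof -
  have "prodA 0 b c = (\<lambda>m l. 0)" "prodB 0 b c = (\<lambda>m l. 0)" "prodC 0 b c = (\<lambda>m l. 0)"
    "prodA a 0 c = (\<lambda>m l. 0)" "prodB a 0 c = (\<lambda>m l. 0)" "prodC a 0 c = (\<lambda>m l. 0)"
    "prodA a b 0 = (\<lambda>m l. 0)" "prodB a b 0 = (\<lambda>m l. 0)" "prodC a b 0 = (\<lambda>m l. 0)"
    by (simp_all add: fun_eq_iff prodA_def prodB_def prodC_def np_simps)
  then show "borch x 0 b c" "borch x a 0 c" "borch x a b 0" by (simp_all add: borch_def)
qed

text \<open>For a fixed sign x the identity is linear in each of the three vectors.\<close>

lemma borch_span:
  assumes "\<And>a b c. a \<in> X \<Longrightarrow> b \<in> Y \<Longrightarrow> c \<in> Z \<Longrightarrow> borch x a b c"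
    and "a \<in> complex_vector.span X" "b \<in> complex_vector.span Y" "c \<in> complex_vector.span Z"
  shows "borch x a b c"
proof -
  have 1: "borch x a b c" if "a \<in> X" "b \<in> Y" for a b
    using assms(4) by (induction rule: complex_vector.span_induct_alt) (auto simp: borch_zero intro: borch_linear assms(1) that)
  have 2: "borch x a b c" if "a \<in> X" for a
    using assms(3) by (induction rule: complex_vector.span_induct_alt) (auto simp: borch_zero intro: borch_linear 1 that)
  show ?thesis
    using assms(2) by (induction rule: complex_vector.span_induct_alt) (auto simp: borch_zero intro: borch_linear 2)
qed

end

lemma (in vsa) truncated_product: "truncated_product np"
proof
  show "cbilinear (\<lambda>a b. np a n b)" for n by (rule cbilinear_np)
  show "\<exists>N. \<forall>n\<ge>N. np a n b = 0" for a b using truncation[of a b] by blast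
qed

section \<open>Parity projections\<close>

context vsa
begin

sublocale T: truncated_product np by (rule truncated_product)

definition even_part :: "'v \<Rightarrow> 'v" where
  "even_part v = (THE v0. v0 \<in> part V False \<and> v - v0 \<in> part V True)"

lemma even_part_eq:
  assumes "v0 \<in> part V False" "v1 \<in> part V True"
  shows "even_part (v0 + v1) = v0"
  unfolding even_part_def
proof (rule the_equality)
  fix w assume w: "w \<in> part V False \<and> v0 + v1 - w \<in> part V True"
  have "v0 - w \<in> part V False"
    using w assms complex_vector.subspace_diff[OF part_subspace] by blast
  moreover have "v0 - w = (v0 + v1 - w) - v1" by simp
  then have "v0 - w \<in> part V True"
    using w assms complex_vector.subspace_diff[OF part_subspace[of True]] by metis
  ultimately show "w = v0" using part_inter[of "v0 - w"] by simp
qed (use assms in auto)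

lemma clinear_even_part: "clinear even_part"
proof (rule clinearI)
  fix x y r
  obtain x0 x1 where x: "x0 \<in> part V False" "x1 \<in> part V True" "x = x0 + x1" using part_decomp[of x] by blast
  obtain y0 y1 where y: "y0 \<in> part V False" "y1 \<in> part V True" "y = y0 + y1" using part_decomp[of y] by blast
  note s = complex_vector.subspace_add[OF part_subspace] complex_vector.subspace_scale[OF part_subspace]
  have "even_part ((x0 + y0) + (x1 + y1)) = x0 + y0" by (intro even_part_eq s x y)
  then show "even_part (x + y) = even_part x + even_part y"
    by (simp add: x y even_part_eq ac_simps)
  have "even_part (r *\<^sub>C x0 + r *\<^sub>C x1) = r *\<^sub>C x0" by (intro even_part_eq s x)
  then show "even_part (r *\<^sub>C x) = r *\<^sub>C even_part x"
    by (simp add: x even_part_eq scaleC_add_right)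
qed

lemma even_part_in: "even_part v \<in> part V False" "v - even_part v \<in> part V True"
  using part_decomp[of v] even_part_eq by (metis add_diff_cancel_left')+

lemma even_part_homog: "v \<in> part V i \<Longrightarrow> even_part v = (if i then 0 else v)"
  using even_part_eq[of v 0] even_part_eq[of 0 v] complex_vector.subspace_0[OF part_subspace]
  by (cases i) auto

text \<open>A linear operator that produces the Koszul sign on homogeneous vectors, so that sign
  rules extend to inhomogeneous ones.\<close>

definition parity_twist :: "bool \<Rightarrow> 'v \<Rightarrow> 'v" where
  "parity_twist i v = (if i then 2 *\<^sub>C even_part v - v else v)"

lemma clinear_parity_twist: "clinear (parity_twist i)"
  unfolding parity_twist_def
  by (cases i) (simp_all add: clinear_id clinear_minus[OF clinear_cmul[OF clinear_even_part] clinear_id])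

lemma parity_twist_homog: "v \<in> part V j \<Longrightarrow> parity_twist i v = ksign i j *\<^sub>C v"
proof -
  assume "v \<in> part V j"
  moreover have "2 *\<^sub>C v - v = v" using scaleC_add_left[of 1 1 v] by (simp add: scaleC_one)
  ultimately show ?thesis
    by (auto simp: parity_twist_def even_part_homog ksign_def scaleC_one)
qed

definition parity_part :: "bool \<Rightarrow> 'v \<Rightarrow> 'v" where
  "parity_part i v = (if i then v - even_part v else even_part v)"

lemma clinear_parity_part: "clinear (parity_part i)"
  unfolding parity_part_def
  by (cases i) (simp_all add: clinear_even_part clinear_minus[OF clinear_id clinear_even_part])

lemma parity_part_in: "parity_part i v \<in> part V i"
  by (simp add: parity_part_def even_part_in)

lemma parity_part_homog: "v \<in> part V j \<Longrightarrow> parity_part i v = (if i = j then v else 0)"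
  by (auto simp: parity_part_def even_part_homog)

lemma parity_part_sum: "v = parity_part False v + parity_part True v"
  by (simp add: parity_part_def)

end

section \<open>Tensor product of two vertex superalgebras\<close>

locale vsa_pair = V: vsa V + W: vsa W
  for V :: "'v::complex_vector vsa" and W :: "'w::complex_vector vsa"
begin

abbreviation VW where "VW \<equiv> tensor_vsa V W"

definition fourprod :: "int \<Rightarrow> 'v \<Rightarrow> 'w \<Rightarrow> 'v \<Rightarrow> 'w \<Rightarrow> ('v, 'w) tensor" where
  "fourprod n a b c d = Sum_any (\<lambda>r::int. nprod V a r c \<otimes> nprod W b (n - 1 - r) d)"

lemma fourprod_support: "\<exists>R. finite R \<and> {r. nprod V a r c \<otimes> nprod W b (n - 1 - r) d \<noteq> 0} \<subseteq> R"
proof -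
  obtain N1 where N1: "\<And>n. n \<ge> N1 \<Longrightarrow> nprod V a n c = 0" using V.truncation[of a c] by blast
  obtain N2 where N2: "\<And>n. n \<ge> N2 \<Longrightarrow> nprod W b n d = 0" using W.truncation[of b d] by blast
  have "r \<in> {n - 1 - N2..N1}" if "nprod V a r c \<otimes> nprod W b (n - 1 - r) d \<noteq> 0" for r
  proof (rule ccontr)
    assume "\<not> r \<in> {n - 1 - N2..N1}"
    then have "r \<ge> N1 \<or> n - 1 - r \<ge> N2" by auto
    then show False using that N1 N2 by (auto simp: tensor_simps)
  qed
  then show ?thesis by (intro exI[of _ "{n - 1 - N2..N1}"]) auto
qed

lemma fourprod_finite: "finite {r. nprod V a r c \<otimes> nprod W b (n - 1 - r) d \<noteq> 0}"
  using fourprod_support finite_subset by metis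

lemma fourprod_clinear:
  "clinear (\<lambda>a. fourprod n a b c d)" "clinear (\<lambda>b. fourprod n a b c d)"
  "clinear (\<lambda>c. fourprod n a b c d)" "clinear (\<lambda>d. fourprod n a b c d)"
proof -
  note S = V.np_simps W.np_simps tensor_simps
  note D = Sum_any.distrib[OF fourprod_finite fourprod_finite, symmetric]
  note E = Sum_any_clinear[OF clinear_cmul[OF clinear_id] fourprod_finite]
  show "clinear (\<lambda>a. fourprod n a b c d)" "clinear (\<lambda>b. fourprod n a b c d)"
    "clinear (\<lambda>c. fourprod n a b c d)" "clinear (\<lambda>d. fourprod n a b c d)"
    by (rule clinearI; simp add: fourprod_def D E S)+
qed

text \<open>The sign rule is prescribed on homogeneous vectors only. Splitting \<open>b\<close> by
  parity and twisting \<open>c\<close> gives a formula linear in all four arguments, hence a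
  bilinear product on the tensor product.\<close>

definition tprod4 where
  "tprod4 n a b c d = fourprod n a (W.parity_part False b) c d
     + fourprod n a (W.parity_part True b) (V.parity_twist True c) d"

lemma tprod4_clinear:
  "clinear (\<lambda>a. tprod4 n a b c d)" "clinear (\<lambda>b. tprod4 n a b c d)"
  "clinear (\<lambda>c. tprod4 n a b c d)" "clinear (\<lambda>d. tprod4 n a b c d)"
  unfolding tprod4_def
  by (intro clinear_plus fourprod_clinear
      clinear_compose[OF fourprod_clinear(2) W.clinear_parity_part]
      clinear_compose[OF fourprod_clinear(3) V.clinear_parity_twist])+

lemma tprod4_bilinear: "cbilinear (\<lambda>c d. tprod4 n a b c d)"
  by (simp add: cbilinear_iff tprod4_clinear)

lemma tprod4_bilinear': "cbilinear (\<lambda>a b. tprod4 n a b c d)"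
  by (simp add: cbilinear_iff tprod4_clinear)

lemma tprod4_homog: "b \<in> part W i \<Longrightarrow> c \<in> part V j \<Longrightarrow>
    tprod4 n a b c d = ksign i j *\<^sub>C fourprod n a b c d"
  by (cases i) (simp_all add: tprod4_def W.parity_part_homog V.parity_twist_homog
      clinear_simps[OF fourprod_clinear(2)] clinear_simps[OF fourprod_clinear(3)] scaleC_one)

definition tprod where
  "tprod n x y = tlift (\<lambda>a b. tlift (\<lambda>c d. tprod4 n a b c d) y) x"

lemma tprod_aux: "cbilinear (\<lambda>a b. tlift (\<lambda>c d. tprod4 n a b c d) y)"
proof -
  note L = clinear_tlift[OF tprod4_bilinear]
  note T = tlift_tensor[OF tprod4_bilinear]
  note C = clinear_simps[OF tprod4_clinear(1)] clinear_simps[OF tprod4_clinear(2)]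
  have "tlift (tprod4 n (a + a') b) y = tlift (tprod4 n a b) y + tlift (tprod4 n a' b) y" for a a' b
    by (rule clinear_tensor_ext[where f = "tlift (tprod4 n (a + a') b)"]) (intro clinear_plus L | simp add: T C)+
  moreover have "tlift (tprod4 n a (b + b')) y = tlift (tprod4 n a b) y + tlift (tprod4 n a b') y" for a b b'
    by (rule clinear_tensor_ext[where f = "tlift (tprod4 n a (b + b'))"]) (intro clinear_plus L | simp add: T C)+
  moreover have "tlift (tprod4 n (r *\<^sub>C a) b) y = r *\<^sub>C tlift (tprod4 n a b) y" for a b r
    by (rule clinear_tensor_ext[where f = "tlift (tprod4 n (r *\<^sub>C a) b)"]) (intro clinear_cmul L | simp add: T C)+
  moreover have "tlift (tprod4 n a (r *\<^sub>C b)) y = r *\<^sub>C tlift (tprod4 n a b) y" for a b r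
    by (rule clinear_tensor_ext[where f = "tlift (tprod4 n a (r *\<^sub>C b))"]) (intro clinear_cmul L | simp add: T C)+
  ultimately show ?thesis by (simp add: cbilinear_iff clinear_iff)
qed

lemma tprod_bilinear: "cbilinear (tprod n)"
proof -
  have "clinear (tprod n x)" for x
  proof (induction x)
    case (add x y)
    then show ?case by (simp add: tprod_def clinear_add[OF clinear_tlift[OF tprod_aux]] clinear_plus)
  next
    case (tensor a b)
    then show ?case by (simp add: tprod_def tlift_tensor[OF tprod_aux] clinear_tlift[OF tprod4_bilinear])
  qed
  moreover have "clinear (\<lambda>x. tprod n x y)" for y
    unfolding tprod_def by (rule clinear_tlift[OF tprod_aux])
  ultimately show ?thesis by (simp add: cbilinear_iff)
qed

lemma tprod_tensor: "b \<in> part W i \<Longrightarrow> c \<in> part V j \<Longrightarrow>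
    tprod n (a \<otimes> b) (c \<otimes> d) = ksign i j *\<^sub>C fourprod n a b c d"
  by (simp add: tprod_def tlift_tensor[OF tprod4_bilinear] tprod4_bilinear' tprod4_homog)

lemma bilinear_tensor_ext:
  assumes "cbilinear P" "cbilinear P'"
    and "\<And>a b c d i j. b \<in> part W i \<Longrightarrow> c \<in> part V j \<Longrightarrow> P (a \<otimes> b) (c \<otimes> d) = P' (a \<otimes> b) (c \<otimes> d)"
  shows "P x y = P' x y"
proof (induction x)
  case (add x y)
  then show ?case by (simp add: clinear_add[OF cbilinearD(2)[OF assms(1)]] clinear_add[OF cbilinearD(2)[OF assms(2)]])
next
  case (tensor a b)
  show ?case
  proof (induction y)
    case (add x y)
    then show ?case by (simp add: clinear_add[OF cbilinearD(1)[OF assms(1)]] clinear_add[OF cbilinearD(1)[OF assms(2)]])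
  next
    case (tensor c d)
    have *: "P (a \<otimes> b') (c \<otimes> d) = P' (a \<otimes> b') (c \<otimes> d)" if "b' \<in> part W i" for b' i
      by (subst (1 2) V.parity_part_sum[of c])
        (simp add: tensor_simps clinear_add[OF cbilinearD(1)[OF assms(1)]] clinear_add[OF cbilinearD(1)[OF assms(2)]]
          assms(3)[OF that V.parity_part_in])
    show ?case
      by (subst (1 2) W.parity_part_sum[of b])
        (simp add: tensor_simps clinear_add[OF cbilinearD(2)[OF assms(1)]] clinear_add[OF cbilinearD(2)[OF assms(2)]]
          *[OF W.parity_part_in])
  qed
qed

text \<open>Existence is provided by \<open>tprod\<close>, uniqueness by the fact that homogeneous
  pure tensors span. Together they discharge the definite description in the definition of the
  product.\<close>

lemma nprod_VW: "nprod VW x n y = tprod n x y"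
proof -
  have "(THE P. cbilinear P \<and>
         (\<forall>a d i j. \<forall>b \<in> part W i. \<forall>c \<in> part V j.
            P (a \<otimes> b) (c \<otimes> d) = ksign i j *\<^sub>C
              Sum_any (\<lambda>r::int. nprod V a r c \<otimes> nprod W b (n - 1 - r) d))) = tprod n"
  proof (rule the_equality, goal_cases)
    case 1
    show ?case using tprod_bilinear tprod_tensor by (auto simp: fourprod_def)
  next
    case (2 P)
    have "P x y = tprod n x y" for x y
      by (rule bilinear_tensor_ext) (use 2 tprod_bilinear tprod_tensor in \<open>auto simp: fourprod_def\<close>)
    then show ?case by (simp add: fun_eq_iff)
  qed
  then show ?thesis by (simp add: tensor_vsa_def)
qed

lemma VW_tensor: "b \<in> part W i \<Longrightarrow> c \<in> part V j \<Longrightarrow>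
    nprod VW (a \<otimes> b) n (c \<otimes> d) =
      ksign i j *\<^sub>C Sum_any (\<lambda>r::int. nprod V a r c \<otimes> nprod W b (n - 1 - r) d)"
  by (simp add: nprod_VW tprod_tensor fourprod_def)

lemma VW_part: "part VW i = complex_vector.span {a \<otimes> b |a b j. a \<in> part V j \<and> b \<in> part W (i \<noteq> j)}"
  and VW_vac: "vac VW = vac V \<otimes> vac W"
  by (simp_all add: tensor_vsa_def)

lemma VW_bilinear: "cbilinear (\<lambda>x y. nprod VW x n y)"
  using tprod_bilinear by (simp add: nprod_VW)

lemma tensor_part: "a \<in> part V i \<Longrightarrow> b \<in> part W j \<Longrightarrow> a \<otimes> b \<in> part VW (i \<noteq> j)"
  unfolding VW_part by (rule complex_vector.span_base) (cases i; cases j; fastforce)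

lemma VW_truncation: "\<exists>N. \<forall>n\<ge>N. nprod VW x n y = 0"
proof -
  note L = clinear_add[OF cbilinearD(1)[OF VW_bilinear]] clinear_add[OF cbilinearD(2)[OF VW_bilinear]]
  have *: "\<exists>N. \<forall>n\<ge>N. tprod4 n a b c d = 0" for a b c d
  proof -
    have f: "\<exists>N. \<forall>n\<ge>N. fourprod n a b c d = 0" for a b c d
    proof -
      obtain N1 where N1: "\<And>n. n \<ge> N1 \<Longrightarrow> nprod V a n c = 0" using V.truncation[of a c] by blast
      obtain N2 where N2: "\<And>n. n \<ge> N2 \<Longrightarrow> nprod W b n d = 0" using W.truncation[of b d] by blast
      have "nprod V a r c \<otimes> nprod W b (n - 1 - r) d = 0" if "n \<ge> N1 + N2 + 1" for n r
      proof (cases "r \<ge> N1")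
        case False
        then have "n - 1 - r \<ge> N2" using that by linarith
        then show ?thesis using N2 by (simp add: tensor_simps)
      qed (simp add: N1 tensor_simps)
      then show ?thesis by (intro exI[of _ "N1 + N2 + 1"]) (simp add: fourprod_def)
    qed
    obtain N1 N2 where "\<forall>n\<ge>N1. fourprod n a (W.parity_part False b) c d = 0"
      "\<forall>n\<ge>N2. fourprod n a (W.parity_part True b) (V.parity_twist True c) d = 0"
      using f by meson
    then show ?thesis by (intro exI[of _ "max N1 N2"]) (simp add: tprod4_def)
  qed
  show ?thesis
  proof (induction x)
    case (add x x')
    then obtain N N' where "\<forall>n\<ge>N. nprod VW x n y = 0" "\<forall>n\<ge>N'. nprod VW x' n y = 0" by blast
    then show ?case by (intro exI[of _ "max N N'"]) (simp add: L)
  next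
    case (tensor a b)
    show ?case
    proof (induction y)
      case (add y y')
      then obtain N N' where "\<forall>n\<ge>N. nprod VW (a \<otimes> b) n y = 0" "\<forall>n\<ge>N'. nprod VW (a \<otimes> b) n y' = 0" by blast
      then show ?case by (intro exI[of _ "max N N'"]) (simp add: L)
    next
      case (tensor c d)
      then show ?case using *[of a b c d]
        by (simp add: nprod_VW tprod_def tprod4_bilinear' tlift_tensor[OF tprod4_bilinear])
    qed
  qed
qed

sublocale VW: truncated_product "nprod VW"
  by unfold_locales (use VW_bilinear VW_truncation in auto)

lemma VW_conv:
  assumes "a' \<in> part W i'" "b \<in> part V j" "b' \<in> part W j'" "c \<in> part V k"
  shows "VW.prodC (a \<otimes> a') (b \<otimes> b') (c \<otimes> c') n l = (ksign i' j * ksign (i' \<noteq> j') k) *\<^sub>C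
      conv (V.T.prodC a b c) (W.T.prodC a' b' c') n l" (is ?C)
    and "a \<in> part V i \<Longrightarrow> VW.prodA (a \<otimes> a') (b \<otimes> b') (c \<otimes> c') m l = (ksign j' k * ksign i' (j \<noteq> k)) *\<^sub>C
      conv (V.T.prodA a b c) (W.T.prodA a' b' c') m l" (is "_ \<Longrightarrow> ?A")
    and "a \<in> part V i \<Longrightarrow> VW.prodB (a \<otimes> a') (b \<otimes> b') (c \<otimes> c') m l = (ksign i' k * ksign j' (i \<noteq> k)) *\<^sub>C
      conv (V.T.prodB a b c) (W.T.prodB a' b' c') m l" (is "_ \<Longrightarrow> ?B")
proof -
  note L = VW.np_simps
  have lc: "clinear (\<lambda>x. nprod VW x l z)" "clinear (\<lambda>x. nprod VW z l x)" for l z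
    by (rule VW.lin_left VW.lin_right)+
  note out = Sum_any_clinear[OF lc(1) fourprod_finite] Sum_any_clinear[OF lc(2) fourprod_finite]
  \<comment> \<open>A sign may be taken out of the sum without knowing that the support is finite,
    because it does not change the support.\<close>
  have sc: "Sum_any (\<lambda>r::int. x *\<^sub>C f r) = x *\<^sub>C Sum_any f" if "x * x = 1" for x and f :: "int \<Rightarrow> ('v, 'w) tensor"
  proof (cases "finite {r. f r \<noteq> 0}")
    case True then show ?thesis using Sum_any_clinear[OF clinear_cmul[OF clinear_id]] by metis
  next
    case False
    have "{r. x *\<^sub>C f r \<noteq> 0} = {r. f r \<noteq> 0}"
      using that by (metis (no_types, lifting) complex_vector.scale_eq_0_iff mult_eq_0_iff zero_neq_one)
    then show ?thesis using False by simp
  qed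
  have k1: "ksign i j * ksign i j = 1" for i j by simp
  show ?C
    unfolding VW.prodC_def VW_tensor[OF assms(1,2)] L(2) out L
    by (simp add: L out VW_tensor[OF W.np_part[OF assms(1,3)] assms(4)] sc[OF k1] scaleC_scaleC
        conv_iterated_flip[OF V.T.colbdd_prod(3) W.T.colbdd_prod(3)]
        V.T.prodC_def W.T.prodC_def)
  show ?A if a: "a \<in> part V i"
    unfolding VW.prodA_def VW_tensor[OF assms(3,4)] L(1) out L
    by (simp add: L out VW_tensor[OF assms(1) V.np_part[OF assms(2,4)]] sc[OF k1] scaleC_scaleC
        conv_iterated(1)[OF V.T.colbdd_prod(1) W.T.colbdd_prod(1)] V.T.prodA_def W.T.prodA_def)
  show ?B if a: "a \<in> part V i"
    unfolding VW.prodB_def VW_tensor[OF assms(1,4)] L(1) out L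
    by (simp add: L out VW_tensor[OF assms(3) V.np_part[OF a assms(4)]] sc[OF k1] scaleC_scaleC
        conv_iterated_flip[OF V.T.colbdd_prod(2) W.T.colbdd_prod(2)] V.T.prodB_def W.T.prodB_def)
qed

text \<open>Up to signs the three double sequences of the tensor product are convolutions of those
  of the factors. The signs of the factors are put into \<open>B\<close>, so that
  \<open>borcherds_conv\<close> applies in its unsigned form.\<close>

lemma VW_borch_homog:
  assumes "a \<in> part V i" "a' \<in> part W i'" "b \<in> part V j" "b' \<in> part W j'" "c \<in> part V k"
  shows "VW.borch (ksign (i \<noteq> i') (j \<noteq> j')) (a \<otimes> a') (b \<otimes> b') (c \<otimes> c')"
proof -
  let ?x = "ksign i j" and ?x' = "ksign i' j'"
  have bo: "V.T.borch ?x a b c" "W.T.borch ?x' a' b' c'"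
    unfolding V.T.borch_iff W.T.borch_iff
    using V.borcherds[OF assms(1,3)] W.borcherds[OF assms(2,4)] by auto
  define A where "A = conv (V.T.prodA a b c) (W.T.prodA a' b' c')"
  define B where "B = conv (\<lambda>m l. ?x *\<^sub>C V.T.prodB a b c m l) (\<lambda>m l. ?x' *\<^sub>C W.T.prodB a' b' c' m l)"
  define C where "C = conv (V.T.prodC a b c) (W.T.prodC a' b' c')"
  have B_eq: "B m l = (?x * ?x') *\<^sub>C conv (V.T.prodB a b c) (W.T.prodB a' b' c') m l" for m l
  proof -
    have "B m l = conv (\<lambda>l m. ?x *\<^sub>C flip (V.T.prodB a b c) l m) (\<lambda>l m. ?x' *\<^sub>C flip (W.T.prodB a' b' c') l m) l m"
      unfolding B_def conv_flip[of "\<lambda>m l. ?x *\<^sub>C V.T.prodB a b c m l"] flip_add_scale ..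
    also have "\<dots> = (?x * ?x') *\<^sub>C conv (V.T.prodB a b c) (W.T.prodB a' b' c') m l"
      unfolding conv_scale(1)[OF V.T.colbdd_prod(2) colbdd_scale[OF W.T.colbdd_prod(2)]]
        conv_scale(2)[OF V.T.colbdd_prod(2) W.T.colbdd_prod(2)] scaleC_scaleC conv_flip[of "V.T.prodB a b c"] ..
    finally show ?thesis .
  qed
  have main: "RC C m n l = RA A m n l - RB B m n l" for m n l
    unfolding A_def B_def C_def
  proof (rule borcherds_conv)
    show "colbdd (V.T.prodA a b c)" "colbdd (W.T.prodA a' b' c')"
      "colbdd (flip (V.T.prodC a b c))" "colbdd (flip (W.T.prodC a' b' c'))"
      by (rule V.T.colbdd_prod W.T.colbdd_prod)+
    show "colbdd (flip (\<lambda>m l. ?x *\<^sub>C V.T.prodB a b c m l))" "colbdd (flip (\<lambda>m l. ?x' *\<^sub>C W.T.prodB a' b' c' m l))"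
      by (rule V.T.colbdd_scaled V.T.colbdd_prod W.T.colbdd_scaled W.T.colbdd_prod)+
    fix m n l
    show "RC (V.T.prodC a b c) m n l = RA (V.T.prodA a b c) m n l - RB (\<lambda>m l. ?x *\<^sub>C V.T.prodB a b c m l) m n l"
      using bo(1) by (simp add: V.T.borch_def RB_scale V.T.colbdd_prod)
    show "RC (W.T.prodC a' b' c') m n l = RA (W.T.prodA a' b' c') m n l - RB (\<lambda>m l. ?x' *\<^sub>C W.T.prodB a' b' c' m l) m n l"
      using bo(2) by (simp add: W.T.borch_def RB_scale W.T.colbdd_prod)
  qed
  \<comment> \<open>The common sign of the iterated product and of the product in the given order.
    The opposite order differs from it by the Koszul sign of the tensor product and by the signs
    already put into \<open>B\<close>.\<close>
  define y where "y = ksign i' j * ksign (i' \<noteq> j') k"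
  have yA: "ksign j' k * ksign i' (j \<noteq> k) = y"
    by (cases i'; cases j; cases j'; cases k; simp add: y_def)
  have yB: "ksign i' k * ksign j' (i \<noteq> k) = y * (ksign (i \<noteq> i') (j \<noteq> j') * (?x * ?x'))"
    by (cases i; cases i'; cases j; cases j'; cases k; simp add: y_def)
  have cb: "colbdd A" "colbdd (flip B)" "colbdd (flip C)"
    unfolding A_def B_def C_def flip_conv
    by (intro colbdd_conv V.T.colbdd_prod W.T.colbdd_prod V.T.colbdd_scaled W.T.colbdd_scaled)+
  have k1: "ksign (i \<noteq> i') (j \<noteq> j') * ksign (i \<noteq> i') (j \<noteq> j') = 1" "?x * ?x' * (?x * ?x') = 1"
    by (cases i; cases i'; cases j; cases j'; simp)+
  have C': "VW.prodC (a \<otimes> a') (b \<otimes> b') (c \<otimes> c') = (\<lambda>n l. y *\<^sub>C C n l)"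
    unfolding fun_eq_iff VW_conv(1)[OF assms(2-5)] C_def y_def by simp
  have A': "VW.prodA (a \<otimes> a') (b \<otimes> b') (c \<otimes> c') = (\<lambda>n l. y *\<^sub>C A n l)"
    unfolding fun_eq_iff VW_conv(2)[OF assms(2-5) assms(1)] A_def yA by simp
  have B': "VW.prodB (a \<otimes> a') (b \<otimes> b') (c \<otimes> c') = (\<lambda>n l. (y * ksign (i \<noteq> i') (j \<noteq> j')) *\<^sub>C B n l)"
    unfolding fun_eq_iff VW_conv(3)[OF assms(2-5) assms(1)] B_eq yB by (simp add: scaleC_scaleC ac_simps)
  show ?thesis
    unfolding VW.borch_def A' B' C' RA_scale[OF cb(1)] RB_scale[OF cb(2)] RC_scale[OF cb(3)] main scaleC_scaleC
    using k1(1) by (simp add: complex_vector.scale_right_diff_distrib mult.assoc mult.left_commute[of _ y])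
qed

lemma VW_pure_span: "x \<in> complex_vector.span {c \<otimes> (d :: 'w) |c d k. c \<in> part V k}"
proof (induction x)
  case (add x y)
  then show ?case by (rule complex_vector.span_add)
next
  case (tensor c d)
  have "V.parity_part i c \<otimes> d \<in> complex_vector.span {c \<otimes> (d :: 'w) |c d k. c \<in> part V k}" for i
    by (rule complex_vector.span_base) (use V.parity_part_in in blast)
  then have "V.parity_part False c \<otimes> d + V.parity_part True c \<otimes> d \<in> complex_vector.span {c \<otimes> (d :: 'w) |c d k. c \<in> part V k}"
    by (intro complex_vector.span_add)
  then show ?case by (simp add: tensor_simps(1)[symmetric] clinear_add[OF clinear_tensor_left, symmetric] V.parity_part_sum[symmetric])
qed

lemma VW_borch:
  assumes "x \<in> part VW i" "y \<in> part VW j"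
  shows "VW.borch (ksign i j) x y z"
proof (rule VW.borch_span[OF _ assms[unfolded VW_part] VW_pure_span])
  fix a b c
  assume "a \<in> {a \<otimes> b |a b j. a \<in> part V j \<and> b \<in> part W (i \<noteq> j)}"
    and "b \<in> {a \<otimes> b |a b ja. a \<in> part V ja \<and> b \<in> part W (j \<noteq> ja)}"
    and "c \<in> {c \<otimes> (d :: 'w) |c d k. c \<in> part V k}"
  then obtain a1 a2 i1 b1 b2 j1 c1 c2 k where
    "a1 \<in> part V i1" "a2 \<in> part W (i \<noteq> i1)" "b1 \<in> part V j1" "b2 \<in> part W (j \<noteq> j1)" "c1 \<in> part V k"
    and e: "a = a1 \<otimes> a2" "b = b1 \<otimes> b2" "c = c1 \<otimes> c2" by blast
  from VW_borch_homog[OF this(1-5), of c2] show "VW.borch (ksign i j) a b c"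
    unfolding e by (cases i; cases i1; cases j; cases j1; simp)
qed

lemma VW_vac_np: "nprod VW (vac VW) n a = (if n = - 1 then a else 0)"
proof (induction a)
    case (add x y) then show ?case by (simp add: VW.np_simps)
  next
    case (tensor c d)
    have *: "nprod VW (vac VW) n (c \<otimes> d) = (if n = - 1 then c \<otimes> d else 0)" if c: "c \<in> part V j" for c j
    proof -
      have "(\<lambda>r. nprod V (vac V) r c \<otimes> nprod W (vac W) (n - 1 - r) d) = (\<lambda>r. if r = - 1 then (if n = - 1 then c \<otimes> d else 0) else 0)"
        by (auto simp: fun_eq_iff V.vac_np W.vac_np tensor_simps)
      then show ?thesis
      unfolding VW_vac VW_tensor[OF W.vac_even c] by (simp only: Sum_any.delta) (simp add: scaleC_one)
    qed
    show ?case
      by (subst (1 2) V.parity_part_sum[of c])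
        (simp add: clinear_add[OF clinear_tensor_left] VW.np_simps *[OF V.parity_part_in])
  qed

lemma VW_np_vac: "n \<ge> - 1 \<Longrightarrow> nprod VW a n (vac VW) = (if n = - 1 then a else 0)"
proof (induction a)
    case (add x y) then show ?case by (simp add: VW.np_simps)
  next
    case (tensor c d)
    have *: "nprod VW (c \<otimes> d) n (vac VW) = (if n = - 1 then c \<otimes> d else 0)" if d: "d \<in> part W j" for d j
    proof -
      have "(\<lambda>r. nprod V c r (vac V) \<otimes> nprod W d (n - 1 - r) (vac W)) = (\<lambda>r. if r = - 1 then (if n = - 1 then c \<otimes> d else 0) else 0)"
      proof
        fix r
        show "nprod V c r (vac V) \<otimes> nprod W d (n - 1 - r) (vac W) = (if r = - 1 then (if n = - 1 then c \<otimes> d else 0) else 0)"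
        proof -
          consider "r \<ge> 0" | "n - 1 - r \<ge> 0" | "r = - 1" "n = - 1" using tensor by linarith
          then show ?thesis
            by cases (use tensor in \<open>simp_all add: V.np_vac W.np_vac tensor_simps\<close>)
        qed
      qed
      then show ?thesis
        unfolding VW_vac VW_tensor[OF d V.vac_even] by (simp only: Sum_any.delta) (simp add: scaleC_one)
    qed
    show ?case
      by (subst (1 2) W.parity_part_sum[of d])
        (simp add: clinear_add[OF clinear_tensor_right] VW.np_simps *[OF W.parity_part_in])
  qed

lemma VW_np_part:
  assumes a: "a \<in> part VW i" and b: "b \<in> part VW j"
  shows "nprod VW a n b \<in> part VW (i \<noteq> j)"
  proof -
    have pp: "complex_vector.subspace (part VW l)" for l by (simp add: VW_part)
    have 1: "nprod VW (a \<otimes> a') n (b \<otimes> b') \<in> part VW (i \<noteq> j)"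
      if "a \<in> part V i1" "a' \<in> part W (i \<noteq> i1)" "b \<in> part V j1" "b' \<in> part W (j \<noteq> j1)" for a a' b b' i1 j1
    proof -
      have "nprod V a r b \<otimes> nprod W a' (n - 1 - r) b' \<in> part VW (i \<noteq> j)" for r
        using tensor_part[OF V.np_part[OF that(1,3)] W.np_part[OF that(2,4)], of r "n - 1 - r"]
        by (cases i; cases i1; cases j; cases j1) simp_all
      then show ?thesis
        unfolding VW_tensor[OF that(2,3)] Sum_any.expand_set
        by (intro complex_vector.subspace_scale[OF pp] complex_vector.subspace_sum[OF pp])
    qed
    have 2: "nprod VW (a \<otimes> a') n b \<in> part VW (i \<noteq> j)" if "a \<in> part V i1" "a' \<in> part W (i \<noteq> i1)" for a a' i1
      by (rule clinear_maps_span_subspace[OF VW.lin_right _ pp b[unfolded VW_part]]) (use 1 that in blast)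
    show ?thesis
      by (rule clinear_maps_span_subspace[OF VW.lin_left _ pp a[unfolded VW_part]]) (use 2 in blast)
  qed

theorem vertex_superalgebra_tensor: "vertex_superalgebra VW"
  unfolding vertex_superalgebra_def
proof (intro conjI allI ballI)
  show sub: "complex_vector.subspace (part VW False)" "complex_vector.subspace (part VW True)"
    by (simp_all add: VW_part)
  \<comment> \<open>The parity involution of the tensor product. It is 1 on the even and -1 on the
    odd part, so a vector in both equals its own negative.\<close>
  define S where "S = tensor_map (V.parity_twist True) (W.parity_twist True)"
  have S: "clinear S" unfolding S_def
    by (intro clinear_tensor_map V.clinear_parity_twist W.clinear_parity_twist)
  have S_part: "S x = (if i then - x else x)" if "x \<in> part VW i" for x i
  proof -
    have "S x = (if i then - 1 else 1) *\<^sub>C x"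
      using that unfolding VW_part
    proof (induction rule: complex_vector.span_induct_alt)
      case base then show ?case by (simp add: clinear_0[OF S])
    next
      case (step c x y)
      then obtain a b j where x: "x = a \<otimes> b" "a \<in> part V j" "b \<in> part W (i \<noteq> j)" by blast
      have "S x = (if i then - 1 else 1) *\<^sub>C x"
        by (cases i; cases j) (use x in \<open>simp_all add: S_def tensor_map_tensor V.clinear_parity_twist
          W.clinear_parity_twist V.parity_twist_homog W.parity_twist_homog tensor_simps scaleC_one\<close>)
      then show ?case using step by (simp add: clinear_simps[OF S] scaleC_add_right scaleC_scaleC mult.commute)
    qed
    then show ?thesis by (simp add: scaleC_one)
  qed
  have z: "x = 0" if "x = - x" for x :: "('v, 'w) tensor"
  proof -
    have "2 *\<^sub>C x = x + x" using scaleC_add_left[of 1 1 x] by (simp add: scaleC_one)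
    also have "\<dots> = 0" using that by (metis add.right_inverse)
    finally show ?thesis by simp
  qed
  show "part VW False \<inter> part VW True = {0}"
  proof (intro equalityI subsetI)
    fix x assume "x \<in> part VW False \<inter> part VW True"
    then have "x = - x" using S_part[of x False] S_part[of x True] by simp
    then show "x \<in> {0}" using z by simp
  qed (use complex_vector.subspace_0[OF sub(1)] complex_vector.subspace_0[OF sub(2)] in simp)
  show "\<exists>v0\<in>part VW False. \<exists>v1\<in>part VW True. v = v0 + v1" for v
  proof (induction v)
    case (add x y)
    then obtain x0 x1 y0 y1 where "x0 \<in> part VW False" "y0 \<in> part VW False" "x1 \<in> part VW True" "y1 \<in> part VW True"
      "x = x0 + x1" "y = y0 + y1" by blast
    then show ?case
      by (intro bexI[of _ "x0 + y0"] bexI[of _ "x1 + y1"]) (simp_all add: complex_vector.subspace_add sub)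
  next
    case (tensor a b)
    let ?p = "\<lambda>i j. V.parity_part i a \<otimes> W.parity_part j b"
    have p: "?p i j \<in> part VW (i \<noteq> j)" for i j by (intro tensor_part V.parity_part_in W.parity_part_in)
    have "a \<otimes> b = (V.parity_part False a + V.parity_part True a) \<otimes> (W.parity_part False b + W.parity_part True b)"
      by (simp add: V.parity_part_sum[symmetric] W.parity_part_sum[symmetric])
    also have "\<dots> = (?p False False + ?p True True) + (?p False True + ?p True False)"
      by (simp add: tensor_simps)
    finally show ?case using p[of False False] p[of True True] p[of False True] p[of True False]
      by (intro bexI[of _ "?p False False + ?p True True"] bexI[of _ "?p False True + ?p True False"])
        (simp_all add: complex_vector.subspace_add sub)
  qed
  show "vac VW \<in> part VW False"
    using tensor_part[OF V.vac_even W.vac_even] by (simp add: VW_vac)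
  show "vac VW \<noteq> 0" by (simp add: VW_vac tensor_eq_0_iff V.vac_nonzero W.vac_nonzero)
  show "cbilinear (\<lambda>a b. nprod VW a n b)" for n by (rule VW_bilinear)
  show "\<exists>N. \<forall>n\<ge>N. nprod VW a n b = 0" for a b by (rule VW_truncation)
  show "nprod VW a (- 1) (vac VW) = a" for a using VW_np_vac[of "-1" a] by simp
  show "n \<ge> 0 \<longrightarrow> nprod VW a n (vac VW) = 0" for a n using VW_np_vac[of n a] by simp
  show "nprod VW (vac VW) n a = (if n = - 1 then a else 0)" for n a by (rule VW_vac_np)
  show "nprod VW a n b \<in> part VW (i \<noteq> j)" if "a \<in> part VW i" "b \<in> part VW j" for i j a b n
    by (rule VW_np_part[OF that])
  show "Sum_any (\<lambda>r::nat. (of_int m gchoose r) *\<^sub>C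
            nprod VW (nprod VW a (n + int r) b) (m + l - int r) c) =
        Sum_any (\<lambda>r::nat. ((- 1) ^ r * (of_int n gchoose r)) *\<^sub>C
            (nprod VW a (m + n - int r) (nprod VW b (l + int r) c)
             - ((- 1) powi n * ksign i j) *\<^sub>C
                 nprod VW b (n + l - int r) (nprod VW a (m + int r) c)))"
    if "a \<in> part VW i" "b \<in> part VW j" for i j a b c l m n
    using VW_borch[OF that, of c] unfolding VW.borch_iff by blast
qed

end

section \<open>Highest weight modules of graded operator algebras\<close>

text \<open>Subtracting one eigenvalue from \<open>T\<close> removes one summand and rescales the
  others by nonzero factors, which is the induction step.\<close>

lemma eigen_components:
  assumes T: "clinear T" and I: "complex_vector.subspace I" "\<And>v. v \<in> I \<Longrightarrow> T v \<in> I"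
    and A: "finite A" "\<And>i. i \<in> A \<Longrightarrow> T (u i) = lam i *\<^sub>C u i" "inj_on lam A" "(\<Sum>i\<in>A. u i) \<in> I" "i \<in> A"
  shows "u i \<in> I"
  using A
proof (induction A arbitrary: u i rule: finite_induct)
  case (insert a A)
  have eig: "T (u j) = lam j *\<^sub>C u j" if "j \<in> insert a A" for j using insert.prems(1) that .
  have "T (\<Sum>i\<in>insert a A. u i) - lam a *\<^sub>C (\<Sum>i\<in>insert a A. u i) \<in> I"
    using insert.prems I by (intro complex_vector.subspace_diff complex_vector.subspace_scale) auto
  also have "T (\<Sum>i\<in>insert a A. u i) - lam a *\<^sub>C (\<Sum>i\<in>insert a A. u i) = (\<Sum>i\<in>A. (lam i - lam a) *\<^sub>C u i)"
    using insert.hyps by (simp add: clinear_simps[OF T] eig complex_vector.scale_sum_right scaleC_add_right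
        sum_subtractf[symmetric] complex_vector.scale_left_diff_distrib)
  finally have sum: "(\<Sum>i\<in>A. (lam i - lam a) *\<^sub>C u i) \<in> I" .
  have "(lam j - lam a) *\<^sub>C u j \<in> I" if "j \<in> A" for j
    by (rule insert.IH[OF _ _ sum that])
      (use insert.prems eig in \<open>auto simp: clinear_simps[OF T] scaleC_scaleC mult.commute inj_on_def\<close>)
  moreover have "lam j - lam a \<noteq> 0" if "j \<in> A" for j
    using insert.prems(2) insert.hyps that by (auto simp: inj_on_def)
  ultimately have 1: "u j \<in> I" if "j \<in> A" for j
    using complex_vector.subspace_scale[OF I(1), of "(lam j - lam a) *\<^sub>C u j" "inverse (lam j - lam a)"] that
    by (simp add: scaleC_scaleC scaleC_one)
  then have "(\<Sum>i\<in>insert a A. u i) - (\<Sum>i\<in>A. u i) \<in> I"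
    by (intro complex_vector.subspace_diff[OF I(1) insert.prems(3)] complex_vector.subspace_sum[OF I(1)])
  moreover have "(\<Sum>i\<in>insert a A. u i) - (\<Sum>i\<in>A. u i) = u a" using insert.hyps by simp
  ultimately have "u a \<in> I" by simp
  then show ?case using 1 insert.prems by auto
qed simp

text \<open>A common frame for the four algebras of modes. Operators commute up to a scalar x, which
  may be a Koszul sign, and up to operators of the total degree applied to the same vector. The
  grading group may be finer than \<open>deg\<close>, which alone decides what counts as
  raising.\<close>

locale graded_ops =
  fixes Op :: "'g::ab_group_add \<Rightarrow> ('v::complex_vector \<Rightarrow> 'v) set" and deg :: "'g \<Rightarrow> int" and w :: 'v
  assumes op_linear: "A \<in> Op g \<Longrightarrow> clinear A"
    and deg_add: "deg (g + h) = deg g + deg h"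
    and op_comm: "A \<in> Op g \<Longrightarrow> B \<in> Op h \<Longrightarrow>
      \<exists>x. A (B v) - x *\<^sub>C B (A v) \<in> complex_vector.span {C v |C. C \<in> Op (g + h)}"
    and op_lowering: "A \<in> Op g \<Longrightarrow> deg g \<le> 0 \<Longrightarrow> A w \<in> (if g = 0 then complex_vector.span {w} else {0})"
begin

lemma deg_0: "deg 0 = 0"
  using deg_add[of 0 0] by simp

inductive mon :: "'g \<Rightarrow> 'v \<Rightarrow> bool" where
  base: "mon 0 w"
| step: "mon h u \<Longrightarrow> A \<in> Op g \<Longrightarrow> deg g > 0 \<Longrightarrow> mon (g + h) (A u)"

definition Mon :: "'g \<Rightarrow> 'v set" where "Mon g = complex_vector.span {v. mon g v}"

lemma Mon_subspace: "complex_vector.subspace (Mon g)"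
  unfolding Mon_def by (rule complex_vector.subspace_span)

lemma mon_Mon: "mon g v \<Longrightarrow> v \<in> Mon g"
  unfolding Mon_def by (simp add: complex_vector.span_base)

text \<open>Commute a lowering operator past the raising ones until it reaches \<open>w\<close>.\<close>

lemma mon_closed: "mon h u \<Longrightarrow> B \<in> Op g \<Longrightarrow> B u \<in> Mon (g + h)"
proof (induction arbitrary: g B rule: mon.induct)
  case base
  show ?case
  proof (cases "deg g > 0")
    case True
    then show ?thesis using mon.step[OF mon.base base] by (simp add: mon_Mon)
  next
    case False
    then have "B w \<in> (if g = 0 then complex_vector.span {w} else {0})" using op_lowering[OF base] by simp
    moreover have "complex_vector.span {w} \<subseteq> Mon 0"
      unfolding Mon_def by (rule complex_vector.span_mono) (simp add: mon.base)
    ultimately show ?thesis using complex_vector.subspace_0[OF Mon_subspace[of g]] by (auto split: if_splits)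
  qed
next
  case (step h u A g' g B)
  show ?case
  proof (cases "deg g > 0")
    case True
    then show ?thesis using mon.step[OF mon.step[OF step.hyps] step.prems] by (simp add: mon_Mon)
  next
    case False
    obtain x where x: "B (A u) - x *\<^sub>C A (B u) \<in> complex_vector.span {C u |C. C \<in> Op (g + g')}"
      using op_comm[OF step.prems step.hyps(2)] by blast
    have "{C u |C. C \<in> Op (g + g')} \<subseteq> Mon (g + (g' + h))"
    proof safe
      fix C assume "C \<in> Op (g + g')"
      from step.IH[OF this] show "C u \<in> Mon (g + (g' + h))" by (simp add: add.assoc)
    qed
    then have 1: "B (A u) - x *\<^sub>C A (B u) \<in> Mon (g + (g' + h))"
      using x complex_vector.span_minimal[OF _ Mon_subspace] by blast
    have "B u \<in> complex_vector.span {v. mon (g + h) v}" using step.IH[OF step.prems] by (simp add: Mon_def)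
    then have "A (B u) \<in> complex_vector.span {v. mon (g + (g' + h)) v}"
    proof (rule clinear_maps_span[OF op_linear[OF step.hyps(2)], rotated])
      fix v assume "v \<in> {v. mon (g + h) v}"
      then have "mon (g' + (g + h)) (A v)" using mon.step[OF _ step.hyps(2,3)] by simp
      then show "A v \<in> complex_vector.span {v. mon (g + (g' + h)) v}"
        by (simp add: add.left_commute complex_vector.span_base)
    qed
    then have "x *\<^sub>C A (B u) \<in> Mon (g + (g' + h))"
      by (simp add: Mon_def complex_vector.span_scale)
    from complex_vector.subspace_add[OF Mon_subspace 1 this] show ?thesis by simp
  qed
qed

lemma Mon_closed: "u \<in> Mon h \<Longrightarrow> B \<in> Op g \<Longrightarrow> B u \<in> Mon (g + h)"
  unfolding Mon_def[of h]
  by (rule clinear_maps_span_subspace[OF op_linear _ Mon_subspace]) (auto intro: mon_closed)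

lemma mon_deg: "mon g u \<Longrightarrow> deg g \<ge> 0 \<and> (deg g = 0 \<longrightarrow> g = 0 \<and> u = w)"
  by (induction rule: mon.induct) (auto simp: deg_add deg_0)

lemma Mon_deg_0: "deg g \<le> 0 \<Longrightarrow> u \<in> Mon g \<Longrightarrow> u \<noteq> 0 \<Longrightarrow> g = 0 \<and> u \<in> complex_vector.span {w}"
proof -
  assume g: "deg g \<le> 0" and u: "u \<in> Mon g" "u \<noteq> 0"
  have sub: "{v. mon g v} \<subseteq> {w}" using mon_deg[of g] g by auto
  have "{v. mon g v} \<noteq> {}"
  proof
    assume "{v. mon g v} = {}"
    then show False using u by (simp add: Mon_def del: Collect_empty_eq)
  qed
  then have "g = 0" using mon_deg[of g] g by auto
  then show ?thesis using u sub complex_vector.span_mono[OF sub] by (auto simp: Mon_def)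
qed

lemma Mon_deg_neg: "deg g < 0 \<Longrightarrow> u \<in> Mon g \<Longrightarrow> u = 0"
  using Mon_deg_0[of g u] by (cases "u = 0") (auto simp: deg_0)

lemma Mon_eigen:
  assumes D: "clinear D" "D w = x *\<^sub>C w" "\<And>A g v. A \<in> Op g \<Longrightarrow> D (A v) = A (D v) + ch g *\<^sub>C A v"
    and ch: "\<And>g h. ch (g + h) = ch g + ch h" and u: "u \<in> Mon g"
  shows "D u = (x + ch g) *\<^sub>C u"
proof -
  have ch0: "ch 0 = 0" using ch[of 0 0] by simp
  have m: "D u = (x + ch g) *\<^sub>C u" if "mon g u" for g u
    using that
    by (induction rule: mon.induct)
      (simp_all add: D ch0 ch clinear_scale[OF op_linear] clinear_add[OF op_linear] scaleC_add_left add_ac)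
  show ?thesis
    using u unfolding Mon_def
    by (induction rule: complex_vector.span_induct_alt)
      (simp_all add: clinear_simps[OF D(1)] m scaleC_add_right scaleC_scaleC mult.commute)
qed

definition total :: "'v set" where "total = complex_vector.span {v. \<exists>g. mon g v}"

lemma total_subspace: "complex_vector.subspace total"
  unfolding total_def by (rule complex_vector.subspace_span)

lemma Mon_total: "Mon g \<subseteq> total"
  unfolding Mon_def total_def by (rule complex_vector.span_mono) auto

lemma w_total: "w \<in> total"
  using mon_Mon[OF mon.base] Mon_total by blast

lemma total_closed:
  assumes "u \<in> total" "B \<in> Op g"
  shows "B u \<in> total"
proof (rule clinear_maps_span_subspace[OF op_linear[OF assms(2)] _ total_subspace assms(1)[unfolded total_def]])
  fix v assume "v \<in> {v. \<exists>g. mon g v}"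
  then show "B v \<in> total" using mon_closed[OF _ assms(2)] Mon_total by blast
qed

lemma total_components:
  assumes "u \<in> total"
  obtains A f where "finite A" "\<And>g. g \<in> A \<Longrightarrow> f g \<in> Mon g" "u = (\<Sum>g\<in>A. f g)"
proof -
  have "\<exists>A f. finite A \<and> (\<forall>g. f g \<in> Mon g) \<and> (\<forall>g. g \<notin> A \<longrightarrow> f g = 0) \<and> u = (\<Sum>g\<in>A. f g)"
    using assms unfolding total_def
  proof (induction rule: complex_vector.span_induct_alt)
    case base
    show ?case by (intro exI[of _ "{}"] exI[of _ "\<lambda>_. 0"]) (simp add: complex_vector.subspace_0[OF Mon_subspace])
  next
    case (step c x y)
    then obtain A f where f: "finite A" "\<forall>g. f g \<in> Mon g" "\<forall>g. g \<notin> A \<longrightarrow> f g = 0" "y = (\<Sum>g\<in>A. f g)" by blast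
    obtain g where g: "mon g x" using step by blast
    let ?f = "f(g := c *\<^sub>C x + f g)"
    have "(\<Sum>h\<in>insert g A. ?f h) = c *\<^sub>C x + (\<Sum>h\<in>insert g A. f h)"
    proof -
      have "(\<Sum>h\<in>A - {g}. ?f h) = (\<Sum>h\<in>A - {g}. f h)" by (rule sum.cong) auto
      then show ?thesis using f(1) by (simp add: sum.insert_remove add.assoc)
    qed
    also have "(\<Sum>h\<in>insert g A. f h) = y" using f by (cases "g \<in> A") (auto simp: insert_absorb)
    finally have "c *\<^sub>C x + y = (\<Sum>h\<in>insert g A. ?f h)" by simp
    moreover have "?f h \<in> Mon h" for h
      using f mon_Mon[OF g] complex_vector.subspace_add[OF Mon_subspace] complex_vector.subspace_scale[OF Mon_subspace] by auto
    ultimately show ?case using f by (intro exI[of _ "insert g A"] exI[of _ ?f]) auto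
  qed
  then show ?thesis using that by blast
qed

lemma total_eigen_split:
  assumes D: "clinear D" and eig: "\<And>g u. u \<in> Mon g \<Longrightarrow> D u = lam g *\<^sub>C u" and inj: "inj lam"
    and I: "complex_vector.subspace I" "\<And>v. v \<in> I \<Longrightarrow> D v \<in> I"
    and A: "finite A" "\<And>g. g \<in> A \<Longrightarrow> f g \<in> Mon g" "(\<Sum>g\<in>A. f g) \<in> I" "g \<in> A"
  shows "f g \<in> I"
  by (rule eigen_components[OF D I A(1) _ _ A(3,4), where lam = lam])
    (use eig A(2) inj in \<open>auto simp: inj_on_def inj_def\<close>)

text \<open>This is the tool for determining singular vectors: a weight operator that annihilates
  such a vector confines it to weight 0, and that part is spanned by \<open>w\<close>.\<close>

lemma total_kernel:
  assumes "u \<in> total" and D: "clinear D" "D w = 0" "\<And>A g v. A \<in> Op g \<Longrightarrow> D (A v) = A (D v) + ch g *\<^sub>C A v"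
    and ch: "\<And>g h. ch (g + h) = ch g + ch h" "\<And>g. deg g > 0 \<Longrightarrow> ch g \<noteq> 0" and u: "D u = 0"
  shows "u \<in> complex_vector.span {w}"
proof -
  obtain A f where A: "finite A" "\<And>g. g \<in> A \<Longrightarrow> f g \<in> Mon g" "u = (\<Sum>g\<in>A. f g)"
    using total_components[OF assms(1)] by blast
  have eig: "D v = ch g *\<^sub>C v" if "v \<in> Mon g" for g v
    using Mon_eigen[OF D(1) _ D(3) ch(1) that, of 0] D(2) by simp
  define P where "P = complex_vector.span {w}"
  \<comment> \<open>Since \<open>ch\<close> need not be injective, the components are first
    collected by eigenvalue.\<close>
  define lams where "lams = ch ` A"
  define h where "h = (\<lambda>x. \<Sum>g | g \<in> A \<and> ch g = x. f g)"
  have hsum: "u = (\<Sum>x\<in>lams. h x)"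
    unfolding h_def lams_def A(3) by (rule sum.image_gen[OF A(1)])
  have heig: "D (h x) = x *\<^sub>C h x" for x
    using eig A(2) by (auto simp: h_def clinear_sum[OF D(1)] complex_vector.scale_sum_right intro!: sum.cong)
  let ?K = "{v. D v = 0}"
  have K: "complex_vector.subspace ?K"
    by (simp add: complex_vector.subspace_def clinear_simps[OF D(1)])
  have "h x \<in> ?K" if "x \<in> lams" for x
  proof (rule eigen_components[where u = h and lam = "\<lambda>x. x" and A = lams and i = x, OF D(1) K])
    show "finite lams" using A(1) by (simp add: lams_def)
    show "(\<Sum>x\<in>lams. h x) \<in> ?K" using u hsum by simp
    show "inj_on (\<lambda>x. x) lams" by simp
  qed (use heig that in \<open>auto simp: clinear_simps[OF D(1)]\<close>)
  then have h0: "h x = 0" if "x \<in> lams" "x \<noteq> 0" for x using heig[of x] that by auto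
  have "u = (\<Sum>x\<in>lams. if x = 0 then h 0 else 0)"
    unfolding hsum by (rule sum.cong) (auto simp: h0)
  also have "\<dots> = h 0"
  proof (cases "0 \<in> lams")
    case False
    then have "h 0 = 0" by (auto simp: h_def lams_def intro!: sum.neutral)
    then show ?thesis using False A(1) by (auto simp: lams_def)
  qed (use A(1) in \<open>simp add: lams_def\<close>)
  also have "\<dots> \<in> P"
    unfolding h_def
  proof (rule complex_vector.subspace_sum)
    show "complex_vector.subspace P" by (simp add: P_def)
    fix g assume "g \<in> {g. g \<in> A \<and> ch g = 0}"
    then have "deg g \<le> 0" "f g \<in> Mon g" using ch(2)[of g] A(2) by force+
    then show "f g \<in> P" using Mon_deg_0[of g "f g"] by (cases "f g = 0") (auto simp: P_def complex_vector.span_zero)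
  qed
  finally show ?thesis by (simp add: P_def)
qed

end

context vsa begin

lemma generated_eq_total:
  assumes "\<And>x. x \<in> X \<Longrightarrow> \<exists>i. x \<in> part V i" "graded_ops Op deg (vac V)"
    and "\<And>x n. x \<in> X \<Longrightarrow> \<exists>g. np x n \<in> Op g"
  shows "vsa_generated V X \<subseteq> graded_ops.total Op deg (vac V)"
proof -
  interpret graded_ops Op deg "vac V" by fact
  show ?thesis
    by (rule generated_induct_modes[OF assms(1) total_subspace w_total]) (use assms(3) total_closed in blast)+
qed

end

section \<open>Vectors annihilated by the positive modes\<close>

subsection \<open>The Heisenberg vertex algebra\<close>

locale heisenberg =
  fixes M :: "'m::complex_vector vsa" and c d :: 'm
  assumes heis: "heisenberg_vsa M c d"

sublocale heisenberg \<subseteq> vsa M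
  using heis by unfold_locales (simp add: heisenberg_vsa_def)

context heisenberg begin

lemma all_even: "v \<in> part M False"
  using part_decomp[of v] heis by (auto simp: heisenberg_vsa_def)

lemma comm: "np c m (np c n v) = np c n (np c m v)" "np d m (np d n v) = np d n (np d m v)"
  "np c m (np d n v) = np d n (np c m v) + (if m + n = 0 then (2 * of_int m) *\<^sub>C v else 0)"
  using heis by (auto simp: heisenberg_vsa_def scomm_def scaleC_one algebra_simps)

lemma generated: "vsa_generated M {c, d} = UNIV"
  using heis by (simp add: heisenberg_vsa_def)

text \<open>Both zero modes commute with all modes of the generators and annihilate the
  vacuum.\<close>

lemma zero_modes: "np c 0 v = 0" "np d 0 v = 0"
proof -
  have "vsa_generated M {c, d} \<subseteq> {v. np c 0 v = 0 \<and> np d 0 v = 0}"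
  proof (rule generated_induct_modes)
    fix x n v assume "x \<in> {c, d}" "v \<in> {v. np c 0 v = 0 \<and> np d 0 v = 0}"
    then show "np x n v \<in> {v. np c 0 v = 0 \<and> np d 0 v = 0}"
      using comm(1)[of 0 n v] comm(2)[of 0 n v] comm(3)[of 0 n v] comm(3)[of n 0 v]
      by (cases "n = 0") (auto simp: np_simps)
  qed (use all_even in \<open>auto simp: complex_vector.subspace_def np_simps np_vac\<close>)
  then show "np c 0 v = 0" "np d 0 v = 0" unfolding generated by auto
qed

text \<open>The identity is counted among the operators of degree 0 in order to absorb the central
  terms; the other three algebras are treated in the same way.\<close>

definition hOp :: "int \<Rightarrow> ('m \<Rightarrow> 'm) set" where
  "hOp g = {np c (- g), np d (- g)} \<union> (if g = 0 then {\<lambda>v. v} else {})"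

lemma graded_ops: "graded_ops hOp (\<lambda>g. g) (vac M)"
proof (rule graded_ops.intro)
  fix A B g h v assume A: "A \<in> hOp g" and B: "B \<in> hOp h"
  let ?S = "complex_vector.span {C v |C. C \<in> hOp (g + h)}"
  have S: "x *\<^sub>C v \<in> ?S" if "g + h = 0" for x
    by (rule complex_vector.span_scale, rule complex_vector.span_base) (use that in \<open>auto simp: hOp_def\<close>)
  consider "A = (\<lambda>v. v)" | "B = (\<lambda>v. v)" | "A = np c (- g)" "B = np c (- h)" | "A = np d (- g)" "B = np d (- h)"
    | "A = np c (- g)" "B = np d (- h)" | "A = np d (- g)" "B = np c (- h)"
    using A B by (auto simp: hOp_def split: if_splits)
  then have "A (B v) - 1 *\<^sub>C B (A v) \<in> ?S"
  proof cases
    case 5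
    then show ?thesis using comm(3)[of "- g" "- h" v] S[of "2 * of_int (- g)"]
      by (cases "g + h = 0") (simp_all add: scaleC_one complex_vector.span_zero)
  next
    case 6
    then show ?thesis using comm(3)[of "- h" "- g" v] S[of "- (2 * of_int (- h))"]
      by (cases "g + h = 0") (simp_all add: scaleC_one complex_vector.span_zero add.commute)
  qed (use comm(1)[of "- g" "- h" v] comm(2)[of "- g" "- h" v] in \<open>simp_all add: scaleC_one complex_vector.span_zero\<close>)
  then show "\<exists>x. A (B v) - x *\<^sub>C B (A v) \<in> ?S" by blast
next
  fix A g assume "A \<in> hOp g" "g \<le> 0"
  then show "A (vac M) \<in> (if g = 0 then complex_vector.span {vac M} else {0})"
    by (auto simp: hOp_def np_vac complex_vector.span_zero complex_vector.span_base split: if_splits)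
next
  fix A g assume "A \<in> hOp g"
  then have "A = (\<lambda>v. v) \<or> (\<exists>x n. A = np x n)" by (auto simp: hOp_def split: if_splits)
  then show "clinear A" using lin_right clinear_id by (elim disjE exE) simp_all
qed simp

lemma singular_vector:
  assumes "\<And>n. n \<ge> 1 \<Longrightarrow> np c n u = 0" "\<And>n. n \<ge> 1 \<Longrightarrow> np d n u = 0"
  shows "u \<in> complex_vector.span {vac M}"
proof -
  interpret graded_ops hOp "\<lambda>g. g" "vac M" by (rule graded_ops)
  \<comment> \<open>Twice the conformal vector. All terms of its mode 1 end in nonnegative modes of
    \<open>c\<close> and \<open>d\<close>; the zero modes vanish and the positive ones annihilate
    \<open>u\<close>.\<close>
  define \<Omega> where "\<Omega> = np c (- 1) d"
  have cd: "np c n d = (if n = 1 then 2 *\<^sub>C vac M else 0)" if "n \<ge> 0" for n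
    using comm(3)[of n "- 1" "vac M"] that by (simp add: np_vac np_simps)
  have dd: "np d n d = 0" if "n \<ge> 0" for n
    using comm(2)[of n "- 1" "vac M"] that by (simp add: np_vac np_simps)
  have c\<Omega>: "np c n \<Omega> = (if n = 1 then 2 *\<^sub>C c else 0)" if "n \<ge> 0" for n
    unfolding \<Omega>_def comm(1)[of n] by (simp add: cd[OF that] np_simps np_vac)
  have d\<Omega>: "np d n \<Omega> = (if n = 1 then 2 *\<^sub>C d else 0)" if "n \<ge> 0" for n
  proof (cases "n = 1")
    case True
    then show ?thesis using comm(3)[of "- 1" n d] dd[OF that] by (simp add: \<Omega>_def np_simps)
  next
    case False
    then show ?thesis using comm(3)[of "- 1" n d] dd[OF that] by (simp add: \<Omega>_def np_simps)
  qed
  have w: "np \<Omega> 1 (np x m v) = np x m (np \<Omega> 1 v) - (2 * of_int m) *\<^sub>C np x m v" if "x \<in> {c, d}" for x m v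
    using weight_operator_commutator[OF all_even all_even c\<Omega>, of m v]
      weight_operator_commutator[OF all_even all_even d\<Omega>, of m v] that by auto
  show ?thesis
  proof (rule total_kernel)
    have "vsa_generated M {c, d} \<subseteq> total"
    proof (rule generated_eq_total[OF _ graded_ops])
      fix x n assume "x \<in> {c, d}"
      then show "\<exists>g. np x n \<in> hOp g" by (intro exI[of _ "- n"]) (auto simp: hOp_def)
    qed (use all_even in blast)
    then show "u \<in> total" unfolding generated by blast
    show "clinear (np \<Omega> 1)" by (rule lin_right)
    show "np \<Omega> 1 (vac M) = 0" by (simp add: np_vac)
    show "np \<Omega> 1 (A v) = A (np \<Omega> 1 v) + (2 * of_int g) *\<^sub>C A v" if "A \<in> hOp g" for A g v
      using that by (auto simp: hOp_def w split: if_splits)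
    show "np \<Omega> 1 u = 0"
      unfolding \<Omega>_def
      by (subst normal_product[OF all_even all_even, of 1]) (use assms zero_modes in \<open>auto simp: np_simps\<close>)
  qed (auto simp: algebra_simps)
qed

end

subsection \<open>The free fermion\<close>

locale fermion =
  fixes F :: "'f::complex_vector vsa" and \<Psi> :: 'f
  assumes ferm: "free_fermion F \<Psi>"

sublocale fermion \<subseteq> vsa F
  using ferm by unfold_locales (simp add: free_fermion_def)

context fermion begin

lemma \<Psi>_odd: "\<Psi> \<in> part F True"
  using ferm by (simp add: free_fermion_def)

lemma comm: "np \<Psi> m (np \<Psi> n v) = - np \<Psi> n (np \<Psi> m v) + (if m + n + 1 = 0 then v else 0)"
proof -
  have "np \<Psi> m (np \<Psi> n v) + np \<Psi> n (np \<Psi> m v) = (if m + n + 1 = 0 then v else 0)"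
    using ferm by (simp add: free_fermion_def scomm_def scaleC_one)
  from this[symmetric] show ?thesis by (simp only: uminus_add_conv_diff add_diff_cancel_right')
qed

lemma generated: "vsa_generated F {\<Psi>} = UNIV"
  using ferm by (simp add: free_fermion_def)

text \<open>Degrees are doubled weights, to stay in the integers: the mode m of
  \<open>\<Psi>\<close> changes the weight by -m - 1/2.\<close>

definition fOp :: "int \<Rightarrow> ('f \<Rightarrow> 'f) set" where
  "fOp g = {np \<Psi> m |m. g = - 2 * m - 1} \<union> (if g = 0 then {\<lambda>v. v} else {})"

lemma graded_ops: "graded_ops fOp (\<lambda>g. g) (vac F)"
proof (rule graded_ops.intro)
  fix A B g h v assume A: "A \<in> fOp g" and B: "B \<in> fOp h"
  let ?S = "complex_vector.span {C v |C. C \<in> fOp (g + h)}"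
  consider "A = (\<lambda>v. v)" | "B = (\<lambda>v. v)" | m n where "A = np \<Psi> m" "g = - 2 * m - 1" "B = np \<Psi> n" "h = - 2 * n - 1"
    using A B by (auto simp: fOp_def split: if_splits)
  then show "\<exists>x. A (B v) - x *\<^sub>C B (A v) \<in> ?S"
  proof cases
    case 3
    have "A (B v) - (- 1) *\<^sub>C B (A v) \<in> ?S"
    proof (cases "m + n + 1 = 0")
      case True
      then have "v \<in> {C v |C. C \<in> fOp (g + h)}" using 3 by (auto simp: fOp_def)
      then show ?thesis using comm[of m n v] True by (simp add: 3 scaleC_one complex_vector.span_base)
    qed (use comm[of m n v] in \<open>simp add: 3 scaleC_one complex_vector.span_zero\<close>)
    then show ?thesis by blast
  qed (auto intro!: exI[of _ 1] simp: scaleC_one complex_vector.span_zero)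
next
  fix A g assume "A \<in> fOp g" "g \<le> 0"
  then show "A (vac F) \<in> (if g = 0 then complex_vector.span {vac F} else {0})"
    by (auto simp: fOp_def np_vac complex_vector.span_zero complex_vector.span_base split: if_splits)
next
  fix A g assume "A \<in> fOp g"
  then have "A = (\<lambda>v. v) \<or> (\<exists>x n. A = np x n)" by (auto simp: fOp_def split: if_splits)
  then show "clinear A" using lin_right clinear_id by (elim disjE exE) simp_all
qed simp

lemma singular_vector:
  assumes "\<And>n. n \<ge> 0 \<Longrightarrow> np \<Psi> n u = 0"
  shows "u \<in> complex_vector.span {vac F}"
proof -
  interpret graded_ops fOp "\<lambda>g. g" "vac F" by (rule graded_ops)
  \<comment> \<open>Twice the conformal vector again; the terms of its mode 1 end in nonnegative
    modes of \<open>\<Psi>\<close>.\<close>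
  define \<Omega> where "\<Omega> = np \<Psi> (- 2) \<Psi>"
  have even: "\<Omega> \<in> part F False" using np_part[OF \<Psi>_odd \<Psi>_odd] by (simp add: \<Omega>_def)
  have \<Psi>\<Psi>: "np \<Psi> n \<Psi> = (if n = 0 then vac F else 0)" if "n \<ge> 0" for n
    using comm[of n "- 1" "vac F"] that by (simp add: np_vac np_simps)
  have \<Psi>\<Omega>: "np \<Psi> n \<Omega> = (if n = 0 then - np \<Psi> (- 2) (vac F) else if n = 1 then \<Psi> else 0)" if "n \<ge> 0" for n
    using comm[of n "- 2" \<Psi>] that by (auto simp: \<Omega>_def \<Psi>\<Psi> np_simps)
  have w: "np \<Omega> 1 (np \<Psi> m v) = np \<Psi> m (np \<Omega> 1 v) - (2 * of_int m + 1) *\<^sub>C np \<Psi> m v" for m v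
  proof -
    have "np \<Psi> m (np \<Omega> 1 v) - np \<Omega> 1 (np \<Psi> m v) = (\<Sum>r<2. (of_int m gchoose r) *\<^sub>C np (np \<Psi> (int r) \<Omega>) (m + 1 - int r) v)"
      using commutator[OF \<Psi>_odd even, of 2 m 1 v] \<Psi>\<Omega> by (simp add: scaleC_one)
    also have "\<dots> = (2 * of_int m + 1) *\<^sub>C np \<Psi> m v"
      by (simp add: numeral_2_eq_2 \<Psi>\<Omega> np_simps derivative_np scaleC_one
          complex_vector.scale_left_diff_distrib[symmetric])
    finally show ?thesis by (simp add: algebra_simps)
  qed
  show ?thesis
  proof (rule total_kernel)
    have "vsa_generated F {\<Psi>} \<subseteq> total"
    proof (rule generated_eq_total[OF _ graded_ops])
      fix x n assume "x \<in> {\<Psi>}"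
      then show "\<exists>g. np x n \<in> fOp g" by (intro exI[of _ "- 2 * n - 1"]) (auto simp: fOp_def)
    qed (use \<Psi>_odd in blast)
    then show "u \<in> total" unfolding generated by blast
    show "clinear (np \<Omega> 1)" by (rule lin_right)
    show "np \<Omega> 1 (vac F) = 0" by (simp add: np_vac)
    show "np \<Omega> 1 (A v) = A (np \<Omega> 1 v) + of_int g *\<^sub>C A v" if "A \<in> fOp g" for A g v
    proof -
      have "(\<exists>m. A = np \<Psi> m \<and> g = - 2 * m - 1) \<or> A = (\<lambda>v. v) \<and> g = 0"
        using that unfolding fOp_def by (simp split: if_splits; blast)
      then consider "A = (\<lambda>v. v)" "g = 0" | m where "A = np \<Psi> m" "g = - 2 * m - 1" by blast
      then show ?thesis
        by cases (simp_all add: w scaleC_add_left complex_vector.scale_left_diff_distrib)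
    qed
    show "np \<Omega> 1 u = 0"
      unfolding \<Omega>_def
      by (subst associativity[OF \<Psi>_odd \<Psi>_odd, of 0]) (use assms in auto)
  qed auto
qed

end

subsection \<open>The simple Neveu-Schwarz algebra\<close>

locale neveu_schwarz =
  fixes cc :: complex and L :: "'l::complex_vector vsa" and \<omega> G :: 'l
  assumes ns: "simple_neveu_schwarz cc L \<omega> G"

sublocale neveu_schwarz \<subseteq> vsa L
  using ns by unfold_locales (simp add: simple_neveu_schwarz_def simple_vsa_def)

context neveu_schwarz begin

lemma parts: "\<omega> \<in> part L False" "G \<in> part L True"
  using ns by (simp_all add: simple_neveu_schwarz_def)

lemma generated: "vsa_generated L {\<omega>, G} = UNIV"
  using ns by (simp add: simple_neveu_schwarz_def)

lemma simple: "vsa_ideal L I \<Longrightarrow> I = {0} \<or> I = UNIV"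
  using ns by (simp add: simple_neveu_schwarz_def simple_vsa_def)

lemma translation: "np \<omega> 0 v = np v (- 2) (vac L)"
  using ns by (simp add: simple_neveu_schwarz_def)

lemma comm_\<omega>\<omega>: "np \<omega> m (np \<omega> n v) = np \<omega> n (np \<omega> m v) + of_int (m - n) *\<^sub>C np \<omega> (m + n - 1) v
    + (if m + n = 2 then (cc / 12 * of_int ((m - 1) ^ 3 - (m - 1))) *\<^sub>C v else 0)"
proof -
  have "\<forall>m n v. scomm L False False \<omega> (m + 1) \<omega> (n + 1) v =
        of_int (m - n) *\<^sub>C nprod L \<omega> (m + n + 1) v
        + (if m + n = 0 then (cc / 12 * of_int (m ^ 3 - m)) *\<^sub>C v else 0)"
    using ns by (simp add: simple_neveu_schwarz_def)
  from this[rule_format, of "m - 1" "n - 1" v] show ?thesis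
    by (simp add: scomm_def scaleC_one algebra_simps)
qed

lemma comm_\<omega>G: "np \<omega> m (np G n v) = np G n (np \<omega> m v) + ((of_int m - 1) / 2 - of_int n + 1 / 2) *\<^sub>C np G (m + n - 1) v"
proof -
  have "\<forall>m n v. scomm L False True \<omega> (m + 1) G (n + 1) v =
        (of_int m / 2 - (of_int n + 1 / 2)) *\<^sub>C nprod L G (m + n + 1) v"
    using ns by (simp add: simple_neveu_schwarz_def)
  from this[rule_format, of "m - 1" "n - 1" v] show ?thesis
    by (simp add: scomm_def scaleC_one algebra_simps)
qed

lemma comm_GG: "np G m (np G n v) = - np G n (np G m v) + 2 *\<^sub>C np \<omega> (m + n) v
    + (if m + n = 1 then (cc / 3 * ((of_int m - 1 / 2)\<^sup>2 - 1 / 4)) *\<^sub>C v else 0)"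
proof -
  have "\<forall>m n v. scomm L True True G (m + 1) G (n + 1) v =
        2 *\<^sub>C nprod L \<omega> (m + n + 2) v
        + (if m + n + 1 = 0 then (cc / 3 * ((of_int m + 1 / 2)\<^sup>2 - 1 / 4)) *\<^sub>C v else 0)"
    using ns by (simp add: simple_neveu_schwarz_def)
  from this[rule_format, of "m - 1" "n - 1" v] show ?thesis
    by (simp add: scomm_def scaleC_one algebra_simps)
qed

definition nOp :: "int \<Rightarrow> ('l \<Rightarrow> 'l) set" where
  "nOp g = {np \<omega> m |m. g = 2 - 2 * m} \<union> {np G m |m. g = 1 - 2 * m} \<union> (if g = 0 then {\<lambda>v. v} else {})"

lemma graded_ops:
  assumes w: "\<And>n. n \<ge> 1 \<Longrightarrow> np G n w = 0" "np \<omega> 1 w \<in> complex_vector.span {w}"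
  shows "graded_ops nOp (\<lambda>g. g) w"
proof (rule graded_ops.intro)
  fix A B g h v assume A: "A \<in> nOp g" and B: "B \<in> nOp h"
  define S where "S = complex_vector.span {C v |C. C \<in> nOp (g + h)}"
  have S1: "np \<omega> m v \<in> S" if "g + h = 2 - 2 * m" for m
    unfolding S_def by (rule complex_vector.span_base) (use that in \<open>auto simp: nOp_def\<close>)
  have S2: "np G m v \<in> S" if "g + h = 1 - 2 * m" for m
    unfolding S_def by (rule complex_vector.span_base) (use that in \<open>auto simp: nOp_def\<close>)
  have S3: "v \<in> S" if "g + h = 0"
    unfolding S_def by (rule complex_vector.span_base) (use that in \<open>auto simp: nOp_def\<close>)
  have S: "x \<in> S \<Longrightarrow> y \<in> S \<Longrightarrow> x + y \<in> S" "x \<in> S \<Longrightarrow> r *\<^sub>C x \<in> S" "0 \<in> S" "x \<in> S \<Longrightarrow> - x \<in> S" for x y r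
    unfolding S_def
    by (rule complex_vector.span_add complex_vector.span_scale complex_vector.span_zero complex_vector.span_neg; assumption)+
  consider "A = (\<lambda>v. v)" | "B = (\<lambda>v. v)"
    | m n where "A = np \<omega> m" "g = 2 - 2 * m" "B = np \<omega> n" "h = 2 - 2 * n"
    | m n where "A = np \<omega> m" "g = 2 - 2 * m" "B = np G n" "h = 1 - 2 * n"
    | m n where "A = np G m" "g = 1 - 2 * m" "B = np \<omega> n" "h = 2 - 2 * n"
    | m n where "A = np G m" "g = 1 - 2 * m" "B = np G n" "h = 1 - 2 * n"
    using A B by (auto simp: nOp_def split: if_splits)
  then have "\<exists>x. A (B v) - x *\<^sub>C B (A v) \<in> S"
  proof cases
    case 3
    have "A (B v) - 1 *\<^sub>C B (A v) \<in> S"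
      using comm_\<omega>\<omega>[of m n v] S1[of "m + n - 1"] S3 3 by (auto simp: scaleC_one intro!: S)
    then show ?thesis by blast
  next
    case 4
    have "A (B v) - 1 *\<^sub>C B (A v) \<in> S"
      using comm_\<omega>G[of m n v] S2[of "m + n - 1"] 4 by (auto simp: scaleC_one intro!: S)
    then show ?thesis by blast
  next
    case 5
    have "- (B (A v) - A (B v)) \<in> S"
      using comm_\<omega>G[of n m v] S2[of "m + n - 1"] 5 by (auto simp: scaleC_one add.commute intro!: S)
    then have "A (B v) - 1 *\<^sub>C B (A v) \<in> S" by (simp add: scaleC_one)
    then show ?thesis by blast
  next
    case 6
    have "A (B v) - (- 1) *\<^sub>C B (A v) \<in> S"
      using comm_GG[of m n v] S1[of "m + n"] S3 6 by (auto simp: scaleC_one intro!: S)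
    then show ?thesis by blast
  qed (auto intro!: exI[of _ 1] simp: scaleC_one S)
  then show "\<exists>x. A (B v) - x *\<^sub>C B (A v) \<in> complex_vector.span {C v |C. C \<in> nOp (g + h)}" by (simp only: S_def)
next
  \<comment> \<open>Virasoro modes of index at least 2 are anticommutators of positive modes of
    \<open>G\<close>, without central term, so conditions on \<open>G\<close> suffice.\<close>
  have w2: "np \<omega> m w = 0" if "m \<ge> 2" for m
    using comm_GG[of 1 "m - 1" w] w(1)[of 1] w(1)[of "m - 1"] that by (simp add: np_simps)
  fix A g assume "A \<in> nOp g" "g \<le> 0"
  then show "A w \<in> (if g = 0 then complex_vector.span {w} else {0})"
    using w w2 by (auto simp: nOp_def complex_vector.span_base complex_vector.span_zero split: if_splits)
next
  fix A g assume "A \<in> nOp g"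
  then have "A = (\<lambda>v. v) \<or> (\<exists>x n. A = np x n)" by (auto simp: nOp_def split: if_splits)
  then show "clinear A" using lin_right clinear_id by (elim disjE exE) simp_all
qed simp

lemma weight_comm: "A \<in> nOp g \<Longrightarrow> np \<omega> 1 (A v) = A (np \<omega> 1 v) + (of_int g / 2) *\<^sub>C A v"
proof -
  assume "A \<in> nOp g"
  then consider "A = (\<lambda>v. v)" "g = 0" | m where "A = np \<omega> m" "g = 2 - 2 * m" | m where "A = np G m" "g = 1 - 2 * m"
    by (auto simp: nOp_def split: if_splits)
  then show ?thesis
  proof cases
    case 2
    have "of_int (1 - m) = (of_int g / 2 :: complex)" by (simp add: 2)
    then show ?thesis using comm_\<omega>\<omega>[of 1 m v] by (auto simp: 2)
  next
    case 3
    have "((of_int 1 - 1) / 2 - of_int m + 1 / 2 :: complex) = of_int g / 2" by (simp add: 3 field_simps)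
    then show ?thesis using comm_\<omega>G[of 1 m v] by (simp only: 3) simp
  qed simp
qed

text \<open>The submodule generated by \<open>w\<close> has weights x + n/2 with n \<ge> 0, none of
  which is 0, so it does not contain the vacuum. Being an ideal of a simple algebra, it is 0.
  Homogeneity of \<open>w\<close> makes it parity-graded, as an ideal must be.\<close>

lemma singular_homog:
  assumes w: "\<And>n. n \<ge> 1 \<Longrightarrow> np G n w = 0" "np \<omega> 1 w = x *\<^sub>C w" "w \<in> part L i"
    and x: "\<And>n. x \<noteq> - of_nat n / 2"
  shows "w = 0"
proof -
  interpret graded_ops nOp "\<lambda>g. g" w
    by (rule graded_ops) (use w in \<open>auto simp: complex_vector.span_base complex_vector.span_scale\<close>)
  have mon_homog: "\<exists>i. u \<in> part L i" if "mon g u" for g u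
    using that
  proof (induction rule: mon.induct)
    case (step h u A g)
    obtain i where i: "u \<in> part L i" using step.IH by blast
    have "A = (\<lambda>v. v) \<or> (\<exists>x n j. A = np x n \<and> x \<in> part L j)"
      using step.hyps(2) parts by (auto simp: nOp_def split: if_splits)
    then show ?case
    proof (elim disjE exE conjE)
      fix x n j assume "A = np x n" "x \<in> part L j"
      then show ?thesis using np_part[of x j u i n] i by blast
    qed (use i in auto)
  qed (use w(3) in blast)
  have left: "np a n v \<in> total" if "v \<in> total" for a n v
  proof (rule generated_preserves[OF _ total_subspace _ _ that])
    show "a \<in> vsa_generated L {\<omega>, G}" by (simp add: generated)
    show "np y n v \<in> total" if "y \<in> {\<omega>, G}" "v \<in> total" for y n v
      using that(1) total_closed[OF that(2), of "np \<omega> n" "2 - 2 * n"] total_closed[OF that(2), of "np G n" "1 - 2 * n"]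
      by (auto simp: nOp_def)
  qed (use parts in blast)
  \<comment> \<open>These vectors are divided powers of the translation operator applied to v.
    Translation is the mode 0 of \<open>\<omega>\<close> and so preserves the submodule.\<close>
  have T: "np v (- 1 - int r) (vac L) \<in> total" if "v \<in> total" for v r
    using that
  proof (induction r arbitrary: v)
    case (Suc r)
    have "np v (- 2) (vac L) \<in> total" using left[OF Suc.prems, of \<omega> 0] by (simp add: translation)
    from Suc.IH[OF this] have "inverse (of_nat (Suc r)) *\<^sub>C of_nat (Suc r) *\<^sub>C np v (- 1 - int (Suc r)) (vac L) \<in> total"
      unfolding derivative_power by (rule complex_vector.subspace_scale[OF total_subspace])
    moreover have "inverse (of_nat (Suc r)) * of_nat (Suc r) = (1::complex)" by (simp del: of_nat_Suc)
    ultimately show ?case by (simp only: scaleC_scaleC scaleC_one)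
  qed (simp add: np_vac)
  \<comment> \<open>Skew-symmetry turns multiplication from the right into multiplication from the
    left followed by powers of the translation.\<close>
  have right1: "np v n a \<in> total" if "v \<in> total" "v \<in> part L i" "a \<in> part L j" for v n a i j
  proof -
    obtain R where "\<And>r. r \<ge> R \<Longrightarrow> np a (n + int r) v = 0" using truncation_nat[of a n v] by blast
    then have eq: "np v n a = (- ((- 1) powi n) * ksign j i) *\<^sub>C
        (\<Sum>r<R. (- 1) ^ r *\<^sub>C np (np a (n + int r) v) (- 1 - int r) (vac L))"
      by (rule skew_symmetry[OF that(3,2)])
    show ?thesis unfolding eq
      by (intro complex_vector.subspace_scale[OF total_subspace] complex_vector.subspace_sum[OF total_subspace]
          T left that(1))
  qed
  have right2: "np v n a \<in> total" if "v \<in> total" "v \<in> part L i" for v n a i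
  proof -
    have "np v n a = np v n (parity_part False a) + np v n (parity_part True a)"
      using clinear_add[OF lin_right, of v n "parity_part False a" "parity_part True a"]
      unfolding parity_part_sum[symmetric] .
    then show ?thesis
      using complex_vector.subspace_add[OF total_subspace right1[OF that parity_part_in] right1[OF that parity_part_in]]
      by metis
  qed
  have dec: "\<exists>v0\<in>total \<inter> part L False. \<exists>v1\<in>total \<inter> part L True. v = v0 + v1" if "v \<in> total" for v
    using that unfolding total_def
  proof (induction rule: complex_vector.span_induct_alt)
    case base
    show ?case using complex_vector.subspace_0[OF part_subspace]
      by (intro bexI[of _ 0]) (auto simp: complex_vector.span_zero)
  next
    case (step c y z)
    then obtain v0 v1 where v: "v0 \<in> total \<inter> part L False" "v1 \<in> total \<inter> part L True" "z = v0 + v1"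
      by (auto simp: total_def)
    obtain j where "y \<in> part L j" using step mon_homog by blast
    then have cj: "c *\<^sub>C y \<in> part L j" by (rule complex_vector.subspace_scale[OF part_subspace])
    have "y \<in> total" using step unfolding total_def by (intro complex_vector.span_base) blast
    then have ct: "c *\<^sub>C y \<in> total" by (rule complex_vector.subspace_scale[OF total_subspace])
    show ?case
    proof (cases j)
      case False
      then have "c *\<^sub>C y + v0 \<in> total \<inter> part L False"
        using v(1) cj ct complex_vector.subspace_add[OF part_subspace] complex_vector.subspace_add[OF total_subspace] by simp
      then show ?thesis unfolding total_def[symmetric]
        using v by (intro bexI[of _ "c *\<^sub>C y + v0"] bexI[of _ v1]) (simp_all add: add.assoc)
    next
      case True
      then have "c *\<^sub>C y + v1 \<in> total \<inter> part L True"
        using v(2) cj ct complex_vector.subspace_add[OF part_subspace] complex_vector.subspace_add[OF total_subspace] by simp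
      then show ?thesis unfolding total_def[symmetric]
        using v by (intro bexI[of _ "c *\<^sub>C y + v1"] bexI[of _ v0]) (simp_all add: add.left_commute)
    qed
  qed
  have "vsa_ideal L total"
    unfolding vsa_ideal_def
  proof (intro conjI ballI allI)
    fix v a n assume v: "v \<in> total"
    then show "np a n v \<in> total" by (rule left)
    obtain v0 v1 where "v0 \<in> total \<inter> part L False" "v1 \<in> total \<inter> part L True" "v = v0 + v1" using dec[OF v] by blast
    then show "np v n a \<in> total"
      using complex_vector.subspace_add[OF total_subspace right2[of v0 False n a] right2[of v1 True n a]]
      by (simp add: np_simps)
  qed (use total_subspace dec in auto)
  from simple[OF this] show "w = 0"
  proof
    assume "total = UNIV"
    then obtain A f where A: "finite A" "\<And>g. g \<in> A \<Longrightarrow> f g \<in> Mon g" "vac L = (\<Sum>g\<in>A. f g)"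
      using total_components[of "vac L"] by blast
    have eig: "np \<omega> 1 u = (x + of_int g / 2) *\<^sub>C u" if "u \<in> Mon g" for g u
      by (rule Mon_eigen[OF lin_right w(2) weight_comm _ that]) (auto simp: add_divide_distrib)
    let ?K = "{v. np \<omega> 1 v = 0}"
    have "f g = 0" if "g \<in> A" for g
    proof (cases "g \<ge> 0")
      case True
      have "f g \<in> ?K"
      proof (rule total_eigen_split[OF lin_right eig])
        show "inj (\<lambda>g. x + of_int g / 2)" by (simp add: inj_def)
        show "complex_vector.subspace ?K" by (simp add: complex_vector.subspace_def np_simps)
        show "(\<Sum>g\<in>A. f g) \<in> ?K" by (simp add: A(3)[symmetric] np_vac)
      qed (use A that in \<open>auto simp: np_simps\<close>)
      then have "(x + of_int g / 2) *\<^sub>C f g = 0" using eig[OF A(2)[OF that]] by simp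
      moreover have "x + of_int g / 2 \<noteq> 0"
        using x[of "nat g"] True by (simp add: eq_neg_iff_add_eq_0)
      ultimately show ?thesis by simp
    next
      case False
      then show ?thesis using Mon_deg_neg[of g "f g"] A(2)[OF that] by simp
    qed
    then show ?thesis using A(3) vac_nonzero by simp
  qed (use w_total in auto)
qed

text \<open>A singular vector splits into singular vectors of pure weight. Those of positive weight
  vanish by simplicity, and weight 0 is spanned by the vacuum.\<close>

lemma singular_vector:
  assumes v: "\<And>n. n \<ge> 1 \<Longrightarrow> np G n v = 0"
  shows "v \<in> complex_vector.span {vac L}"
proof -
  interpret graded_ops nOp "\<lambda>g. g" "vac L"
    by (rule graded_ops) (auto simp: np_vac complex_vector.span_zero)
  have "vsa_generated L {\<omega>, G} \<subseteq> total"
  proof (rule generated_eq_total[OF _ graded_ops_axioms])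
    fix x n assume "x \<in> {\<omega>, G}"
    then have "np x n \<in> nOp (2 - 2 * n) \<or> np x n \<in> nOp (1 - 2 * n)" by (auto simp: nOp_def)
    then show "\<exists>g. np x n \<in> nOp g" by blast
  qed (use parts in blast)
  then have "v \<in> total" unfolding generated by blast
  then obtain A f where A: "finite A" "\<And>g. g \<in> A \<Longrightarrow> f g \<in> Mon g" "v = (\<Sum>g\<in>A. f g)"
    using total_components by blast
  have eig: "np \<omega> 1 u = (of_int g / 2) *\<^sub>C u" if "u \<in> Mon g" for g u
  proof -
    have "np \<omega> 1 u = (0 + of_int g / 2) *\<^sub>C u"
      by (rule Mon_eigen[OF lin_right _ weight_comm _ that]) (simp_all add: np_vac add_divide_distrib)
    then show ?thesis by simp
  qed
  have Mon_part: "Mon g \<subseteq> part L (odd g)" for g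
  proof -
    have "u \<in> part L (odd g)" if "mon g u" for u g
      using that
    proof (induction rule: mon.induct)
      case (step h u A g)
      then show ?case using np_part[OF parts(1), of u "odd h"] np_part[OF parts(2), of u "odd h"]
        by (auto simp: nOp_def split: if_splits)
    qed (simp add: vac_even)
    then show ?thesis unfolding Mon_def by (intro complex_vector.span_minimal part_subspace) auto
  qed
  \<comment> \<open>A mode of \<open>G\<close> shifts all weights by the same amount, so the images
    of the components have distinct weights and vanish separately.\<close>
  have "np G n (f g) = 0" if g: "g \<in> A" and n: "n \<ge> 1" for g n
  proof -
    have "(\<Sum>g\<in>A. np G n (f g)) = 0" using v[OF n] unfolding A(3) by (simp add: np_simps)
    moreover have "np \<omega> 1 (np G n (f g)) = (of_int (1 - 2 * n + g) / 2) *\<^sub>C np G n (f g)" if "g \<in> A" for g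
      by (rule eig, rule Mon_closed[OF A(2)[OF that]]) (auto simp: nOp_def)
    ultimately have "np G n (f g) \<in> {0}"
      by (intro eigen_components[where u = "\<lambda>g. np G n (f g)" and A = A and T = "np \<omega> 1"
            and lam = "\<lambda>g. of_int (1 - 2 * n + g) / 2", OF lin_right _ _ A(1) _ _ _ g])
        (simp_all add: inj_on_def clinear_0[OF lin_right])
    then show ?thesis by simp
  qed
  note sing = this
  have *: "f g \<in> complex_vector.span {vac L}" if "g \<in> A" for g
  proof (cases "g > 0")
    case True
    have "(of_int g / 2 :: complex) \<noteq> - of_nat n / 2" for n
    proof
      assume "(of_int g / 2 :: complex) = - of_nat n / 2"
      then have "(of_int g :: complex) = of_int (- int n)" by simp
      then show False using True by (simp only: of_int_eq_iff)
    qed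
    then have "f g = 0"
      using singular_homog[OF sing[OF that] eig[OF A(2)[OF that]]] Mon_part A(2)[OF that] by blast
    then show ?thesis by (simp add: complex_vector.span_zero)
  next
    case False
    then show ?thesis using Mon_deg_0[of g "f g"] A(2)[OF that]
      by (cases "f g = 0") (auto simp: complex_vector.span_zero)
  qed
  show ?thesis unfolding A(3) by (rule complex_vector.span_sum) (rule *)
qed

end

section \<open>Affine \<open>osp(1,2)\<close> in a vertex superalgebra\<close>

text \<open>Equality of vectors can be tested on linear functionals, which turns linear identities into
  ring identities.\<close>

lemma vector_eqI:
  fixes u w :: "'a::complex_vector"
  assumes "\<And>\<phi> :: 'a \<Rightarrow> complex. (\<And>x y. \<phi> (x + y) = \<phi> x + \<phi> y) \<Longrightarrow> (\<And>r x. \<phi> (r *\<^sub>C x) = r * \<phi> x) \<Longrightarrow>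
    (\<And>x. \<phi> (- x) = - \<phi> x) \<Longrightarrow> (\<And>x y. \<phi> (x - y) = \<phi> x - \<phi> y) \<Longrightarrow> \<phi> 0 = 0 \<Longrightarrow> \<phi> u = \<phi> w"
  shows "u = w"
proof (rule ccontr)
  assume "u \<noteq> w"
  then have "u - w \<noteq> 0" by simp
  then obtain \<phi> :: "'a \<Rightarrow> complex" where \<phi>: "clinear \<phi>" "\<phi> (u - w) = 1" using complex_functional_exists by blast
  have "\<phi> u = \<phi> w" by (rule assms) (simp_all add: clinear_simps[OF \<phi>(1)] scaleC_complex)
  then show False using \<phi> by (simp add: clinear_diff)
qed

lemma scaleC_2: "2 *\<^sub>C (v :: 'a::complex_vector) = v + v"
  using scaleC_add_left[of 1 1 v] by (simp add: scaleC_one)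

lemma Sum_any_single: "Sum_any (\<lambda>g. Poly_Mapping.lookup (Poly_Mapping.single b r) g *\<^sub>C F g) = r *\<^sub>C F b"
proof -
  have "(\<lambda>g. Poly_Mapping.lookup (Poly_Mapping.single b r) g *\<^sub>C F g) = (\<lambda>g. if g = b then r *\<^sub>C F b else 0)"
    by (auto simp: fun_eq_iff lookup_single when_def)
  then show ?thesis by (simp only: Sum_any.delta)
qed

fun osp12_weight :: "osp12_basis \<Rightarrow> int" where
  "osp12_weight osp_e = 2" | "osp12_weight osp_f = - 2" | "osp12_weight osp_h = 0"
| "osp12_weight osp_x = 1" | "osp12_weight osp_y = - 1"

text \<open>The bare relations of the affinization, to be used three times: for the given algebra,
  for the explicit vectors in the target and for the pairs in the direct product.\<close>

locale affine_osp = vsa V for V :: "'v::complex_vector vsa" +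
  fixes k :: complex and \<iota> :: "osp12_basis \<Rightarrow> 'v"
  assumes \<iota>_part: "\<iota> a \<in> part V (osp12_odd a)"
    and \<iota>_comm: "scomm V (osp12_odd a) (osp12_odd b) (\<iota> a) m (\<iota> b) n v =
        Sum_any (\<lambda>g. Poly_Mapping.lookup (osp12_bracket a b) g *\<^sub>C np (\<iota> g) (m + n) v)
        + (if m + n = 0 then (of_int m * osp12_form a b * k) *\<^sub>C v else 0)"
begin

definition bra :: "osp12_basis \<Rightarrow> osp12_basis \<Rightarrow> int \<Rightarrow> 'v \<Rightarrow> 'v" where
  "bra a b m v = Sum_any (\<lambda>g. Poly_Mapping.lookup (osp12_bracket a b) g *\<^sub>C np (\<iota> g) m v)"

lemma bra_simps [simp]:
  "bra osp_e osp_f m v = np (\<iota> osp_h) m v" "bra osp_f osp_e m v = - np (\<iota> osp_h) m v"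
  "bra osp_h osp_e m v = 2 *\<^sub>C np (\<iota> osp_e) m v" "bra osp_e osp_h m v = - (2 *\<^sub>C np (\<iota> osp_e) m v)"
  "bra osp_h osp_f m v = - (2 *\<^sub>C np (\<iota> osp_f) m v)" "bra osp_f osp_h m v = 2 *\<^sub>C np (\<iota> osp_f) m v"
  "bra osp_h osp_x m v = np (\<iota> osp_x) m v" "bra osp_x osp_h m v = - np (\<iota> osp_x) m v"
  "bra osp_f osp_x m v = - np (\<iota> osp_y) m v" "bra osp_x osp_f m v = np (\<iota> osp_y) m v"
  "bra osp_h osp_y m v = - np (\<iota> osp_y) m v" "bra osp_y osp_h m v = np (\<iota> osp_y) m v"
  "bra osp_e osp_y m v = - np (\<iota> osp_x) m v" "bra osp_y osp_e m v = np (\<iota> osp_x) m v"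
  "bra osp_x osp_x m v = 2 *\<^sub>C np (\<iota> osp_e) m v" "bra osp_x osp_y m v = np (\<iota> osp_h) m v"
  "bra osp_y osp_x m v = np (\<iota> osp_h) m v" "bra osp_y osp_y m v = - (2 *\<^sub>C np (\<iota> osp_f) m v)"
  "bra osp_e osp_e m v = 0" "bra osp_f osp_f m v = 0" "bra osp_h osp_h m v = 0"
  "bra osp_e osp_x m v = 0" "bra osp_x osp_e m v = 0" "bra osp_f osp_y m v = 0" "bra osp_y osp_f m v = 0"
  by (simp_all add: bra_def Sum_any_single scaleC_one)

lemma comm: "np (\<iota> a) m (np (\<iota> b) n v) =
    ksign (osp12_odd a) (osp12_odd b) *\<^sub>C np (\<iota> b) n (np (\<iota> a) m v) + bra a b (m + n) v
    + (if m + n = 0 then (of_int m * osp12_form a b * k) *\<^sub>C v else 0)"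
  using \<iota>_comm[of a b m n v] by (simp add: scomm_def bra_def algebra_simps)

lemma gen_prod: "m \<ge> 0 \<Longrightarrow> np (\<iota> a) m (\<iota> b) =
    (if m = 0 then bra a b (- 1) (vac V) else if m = 1 then (osp12_form a b * k) *\<^sub>C vac V else 0)"
  using comm[of a m b "- 1" "vac V"]
  by (cases a; cases b) (simp_all add: np_vac np_simps)

text \<open>These are \<open>2(k+2)\<close> and \<open>2k+3\<close> times the Sugawara vectors of \<open>sl(2)\<close> and \<open>osp(1,2)\<close>.\<close>

definition Om_sl :: 'v where
  "Om_sl = np (\<iota> osp_e) (- 1) (\<iota> osp_f) + np (\<iota> osp_f) (- 1) (\<iota> osp_e)
     + (1 / 2) *\<^sub>C np (\<iota> osp_h) (- 1) (\<iota> osp_h)"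

definition Om_osp :: 'v where
  "Om_osp = Om_sl - (1 / 2) *\<^sub>C (np (\<iota> osp_x) (- 1) (\<iota> osp_y) - np (\<iota> osp_y) (- 1) (\<iota> osp_x))"

lemma Om_even: "Om_sl \<in> part V False" "Om_osp \<in> part V False"
proof -
  have p: "np (\<iota> a) n (\<iota> b) \<in> part V (osp12_odd a \<noteq> osp12_odd b)" for a b n
    using np_part[OF \<iota>_part \<iota>_part] .
  show 1: "Om_sl \<in> part V False"
    unfolding Om_sl_def using p[of osp_e "-1" osp_f] p[of osp_f "-1" osp_e] p[of osp_h "-1" osp_h]
    by (intro complex_vector.subspace_add[OF part_subspace] complex_vector.subspace_scale[OF part_subspace]) auto
  show "Om_osp \<in> part V False"
    unfolding Om_osp_def using 1 p[of osp_x "-1" osp_y] p[of osp_y "-1" osp_x]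
    by (intro complex_vector.subspace_diff[OF part_subspace] complex_vector.subspace_scale[OF part_subspace]) auto
qed

lemma gen_np_quad:
  assumes "n \<ge> 0"
  shows "np (\<iota> a) n (np (\<iota> b) (- 1) (\<iota> c)) =
    ksign (osp12_odd a) (osp12_odd b) *\<^sub>C np (\<iota> b) (- 1) (np (\<iota> a) n (\<iota> c)) + bra a b (n - 1) (\<iota> c)
    + (if n = 1 then (osp12_form a b * k) *\<^sub>C \<iota> c else 0)"
  using comm[of a n b "- 1" "\<iota> c"] by simp

lemma Om_sl_prod:
  assumes "a \<in> {osp_e, osp_f, osp_h}" "n \<ge> 0"
  shows "np (\<iota> a) n Om_sl = (if n = 1 then (2 * k + 4) *\<^sub>C \<iota> a else 0)"
proof -
  consider "n = 0" | "n = 1" | "n = 2" | "n \<ge> 3" using assms(2) by linarith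
  then show ?thesis
    by cases (rule vector_eqI, use assms(1) in \<open>auto simp: Om_sl_def np_simps gen_np_quad gen_prod np_vac field_simps\<close>)+
qed

text \<open>The factor is 2(k + 3/2), with 3/2 the dual Coxeter number. Modes 0, 1 and 2 are
  computed; higher modes vanish on quadratic vectors.\<close>

lemma Om_osp_prod:
  assumes "n \<ge> 0"
  shows "np (\<iota> a) n Om_osp = (if n = 1 then (2 * k + 3) *\<^sub>C \<iota> a else 0)"
proof -
  consider "n = 0" | "n = 1" | "n = 2" | "n \<ge> 3" using assms by linarith
  then show ?thesis
  proof cases
    case 1
    show ?thesis unfolding 1
      by (rule vector_eqI, cases a)
        (simp_all (no_asm_simp) add: Om_osp_def Om_sl_def np_simps gen_np_quad gen_prod np_vac field_simps)
  next
    case 2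
    show ?thesis unfolding 2
      by (rule vector_eqI, cases a)
        (simp_all (no_asm_simp) add: Om_osp_def Om_sl_def np_simps gen_np_quad gen_prod np_vac field_simps)
  next
    case 3
    show ?thesis unfolding 3
      by (rule vector_eqI, cases a)
        (simp_all (no_asm_simp) add: Om_osp_def Om_sl_def np_simps gen_np_quad gen_prod np_vac field_simps)
  next
    case 4
    have z: "np (\<iota> b) m (\<iota> c) = 0" if "m \<ge> 2" for b m c using gen_prod[of m b c] that by simp
    have z': "bra b c (n - 1) (\<iota> d) = 0" for b c d
      using 4 by (cases b; cases c) (simp_all add: z)
    show ?thesis using 4 by (simp add: Om_osp_def Om_sl_def np_simps gen_np_quad z z')
  qed
qed

subsection \<open>Grading\<close>

definition oOp :: "int \<times> int \<Rightarrow> ('v \<Rightarrow> 'v) set" where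
  "oOp g = {np (\<iota> a) m |a m. g = (- m, osp12_weight a)} \<union> (if g = 0 then {\<lambda>v. v} else {})"

lemma gen_oOp: "np (\<iota> a) m \<in> oOp (- m, osp12_weight a)"
  unfolding oOp_def by blast

lemma oOp_cases:
  assumes "A \<in> oOp g"
  obtains a m where "A = np (\<iota> a) m" "g = (- m, osp12_weight a)" | "A = (\<lambda>v. v)" "g = 0"
  using assms unfolding oOp_def by (simp split: if_splits; blast)

lemma bra_weight: "bra a b m v \<in> complex_vector.span {np (\<iota> c) m v |c. osp12_weight c = osp12_weight a + osp12_weight b}"
proof -
  let ?S = "{np (\<iota> c) m v |c. osp12_weight c = osp12_weight a + osp12_weight b}"
  define S where "S = complex_vector.span ?S"
  have *: "np (\<iota> c) m v \<in> S" if "osp12_weight c = osp12_weight a + osp12_weight b" for c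
    unfolding S_def by (rule complex_vector.span_base) (use that in blast)
  have S: "complex_vector.subspace S" by (simp add: S_def)
  note S' = complex_vector.subspace_scale[OF S] complex_vector.subspace_neg[OF S] complex_vector.subspace_0[OF S]
  show ?thesis unfolding S_def[symmetric]
    by (cases a; cases b) (auto intro!: S' *)
qed

lemma form_weight: "osp12_form a b \<noteq> 0 \<Longrightarrow> osp12_weight a + osp12_weight b = 0"
  by (cases a; cases b) auto

lemma graded_ops: "graded_ops oOp fst (vac V)"
proof (rule graded_ops.intro)
  fix A B g h v assume A: "A \<in> oOp g" and B: "B \<in> oOp h"
  define S where "S = complex_vector.span {C v |C. C \<in> oOp (g + h)}"
  have S: "complex_vector.subspace S" by (simp add: S_def)
  consider "A = (\<lambda>v. v)" | "B = (\<lambda>v. v)"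
    | a m b n where "A = np (\<iota> a) m" "g = (- m, osp12_weight a)" "B = np (\<iota> b) n" "h = (- n, osp12_weight b)"
    using oOp_cases[OF A] oOp_cases[OF B] by metis
  then have "\<exists>x. A (B v) - x *\<^sub>C B (A v) \<in> S"
  proof cases
    case (3 a m b n)
    have "{np (\<iota> c) (m + n) v |c. osp12_weight c = osp12_weight a + osp12_weight b} \<subseteq> {C v |C. C \<in> oOp (g + h)}"
    proof safe
      fix c assume "osp12_weight c = osp12_weight a + osp12_weight b"
      then have "np (\<iota> c) (m + n) \<in> oOp (g + h)" using gen_oOp[of c "m + n"] by (simp add: 3 add.commute)
      then show "\<exists>C. np (\<iota> c) (m + n) v = C v \<and> C \<in> oOp (g + h)" by blast
    qed
    then have 1: "bra a b (m + n) v \<in> S"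
      unfolding S_def using bra_weight[of a b "m + n" v] complex_vector.span_mono by blast
    have 2: "(if m + n = 0 then (of_int m * osp12_form a b * k) *\<^sub>C v else 0) \<in> S"
    proof (cases "m + n = 0 \<and> osp12_form a b \<noteq> 0")
      case True
      then have "g + h = 0" using form_weight[of a b] by (auto simp: 3 zero_prod_def)
      then have "(\<lambda>v. v) \<in> oOp (g + h)" by (simp add: oOp_def)
      then have "v \<in> S" unfolding S_def by (intro complex_vector.span_base CollectI exI[of _ "\<lambda>v. v"]) simp
      then show ?thesis using complex_vector.subspace_scale[OF S] True by simp
    next
      case False
      then have "(if m + n = 0 then (of_int m * osp12_form a b * k) *\<^sub>C v else 0) = 0" by auto
      then show ?thesis using complex_vector.subspace_0[OF S] by (simp only:)
    qed
    have "A (B v) - ksign (osp12_odd a) (osp12_odd b) *\<^sub>C B (A v) \<in> S"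
      using complex_vector.subspace_add[OF S 1 2] comm[of a m b n v] unfolding 3 by (simp add: algebra_simps)
    then show ?thesis by blast
  next
    case 1
    then have "A (B v) - 1 *\<^sub>C B (A v) = 0" by (simp add: scaleC_one)
    then show ?thesis using complex_vector.subspace_0[OF S] by metis
  next
    case 2
    then have "A (B v) - 1 *\<^sub>C B (A v) = 0" by (simp add: scaleC_one)
    then show ?thesis using complex_vector.subspace_0[OF S] by metis
  qed
  then show "\<exists>x. A (B v) - x *\<^sub>C B (A v) \<in> complex_vector.span {C v |C. C \<in> oOp (g + h)}" by (simp only: S_def)
next
  fix A g assume "A \<in> oOp g" "fst g \<le> 0"
  then show "A (vac V) \<in> (if g = 0 then complex_vector.span {vac V} else {0})"
    by (elim oOp_cases) (auto simp: np_vac complex_vector.span_zero complex_vector.span_base)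
next
  fix A g assume "A \<in> oOp g"
  then show "clinear A" by (elim oOp_cases) (simp_all add: lin_right clinear_id)
qed simp

sublocale G: graded_ops oOp fst "vac V"
  by (rule graded_ops)

lemma generated_total: "vsa_generated V (range \<iota>) = G.total"
proof
  show "vsa_generated V (range \<iota>) \<subseteq> G.total"
    by (rule generated_eq_total[OF _ graded_ops]) (use \<iota>_part gen_oOp in blast)+
  have "v \<in> vsa_generated V (range \<iota>)" if "G.mon g v" for g v
    using that
  proof (induction rule: G.mon.induct)
    case (step h u A g)
    show ?case using step.hyps(2)
    proof (cases rule: oOp_cases)
      case (1 a m)
      then show ?thesis using generatedD(3)[OF generated_base step.IH, of "\<iota> a" m] by simp
    qed (use step.IH in simp)
  qed (rule generatedD)
  then show "G.total \<subseteq> vsa_generated V (range \<iota>)"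
    unfolding G.total_def by (intro complex_vector.span_minimal generatedD) auto
qed

text \<open>The odd generators are those of odd h(0)-weight, so the eigenvalue of h(0) determines
  the parity. A nonzero even vector therefore has an even eigenvalue.\<close>

lemma Mon_parity: "G.Mon (n, s) \<subseteq> part V (odd s)"
proof -
  have "u \<in> part V (odd (snd g))" if "G.mon g u" for g u
    using that
  proof (induction rule: G.mon.induct)
    case (step h u A g)
    have odd: "odd (osp12_weight a) = osp12_odd a" for a by (cases a) auto
    show ?case using step.hyps(2)
    proof (cases rule: oOp_cases)
      case (1 a m)
      have "(osp12_odd a \<noteq> odd (snd h)) = odd (osp12_weight a + snd h)" using odd[of a] by auto
      then show ?thesis using np_part[OF \<iota>_part[of a] step.IH, of m] unfolding 1 by (simp only: snd_add snd_conv)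
    qed (use step.hyps(3) in simp)
  qed (simp add: vac_even)
  then show ?thesis unfolding G.Mon_def by (intro complex_vector.span_minimal part_subspace) auto
qed

text \<open>Each raising operator has degree at least 1 and raises the h(0)-eigenvalue by at most 2.
  In a fixed degree the eigenvalues are thus bounded above, and a highest one exists.\<close>

lemma Mon_bound: "u \<in> G.Mon (n, s) \<Longrightarrow> s > 2 * n \<Longrightarrow> u = 0"
proof -
  assume u: "u \<in> G.Mon (n, s)" and s: "s > 2 * n"
  have "snd g \<le> 2 * fst g" if "G.mon g u" for g u
    using that
  proof (induction rule: G.mon.induct)
    case (step h u A g)
    have b: "osp12_weight a \<le> 2" for a by (cases a) auto
    have "snd g \<le> 2" using step.hyps(2) by (elim oOp_cases) (simp_all add: b)
    then have "snd g \<le> 2 * fst g" using step.hyps(3) by linarith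
    then show ?case using step.IH by simp
  qed simp
  then have "{v. G.mon (n, s) v} = {}" using s by fastforce
  then show "u = 0" using u by (simp add: G.Mon_def del: Collect_empty_eq)
qed

lemma Om_weight: "np Om_osp 1 (np (\<iota> a) m c) = np (\<iota> a) m (np Om_osp 1 c) - ((2 * k + 3) * of_int m) *\<^sub>C np (\<iota> a) m c"
  by (rule weight_operator_commutator[OF \<iota>_part Om_even(2) Om_osp_prod])

lemma h_weight: "np (\<iota> osp_h) 0 (np (\<iota> a) m c) = np (\<iota> a) m (np (\<iota> osp_h) 0 c) + of_int (osp12_weight a) *\<^sub>C np (\<iota> a) m c"
  using comm[of osp_h 0 a m c] by (cases a) (simp_all add: scaleC_one)

text \<open>Both gradings are read off from the single operator \<open>\<Omega>\<^sub>(\<^sub>1\<^sub>)/(2k+3) + i h\<^sub>(\<^sub>0\<^sub>)\<close>.\<close>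

definition grading :: "'v \<Rightarrow> 'v" where
  "grading v = inverse (2 * k + 3) *\<^sub>C np Om_osp 1 v + \<i> *\<^sub>C np (\<iota> osp_h) 0 v"

lemma clinear_grading: "clinear grading"
  unfolding grading_def by (intro clinear_plus clinear_cmul lin_right)

lemma h_Mon: "v \<in> G.Mon g \<Longrightarrow> np (\<iota> osp_h) 0 v = of_int (snd g) *\<^sub>C v"
proof -
  assume v: "v \<in> G.Mon g"
  have "np (\<iota> osp_h) 0 v = (0 + of_int (snd g)) *\<^sub>C v"
  proof (rule G.Mon_eigen[OF lin_right _ _ _ v])
    fix A g v assume "A \<in> oOp g"
    then show "np (\<iota> osp_h) 0 (A v) = A (np (\<iota> osp_h) 0 v) + of_int (snd g) *\<^sub>C A v"
      by (elim oOp_cases) (simp_all add: h_weight)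
  qed (simp_all add: np_vac)
  then show ?thesis by simp
qed

lemma grading_Mon:
  assumes k: "2 * k + 3 \<noteq> 0" and v: "v \<in> G.Mon g"
  shows "grading v = (of_int (fst g) + \<i> * of_int (snd g)) *\<^sub>C v"
proof -
  have c: "inverse (2 * k + 3) * ((2 * k + 3) * x) = x" for x using k by simp
  have "grading v = (0 + (of_int (fst g) + \<i> * of_int (snd g))) *\<^sub>C v"
  proof (rule G.Mon_eigen[OF clinear_grading _ _ _ v])
    fix A g v assume A: "A \<in> oOp g"
    show "grading (A v) = A (grading v) + (of_int (fst g) + \<i> * of_int (snd g)) *\<^sub>C A v"
      using A
    proof (cases rule: oOp_cases)
      case (1 a m)
      then show ?thesis
        unfolding 1 grading_def Om_weight h_weight np_simps scaleC_scaleC c fst_conv snd_conv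
          complex_vector.scale_right_diff_distrib scaleC_add_right scaleC_add_left
        by (simp add: scaleC_scaleC)
    qed simp
  qed (simp_all add: grading_def np_vac algebra_simps)
  then show ?thesis by simp
qed

lemma grading_inj: "inj (\<lambda>g :: int \<times> int. of_int (fst g) + \<i> * (of_int (snd g) :: complex))"
  by (rule injI) (auto simp: complex_eq_iff prod_eq_iff)

end

section \<open>Sufficiency of the relations of \<open>x\<close>, \<open>y\<close> and \<open>h\<close>\<close>

locale osp_relations = vsa V for V :: "'v::complex_vector vsa" +
  fixes k :: complex and e f h x y :: 'v
  assumes even: "e \<in> part V False" "f \<in> part V False" "h \<in> part V False"
    and odd: "x \<in> part V True" "y \<in> part V True"
    and hh: "np h m (np h n v) = np h n (np h m v) + (if m + n = 0 then (2 * of_int m * k) *\<^sub>C v else 0)"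
    and hx: "np h m (np x n v) = np x n (np h m v) + np x (m + n) v"
    and hy: "np h m (np y n v) = np y n (np h m v) - np y (m + n) v"
    and xx: "np x m (np x n v) = 2 *\<^sub>C np e (m + n) v - np x n (np x m v)"
    and yx: "np y m (np x n v) = np h (m + n) v + (if m + n = 0 then (2 * of_int n * k) *\<^sub>C v else 0) - np x n (np y m v)"
    and yy: "np y m (np y n v) = - (2 *\<^sub>C np f (m + n) v) - np y n (np y m v)"
    and ex: "np e m (np x n v) = np x n (np e m v)"
    and fy: "np f m (np y n v) = np y n (np f m v)"
begin

text \<open>With second index 0 the relation for \<open>x\<close> exhibits every mode of
  \<open>e\<close> as an anticommutator. The brackets with \<open>e\<close> then follow from those
  with \<open>x\<close>.\<close>

lemma e_expand: "np e m v = (1 / 2) *\<^sub>C (np x m (np x 0 v) + np x 0 (np x m v))"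
  using xx[of m 0 v] by (simp add: scaleC_scaleC scaleC_one)

lemma f_expand: "np f m v = - ((1 / 2) *\<^sub>C (np y m (np y 0 v) + np y 0 (np y m v)))"
  using yy[of m 0 v] by (simp add: scaleC_scaleC scaleC_one)

lemma he: "np h l (np e m v) = np e m (np h l v) + 2 *\<^sub>C np e (l + m) v"
proof -
  have "np h l (np e m v) = (1 / 2) *\<^sub>C (np x m (np x 0 (np h l v)) + np x 0 (np x m (np h l v))
    + (np x m (np x l v) + np x l (np x m v)) + (np x (l + m) (np x 0 v) + np x 0 (np x (l + m) v)))"
    by (subst e_expand) (simp add: np_simps hx algebra_simps)
  also have "\<dots> = np e m (np h l v) + 2 *\<^sub>C np e (l + m) v"
    unfolding xx[of m l] xx[of "l + m" 0] e_expand[of m "np h l v"]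
    by (rule vector_eqI) (simp (no_asm_simp) add: field_simps)
  finally show ?thesis .
qed

lemma hf: "np h l (np f m v) = np f m (np h l v) - 2 *\<^sub>C np f (l + m) v"
proof -
  have "np h l (np f m v) = - ((1 / 2) *\<^sub>C (np y m (np y 0 (np h l v)) + np y 0 (np y m (np h l v))
    - (np y m (np y l v) + np y l (np y m v)) - (np y (l + m) (np y 0 v) + np y 0 (np y (l + m) v))))"
    by (subst f_expand) (simp add: np_simps hy algebra_simps)
  also have "\<dots> = np f m (np h l v) - 2 *\<^sub>C np f (l + m) v"
    unfolding yy[of m l] yy[of "l + m" 0] f_expand[of m "np h l v"]
    by (rule vector_eqI) (simp (no_asm_simp) add: field_simps)
  finally show ?thesis .
qed

lemma ye: "np y l (np e m v) = np e m (np y l v) + np x (l + m) v"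
proof (rule vector_eqI)
  fix \<phi> :: "'v \<Rightarrow> complex"
  assume \<phi>: "\<And>x y. \<phi> (x + y) = \<phi> x + \<phi> y" "\<And>r x. \<phi> (r *\<^sub>C x) = r * \<phi> x"
    "\<And>x. \<phi> (- x) = - \<phi> x" "\<And>x y. \<phi> (x - y) = \<phi> x - \<phi> y" "\<phi> 0 = 0"
  show "\<phi> (np y l (np e m v)) = \<phi> (np e m (np y l v) + np x (l + m) v)"
    unfolding e_expand[of m]
    by (cases "l = 0"; cases "l + m = 0") (simp_all add: \<phi> np_simps yx hx field_simps eq_neg_iff_add_eq_0)
qed

lemma fx: "np f m (np x l v) = np x l (np f m v) - np y (l + m) v"
proof (rule vector_eqI)
  fix \<phi> :: "'v \<Rightarrow> complex"
  assume \<phi>: "\<And>x y. \<phi> (x + y) = \<phi> x + \<phi> y" "\<And>r x. \<phi> (r *\<^sub>C x) = r * \<phi> x"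
    "\<And>x. \<phi> (- x) = - \<phi> x" "\<And>x y. \<phi> (x - y) = \<phi> x - \<phi> y" "\<phi> 0 = 0"
  show "\<phi> (np f m (np x l v)) = \<phi> (np x l (np f m v) - np y (l + m) v)"
    unfolding f_expand[of m]
    by (cases "l = 0"; cases "l + m = 0") (simp_all add: \<phi> np_simps yx hy field_simps eq_neg_iff_add_eq_0)
qed

lemma fe: "np f l (np e m v) = np e m (np f l v) - np h (l + m) v - (if l + m = 0 then (of_int m * k) *\<^sub>C v else 0)"
proof (rule vector_eqI)
  fix \<phi> :: "'v \<Rightarrow> complex"
  assume \<phi>: "\<And>x y. \<phi> (x + y) = \<phi> x + \<phi> y" "\<And>r x. \<phi> (r *\<^sub>C x) = r * \<phi> x"
    "\<And>x. \<phi> (- x) = - \<phi> x" "\<And>x y. \<phi> (x - y) = \<phi> x - \<phi> y" "\<phi> 0 = 0"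
  show "\<phi> (np f l (np e m v)) = \<phi> (np e m (np f l v) - np h (l + m) v - (if l + m = 0 then (of_int m * k) *\<^sub>C v else 0))"
    unfolding e_expand[of m]
    by (cases "l + m = 0") (simp_all add: \<phi> np_simps yx fx field_simps)
qed

lemma ee: "np e l (np e m v) = np e m (np e l v)"
  by (simp add: e_expand[of m] np_simps ex)

lemma ff: "np f l (np f m v) = np f m (np f l v)"
  by (simp add: f_expand[of m] np_simps fy)

definition gens :: "osp12_basis \<Rightarrow> 'v" where
  "gens a = (case a of osp_e \<Rightarrow> e | osp_f \<Rightarrow> f | osp_h \<Rightarrow> h | osp_x \<Rightarrow> x | osp_y \<Rightarrow> y)"

lemma gens_simps [simp]:
  "gens osp_e = e" "gens osp_f = f" "gens osp_h = h" "gens osp_x = x" "gens osp_y = y"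
  by (simp_all add: gens_def)

lemma relations_0: "scomm V (osp12_odd a) (osp12_odd b) (gens a) m (gens b) (- m) v =
    Sum_any (\<lambda>g. Poly_Mapping.lookup (osp12_bracket a b) g *\<^sub>C np (gens g) 0 v)
    + (of_int m * osp12_form a b * k) *\<^sub>C v"
  by (cases a; cases b; simp add: scomm_def Sum_any_single scaleC_one hh[of m "- m"] hx hy xx[of m "- m"]
    yx yy[of m "- m"] ex fy he hf ye fx fe ee[of m "- m"] ff[of m "- m"])

lemma relations_nonzero: "m + n \<noteq> 0 \<Longrightarrow>
    scomm V (osp12_odd a) (osp12_odd b) (gens a) m (gens b) n v =
    Sum_any (\<lambda>g. Poly_Mapping.lookup (osp12_bracket a b) g *\<^sub>C np (gens g) (m + n) v)"
  by (cases a; cases b; simp add: scomm_def Sum_any_single scaleC_one hh[of m n] hx hy xx[of m n]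
    yx yy[of m n] ex fy he hf ye fx fe ee[of m n] ff[of m n] add.commute[of n m])

lemma affine_osp: "affine_osp V k gens"
proof (intro affine_osp.intro affine_osp_axioms.intro vsa_axioms)
  show "gens a \<in> part V (osp12_odd a)" for a by (cases a) (simp_all add: even odd)
  fix a b m n v
  show "scomm V (osp12_odd a) (osp12_odd b) (gens a) m (gens b) n v =
        Sum_any (\<lambda>g. Poly_Mapping.lookup (osp12_bracket a b) g *\<^sub>C np (gens g) (m + n) v)
        + (if m + n = 0 then (of_int m * osp12_form a b * k) *\<^sub>C v else 0)"
  proof (cases "m + n = 0")
    case True
    then have "n = - m" by simp
    then show ?thesis using relations_0[of a b m v] by simp
  qed (simp add: relations_nonzero)
qed

end

text \<open>Otherwise \<open>e\<^sup>0\<close> is rewritten to the unit of the group algebra.\<close>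

declare single_one [simp del]

section \<open>The half-lattice vertex algebra\<close>

locale half_lattice = heisenberg M c d for M :: "'m::complex_vector vsa" and c d +
  fixes P :: "('m, int \<Rightarrow>\<^sub>0 complex) tensor vsa" and K :: complex
  assumes half_lattice: "half_lattice_vsa M c d P"

sublocale half_lattice \<subseteq> P: vsa P
  using half_lattice by unfold_locales (simp add: half_lattice_vsa_def)

context half_lattice begin

definition \<nu> where "\<nu> = (1 / 2) *\<^sub>C d - (K / 4) *\<^sub>C c"
definition \<mu> where "\<mu> = (1 / 2) *\<^sub>C d + (K / 4) *\<^sub>C c"

abbreviation st :: "'m \<Rightarrow> int \<Rightarrow> ('m, int \<Rightarrow>\<^sub>0 complex) tensor" where
  "st u s \<equiv> u \<otimes> Poly_Mapping.single s 1"

definition ex :: "int \<Rightarrow> ('m, int \<Rightarrow>\<^sub>0 complex) tensor" where "ex s = st (vac M) s"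
definition Cm where "Cm n = nprod P (st c 0) n"
definition Dm where "Dm n = nprod P (st d 0) n"
definition Nm where "Nm n = nprod P (st \<nu> 0) n"
definition Um where "Um n = nprod P (st \<mu> 0) n"
definition Xm where "Xm r n = nprod P (ex r) n"

lemma vacP: "vac P = ex 0"
  using half_lattice by (simp add: half_lattice_vsa_def ex_def)

lemma all_even_P: "v \<in> part P False"
  using P.part_decomp[of v] half_lattice by (auto simp: half_lattice_vsa_def)

lemma Cm_st: "Cm n (st u s) = st (np c n u) s"
  and Dm_st: "Dm n (st u s) = st (np d n u) s + (if n = 0 then of_int s *\<^sub>C st u s else 0)"
  and Xm_st: "Xm r N (st u s) = Sum_any (\<lambda>t::nat. if int t - N - 1 < 0 then 0 else
          exp_coeff (\<lambda>j v. np ((of_int r / 2) *\<^sub>C c) (- int j) v) (nat (int t - N - 1))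
            (exp_coeff (\<lambda>j v. - np ((of_int r / 2) *\<^sub>C c) (int j) v) t u)
          \<otimes> Poly_Mapping.single (r + s) 1)"
  using half_lattice by (simp_all add: half_lattice_vsa_def ex_def Cm_def Dm_def Xm_def)

lemma lin_modes: "clinear (Cm n)" "clinear (Dm n)" "clinear (Nm n)" "clinear (Um n)" "clinear (Xm r n)"
  unfolding Cm_def Dm_def Nm_def Um_def Xm_def by (rule P.lin_right)+

lemmas mode_simps = clinear_simps[OF lin_modes(1)] clinear_simps[OF lin_modes(2)]
  clinear_simps[OF lin_modes(3)] clinear_simps[OF lin_modes(4)] clinear_simps[OF lin_modes(5)]

lemma Nm_eq: "Nm n v = (1 / 2) *\<^sub>C Dm n v - (K / 4) *\<^sub>C Cm n v"
  and Um_eq: "Um n v = (1 / 2) *\<^sub>C Dm n v + (K / 4) *\<^sub>C Cm n v"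
  by (simp_all add: Nm_def Um_def \<nu>_def \<mu>_def Cm_def Dm_def tensor_simps P.np_simps)

lemma M_prod: "n \<ge> 0 \<Longrightarrow> np c n c = 0" "n \<ge> 0 \<Longrightarrow> np d n d = 0"
  "n \<ge> 0 \<Longrightarrow> np c n d = (if n = 1 then 2 *\<^sub>C vac M else 0)"
  using comm(1)[of n "- 1" "vac M"] comm(2)[of n "- 1" "vac M"] comm(3)[of n "- 1" "vac M"]
  by (simp_all add: np_vac np_simps)

lemma comm_P:
  assumes "\<And>j. j \<ge> 0 \<Longrightarrow> nprod P a j b = (if j = 0 then z0 else if j = 1 then z1 else 0)"
  shows "nprod P a m (nprod P b n v) = nprod P b n (nprod P a m v) + nprod P z0 (m + n) v
     + of_int m *\<^sub>C nprod P z1 (m + n - 1) v"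
proof -
  have "nprod P a m (nprod P b n v) - nprod P b n (nprod P a m v) =
    (\<Sum>r<2. (of_int m gchoose r) *\<^sub>C nprod P (nprod P a (int r) b) (m + n - int r) v)"
    using P.commutator[OF all_even_P all_even_P, of 2 a b m n v] assms by (simp add: scaleC_one)
  then show ?thesis by (simp add: numeral_2_eq_2 assms scaleC_one algebra_simps)
qed

lemma comm_C: "Cm m (Cm n v) = Cm n (Cm m v)"
  and comm_D: "Dm m (Dm n v) = Dm n (Dm m v)"
  and comm_CD: "Cm m (Dm n v) = Dm n (Cm m v) + (if m + n = 0 then (2 * of_int m) *\<^sub>C v else 0)"
  and comm_CX: "Xm r n (Cm m v) = Cm m (Xm r n v)"
  and comm_DX: "Xm r n (Dm m v) = Dm m (Xm r n v) - of_int r *\<^sub>C Xm r (m + n) v"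
proof -
  note C = Cm_st[unfolded Cm_def] and D = Dm_st[unfolded Dm_def]
  show "Cm m (Cm n v) = Cm n (Cm m v)"
    unfolding Cm_def by (subst comm_P[of _ _ 0 0]) (simp_all add: C M_prod tensor_simps P.np_simps)
  show "Dm m (Dm n v) = Dm n (Dm m v)"
    unfolding Dm_def by (subst comm_P[of _ _ 0 0]) (simp_all add: D M_prod tensor_simps P.np_simps)
  have "Cm m (Dm n v) = Dm n (Cm m v) + nprod P 0 (m + n) v + of_int m *\<^sub>C nprod P (2 *\<^sub>C vac P) (m + n - 1) v"
    unfolding Cm_def Dm_def by (rule comm_P) (simp add: C M_prod tensor_simps vacP ex_def)
  then show "Cm m (Dm n v) = Dm n (Cm m v) + (if m + n = 0 then (2 * of_int m) *\<^sub>C v else 0)"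
    by (auto simp: P.np_simps P.vac_np scaleC_scaleC mult.commute)
  have "Cm m (Xm r n v) = Xm r n (Cm m v) + nprod P 0 (m + n) v + of_int m *\<^sub>C nprod P 0 (m + n - 1) v"
    unfolding Cm_def Xm_def by (rule comm_P) (simp add: C ex_def np_vac tensor_simps)
  then show "Xm r n (Cm m v) = Cm m (Xm r n v)" by (simp add: P.np_simps)
  have "Dm m (Xm r n v) = Xm r n (Dm m v) + nprod P (of_int r *\<^sub>C ex r) (m + n) v + of_int m *\<^sub>C nprod P 0 (m + n - 1) v"
    unfolding Dm_def Xm_def by (rule comm_P) (simp add: D ex_def np_vac tensor_simps)
  then show "Xm r n (Dm m v) = Dm m (Xm r n v) - of_int r *\<^sub>C Xm r (m + n) v"
    by (simp add: P.np_simps Xm_def)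
qed

lemma comm_NC: "Nm m (Cm n v) = Cm n (Nm m v) + (if m + n = 0 then of_int m *\<^sub>C v else 0)"
  using comm_CD[of n m v] comm_C[of m n v]
  by (auto simp: Nm_eq mode_simps scaleC_scaleC complex_vector.scale_right_diff_distrib
    scaleC_add_right eq_neg_iff_add_eq_0[symmetric] add.commute)

lemma comm_DC: "Dm m (Cm n v) = Cm n (Dm m v) + (if m + n = 0 then (2 * of_int m) *\<^sub>C v else 0)"
  using comm_CD[of n m v] by (cases "m + n = 0") (auto simp: eq_neg_iff_add_eq_0[symmetric] add.commute)

lemma comm_N: "Nm m (Nm n v) = Nm n (Nm m v) - (if m + n = 0 then (K / 2 * of_int m) *\<^sub>C v else 0)"
proof (cases "m + n = 0")
  case True
  then have n: "n = - m" by simp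
  show ?thesis
    unfolding n Nm_eq mode_simps comm_CD[of m "- m"] comm_DC[of m "- m"] comm_D[of m "- m"] comm_C[of m "- m"]
    by (rule vector_eqI) (simp (no_asm_simp) add: algebra_simps)
next
  case False
  then show ?thesis
    unfolding Nm_eq mode_simps comm_CD[of m n] comm_DC[of m n] comm_D[of m n] comm_C[of m n]
    by (simp add: algebra_simps)
qed

lemma comm_UN: "Um m (Nm n v) = Nm n (Um m v)"
proof (cases "m + n = 0")
  case True
  then have n: "n = - m" by simp
  show ?thesis
    unfolding n Nm_eq Um_eq mode_simps comm_CD[of m "- m"] comm_DC[of m "- m"] comm_D[of m "- m"] comm_C[of m "- m"]
    by (rule vector_eqI) (simp (no_asm_simp) add: algebra_simps)
next
  case False
  then show ?thesis
    unfolding Nm_eq Um_eq mode_simps comm_CD[of m n] comm_DC[of m n] comm_D[of m n] comm_C[of m n]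
    by (simp add: algebra_simps)
qed

lemma comm_XN: "Xm r n (Nm m v) = Nm m (Xm r n v) - (of_int r / 2) *\<^sub>C Xm r (m + n) v"
  unfolding Nm_eq mode_simps comm_CX comm_DX
  by (rule vector_eqI) (simp (no_asm_simp) add: algebra_simps)

lemma modes_ex: "n \<ge> 0 \<Longrightarrow> Cm n (ex s) = 0"
  "n \<ge> 0 \<Longrightarrow> Nm n (ex s) = (if n = 0 then (of_int s / 2) *\<^sub>C ex s else 0)"
  "n \<ge> 0 \<Longrightarrow> Um n (ex s) = (if n = 0 then (of_int s / 2) *\<^sub>C ex s else 0)"
  by (auto simp: Nm_eq Um_eq ex_def Cm_st Dm_st np_vac tensor_simps scaleC_scaleC)

lemma exp_annihilated:
  assumes "\<And>j. j \<ge> 1 \<Longrightarrow> x j 0 = 0" "\<And>j. j \<ge> 1 \<Longrightarrow> x j u = 0"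
  shows "t \<ge> 1 \<Longrightarrow> exp_coeff x t u = 0"
proof (induction t rule: less_induct)
  case (less t)
  then obtain n where t: "t = Suc n" by (cases t) auto
  have "x (Suc j) (exp_coeff x (n - j) u) = 0" if "j \<le> n" for j
  proof (cases "n - j = 0")
    case False
    then have "exp_coeff x (n - j) u = 0" using less.IH[of "n - j"] t by simp
    then show ?thesis using assms(1) by simp
  qed (use assms(2) in simp)
  then show ?case by (simp add: t)
qed

text \<open>The annihilating exponential acts as the identity on the vacuum of M(1), so only the
  term t = 0 is left.\<close>

lemma Xm_ex_sum: "Xm r N (ex s) = (if N < 0 then
    exp_coeff (\<lambda>j v. np ((of_int r / 2) *\<^sub>C c) (- int j) v) (nat (- N - 1)) (vac M) \<otimes> Poly_Mapping.single (r + s) 1 else 0)"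
proof -
  have z: "exp_coeff (\<lambda>j v. - np ((of_int r / 2) *\<^sub>C c) (int j) v) t (vac M) = 0" if "t \<ge> 1" for t
    by (rule exp_annihilated[OF _ _ that]) (simp_all add: np_simps np_vac)
  have lin0: "exp_coeff (\<lambda>j v. np ((of_int r / 2) *\<^sub>C c) (- int j) v) n 0 = 0" for n
  proof (cases "n \<ge> 1")
    case True then show ?thesis by (intro exp_annihilated) (simp_all add: np_simps)
  qed (simp add: not_le)
  show ?thesis
    unfolding ex_def Xm_st
    by (subst Sum_any_lessThan[of 1]) (auto simp: z lin0 tensor_simps not_less)
qed

text \<open>The coefficients are the elementary Schur polynomials of degrees 0, 1 and 2 in the
  creation operators of rc/2.\<close>

lemma Xm_ex:
  "N \<ge> 0 \<Longrightarrow> Xm r N (ex s) = 0"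
  "Xm r (- 1) (ex s) = ex (r + s)"
  "Xm r (- 2) (ex s) = (of_int r / 2) *\<^sub>C Cm (- 1) (ex (r + s))"
  "Xm r (- 3) (ex s) = (of_int r ^ 2 / 8) *\<^sub>C Cm (- 1) (Cm (- 1) (ex (r + s))) + (of_int r / 4) *\<^sub>C Cm (- 2) (ex (r + s))"
  unfolding Xm_ex_sum by (simp_all add: ex_def Cm_st numeral_2_eq_2 np_simps tensor_simps scaleC_scaleC
      scaleC_add_right power2_eq_square)

lemma lookup_functional: "clinear (\<lambda>p :: int \<Rightarrow>\<^sub>0 complex. Poly_Mapping.lookup p s)"
  by (rule clinearI) (simp_all add: lookup_add lookup_scaleC)

definition coord :: "int \<Rightarrow> ('m, int \<Rightarrow>\<^sub>0 complex) tensor \<Rightarrow> 'm" where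
  "coord s = contract_right (\<lambda>p. Poly_Mapping.lookup p s)"

lemma clinear_coord: "clinear (coord s)"
  unfolding coord_def by (rule clinear_contract_right[OF lookup_functional])

lemma coord_tensor: "coord s (u \<otimes> p) = Poly_Mapping.lookup p s *\<^sub>C u"
  unfolding coord_def by (rule contract_right_tensor[OF lookup_functional])

lemma coord_st: "coord s (st u s') = (if s = s' then u else 0)"
  by (simp add: coord_tensor lookup_single when_def scaleC_one)

lemma coord_expand: "\<exists>A. finite A \<and> (\<forall>A'. finite A' \<and> A \<subseteq> A' \<longrightarrow> u = (\<Sum>s\<in>A'. st (coord s u) s))"
proof (induction u)
  case (add x y)
  then obtain A B where A: "finite A" "\<forall>A'. finite A' \<and> A \<subseteq> A' \<longrightarrow> x = (\<Sum>s\<in>A'. st (coord s x) s)"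
    and B: "finite B" "\<forall>A'. finite A' \<and> B \<subseteq> A' \<longrightarrow> y = (\<Sum>s\<in>A'. st (coord s y) s)" by blast
  show ?case
  proof (intro exI[of _ "A \<union> B"] conjI allI impI)
    fix A' assume A': "finite A' \<and> A \<union> B \<subseteq> A'"
    have "(\<Sum>s\<in>A'. st (coord s (x + y)) s) = (\<Sum>s\<in>A'. st (coord s x) s) + (\<Sum>s\<in>A'. st (coord s y) s)"
      by (simp add: clinear_add[OF clinear_coord] clinear_add[OF clinear_tensor_left] sum.distrib)
    then show "x + y = (\<Sum>s\<in>A'. st (coord s (x + y)) s)"
      using A(2)[rule_format, of A'] B(2)[rule_format, of A'] A' by simp
  qed (use A B in simp)
next
  case (tensor u p)
  show ?case
  proof (intro exI[of _ "Poly_Mapping.keys p"] conjI allI impI)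
    fix A' assume A': "finite A' \<and> Poly_Mapping.keys p \<subseteq> A'"
    have "p = (\<Sum>s\<in>A'. Poly_Mapping.lookup p s *\<^sub>C Poly_Mapping.single s 1)"
    proof (rule poly_mapping_eqI)
      fix t
      have "(\<Sum>s\<in>A'. Poly_Mapping.lookup (Poly_Mapping.lookup p s *\<^sub>C Poly_Mapping.single s 1) t) =
        (\<Sum>s\<in>A'. if s = t then Poly_Mapping.lookup p t else 0)"
        by (rule sum.cong) (auto simp: lookup_scaleC lookup_single when_def scaleC_complex)
      also have "\<dots> = Poly_Mapping.lookup p t"
        using A' by (auto simp: in_keys_iff)
      finally show "Poly_Mapping.lookup p t = Poly_Mapping.lookup (\<Sum>s\<in>A'. Poly_Mapping.lookup p s *\<^sub>C Poly_Mapping.single s 1) t"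
        by (simp add: lookup_sum)
    qed
    then have "u \<otimes> p = (\<Sum>s\<in>A'. u \<otimes> (Poly_Mapping.lookup p s *\<^sub>C Poly_Mapping.single s 1))"
      using clinear_sum[OF clinear_tensor_right, of u] by metis
    also have "\<dots> = (\<Sum>s\<in>A'. st (coord s (u \<otimes> p)) s)"
      by (rule sum.cong) (simp_all add: coord_tensor tensor_simps)
    finally show "u \<otimes> p = (\<Sum>s\<in>A'. st (coord s (u \<otimes> p)) s)" .
  qed simp
qed

lemma zero_modes_P: "Cm 0 u = 0" "coord s (Dm 0 u) = of_int s *\<^sub>C coord s u"
proof -
  have *: "Cm 0 (st m s') = 0" "coord s (Dm 0 (st m s')) = of_int s *\<^sub>C coord s (st m s')" for m s'
    by (simp_all add: Cm_st Dm_st zero_modes tensor_simps clinear_scale[OF clinear_coord] coord_st)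
  obtain A where A: "u = (\<Sum>s\<in>A. st (coord s u) s)" using coord_expand[of u] by blast
  show "Cm 0 u = 0" by (subst A) (simp add: mode_simps *)
  have "coord s (Dm 0 (\<Sum>s\<in>A. st (coord s u) s)) = of_int s *\<^sub>C coord s (\<Sum>s\<in>A. st (coord s u) s)"
    by (simp only: mode_simps clinear_sum[OF clinear_coord] * complex_vector.scale_sum_right)
  then show "coord s (Dm 0 u) = of_int s *\<^sub>C coord s u" by (simp only: A[symmetric])
qed

lemma exp_coeff_add:
  assumes "\<And>j v w. x j (v + w) = x j v + x j w"
  shows "exp_coeff x t (v + w) = exp_coeff x t v + exp_coeff x t w"
proof (induction t rule: less_induct)
  case (less t)
  show ?case
  proof (cases t)
    case (Suc n)
    have "(\<Sum>j\<in>{0..n}. x (Suc j) (exp_coeff x (n - j) (v + w))) =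
      (\<Sum>j\<in>{0..n}. x (Suc j) (exp_coeff x (n - j) v) + x (Suc j) (exp_coeff x (n - j) w))"
      by (rule sum.cong) (simp_all add: less.IH Suc assms)
    then show ?thesis by (simp add: Suc sum.distrib scaleC_add_right)
  qed simp
qed

text \<open>The coefficient of index t lowers the degree by t, and degrees are nonnegative, so
  nothing is left beyond the highest degree occurring in \<open>u\<close>. This yields a largest
  index with nonzero coefficient.\<close>

lemma exp_coeff_vanishes: "\<exists>T. \<forall>t \<ge> T. exp_coeff (\<lambda>j v. - np (x *\<^sub>C c) (int j) v) t u = 0"
proof -
  interpret G: graded_ops hOp "\<lambda>g. g" "vac M" by (rule graded_ops)
  let ?e = "exp_coeff (\<lambda>j v. - np (x *\<^sub>C c) (int j) v)"
  have Mon: "?e t u \<in> G.Mon (g - int t)" if "u \<in> G.Mon g" for g t u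
  proof (induction t rule: less_induct)
    case (less t)
    show ?case
    proof (cases t)
      case (Suc n)
      have "- np (x *\<^sub>C c) (int (Suc j)) (?e (n - j) u) \<in> G.Mon (g - int t)" if "j \<le> n" for j
      proof -
        have "?e (n - j) u \<in> G.Mon (g - int (n - j))" using less.IH[of "n - j"] Suc by simp
        moreover have "np c (int (Suc j)) \<in> hOp (- int (Suc j))"
          by (simp only: hOp_def minus_minus) simp
        ultimately have "np c (int (Suc j)) (?e (n - j) u) \<in> G.Mon (- int (Suc j) + (g - int (n - j)))"
          by (rule G.Mon_closed)
        moreover have "- int (Suc j) + (g - int (n - j)) = g - int t" using that Suc by simp
        ultimately have "np c (int (Suc j)) (?e (n - j) u) \<in> G.Mon (g - int t)" by (simp only:)
        then show ?thesis
          unfolding clinear_scale[OF lin_left]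
          by (intro complex_vector.subspace_neg[OF G.Mon_subspace] complex_vector.subspace_scale[OF G.Mon_subspace])
      qed
      then show ?thesis unfolding Suc
        by (auto intro!: complex_vector.subspace_scale[OF G.Mon_subspace] complex_vector.subspace_sum[OF G.Mon_subspace])
    qed (use that in simp)
  qed
  have add: "?e t (v + w) = ?e t v + ?e t w" for t v w
    by (rule exp_coeff_add) (simp add: np_simps)
  have "vsa_generated M {c, d} \<subseteq> G.total"
  proof (rule generated_eq_total[OF _ graded_ops])
    fix x n assume "x \<in> {c, d}"
    then show "\<exists>g. np x n \<in> hOp g" by (intro exI[of _ "- n"]) (auto simp: hOp_def)
  qed (use all_even in blast)
  then have "u \<in> G.total" unfolding generated by blast
  then obtain A f where A: "finite A" "\<And>g. g \<in> A \<Longrightarrow> f g \<in> G.Mon g" "u = (\<Sum>g\<in>A. f g)"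
    using G.total_components by blast
  have zero: "?e t 0 = 0" for t using add[of t 0 0] by simp
  have sum: "?e t (\<Sum>g\<in>B. f g) = (\<Sum>g\<in>B. ?e t (f g))" for t B
    by (induction B rule: infinite_finite_induct) (simp_all add: zero add)
  define T where "T = nat (Max (insert 0 A)) + 1"
  have "?e t u = 0" if "t \<ge> T" for t
  proof -
    have "?e t (f g) = 0" if g: "g \<in> A" for g
    proof -
      have "g \<le> Max (insert 0 A)" using A(1) g by simp
      then have "g - int t < 0" using \<open>t \<ge> T\<close> by (simp add: T_def)
      then show ?thesis using G.Mon_deg_neg Mon[OF A(2)[OF g], of t] by blast
    qed
    then show ?thesis by (simp add: A(3) sum)
  qed
  then show ?thesis by blast
qed

lemma single_nonzero: "Poly_Mapping.single t (1::complex) \<noteq> 0"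
  by (metis lookup_single_eq lookup_zero zero_neq_one)

text \<open>Only the components in the eigenspace of \<open>\<mu>\<^sub>(\<^sub>0\<^sub>)\<close> survive; the largest \<open>t\<close> with nonvanishing
  coefficient of the annihilating exponential would be seen in a nonnegative mode of \<open>e\<^sup>c\<close>.\<close>

lemma singular_vector_P:
  assumes X: "\<And>n. n \<ge> 0 \<Longrightarrow> Xm 2 n u = 0" and U: "\<And>n. n \<ge> 1 \<Longrightarrow> Um n u = 0" "Um 0 u = (of_int s / 2) *\<^sub>C u"
  shows "\<exists>r. u = r *\<^sub>C ex s"
proof -
  have D0: "Dm 0 u = of_int s *\<^sub>C u"
  proof -
    have "2 *\<^sub>C Um 0 u = of_int s *\<^sub>C u" by (simp add: U(2) scaleC_scaleC)
    then show ?thesis by (simp add: Um_eq zero_modes_P scaleC_scaleC scaleC_one)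
  qed
  have "coord s' u = 0" if "s' \<noteq> s" for s'
    using zero_modes_P(2)[of s' u] that by (simp add: D0 clinear_scale[OF clinear_coord])
  note zero = this
  obtain A where A: "finite A" "\<forall>A'. finite A' \<and> A \<subseteq> A' \<longrightarrow> u = (\<Sum>s\<in>A'. st (coord s u) s)"
    using coord_expand[of u] by blast
  have 1: "u = (\<Sum>s\<in>insert s A. st (coord s u) s)"
    by (rule A(2)[rule_format]) (use A(1) in auto)
  have 2: "(\<Sum>s\<in>A - {s}. st (coord s u) s) = 0"
    by (rule sum.neutral) (simp add: zero tensor_simps)
  define m where "m = coord s u"
  have 3: "(\<Sum>s\<in>insert s A. st (coord s u) s) = st m s"
    using A(1) 2 by (simp add: sum.insert_remove m_def)
  have u: "u = st m s" using 1 3 by (rule trans)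
  define p where "p = exp_coeff (\<lambda>j v. np ((of_int 2 / 2) *\<^sub>C c) (- int j) v)"
  define e where "e = exp_coeff (\<lambda>j v. - np ((of_int 2 / 2) *\<^sub>C c) (int j) v)"
  have e_0: "e 0 v = v" for v by (simp add: e_def)
  have p_0: "p 0 v = v" for v by (simp add: p_def)
  have p0: "p n 0 = 0" for n
  proof (cases "n \<ge> 1")
    case True then show ?thesis unfolding p_def by (intro exp_annihilated) (simp_all add: np_simps)
  qed (simp add: not_le p_0)
  obtain T where T: "\<And>t. t \<ge> T \<Longrightarrow> e t m = 0" using exp_coeff_vanishes[of "of_int 2 / 2" m] unfolding e_def by blast
  have e0: "e t m = 0" if "t \<ge> 1" for t
  proof (rule ccontr)
    assume nz: "e t m \<noteq> 0"
    define T1 where "T1 = Max {t. e t m \<noteq> 0}"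
    have fin: "finite {t. e t m \<noteq> 0}"
      by (rule finite_subset[of _ "{..<T}"]) (use T not_less in auto)
    have T1: "e T1 m \<noteq> 0" "t \<le> T1" "\<And>t'. t' > T1 \<Longrightarrow> e t' m = 0"
      unfolding T1_def using Max_in[OF fin] nz Max_ge[OF fin] not_less by auto
    \<comment> \<open>In this mode the terms t < T1 would need a negative power from the creation
      exponential, and those with t > T1 vanish. The term t = T1 stands alone.\<close>
    have "Xm 2 (int T1 - 1) (st m s) = Sum_any (\<lambda>t::nat. if int t - (int T1 - 1) - 1 < 0 then 0 else
          p (nat (int t - (int T1 - 1) - 1)) (e t m) \<otimes> Poly_Mapping.single (2 + s) 1)"
      unfolding p_def e_def by (rule Xm_st)
    also have "\<dots> = Sum_any (\<lambda>t. if t = T1 then st (e T1 m) (2 + s) else 0)"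
    proof (rule arg_cong[of _ _ Sum_any], rule ext)
      fix t
      show "(if int t - (int T1 - 1) - 1 < 0 then 0 else
          p (nat (int t - (int T1 - 1) - 1)) (e t m) \<otimes> Poly_Mapping.single (2 + s) 1) =
        (if t = T1 then st (e T1 m) (2 + s) else 0)"
        using T1(3)[of t] by (cases "t < T1"; cases "t = T1") (simp_all add: p0 p_0 tensor_simps)
    qed
    also have "\<dots> = st (e T1 m) (2 + s)" by (rule Sum_any.delta)
    finally have "st (e T1 m) (2 + s) = 0"
      using X[of "int T1 - 1"] u T1(2) that by simp
    moreover have "Poly_Mapping.single (2 + s) (1::complex) \<noteq> 0" by (rule single_nonzero)
    ultimately show False using T1(1) unfolding tensor_eq_0_iff by blast
  qed
  \<comment> \<open>In the recursion for index j + 1 the lower coefficients of positive index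
    vanish, which leaves a multiple of the single mode c(j + 1).\<close>
  have c0: "np c n m = 0" if "n \<ge> 1" for n
  proof -
    define j where "j = nat (n - 1)"
    have n: "n = int (Suc j)" using that by (simp add: j_def)
    have "e (Suc j) m = (1 / of_nat (Suc j)) *\<^sub>C (\<Sum>i\<in>{0..j}. - np ((of_int 2 / 2) *\<^sub>C c) (int (Suc i)) (e (j - i) m))"
      by (simp only: e_def exp_coeff.simps)
    also have "(\<Sum>i\<in>{0..j}. - np ((of_int 2 / 2) *\<^sub>C c) (int (Suc i)) (e (j - i) m)) =
      (\<Sum>i\<in>{0..j}. if i = j then - np c (int (Suc j)) m else 0)"
    proof (rule sum.cong)
      fix i assume "i \<in> {0..j}"
      then show "- np ((of_int 2 / 2) *\<^sub>C c) (int (Suc i)) (e (j - i) m) = (if i = j then - np c (int (Suc j)) m else 0)"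
        using e0[of "j - i"] by (cases "i = j") (auto simp: e_0 np_simps scaleC_one simp del: of_nat_Suc)
    qed simp
    finally have "(1 / of_nat (Suc j)) *\<^sub>C - np c (int (Suc j)) m = 0" using e0[of "Suc j"] by simp
    then show ?thesis unfolding n by (simp del: of_nat_Suc)
  qed
  have d0: "np d n m = 0" if "n \<ge> 1" for n
  proof -
    have "Um n (st m s) = 0" using U(1)[OF that] u by simp
    then have "st (np d n m) s = 0" using that by (simp add: Um_eq Cm_st Dm_st c0 tensor_simps)
    moreover have "Poly_Mapping.single s (1::complex) \<noteq> 0" by (rule single_nonzero)
    ultimately show ?thesis unfolding tensor_eq_0_iff by blast
  qed
  have "m \<in> complex_vector.span {vac M}" by (rule singular_vector[OF c0 d0])
  then obtain r where "m = r *\<^sub>C vac M" by (auto simp: complex_vector.span_singleton)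
  then have "u = r *\<^sub>C ex s" using u by (simp add: ex_def tensor_simps)
  then show ?thesis by blast
qed

end

section \<open>Products in a tensor product as explicit finite sums\<close>

context vsa_pair begin

text \<open>The index u counts down from hi - 1, the highest mode of \<open>a\<close> that can act
  nontrivially, until the mode of \<open>b\<close> reaches Nh. Numerical bounds turn the product
  into an explicit sum.\<close>

lemma VW_tensor_sum:
  assumes "b \<in> part W i" "c \<in> part V j"
    and hi: "\<And>r. r \<ge> hi \<Longrightarrow> nprod V a r c = 0" and Nh: "\<And>N. N \<ge> Nh \<Longrightarrow> nprod W b N d = 0"
    and R: "int R \<ge> Nh - (n - hi)"
  shows "nprod VW (a \<otimes> b) n (c \<otimes> d) = ksign i j *\<^sub>C
    (\<Sum>u<R. nprod V a (hi - 1 - int u) c \<otimes> nprod W b (n - hi + int u) d)"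
proof -
  let ?g = "\<lambda>r::int. nprod V a r c \<otimes> nprod W b (n - 1 - r) d"
  have "Sum_any ?g = (\<Sum>r\<in>(\<lambda>u. hi - 1 - int u) ` {..<R}. ?g r)"
  proof (rule Sum_any.expand_superset)
    show "{r. ?g r \<noteq> 0} \<subseteq> (\<lambda>u. hi - 1 - int u) ` {..<R}"
    proof
      fix r assume "r \<in> {r. ?g r \<noteq> 0}"
      then have "r < hi" "n - 1 - r < Nh" using hi[of r] Nh[of "n - 1 - r"] by (auto simp: tensor_simps not_le[symmetric])
      then show "r \<in> (\<lambda>u. hi - 1 - int u) ` {..<R}"
        using R by (intro image_eqI[of _ _ "nat (hi - 1 - r)"]) auto
    qed
  qed simp
  also have "\<dots> = (\<Sum>u<R. ?g (hi - 1 - int u))"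
    by (subst sum.reindex) (auto simp: inj_on_def)
  finally show ?thesis by (simp add: VW_tensor[OF assms(1,2)] algebra_simps)
qed

lemma VW_left: "nprod VW (a \<otimes> vac W) n (c \<otimes> d) = nprod V a n c \<otimes> d"
proof -
  have *: "nprod VW (a \<otimes> vac W) n (c \<otimes> d) = nprod V a n c \<otimes> d" if c: "c \<in> part V j" for c j
  proof -
    have "(\<lambda>r. nprod V a r c \<otimes> nprod W (vac W) (n - 1 - r) d) = (\<lambda>r. if r = n then nprod V a n c \<otimes> d else 0)"
      by (auto simp: fun_eq_iff W.vac_np tensor_simps)
    then show ?thesis unfolding VW_tensor[OF W.vac_even c] by (simp only: Sum_any.delta) (simp add: scaleC_one)
  qed
  have "c \<otimes> d = V.parity_part False c \<otimes> d + V.parity_part True c \<otimes> d"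
    using clinear_add[OF clinear_tensor_left, of "V.parity_part False c" "V.parity_part True c" d]
    unfolding V.parity_part_sum[symmetric] .
  then have "nprod VW (a \<otimes> vac W) n (c \<otimes> d) = (nprod V a n (V.parity_part False c) + nprod V a n (V.parity_part True c)) \<otimes> d"
    by (simp only: VW.np_simps *[OF V.parity_part_in] clinear_add[OF clinear_tensor_left])
  also have "nprod V a n (V.parity_part False c) + nprod V a n (V.parity_part True c) = nprod V a n c"
    using V.np_simps(1)[of a n "V.parity_part False c" "V.parity_part True c"] unfolding V.parity_part_sum[symmetric] by simp
  finally show ?thesis .
qed

lemma VW_right: "b \<in> part W i \<Longrightarrow> c \<in> part V j \<Longrightarrow>
    nprod VW (vac V \<otimes> b) n (c \<otimes> d) = ksign i j *\<^sub>C (c \<otimes> nprod W b n d)"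
proof -
  assume bc: "b \<in> part W i" "c \<in> part V j"
  have "(\<lambda>r. nprod V (vac V) r c \<otimes> nprod W b (n - 1 - r) d) = (\<lambda>r. if r = - 1 then c \<otimes> nprod W b n d else 0)"
    by (auto simp: fun_eq_iff V.vac_np tensor_simps)
  then show ?thesis unfolding VW_tensor[OF bc] by (simp only: Sum_any.delta)
qed

lemma split_left: "c \<otimes> d = V.parity_part False c \<otimes> d + V.parity_part True c \<otimes> d"
  using clinear_add[OF clinear_tensor_left, of "V.parity_part False c" "V.parity_part True c" d]
  unfolding V.parity_part_sum[symmetric] .

lemma VW_right_even: "b \<in> part W False \<Longrightarrow> nprod VW (vac V \<otimes> b) n (c \<otimes> d) = c \<otimes> nprod W b n d"
  unfolding split_left[of c]
  by (simp add: VW.np_simps VW_right[OF _ V.parity_part_in] scaleC_one)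

end

section \<open>Products of the half-lattice vectors occurring in y and f\<close>

context half_lattice begin

abbreviation "nn \<equiv> Nm (- 1) (ex (- 1))"

text \<open>Up to sign, \<open>QP\<close> is the part of \<open>f\<close> in the half-lattice factor.\<close>

definition QP where "QP = Nm (- 1) (Nm (- 1) (ex (- 2))) + (K + 1) *\<^sub>C Nm (- 2) (ex (- 2))"

lemma np_Nm1:
  assumes "\<And>r. r \<ge> R \<Longrightarrow> nprod P a (n + int r) b = 0 \<and> Nm (int r) b = 0"
  shows "nprod P (Nm (- 1) a) n b = (\<Sum>r<R. Nm (- 1 - int r) (nprod P a (n + int r) b) + nprod P a (n - 1 - int r) (Nm (int r) b))"
  unfolding Nm_def
  by (subst P.normal_product[OF all_even_P all_even_P, of R]) (use assms in \<open>auto simp: Nm_def scaleC_one\<close>)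

lemma np_Nm2:
  assumes "\<And>r. r \<ge> R \<Longrightarrow> nprod P a (n + int r) b = 0 \<and> Nm (int r - 1) b = 0" "R > 0"
  shows "nprod P (Nm (- 2) a) n b = (\<Sum>r<R. of_nat (Suc r) *\<^sub>C Nm (- int r - 2) (nprod P a (n + int r) b)
     - of_nat r *\<^sub>C nprod P a (n - 1 - int r) (Nm (int r - 1) b))"
proof -
  let ?dn = "nprod P (st \<nu> 0) (- 2) (vac P)"
  have d: "nprod P ?dn m v = (- of_int m) *\<^sub>C Nm (m - 1) v" for m v
    unfolding Nm_def by (rule P.derivative_np)
  have "Nm (- 2) a = nprod P ?dn (- 1) a" using d[of "- 1" a] by (simp add: scaleC_one)
  moreover have "nprod P (nprod P ?dn (- 1) a) n b =
    (\<Sum>r<R. nprod P ?dn (- 1 - int r) (nprod P a (n + int r) b) + ksign False False *\<^sub>C nprod P a (n - 1 - int r) (nprod P ?dn (int r) b))"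
    by (rule P.normal_product[OF all_even_P all_even_P]) (use assms in \<open>auto simp: d\<close>)
  ultimately show ?thesis
    by (simp add: d scaleC_one P.np_simps algebra_simps)
qed

text \<open>Oriented as rewrite rules: nonnegative modes of \<nu> move to the right, where they meet
  the exponentials, and creation modes of c move to the left of those of \<nu>.\<close>

lemma Nm_push: "j \<ge> 0 \<Longrightarrow> m < 0 \<Longrightarrow> Nm j (Nm m v) = Nm m (Nm j v) - (if j + m = 0 then (K / 2 * of_int j) *\<^sub>C v else 0)"
  "j \<ge> 0 \<Longrightarrow> m < 0 \<Longrightarrow> Nm j (Cm m v) = Cm m (Nm j v) + (if j + m = 0 then of_int j *\<^sub>C v else 0)"
  "m < 0 \<Longrightarrow> Nm (- 2) (Nm (- 1) v) = Nm (- 1) (Nm (- 2) v)"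
  "Nm (- 1) (Cm (- 1) v) = Cm (- 1) (Nm (- 1) v)" "Nm (- 1) (Cm (- 2) v) = Cm (- 2) (Nm (- 1) v)"
  "Nm (- 2) (Cm (- 1) v) = Cm (- 1) (Nm (- 2) v)"
  using comm_N[of j m v] comm_NC[of j m v] comm_N[of "- 2" "- 1" v] comm_NC[of "- 1" "- 1" v] comm_NC[of "- 1" "- 2" v] comm_NC[of "- 2" "- 1" v]
  by simp_all

lemma nprod_ex: "nprod P (ex r) n v = Xm r n v"
  by (simp add: Xm_def)

lemmas P_eval = nprod_ex comm_XN comm_CX mode_simps modes_ex Xm_ex Nm_push scaleC_scaleC

lemma Xm_nn: "N \<ge> 1 \<Longrightarrow> Xm r N nn = 0" "Xm r 0 nn = (- of_int r / 2) *\<^sub>C ex (r - 1)"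
  "Xm r (- 1) nn = Nm (- 1) (ex (r - 1)) - (of_int r ^ 2 / 4) *\<^sub>C Cm (- 1) (ex (r - 1))"
  "Xm r (- 2) nn = (of_int r / 2) *\<^sub>C Cm (- 1) (Nm (- 1) (ex (r - 1)))
     - (of_int r / 2) *\<^sub>C ((of_int r ^ 2 / 8) *\<^sub>C Cm (- 1) (Cm (- 1) (ex (r - 1))) + (of_int r / 4) *\<^sub>C Cm (- 2) (ex (r - 1)))"
  by (simp_all add: P_eval power2_eq_square)

lemma Nm_nn: "j \<ge> 2 \<Longrightarrow> Nm j nn = 0" "Nm 1 nn = (- K / 2) *\<^sub>C ex (- 1)" "Nm 0 nn = (- 1 / 2) *\<^sub>C nn"
  by (simp_all add: P_eval)

lemma nn_ex: "N \<ge> 1 \<Longrightarrow> nprod P nn N (ex s) = 0"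
  "nprod P nn 0 (ex (- 1)) = (- 1 / 2) *\<^sub>C ex (- 2)"
  "nprod P nn (- 1) (ex (- 1)) = Nm (- 1) (ex (- 2)) + (1 / 4) *\<^sub>C Cm (- 1) (ex (- 2))"
  "nprod P nn (- 2) (ex (- 1)) = - (1 / 2) *\<^sub>C Cm (- 1) (Nm (- 1) (ex (- 2))) + Nm (- 2) (ex (- 2))
     - (1 / 2) *\<^sub>C ((1 / 8) *\<^sub>C Cm (- 1) (Cm (- 1) (ex (- 2))) - (1 / 4) *\<^sub>C Cm (- 2) (ex (- 2)))"
  by (subst np_Nm1[of 2]; simp add: P_eval numeral_2_eq_2)+

lemma nn_nn_1: "nprod P nn 1 nn = (- K / 2 - 1 / 4) *\<^sub>C ex (- 2)"
  by (subst np_Nm1[of 2]; (rule vector_eqI)?; simp (no_asm_simp) add: P_eval Xm_nn Nm_nn numeral_2_eq_2 algebra_simps)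

lemma nn_nn_pos: "N \<ge> 2 \<Longrightarrow> nprod P nn N nn = 0"
  by (subst np_Nm1[of 2]; simp add: P_eval Xm_nn Nm_nn numeral_2_eq_2)

lemma nn_nn_neg: "nprod P nn (- 1) nn =
   Nm (- 1) (Xm (- 1) (- 1) nn) + Nm (- 2) (Xm (- 1) 0 nn) - (1 / 2) *\<^sub>C Xm (- 1) (- 2) nn - (K / 2) *\<^sub>C Xm (- 1) (- 3) (ex (- 1))"
  by (subst np_Nm1[of 2]; (rule vector_eqI)?; simp (no_asm_simp) add: nprod_ex Xm_nn(1) Nm_nn mode_simps numeral_2_eq_2)

abbreviation "n2 \<equiv> Nm (- 1) (ex (- 2))"

lemma n2_ex: "N \<ge> 1 \<Longrightarrow> nprod P n2 N (ex s) = 0"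
  "nprod P n2 0 (ex s) = (of_int s / 2) *\<^sub>C ex (s - 2)"
  "nprod P n2 (- 1) (ex s) = Nm (- 1) (ex (s - 2)) - (of_int s / 2) *\<^sub>C Cm (- 1) (ex (s - 2))"
  by (subst np_Nm1[of 2]; simp add: P_eval numeral_2_eq_2)+

lemma n2_nn: "N \<ge> 2 \<Longrightarrow> nprod P n2 N nn = 0"
  "nprod P n2 1 nn = (- K / 2 - 1 / 2) *\<^sub>C ex (- 3)"
  "nprod P n2 0 nn = (1 / 2) *\<^sub>C Nm (- 1) (ex (- 3)) + (K / 2 + 1 / 2) *\<^sub>C Cm (- 1) (ex (- 3))"
  by (subst np_Nm1[of 2]; (rule vector_eqI)?; simp (no_asm_simp) add: P_eval Xm_nn Nm_nn numeral_2_eq_2 algebra_simps)+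

lemma nprod_QP: "nprod P QP N b = nprod P (Nm (- 1) n2) N b + (K + 1) *\<^sub>C nprod P (Nm (- 2) (ex (- 2))) N b"
  by (simp add: QP_def P.np_simps)

text \<open>The coefficient is s^2/4 from the square of \<nu>(0) plus -(K + 1) s/2 from the
  derivative term. Its two roots become the only h(0)-eigenvalues that a singular vector of the
  target can have.\<close>

lemma QP_ex: "N \<ge> 2 \<Longrightarrow> nprod P QP N (ex s) = 0"
  "nprod P QP 1 (ex s) = (of_int s * (of_int s - 2 * K - 2) / 4) *\<^sub>C ex (s - 2)"
proof -
  assume N: "N \<ge> 2"
  show "nprod P QP N (ex s) = 0"
    unfolding nprod_QP using N
    by (subst np_Nm1[of 1]; (subst np_Nm2[of 2])?; simp add: P_eval n2_ex numeral_2_eq_2 P.np_simps)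
next
  show "nprod P QP 1 (ex s) = (of_int s * (of_int s - 2 * K - 2) / 4) *\<^sub>C ex (s - 2)"
    unfolding nprod_QP
    by (subst np_Nm1[of 1]; (subst np_Nm2[of 2])?; (rule vector_eqI)?; simp (no_asm_simp) add: P_eval n2_ex numeral_2_eq_2 P.np_simps;
      simp (no_asm) add: field_simps)
qed

lemma QP_nn: "N \<ge> 3 \<Longrightarrow> nprod P QP N nn = 0"
  "nprod P QP 2 nn = (K / 2 + 1 / 4 + (K + 1) * (K + 1 / 2)) *\<^sub>C ex (- 3)"
  "nprod P QP 1 nn = (- K / 2 - 1 / 4) *\<^sub>C Nm (- 1) (ex (- 3)) - ((K + 1 / 2) * (K + 3 / 2)) *\<^sub>C Cm (- 1) (ex (- 3))"
proof -
  assume N: "N \<ge> 3"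
  show "nprod P QP N nn = 0"
    unfolding nprod_QP using N
    by (subst np_Nm1[of 2]; (subst np_Nm2[of 3])?; simp add: nprod_ex mode_simps modes_ex Xm_ex n2_ex n2_nn Nm_nn Xm_nn eval_nat_numeral P.np_simps)
next
  show "nprod P QP 2 nn = (K / 2 + 1 / 4 + (K + 1) * (K + 1 / 2)) *\<^sub>C ex (- 3)"
    unfolding nprod_QP
    by (subst np_Nm1[of 2]; (subst np_Nm2[of 3])?; (rule vector_eqI)?; simp (no_asm_simp) add: P_eval n2_ex n2_nn Nm_nn Xm_nn eval_nat_numeral P.np_simps;
      simp (no_asm) add: field_simps)
next
  show "nprod P QP 1 nn = (- K / 2 - 1 / 4) *\<^sub>C Nm (- 1) (ex (- 3)) - ((K + 1 / 2) * (K + 3 / 2)) *\<^sub>C Cm (- 1) (ex (- 3))"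
    unfolding nprod_QP
    by (subst np_Nm1[of 2]; (subst np_Nm2[of 3])?; (rule vector_eqI)?; simp (no_asm_simp) add: P_eval n2_ex n2_nn Nm_nn Xm_nn eval_nat_numeral P.np_simps;
      simp (no_asm) add: field_simps)
qed

end

section \<open>Products of the generators of the Neveu-Schwarz algebra and of the fermion\<close>

context neveu_schwarz begin

lemma G_prod: "n \<ge> 0 \<Longrightarrow> np G n G = (if n = 0 then 2 *\<^sub>C \<omega> else if n = 2 then (2 * cc / 3) *\<^sub>C vac L else 0)"
  using comm_GG[of n "- 1" "vac L"]
  by (cases "n = 0"; cases "n = 2") (simp_all add: np_vac np_simps power2_eq_square)

lemma \<omega>_prod: "n \<ge> 1 \<Longrightarrow> np \<omega> n G = (if n = 1 then (3 / 2) *\<^sub>C G else 0)"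
  using comm_\<omega>G[of n "- 1" "vac L"]
  by (cases "n = 1") (simp_all add: np_vac np_simps)

end

context fermion begin

definition d\<Psi> where "d\<Psi> = np \<Psi> (- 2) (vac F)"
definition \<omega>F where "\<omega>F = (1 / 2) *\<^sub>C np \<Psi> (- 2) \<Psi>"

lemma \<Psi>_prod: "n \<ge> 0 \<Longrightarrow> np \<Psi> n \<Psi> = (if n = 0 then vac F else 0)"
  "n \<ge> 0 \<Longrightarrow> np \<Psi> n d\<Psi> = (if n = 1 then vac F else 0)"
  using comm[of n "- 1" "vac F"] comm[of n "- 2" "vac F"] by (simp_all add: np_vac np_simps d\<Psi>_def)

lemma \<Psi>_prod_neg: "np \<Psi> (- 1) \<Psi> = 0" "np \<Psi> (- 2) \<Psi> = 2 *\<^sub>C \<omega>F" "np \<Psi> (- 1) d\<Psi> = - (2 *\<^sub>C \<omega>F)"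
proof -
  have "2 *\<^sub>C np \<Psi> (- 1) \<Psi> = 0" using comm[of "- 1" "- 1" "vac F"] scaleC_add_left[of 1 1 "np \<Psi> (- 1) \<Psi>"]
    by (simp add: np_vac scaleC_one eq_neg_iff_add_eq_0)
  then show "np \<Psi> (- 1) \<Psi> = 0" by simp
  show "np \<Psi> (- 2) \<Psi> = 2 *\<^sub>C \<omega>F" by (simp add: \<omega>F_def scaleC_scaleC scaleC_one)
  show "np \<Psi> (- 1) d\<Psi> = - (2 *\<^sub>C \<omega>F)"
    using comm[of "- 1" "- 2" "vac F"] by (simp add: np_vac d\<Psi>_def \<omega>F_def scaleC_scaleC scaleC_one)
qed

lemma F_parts: "d\<Psi> \<in> part F True" "\<omega>F \<in> part F False"
  using np_part[OF \<Psi>_odd vac_even] np_part[OF \<Psi>_odd \<Psi>_odd]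
  by (simp_all add: d\<Psi>_def \<omega>F_def complex_vector.subspace_scale[OF part_subspace])

lemma \<omega>F_np:
  assumes "\<And>r. r \<ge> R \<Longrightarrow> np \<Psi> (l + int r) u = 0 \<and> np \<Psi> (int r) u = 0"
  shows "np \<omega>F l u = (1 / 2) *\<^sub>C (\<Sum>r<R. of_nat (Suc r) *\<^sub>C (np \<Psi> (- 2 - int r) (np \<Psi> (l + int r) u)
     + np \<Psi> (l - 2 - int r) (np \<Psi> (int r) u)))"
proof -
  have "np (np \<Psi> (- 2) \<Psi>) l u = (\<Sum>r<R. ((- 1) ^ r * (of_int (- 2) gchoose r)) *\<^sub>C
      (np \<Psi> (- 2 - int r) (np \<Psi> (l + int r) u)
        - ((- 1) powi (- 2) * ksign True True) *\<^sub>C np \<Psi> (- 2 + l - int r) (np \<Psi> (int r) u)))"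
    by (rule associativity[OF \<Psi>_odd \<Psi>_odd]) (use assms in auto)
  also have "\<dots> = (\<Sum>r<R. of_nat (Suc r) *\<^sub>C (np \<Psi> (- 2 - int r) (np \<Psi> (l + int r) u)
     + np \<Psi> (l - 2 - int r) (np \<Psi> (int r) u)))"
    by (rule sum.cong) (simp_all add: gchoose_minus_two power_mult_distrib[symmetric] scaleC_one
        add.commute[of "- 2" l] mult.assoc[symmetric])
  finally show ?thesis by (simp add: \<omega>F_def np_simps)
qed

lemma \<omega>F_prod: "n \<ge> 2 \<Longrightarrow> np \<omega>F n \<Psi> = 0" "np \<omega>F 1 \<Psi> = (1 / 2) *\<^sub>C \<Psi>"
  "n \<ge> 3 \<Longrightarrow> np \<omega>F n d\<Psi> = 0" "np \<omega>F 2 d\<Psi> = \<Psi>" "np \<omega>F 1 d\<Psi> = (3 / 2) *\<^sub>C d\<Psi>"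
proof -
  have d: "np \<Psi> (- 2) (vac F) = d\<Psi>" by (simp add: d\<Psi>_def)
  show "np \<omega>F 1 \<Psi> = (1 / 2) *\<^sub>C \<Psi>" "np \<omega>F 2 d\<Psi> = \<Psi>"
    by (subst \<omega>F_np[of 2]; simp add: \<Psi>_prod np_simps np_vac numeral_2_eq_2 scaleC_one scaleC_scaleC)+
  show "np \<omega>F 1 d\<Psi> = (3 / 2) *\<^sub>C d\<Psi>"
    by (subst \<omega>F_np[of 2]; (rule vector_eqI)?; simp (no_asm_simp) add: \<Psi>_prod np_simps np_vac numeral_2_eq_2 scaleC_one d)
  show "n \<ge> 2 \<Longrightarrow> np \<omega>F n \<Psi> = 0" "n \<ge> 3 \<Longrightarrow> np \<omega>F n d\<Psi> = 0"
    by (subst \<omega>F_np[of 2]; simp add: \<Psi>_prod np_simps np_vac numeral_2_eq_2 scaleC_one)+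
qed

end

section \<open>The generators in the tensor product\<close>

text \<open>In the application \<open>t = 2k+3 = p/q\<close>, \<open>\<kappa> = \<surd>(-2k-3)\<close> and \<open>\<rho> = \<surd>2\<close>.\<close>

locale realization =
  N: neveu_schwarz cc L \<omega> G + F: fermion F \<Psi> + H: half_lattice M c d P K
  for cc :: complex and L :: "'l::complex_vector vsa" and \<omega> G
    and F :: "'f::complex_vector vsa" and \<Psi>
    and M :: "'m::complex_vector vsa" and c d and P K +
  fixes t \<kappa> \<rho> :: complex
  assumes \<kappa>: "\<kappa> * \<kappa> = - t" and cct: "cc * t = 3 * t / 2 - 3 * (t - 1)\<^sup>2" and K: "K = (t - 3) / 2"
    and t0: "t \<noteq> 0" "t \<noteq> - 1" and \<rho>: "\<rho> * \<rho> = 2"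

sublocale realization \<subseteq> S: vsa_pair L F ..

sublocale realization \<subseteq> SV: vsa "tensor_vsa L F"
  by unfold_locales (rule S.vertex_superalgebra_tensor)

sublocale realization \<subseteq> W: vsa_pair "tensor_vsa L F" P ..

sublocale realization \<subseteq> WV: vsa "tensor_vsa (tensor_vsa L F) P"
  by unfold_locales (rule W.vertex_superalgebra_tensor)

section \<open>Products in the tensor product of the Neveu-Schwarz algebra and the fermion\<close>

context realization begin

abbreviation "vS \<equiv> vac (tensor_vsa L F)"
definition "Gs = G \<otimes> vac F"
definition "Ps = vac L \<otimes> \<Psi>"
definition "dPs = vac L \<otimes> F.d\<Psi>"
definition "ws = \<omega> \<otimes> vac F"
definition "wF = vac L \<otimes> F.\<omega>F"
definition "GP = G \<otimes> \<Psi>"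

abbreviation "sp \<equiv> nprod (tensor_vsa L F)"

lemma S_parts: "Gs \<in> part (tensor_vsa L F) True" "Ps \<in> part (tensor_vsa L F) True"
  "dPs \<in> part (tensor_vsa L F) True" "ws \<in> part (tensor_vsa L F) False"
  "wF \<in> part (tensor_vsa L F) False" "GP \<in> part (tensor_vsa L F) False"
  unfolding Gs_def Ps_def dPs_def ws_def wF_def GP_def
  using S.tensor_part[OF N.parts(2) F.vac_even] S.tensor_part[OF N.vac_even F.\<Psi>_odd]
    S.tensor_part[OF N.vac_even F.F_parts(1)] S.tensor_part[OF N.parts(1) F.vac_even]
    S.tensor_part[OF N.vac_even F.F_parts(2)] S.tensor_part[OF N.parts(2) F.\<Psi>_odd] by simp_all

lemma vS: "vS = vac L \<otimes> vac F"
  by (rule S.VW_vac)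

lemma Gs_prod: "n \<ge> 0 \<Longrightarrow> sp Gs n Gs = (if n = 0 then 2 *\<^sub>C ws else if n = 2 then (2 * cc / 3) *\<^sub>C vS else 0)"
  "n \<ge> 0 \<Longrightarrow> sp Gs n Ps = 0" "sp Gs (- 1) Ps = GP" "n \<ge> 0 \<Longrightarrow> sp Gs n dPs = 0"
  unfolding Gs_def Ps_def dPs_def GP_def ws_def vS S.VW_left
  by (simp_all add: N.G_prod N.np_vac tensor_simps)

lemma Ps_prod: "n \<ge> 0 \<Longrightarrow> sp Ps n Ps = (if n = 0 then vS else 0)"
  "n \<ge> 0 \<Longrightarrow> sp Ps n dPs = (if n = 1 then vS else 0)"
  "n \<ge> 0 \<Longrightarrow> sp Ps n Gs = 0" "sp Ps (- 1) Gs = - GP"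
  "sp Ps (- 1) Ps = 0" "sp Ps (- 2) Ps = 2 *\<^sub>C wF" "sp Ps (- 1) dPs = - (2 *\<^sub>C wF)"
  unfolding Gs_def Ps_def dPs_def GP_def wF_def vS S.VW_right[OF F.\<Psi>_odd N.vac_even] S.VW_right[OF F.\<Psi>_odd N.parts(2)]
  by (simp_all add: F.\<Psi>_prod F.\<Psi>_prod_neg F.np_vac tensor_simps scaleC_one)

lemma dPs_np: "sp dPs n v = (- of_int n) *\<^sub>C sp Ps (n - 1) v"
proof -
  have "dPs = sp Ps (- 2) vS"
    unfolding dPs_def Ps_def vS S.VW_right[OF F.\<Psi>_odd N.vac_even] by (simp add: F.d\<Psi>_def scaleC_one)
  then show ?thesis using SV.derivative_np by simp
qed

lemma ws_prod: "n \<ge> 1 \<Longrightarrow> sp ws n Gs = (if n = 1 then (3 / 2) *\<^sub>C Gs else 0)"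
  "n \<ge> 0 \<Longrightarrow> sp ws n Ps = 0" "n \<ge> 0 \<Longrightarrow> sp ws n dPs = 0"
  unfolding Gs_def Ps_def dPs_def ws_def S.VW_left
  by (simp_all add: N.\<omega>_prod N.np_vac tensor_simps)

lemma wF_prod: "n \<ge> 0 \<Longrightarrow> sp wF n Gs = 0"
  "n \<ge> 1 \<Longrightarrow> sp wF n Ps = (if n = 1 then (1 / 2) *\<^sub>C Ps else 0)"
  "n \<ge> 1 \<Longrightarrow> sp wF n dPs = (if n = 1 then (3 / 2) *\<^sub>C dPs else if n = 2 then Ps else 0)"
  unfolding Gs_def Ps_def dPs_def wF_def S.VW_right[OF F.F_parts(2) N.vac_even] S.VW_right[OF F.F_parts(2) N.parts(2)]
  by (auto simp: F.\<omega>F_prod F.np_vac tensor_simps scaleC_one not_less)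

text \<open>In the product with \<open>Gs\<close> the minus sign arises when \<open>\<Psi>\<close>
  passes the odd vector \<open>G\<close>.\<close>

lemma GP_prod: "n \<ge> 1 \<Longrightarrow> sp GP n Gs = (if n = 1 then - ((2 * cc / 3) *\<^sub>C dPs) else if n = 2 then - ((2 * cc / 3) *\<^sub>C Ps) else 0)"
  "n \<ge> 1 \<Longrightarrow> sp GP n Ps = 0"
  "n \<ge> 1 \<Longrightarrow> sp GP n dPs = (if n = 1 then Gs else 0)"
proof -
  assume n: "n \<ge> 1"
  have 1: "sp GP n Gs = ksign True True *\<^sub>C (\<Sum>u<2. nprod L G (3 - 1 - int u) G \<otimes> nprod F \<Psi> (n - 3 + int u) (vac F))"
    unfolding GP_def Gs_def
    by (rule S.VW_tensor_sum[OF F.\<Psi>_odd N.parts(2), where Nh = 0]) (use n in \<open>auto simp: N.G_prod F.np_vac\<close>)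
  show "sp GP n Gs = (if n = 1 then - ((2 * cc / 3) *\<^sub>C dPs) else if n = 2 then - ((2 * cc / 3) *\<^sub>C Ps) else 0)"
    unfolding 1 using n
    by (cases "n = 1"; cases "n = 2")
      (simp_all add: numeral_2_eq_2 N.G_prod F.np_vac tensor_simps dPs_def Ps_def F.d\<Psi>_def scaleC_one del: One_nat_def)
  have 2: "sp GP n Ps = ksign True False *\<^sub>C (\<Sum>u<0. nprod L G (0 - 1 - int u) (vac L) \<otimes> nprod F \<Psi> (n - 0 + int u) \<Psi>)"
    unfolding GP_def Ps_def
    by (rule S.VW_tensor_sum[OF F.\<Psi>_odd N.vac_even, where Nh = 1]) (use n in \<open>auto simp: N.np_vac F.\<Psi>_prod\<close>)
  then show "sp GP n Ps = 0" by simp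
  have 3: "sp GP n dPs = ksign True False *\<^sub>C (\<Sum>u<1. nprod L G (0 - 1 - int u) (vac L) \<otimes> nprod F \<Psi> (n - 0 + int u) F.d\<Psi>)"
    unfolding GP_def dPs_def
    by (rule S.VW_tensor_sum[OF F.\<Psi>_odd N.vac_even, where Nh = 2]) (use n in \<open>auto simp: N.np_vac F.\<Psi>_prod\<close>)
  then show "sp GP n dPs = (if n = 1 then Gs else 0)"
    using n by (simp add: N.np_vac F.\<Psi>_prod Gs_def scaleC_one tensor_simps)
qed

end

context half_lattice begin

lemma st_modes: "st \<mu> 0 = Um (- 1) (ex 0)" "st \<nu> 0 = Nm (- 1) (ex 0)"
  unfolding Um_def Nm_def vacP[symmetric] P.np_vac by simp_all

lemma Um_Nm: "Um n v = Nm n v + (K / 2) *\<^sub>C Cm n v"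
  unfolding Um_eq Nm_eq by (rule vector_eqI) (simp (no_asm_simp) add: algebra_simps)

lemma comm_U: "Um m (Um n v) = Um n (Um m v) + (if m + n = 0 then (K / 2 * of_int m) *\<^sub>C v else 0)"
proof (cases "m + n = 0")
  case True
  then have n: "n = - m" by simp
  show ?thesis
    unfolding n Um_eq mode_simps comm_CD[of m "- m"] comm_DC[of m "- m"] comm_D[of m "- m"] comm_C[of m "- m"]
    by (rule vector_eqI) (simp (no_asm_simp) add: algebra_simps)
next
  case False
  then show ?thesis
    unfolding Um_eq mode_simps comm_CD[of m n] comm_DC[of m n] comm_D[of m n] comm_C[of m n]
    by (simp add: algebra_simps)
qed

end

section \<open>The osp(1,2) generators in the full tensor product and their relations\<close>

context realization begin

abbreviation "WW \<equiv> tensor_vsa (tensor_vsa L F) P"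
abbreviation "wp \<equiv> nprod WW"

lemma wF_0: "sp wF 0 Ps = dPs" and GP_0: "sp GP 0 Ps = Gs"
proof -
  have "nprod F F.\<omega>F 0 \<Psi> = F.d\<Psi>"
    by (subst F.\<omega>F_np[of 2]; (rule vector_eqI)?; simp (no_asm_simp) add: F.\<Psi>_prod F.np_simps F.np_vac numeral_2_eq_2 F.\<Psi>_prod_neg F.d\<Psi>_def scaleC_one)
  then show "sp wF 0 Ps = dPs"
    unfolding wF_def Ps_def dPs_def S.VW_right[OF F.F_parts(2) N.vac_even] by (simp add: scaleC_one)
  have "sp GP 0 Ps = ksign True False *\<^sub>C (\<Sum>u<1. nprod L G (0 - 1 - int u) (vac L) \<otimes> nprod F \<Psi> (0 - 0 + int u) \<Psi>)"
    unfolding GP_def Ps_def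
    by (rule S.VW_tensor_sum[OF F.\<Psi>_odd N.vac_even, where Nh = 1]) (auto simp: N.np_vac F.\<Psi>_prod)
  then show "sp GP 0 Ps = Gs" by (simp add: N.np_vac F.\<Psi>_prod Gs_def scaleC_one tensor_simps)
qed

lemma W_tensor:
  assumes "c' \<in> part (tensor_vsa L F) j" "\<And>r. r \<ge> hi \<Longrightarrow> sp a r c' = 0" "\<And>N. N \<ge> Nh \<Longrightarrow> nprod P b N d' = 0"
    "int R \<ge> Nh - (n - hi)"
  shows "wp (a \<otimes> b) n (c' \<otimes> d') = (\<Sum>u<R. sp a (hi - 1 - int u) c' \<otimes> nprod P b (n - hi + int u) d')"
  using W.VW_tensor_sum[OF H.all_even_P assms] by (simp add: scaleC_one)

lemma W_right: "wp (vS \<otimes> b) n (c' \<otimes> d') = c' \<otimes> nprod P b n d'"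
  by (rule W.VW_right_even[OF H.all_even_P])

abbreviation "Cm \<equiv> H.Cm"
abbreviation "Nm \<equiv> H.Nm"
abbreviation "Um \<equiv> H.Um"
abbreviation "ex \<equiv> H.ex"
abbreviation "nn \<equiv> H.nn"

text \<open>The factor \<rho> is split off from x and y, because products of these vectors only see
  \<rho>^2 = 2. \<open>Ol\<close> is k + 2 times the conformal vector with index ((p+q)/2, q),
  simplified by k + 2 = (t + 1)/2 and i sqrt(pq) = \<kappa> q.\<close>

definition "x1 = Ps \<otimes> ex 1"
definition "y1 = (- (\<kappa> / 2)) *\<^sub>C (Gs \<otimes> ex (- 1)) + Ps \<otimes> nn + ((t - 2) / 2) *\<^sub>C (dPs \<otimes> ex (- 1))"
definition "Ol = (t / 2) *\<^sub>C ws + (\<kappa> / 2) *\<^sub>C GP + ((2 - t) / 2) *\<^sub>C wF"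
definition "xW = \<rho> *\<^sub>C x1"
definition "yW = \<rho> *\<^sub>C y1"
definition "eW = vS \<otimes> ex 2"
definition "hW = 2 *\<^sub>C (vS \<otimes> H.st H.\<mu> 0)"
definition "fW = Ol \<otimes> ex (- 2) - vS \<otimes> H.QP"

lemma gen_parts: "eW \<in> part WW False" "fW \<in> part WW False" "hW \<in> part WW False"
  "xW \<in> part WW True" "yW \<in> part WW True"
proof -
  note s = complex_vector.subspace_scale[OF WV.part_subspace] complex_vector.subspace_add[OF WV.part_subspace]
    complex_vector.subspace_diff[OF WV.part_subspace]
  have p: "a \<in> part (tensor_vsa L F) i \<Longrightarrow> a \<otimes> b \<in> part WW i" for a b i
    using W.tensor_part[OF _ H.all_even_P, of a i b] by simp
  note q = p[OF SV.vac_even] p[OF S_parts(1)] p[OF S_parts(2)] p[OF S_parts(3)]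
  have "Ol \<in> part (tensor_vsa L F) False" unfolding Ol_def
    by (intro complex_vector.subspace_scale[OF SV.part_subspace] complex_vector.subspace_add[OF SV.part_subspace] S_parts)
  then show "eW \<in> part WW False" "fW \<in> part WW False"
    unfolding eW_def fW_def by (intro s q p; assumption?)+
  show "hW \<in> part WW False" unfolding hW_def by (rule s(1)[OF p[OF SV.vac_even]])
  show "xW \<in> part WW True" unfolding xW_def x1_def by (rule s(1)[OF p[OF S_parts(2)]])
  show "yW \<in> part WW True" unfolding yW_def y1_def by (rule s(1)[OF s(2)[OF s(2)[OF s(1)[OF q(2)] q(3)] s(1)[OF q(4)]]])
qed

lemma \<rho>\<rho>: "wp (\<rho> *\<^sub>C u) n (\<rho> *\<^sub>C v) = 2 *\<^sub>C wp u n v"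
  by (simp add: WV.np_simps scaleC_scaleC \<rho>)

lemmas P_norm = H.nprod_ex H.mode_simps H.modes_ex H.Xm_ex H.Nm_push scaleC_scaleC scaleC_one
  H.Xm_nn H.Nm_nn H.nn_ex H.nn_nn_1 H.nn_nn_pos H.nn_nn_neg H.comm_CX H.comm_XN

lemma x_x: "n \<ge> 0 \<Longrightarrow> wp xW n xW = (if n = 0 then 2 *\<^sub>C eW else 0)"
proof -
  assume n: "n \<ge> 0"
  have "wp x1 n x1 = (\<Sum>u<nat (1 - n). sp Ps (1 - 1 - int u) Ps \<otimes> nprod P (ex 1) (n - 1 + int u) (ex 1))"
    unfolding x1_def by (rule W_tensor[OF S_parts(2), where Nh = 0]) (auto simp: P_norm Ps_prod)
  then show ?thesis using n
    by (cases "n = 0") (simp_all add: xW_def \<rho>\<rho> Ps_prod P_norm eW_def)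
qed

lemma x_A: "wp x1 n (Gs \<otimes> ex (- 1)) = (\<Sum>u<nat (- n). sp Ps (0 - 1 - int u) Gs \<otimes> nprod P (ex 1) (n - 0 + int u) (ex (- 1)))"
  and x_B: "wp x1 n (Ps \<otimes> nn) = (\<Sum>u<nat (2 - n). sp Ps (1 - 1 - int u) Ps \<otimes> nprod P (ex 1) (n - 1 + int u) nn)"
  and x_D: "wp x1 n (dPs \<otimes> ex (- 1)) = (\<Sum>u<nat (2 - n). sp Ps (2 - 1 - int u) dPs \<otimes> nprod P (ex 1) (n - 2 + int u) (ex (- 1)))"
  unfolding x1_def
  by (rule W_tensor[OF S_parts(1), where Nh = 0] W_tensor[OF S_parts(2), where Nh = 1] W_tensor[OF S_parts(3), where Nh = 0];
    auto simp: P_norm Ps_prod)+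

lemma t_K: "t = 2 * K + 3" using K by (simp add: field_simps)

lemma x_y: "n \<ge> 0 \<Longrightarrow> wp xW n yW = (if n = 0 then hW else if n = 1 then (2 * K) *\<^sub>C vac WW else 0)"
proof -
  assume n: "n \<ge> 0"
  have "n = 0 \<or> n = 1 \<or> n \<ge> 2" using n by linarith
  then have "wp x1 n y1 = (if n = 0 then vS \<otimes> H.st H.\<mu> 0 else if n = 1 then K *\<^sub>C vac WW else 0)"
  proof (elim disjE)
    assume n: "n = 0"
    show ?thesis unfolding n y1_def
      by (rule vector_eqI) (simp (no_asm_simp) add: WV.np_simps x_A x_B x_D numeral_2_eq_2 Ps_prod P_norm
        H.st_modes H.Um_Nm t_K tensor_simps; simp (no_asm) add: field_simps)
  next
    assume n: "n = 1"
    show ?thesis unfolding n y1_def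
      by (rule vector_eqI) (simp (no_asm_simp) add: WV.np_simps x_A x_B x_D numeral_2_eq_2 Ps_prod P_norm
        W.VW_vac H.vacP t_K tensor_simps; simp (no_asm) add: field_simps)
  qed (simp add: y1_def WV.np_simps x_A x_B x_D)
  then show ?thesis by (simp add: xW_def yW_def \<rho>\<rho> hW_def scaleC_scaleC)
qed

text \<open>The three summands of \<open>y1\<close> give nine products, each a finite sum whose
  bounds come from the product tables of the factors.\<close>

lemma AA: "wp (Gs \<otimes> ex (- 1)) n (Gs \<otimes> ex (- 1)) = (\<Sum>u<nat (3 - n). sp Gs (3 - 1 - int u) Gs \<otimes> nprod P (ex (- 1)) (n - 3 + int u) (ex (- 1)))"
  and AB: "wp (Gs \<otimes> ex (- 1)) n (Ps \<otimes> nn) = (\<Sum>u<nat (1 - n). sp Gs (0 - 1 - int u) Ps \<otimes> nprod P (ex (- 1)) (n - 0 + int u) nn)"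
  and AD: "wp (Gs \<otimes> ex (- 1)) n (dPs \<otimes> ex (- 1)) = (\<Sum>u<nat (- n). sp Gs (0 - 1 - int u) dPs \<otimes> nprod P (ex (- 1)) (n - 0 + int u) (ex (- 1)))"
  and BA: "wp (Ps \<otimes> nn) n (Gs \<otimes> ex (- 1)) = (\<Sum>u<nat (1 - n). sp Ps (0 - 1 - int u) Gs \<otimes> nprod P nn (n - 0 + int u) (ex (- 1)))"
  and BB: "wp (Ps \<otimes> nn) n (Ps \<otimes> nn) = (\<Sum>u<nat (3 - n). sp Ps (1 - 1 - int u) Ps \<otimes> nprod P nn (n - 1 + int u) nn)"
  and BD: "wp (Ps \<otimes> nn) n (dPs \<otimes> ex (- 1)) = (\<Sum>u<nat (3 - n). sp Ps (2 - 1 - int u) dPs \<otimes> nprod P nn (n - 2 + int u) (ex (- 1)))"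
  and DA: "wp (dPs \<otimes> ex (- 1)) n (Gs \<otimes> ex (- 1)) = (\<Sum>u<nat (- n). sp dPs (0 - 1 - int u) Gs \<otimes> nprod P (ex (- 1)) (n - 0 + int u) (ex (- 1)))"
  and DB: "wp (dPs \<otimes> ex (- 1)) n (Ps \<otimes> nn) = (\<Sum>u<nat (3 - n). sp dPs (2 - 1 - int u) Ps \<otimes> nprod P (ex (- 1)) (n - 2 + int u) nn)"
  and DD: "wp (dPs \<otimes> ex (- 1)) n (dPs \<otimes> ex (- 1)) = (\<Sum>u<nat (3 - n). sp dPs (3 - 1 - int u) dPs \<otimes> nprod P (ex (- 1)) (n - 3 + int u) (ex (- 1)))"
proof -
  have d: "r \<ge> 0 \<Longrightarrow> sp dPs r Gs = 0" "r \<ge> 2 \<Longrightarrow> sp dPs r Ps = 0" "r \<ge> 3 \<Longrightarrow> sp dPs r dPs = 0" for r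
    by (cases "r = 0"; auto simp: dPs_np Ps_prod)+
  show "wp (Gs \<otimes> ex (- 1)) n (Gs \<otimes> ex (- 1)) = (\<Sum>u<nat (3 - n). sp Gs (3 - 1 - int u) Gs \<otimes> nprod P (ex (- 1)) (n - 3 + int u) (ex (- 1)))"
    by (rule W_tensor[OF S_parts(1), where Nh = 0]) (auto simp: P_norm Gs_prod)
  show "wp (Gs \<otimes> ex (- 1)) n (Ps \<otimes> nn) = (\<Sum>u<nat (1 - n). sp Gs (0 - 1 - int u) Ps \<otimes> nprod P (ex (- 1)) (n - 0 + int u) nn)"
    by (rule W_tensor[OF S_parts(2), where Nh = 1]) (auto simp: P_norm Gs_prod)
  show "wp (Gs \<otimes> ex (- 1)) n (dPs \<otimes> ex (- 1)) = (\<Sum>u<nat (- n). sp Gs (0 - 1 - int u) dPs \<otimes> nprod P (ex (- 1)) (n - 0 + int u) (ex (- 1)))"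
    by (rule W_tensor[OF S_parts(3), where Nh = 0]) (auto simp: P_norm Gs_prod)
  show "wp (Ps \<otimes> nn) n (Gs \<otimes> ex (- 1)) = (\<Sum>u<nat (1 - n). sp Ps (0 - 1 - int u) Gs \<otimes> nprod P nn (n - 0 + int u) (ex (- 1)))"
    by (rule W_tensor[OF S_parts(1), where Nh = 1]) (auto simp: P_norm Ps_prod)
  show "wp (Ps \<otimes> nn) n (Ps \<otimes> nn) = (\<Sum>u<nat (3 - n). sp Ps (1 - 1 - int u) Ps \<otimes> nprod P nn (n - 1 + int u) nn)"
    by (rule W_tensor[OF S_parts(2), where Nh = 2]) (auto simp: P_norm Ps_prod)
  show "wp (Ps \<otimes> nn) n (dPs \<otimes> ex (- 1)) = (\<Sum>u<nat (3 - n). sp Ps (2 - 1 - int u) dPs \<otimes> nprod P nn (n - 2 + int u) (ex (- 1)))"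
    by (rule W_tensor[OF S_parts(3), where Nh = 1]) (auto simp: P_norm Ps_prod)
  show "wp (dPs \<otimes> ex (- 1)) n (Gs \<otimes> ex (- 1)) = (\<Sum>u<nat (- n). sp dPs (0 - 1 - int u) Gs \<otimes> nprod P (ex (- 1)) (n - 0 + int u) (ex (- 1)))"
    by (rule W_tensor[OF S_parts(1), where Nh = 0]) (auto simp: P_norm d)
  show "wp (dPs \<otimes> ex (- 1)) n (Ps \<otimes> nn) = (\<Sum>u<nat (3 - n). sp dPs (2 - 1 - int u) Ps \<otimes> nprod P (ex (- 1)) (n - 2 + int u) nn)"
    by (rule W_tensor[OF S_parts(2), where Nh = 1]) (auto simp: P_norm d)
  show "wp (dPs \<otimes> ex (- 1)) n (dPs \<otimes> ex (- 1)) = (\<Sum>u<nat (3 - n). sp dPs (3 - 1 - int u) dPs \<otimes> nprod P (ex (- 1)) (n - 3 + int u) (ex (- 1)))"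
    by (rule W_tensor[OF S_parts(3), where Nh = 0]) (auto simp: P_norm d)
qed

lemmas y_y_expand = WV.np_simps AA AB AD BA BB BD DA DB DD eval_nat_numeral dPs_np Ps_prod Gs_prod P_norm
  tensor_simps

text \<open>The trailing factor z lets the rule act inside right-nested products.\<close>

lemma \<kappa>\<kappa>: "\<kappa> * (\<kappa> * z) = - ((2 * K + 3) * z)"
proof -
  have "\<kappa> * (\<kappa> * z) = (\<kappa> * \<kappa>) * z" by (rule mult.assoc[symmetric])
  then show ?thesis unfolding \<kappa> by (simp only: t_K mult_minus_left)
qed

text \<open>Here the value of the central charge enters the relations: the polynomial is 3 (t - 1)^2
  - 3t/2 at t = 2K + 3.\<close>

lemma \<kappa>\<kappa>cc: "\<kappa> * (\<kappa> * (cc * z)) = (15 / 2 + 21 * K + 12 * K * K) * z"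
proof -
  have "\<kappa> * (\<kappa> * (cc * z)) = - ((cc * t) * z)"
    unfolding \<kappa>\<kappa> t_K[symmetric] by (simp only: mult.commute mult.left_commute)
  also have "\<dots> = (15 / 2 + 21 * K + 12 * K * K) * z"
    unfolding cct unfolding t_K by (simp add: field_simps power2_eq_square)
  finally show ?thesis .
qed

lemma y_y_2: "wp y1 2 y1 = 0"
  unfolding y1_def
  by (rule vector_eqI) (simp (no_asm_simp) add: y_y_expand t_K; simp (no_asm) add: field_simps \<kappa>\<kappa>cc)

text \<open>This product is the origin of the formula for f. The rule for \<kappa>^2 is restricted
  to the term with \<open>ws\<close>, which leaves the terms with the central charge to
  \<open>\<kappa>\<kappa>cc\<close>.\<close>

lemma y_y_0: "wp y1 0 y1 = - fW"
  unfolding y1_def fW_def Ol_def H.QP_def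
  by (rule vector_eqI) (simp (no_asm_simp) add: y_y_expand t_K; simp (no_asm) add: field_simps \<kappa>\<kappa>cc
    \<kappa>\<kappa>[of "\<phi> (ws \<otimes> ex (- 2)) * z" for \<phi> z])

lemma y_y_high: "n \<ge> 3 \<Longrightarrow> wp y1 n y1 = 0"
  by (simp add: y1_def WV.np_simps AA AB AD BA BB BD DA DB DD)

lemma yW_part: "yW \<in> part WW True" by (rule gen_parts)

text \<open>The products 0 and \<ge> 2 are computed. For n = 1 the skew-symmetry of an odd vector
  with itself gives y_1 y = - y_1 y, because the higher products vanish.\<close>

lemma y_y: "n \<ge> 0 \<Longrightarrow> wp yW n yW = (if n = 0 then - (2 *\<^sub>C fW) else 0)"
proof -
  assume n: "n \<ge> 0"
  have *: "wp yW n yW = 2 *\<^sub>C wp y1 n y1" for n by (simp add: yW_def \<rho>\<rho>)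
  have hi: "wp yW n yW = 0" if "n \<ge> 2" for n
    using y_y_2 y_y_high[of n] that by (cases "n = 2") (simp_all add: *)
  have "wp yW 1 yW = (- ((- 1) powi 1) * ksign True True) *\<^sub>C
    (\<Sum>r<1. (- 1) ^ r *\<^sub>C wp (wp yW (1 + int r) yW) (- 1 - int r) (vac WW))"
    by (rule WV.skew_symmetry[OF yW_part yW_part]) (simp add: hi)
  then have "2 *\<^sub>C wp yW 1 yW = 0" by (simp add: WV.np_vac scaleC_one scaleC_2 eq_neg_iff_add_eq_0)
  then show ?thesis using n hi[of n] by (cases "n = 0"; cases "n = 1") (simp_all add: * y_y_0)
qed

lemma Ol_G: "n \<ge> 1 \<Longrightarrow> sp Ol n Gs = (if n = 1 then (3 * t / 4) *\<^sub>C Gs - (\<kappa> * cc / 3) *\<^sub>C dPs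
     else if n = 2 then - ((\<kappa> * cc / 3) *\<^sub>C Ps) else 0)"
  and Ol_P: "n \<ge> 0 \<Longrightarrow> sp Ol n Ps = (if n = 1 then ((2 - t) / 4) *\<^sub>C Ps
     else if n = 0 then (\<kappa> / 2) *\<^sub>C Gs + ((2 - t) / 2) *\<^sub>C dPs else 0)"
  and Ol_D: "n \<ge> 1 \<Longrightarrow> sp Ol n dPs = (if n = 1 then (\<kappa> / 2) *\<^sub>C Gs + (3 * (2 - t) / 4) *\<^sub>C dPs
     else if n = 2 then ((2 - t) / 2) *\<^sub>C Ps else 0)"
  unfolding Ol_def
  by (cases "n = 0"; simp add: SV.np_simps ws_prod GP_prod wF_prod wF_0 GP_0 scaleC_scaleC field_simps)+

lemma O_A: "wp (Ol \<otimes> ex (- 2)) n (Gs \<otimes> ex (- 1)) = (\<Sum>u<nat (3 - n). sp Ol (3 - 1 - int u) Gs \<otimes> nprod P (ex (- 2)) (n - 3 + int u) (ex (- 1)))"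
  and O_B: "wp (Ol \<otimes> ex (- 2)) n (Ps \<otimes> nn) = (\<Sum>u<nat (3 - n). sp Ol (2 - 1 - int u) Ps \<otimes> nprod P (ex (- 2)) (n - 2 + int u) nn)"
  and O_D: "wp (Ol \<otimes> ex (- 2)) n (dPs \<otimes> ex (- 1)) = (\<Sum>u<nat (3 - n). sp Ol (3 - 1 - int u) dPs \<otimes> nprod P (ex (- 2)) (n - 3 + int u) (ex (- 1)))"
  by (rule W_tensor[OF S_parts(1), where Nh = 0] W_tensor[OF S_parts(2), where Nh = 1] W_tensor[OF S_parts(3), where Nh = 0];
    auto simp: P_norm Ol_G Ol_P Ol_D)+

lemmas f_y_expand = WV.np_simps O_A O_B O_D W_right eval_nat_numeral Ol_G Ol_P Ol_D P_norm tensor_simps H.QP_ex H.QP_nn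

lemma f_y_pos: "n \<ge> 1 \<Longrightarrow> wp fW n y1 = 0"
proof -
  have 1: "wp fW 1 y1 = 0"
    unfolding y1_def fW_def
    by (rule vector_eqI) (simp (no_asm_simp) add: f_y_expand; simp (no_asm) add: t_K field_simps \<kappa>\<kappa>cc
      \<kappa>\<kappa>[of "\<phi> (ws \<otimes> ex (- 2)) * z" for \<phi> z])
  have 2: "wp fW 2 y1 = 0"
    unfolding y1_def fW_def
    by (rule vector_eqI) (simp (no_asm_simp) add: f_y_expand; simp (no_asm) add: t_K field_simps \<kappa>\<kappa>cc
      \<kappa>\<kappa>[of "\<phi> (ws \<otimes> ex (- 2)) * z" for \<phi> z])
  have 3: "n \<ge> 3 \<Longrightarrow> wp fW n y1 = 0"
    unfolding y1_def fW_def by (simp add: WV.np_simps O_A O_B O_D W_right H.QP_ex H.QP_nn tensor_simps)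
  assume "n \<ge> 1"
  then consider "n = 1" | "n = 2" | "n \<ge> 3" by linarith
  then show ?thesis using 1 2 3 by cases simp_all
qed

lemma yy_W: "wp yW m (wp yW n v) = - (2 *\<^sub>C wp fW (m + n) v) - wp yW n (wp yW m v)"
  using WV.commutator[OF yW_part yW_part, of 1 m n v]
  by (simp add: y_y scaleC_one WV.np_simps algebra_simps)

text \<open>The positive products are computed. The product 0 follows from the Jacobi identity for
  three copies of y: with y_0 y = -2f and y_0 f = - f_0 y it becomes 6 f_0 y = 0.\<close>

lemma f_y: "n \<ge> 0 \<Longrightarrow> wp fW n yW = 0"
proof -
  assume n: "n \<ge> 0"
  have pos: "wp fW n yW = 0" if "n \<ge> 1" for n using f_y_pos[OF that] by (simp add: yW_def WV.np_simps)
  have "wp yW 0 fW = (- ((- 1) powi 0) * ksign False True) *\<^sub>C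
    (\<Sum>r<1. (- 1) ^ r *\<^sub>C wp (wp fW (0 + int r) yW) (- 1 - int r) (vac WW))"
    by (rule WV.skew_symmetry[OF gen_parts(2) yW_part]) (simp add: pos)
  then have 1: "wp yW 0 fW = - wp fW 0 yW" by (simp add: WV.np_vac scaleC_one)
  have 2: "2 *\<^sub>C wp fW 0 yW = - (2 *\<^sub>C wp fW 0 yW) - 2 *\<^sub>C wp fW 0 yW"
    using yy_W[of 0 0 yW] by (simp add: y_y WV.np_simps 1)
  have "wp fW 0 yW = 0"
  proof (rule vector_eqI)
    fix \<phi> :: "(('l, 'f) tensor, ('m, int \<Rightarrow>\<^sub>0 complex) tensor) tensor \<Rightarrow> complex"
    assume "\<And>x y. \<phi> (x - y) = \<phi> x - \<phi> y" "\<And>r x. \<phi> (r *\<^sub>C x) = r * \<phi> x" "\<And>x. \<phi> (- x) = - \<phi> x" "\<phi> 0 = 0"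
    then show "\<phi> (wp fW 0 yW) = \<phi> 0" using arg_cong[OF 2, of \<phi>] by simp
  qed
  then show ?thesis using pos[of n] n by (cases "n = 0") simp_all
qed

lemma h_np: "wp hW n (a \<otimes> b) = 2 *\<^sub>C (a \<otimes> Um n b)"
  by (simp add: hW_def WV.np_simps W_right H.Um_def)

lemma Um_nn: "n \<ge> 0 \<Longrightarrow> Um n nn = (if n = 0 then (- 1 / 2) *\<^sub>C nn else 0)"
  by (simp add: H.comm_UN H.modes_ex H.mode_simps)

lemma h_x: "n \<ge> 0 \<Longrightarrow> wp hW n xW = (if n = 0 then xW else 0)"
  and h_y: "n \<ge> 0 \<Longrightarrow> wp hW n yW = (if n = 0 then - yW else 0)"
  and h_h: "n \<ge> 0 \<Longrightarrow> wp hW n hW = (if n = 1 then (2 * K) *\<^sub>C vac WW else 0)"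
proof -
  assume n: "n \<ge> 0"
  show "wp hW n xW = (if n = 0 then xW else 0)"
    using n by (simp add: xW_def x1_def h_np WV.np_simps H.modes_ex scaleC_scaleC scaleC_one tensor_simps)
  show "wp hW n yW = (if n = 0 then - yW else 0)"
    using n by (simp add: yW_def y1_def h_np WV.np_simps Um_nn H.modes_ex scaleC_scaleC scaleC_one tensor_simps algebra_simps)
  have "Um n (H.st H.\<mu> 0) = (if n = 1 then (K / 2) *\<^sub>C vac P else 0)"
    using n H.comm_U[of n "- 1" "ex 0"] by (simp add: H.st_modes H.modes_ex H.mode_simps H.vacP)
  then show "wp hW n hW = (if n = 1 then (2 * K) *\<^sub>C vac WW else 0)"
    by (subst (2) hW_def) (simp add: WV.np_simps h_np W.VW_vac scaleC_scaleC tensor_simps)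
qed

lemma e_x: "n \<ge> 0 \<Longrightarrow> wp eW n xW = 0"
  by (simp add: eW_def xW_def x1_def WV.np_simps W_right P_norm tensor_simps)

text \<open>Each mode relation is the commutator formula, cut off after the last nonvanishing
  nonnegative product in the tables above.\<close>

lemma osp_relations: "osp_relations WW K eW fW hW xW yW"
proof (intro osp_relations.intro osp_relations_axioms.intro WV.vsa_axioms gen_parts)
  fix m n v
  note s = scaleC_one WV.np_simps WV.vac_np algebra_simps
  show "wp hW m (wp hW n v) = wp hW n (wp hW m v) + (if m + n = 0 then (2 * of_int m * K) *\<^sub>C v else 0)"
    using WV.commutator[OF gen_parts(3) gen_parts(3), of 2 m n v]
    by (auto simp: h_h numeral_2_eq_2 scaleC_scaleC s)
  show "wp hW m (wp xW n v) = wp xW n (wp hW m v) + wp xW (m + n) v"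
    using WV.commutator[OF gen_parts(3) gen_parts(4), of 1 m n v] by (simp add: h_x s)
  show "wp hW m (wp yW n v) = wp yW n (wp hW m v) - wp yW (m + n) v"
    using WV.commutator[OF gen_parts(3) gen_parts(5), of 1 m n v] by (simp add: h_y s)
  show "wp xW m (wp xW n v) = 2 *\<^sub>C wp eW (m + n) v - wp xW n (wp xW m v)"
    using WV.commutator[OF gen_parts(4) gen_parts(4), of 1 m n v] by (simp add: x_x s)
  show "wp yW m (wp xW n v) = wp hW (m + n) v + (if m + n = 0 then (2 * of_int n * K) *\<^sub>C v else 0) - wp xW n (wp yW m v)"
  proof -
    have "wp xW n (wp yW m v) + wp yW m (wp xW n v) = wp hW (n + m) v + of_int n *\<^sub>C wp ((2 * K) *\<^sub>C vac WW) (n + m - 1) v"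
      using WV.commutator[OF gen_parts(4) gen_parts(5), of 2 n m v]
      by (simp add: x_y numeral_2_eq_2 scaleC_one)
    also have "of_int n *\<^sub>C wp ((2 * K) *\<^sub>C vac WW) (n + m - 1) v = (if m + n = 0 then (2 * of_int n * K) *\<^sub>C v else 0)"
      by (auto simp: WV.np_simps WV.vac_np scaleC_scaleC mult.assoc mult.left_commute)
    finally show ?thesis by (simp only: add.commute[of n m] eq_diff_eq add.commute[of "wp xW n (wp yW m v)"])
  qed
  show "wp yW m (wp yW n v) = - (2 *\<^sub>C wp fW (m + n) v) - wp yW n (wp yW m v)" by (rule yy_W)
  show "wp eW m (wp xW n v) = wp xW n (wp eW m v)"
    using WV.commutator[OF gen_parts(1) gen_parts(4), of 0 m n v] by (simp add: e_x s)
  show "wp fW m (wp yW n v) = wp yW n (wp fW m v)"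
    using WV.commutator[OF gen_parts(2) gen_parts(5), of 0 m n v] by (simp add: f_y s)
qed

end

sublocale realization \<subseteq> O: osp_relations "tensor_vsa (tensor_vsa L F) P" K eW fW hW xW yW
  by (rule osp_relations)

sublocale realization \<subseteq> A: affine_osp "tensor_vsa (tensor_vsa L F) P" K O.gens
  by (rule O.affine_osp)

context realization begin

text \<open>This is \<open>t(t+1)\<close> times the vector \<open>\<omega>\<close> with index \<open>(p, (p+q)/2)\<close>; by \<open>Om_relation\<close> it is the
  difference of the two Sugawara vectors, the coset conformal vector.\<close>

definition "coset_omega = (t *\<^sub>C ws - (\<kappa> * t) *\<^sub>C GP + (t * (2 * t - 1)) *\<^sub>C wF) \<otimes> ex 0"

text \<open>Skew-symmetry reverses the order at the cost of the derivative of h, which is 2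
  \<mu>(-2) applied to the vacuum. In the Sugawara vectors only e_(-1) f, x_(-1) y and h_(-1) h then
  remain to be computed.\<close>

lemma fe_W: "wp fW (- 1) eW = wp eW (- 1) fW - 2 *\<^sub>C (vS \<otimes> Um (- 2) (ex 0))"
  and yx_W: "wp yW (- 1) xW = 2 *\<^sub>C (vS \<otimes> Um (- 2) (ex 0)) - wp xW (- 1) yW"
proof -
  have ef: "n \<ge> 0 \<Longrightarrow> wp eW n fW = (if n = 0 then hW else if n = 1 then K *\<^sub>C vac WW else 0)" for n
    using A.gen_prod[of n osp_e osp_f] by (simp add: WV.np_vac)
  have h2: "wp hW (- 2) (vac WW) = 2 *\<^sub>C (vS \<otimes> Um (- 2) (ex 0))"
    unfolding W.VW_vac h_np H.vacP ..
  have "wp fW (- 1) eW = (- ((- 1) powi (- 1)) * ksign False False) *\<^sub>C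
    (\<Sum>r<3. (- 1) ^ r *\<^sub>C wp (wp eW (- 1 + int r) fW) (- 1 - int r) (vac WW))"
    by (rule WV.skew_symmetry[OF gen_parts(1) gen_parts(2)]) (simp add: ef)
  also have "\<dots> = wp eW (- 1) fW - 2 *\<^sub>C (vS \<otimes> Um (- 2) (ex 0))"
    by (simp add: eval_nat_numeral ef WV.np_vac WV.vac_np WV.np_simps scaleC_one h2[simplified])
  finally show "wp fW (- 1) eW = wp eW (- 1) fW - 2 *\<^sub>C (vS \<otimes> Um (- 2) (ex 0))" .
  have "wp yW (- 1) xW = (- ((- 1) powi (- 1)) * ksign True True) *\<^sub>C
    (\<Sum>r<3. (- 1) ^ r *\<^sub>C wp (wp xW (- 1 + int r) yW) (- 1 - int r) (vac WW))"
    by (rule WV.skew_symmetry[OF gen_parts(4) gen_parts(5)]) (simp add: x_y)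
  also have "\<dots> = 2 *\<^sub>C (vS \<otimes> Um (- 2) (ex 0)) - wp xW (- 1) yW"
    by (simp add: eval_nat_numeral x_y WV.np_vac WV.vac_np WV.np_simps scaleC_one h2[simplified])
  finally show "wp yW (- 1) xW = 2 *\<^sub>C (vS \<otimes> Um (- 2) (ex 0)) - wp xW (- 1) yW" .
qed

lemma Om_relation: "(t + 1) *\<^sub>C A.Om_osp - t *\<^sub>C A.Om_sl = coset_omega"
proof -
  have xy: "wp xW (- 1) yW = 2 *\<^sub>C wp x1 (- 1) y1" by (simp add: xW_def yW_def \<rho>\<rho>)
  have hh: "wp hW (- 1) hW = 4 *\<^sub>C (vS \<otimes> Um (- 1) (Um (- 1) (ex 0)))"
    by (subst (2) hW_def) (simp add: WV.np_simps h_np scaleC_scaleC H.st_modes)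
  have ef: "wp eW (- 1) fW = Ol \<otimes> H.Xm 2 (- 1) (ex (- 2)) - vS \<otimes> H.Xm 2 (- 1) H.QP"
    by (simp add: eW_def fW_def WV.np_simps W_right H.nprod_ex)
  show ?thesis
    unfolding A.Om_osp_def A.Om_sl_def O.gens_simps fe_W yx_W xy hh ef coset_omega_def Ol_def H.QP_def y1_def H.Um_Nm
    by (rule vector_eqI) (simp (no_asm_simp) add: WV.np_simps x_A x_B x_D eval_nat_numeral Ps_prod P_norm
        tensor_simps; simp (no_asm) add: t_K field_simps)
qed

text \<open>In mode 1 the two Sugawara vectors give the factors 2k + 3 = t and 2k + 4 = t + 1, so
  the contributions (t + 1) t and t (t + 1) cancel. All other nonnegative modes give 0.\<close>

lemma gens_coset_omega: "a \<in> {osp_e, osp_f, osp_h} \<Longrightarrow> n \<ge> 0 \<Longrightarrow> wp (O.gens a) n coset_omega = 0"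
  unfolding Om_relation[symmetric] WV.np_simps A.Om_osp_prod
  by (subst A.Om_sl_prod) (auto simp: t_K scaleC_scaleC algebra_simps)

lemma coset_omega_generated: "coset_omega \<in> vsa_generated WW (range O.gens)"
  unfolding Om_relation[symmetric] A.Om_osp_def A.Om_sl_def
  by (intro complex_vector.subspace_diff[OF WV.generatedD(1)] complex_vector.subspace_add[OF WV.generatedD(1)]
    complex_vector.subspace_scale[OF WV.generatedD(1)] WV.generatedD(3) WV.generated_base rangeI)

subsection \<open>Singular vectors\<close>

lemma W_tensor_any:
  assumes "\<And>r i. r \<ge> hi \<Longrightarrow> sp a r (SV.parity_part i c') = 0" "\<And>N. N \<ge> Nh \<Longrightarrow> nprod P b N d' = 0"
    "int R \<ge> Nh - (n - hi)"
  shows "wp (a \<otimes> b) n (c' \<otimes> d') = (\<Sum>u<R. sp a (hi - 1 - int u) c' \<otimes> nprod P b (n - hi + int u) d')"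
proof -
  have "wp (a \<otimes> b) n (SV.parity_part i c' \<otimes> d') =
      (\<Sum>u<R. sp a (hi - 1 - int u) (SV.parity_part i c') \<otimes> nprod P b (n - hi + int u) d')" for i
    by (rule W_tensor[OF SV.parity_part_in assms(1) assms(2,3)])
  then show ?thesis
    by (subst W.split_left, subst (3) SV.parity_part_sum) (simp add: WV.np_simps SV.np_simps tensor_simps sum.distrib)
qed

lemma high_modes: obtains hi where "\<And>r i. r \<ge> hi \<Longrightarrow> sp a r (SV.parity_part i c') = 0"
    "\<And>r. r \<ge> hi \<Longrightarrow> sp a r c' = 0" "hi \<ge> n"
proof -
  obtain h0 h1 where h: "\<And>r. r \<ge> h0 \<Longrightarrow> sp a r (SV.parity_part False c') = 0" "\<And>r. r \<ge> h1 \<Longrightarrow> sp a r (SV.parity_part True c') = 0"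
    using SV.truncation by metis
  define hi where "hi = max n (max h0 h1)"
  have 1: "sp a r (SV.parity_part i c') = 0" if "r \<ge> hi" for r i using h[of r] that by (cases i) (auto simp: hi_def)
  have 2: "sp a r c' = 0" if "r \<ge> hi" for r
    by (subst SV.parity_part_sum) (simp add: SV.np_simps 1 that)
  show ?thesis using that[of hi] 1 2 by (simp add: hi_def)
qed

lemma W_tensor_zero:
  assumes "\<And>r. sp a r c' = 0 \<or> nprod P b (n - 1 - r) d' = 0"
  shows "wp (a \<otimes> b) n (c' \<otimes> d') = 0"
proof -
  obtain hi where hi: "\<And>r i. r \<ge> hi \<Longrightarrow> sp a r (SV.parity_part i c') = 0" using high_modes by metis
  obtain Nh where Nh: "\<And>N. N \<ge> Nh \<Longrightarrow> nprod P b N d' = 0" using H.P.truncation by metis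
  have x: "i \<le> int (nat i)" for i by simp
  have "wp (a \<otimes> b) n (c' \<otimes> d') = (\<Sum>u<nat (Nh - (n - hi)). sp a (hi - 1 - int u) c' \<otimes> nprod P b (n - hi + int u) d')"
    by (rule W_tensor_any[OF hi Nh]) (assumption | rule x)+
  also have "\<dots> = 0"
  proof (rule sum.neutral, rule ballI)
    fix u
    have "n - 1 - (hi - 1 - int u) = n - hi + int u" by simp
    then show "sp a (hi - 1 - int u) c' \<otimes> nprod P b (n - hi + int u) d' = 0"
      using assms[of "hi - 1 - int u"] by (metis clinear_0[OF clinear_tensor_left] clinear_0[OF clinear_tensor_right])
  qed
  finally show ?thesis .
qed

text \<open>The leading coefficient of \<open>Y(e\<^sup>\<alpha>, z) e\<^sup>\<beta>\<close> transports annihilation conditions to the first factor.\<close>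

lemma leading_mode:
  assumes "\<And>n. n \<ge> n0 \<Longrightarrow> wp (a \<otimes> ex r) n (c' \<otimes> ex s) = 0" "n \<ge> n0"
  shows "sp a n c' = 0"
proof -
  obtain hi where hi: "\<And>r i. r \<ge> hi \<Longrightarrow> sp a r (SV.parity_part i c') = 0"
    "\<And>r. r \<ge> hi \<Longrightarrow> sp a r c' = 0" "hi \<ge> n0" using high_modes by metis
  \<comment> \<open>Descend from the top mode: in mode hi - j of the tensor product all higher modes
    of \<open>a\<close> are already known to vanish, and the mode hi - j of \<open>a\<close> occurs
    with a single exponential as its second factor.\<close>
  have "sp a (hi - int j) c' = 0" if "hi - int j \<ge> n0" for j
    using that
  proof (induction j rule: less_induct)
    case (less j)
    show ?case
    proof (cases j)
      case (Suc i)
      have "wp (a \<otimes> ex r) (hi - int j) (c' \<otimes> ex s) =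
        (\<Sum>u<Suc i. sp a (hi - 1 - int u) c' \<otimes> nprod P (ex r) (hi - int j - hi + int u) (ex s))"
        by (rule W_tensor_any[OF hi(1), where Nh = 0]) (simp_all add: P_norm Suc)
      also have "\<dots> = (\<Sum>u<Suc i. if u = i then sp a (hi - int j) c' \<otimes> ex (r + s) else 0)"
      proof (rule sum.cong)
        fix u assume "u \<in> {..<Suc i}"
        then have "u < i \<or> u = i" by auto
        then show "sp a (hi - 1 - int u) c' \<otimes> nprod P (ex r) (hi - int j - hi + int u) (ex s) =
          (if u = i then sp a (hi - int j) c' \<otimes> ex (r + s) else 0)"
        proof
          assume "u < i"
          then show ?thesis using less.IH[of "Suc u"] less.prems Suc by (simp add: algebra_simps tensor_simps)
        qed (simp add: Suc P_norm algebra_simps)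
      qed simp
      also have "\<dots> = sp a (hi - int j) c' \<otimes> ex (r + s)" by simp
      finally have "sp a (hi - int j) c' \<otimes> ex (r + s) = 0" using assms(1)[OF less.prems] by simp
      then show ?thesis by (simp add: tensor_eq_0_iff H.ex_def H.single_nonzero N.vac_nonzero H.vac_nonzero)
    qed (use hi in simp)
  qed
  from this[of "nat (hi - n)"] show ?thesis using assms(2) hi(2)[of n] by (cases "n \<ge> hi") simp_all
qed

text \<open>Every slice over the left factor is a singular vector of the fermion algebra, hence a
  multiple of its vacuum.\<close>

lemma fermion_vacuum:
  assumes "\<And>n. n \<ge> 0 \<Longrightarrow> sp Ps n a = 0"
  obtains w where "a = w \<otimes> vac F"
proof (rule contract_left_line[of a "vac F"])
  fix \<phi> :: "'l \<Rightarrow> complex" assume \<phi>: "clinear \<phi>"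
  \<comment> \<open>The parity twist compensates the sign with which \<open>\<Psi>\<close> passes
    the left factor.\<close>
  let ?\<psi> = "\<lambda>x. \<phi> (N.parity_twist True x)"
  have \<psi>: "clinear ?\<psi>" by (rule clinear_compose[OF \<phi> N.clinear_parity_twist])
  have "nprod F \<Psi> n (contract_left \<phi> a) = contract_left ?\<psi> (sp Ps n a)" for n
  proof (rule clinear_tensor_ext[of "\<lambda>a. nprod F \<Psi> n (contract_left \<phi> a)"])
    show "clinear (\<lambda>a. nprod F \<Psi> n (contract_left \<phi> a))"
      by (rule clinear_compose[OF F.lin_right clinear_contract_left[OF \<phi>]])
    show "clinear (\<lambda>a. contract_left ?\<psi> (sp Ps n a))"
      by (rule clinear_compose[OF clinear_contract_left[OF \<psi>] SV.lin_right])
    fix l f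
    have *: "nprod F \<Psi> n (contract_left \<phi> (l \<otimes> f)) = contract_left ?\<psi> (sp Ps n (l \<otimes> f))" if "l \<in> part L j" for l j
      using that unfolding Ps_def S.VW_right[OF F.\<Psi>_odd that]
      by (simp add: contract_left_tensor[OF \<phi>] contract_left_tensor[OF \<psi>] clinear_simps[OF clinear_contract_left[OF \<psi>]]
        N.parity_twist_homog clinear_simps[OF \<phi>] F.np_simps scaleC_scaleC scaleC_complex mult.assoc[symmetric])
    show "nprod F \<Psi> n (contract_left \<phi> (l \<otimes> f)) = contract_left ?\<psi> (sp Ps n (l \<otimes> f))"
      unfolding S.split_left[of l f]
      by (simp add: clinear_simps[OF clinear_contract_left[OF \<psi>]] clinear_simps[OF clinear_contract_left[OF \<phi>]]
         F.np_simps SV.np_simps *[OF N.parity_part_in])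
  qed
  then have "nprod F \<Psi> n (contract_left \<phi> a) = 0" if "n \<ge> 0" for n
    using assms[OF that] by (simp add: clinear_simps[OF clinear_contract_left[OF \<psi>]])
  then have "contract_left \<phi> a \<in> complex_vector.span {vac F}" by (rule F.singular_vector)
  then show "\<exists>r. contract_left \<phi> a = r *\<^sub>C vac F" by (auto simp: complex_vector.span_singleton)
qed (use that in blast)

text \<open>The generators act triangularly on the factors. \<open>eW\<close> and \<open>hW\<close>
  involve only the half-lattice factor and determine it; then \<open>xW\<close> sees only
  \<open>\<Psi>\<close>; in \<open>yW\<close> the two terms with \<open>\<Psi>\<close> drop out and
  leave \<open>G\<close>. The condition on \<open>fW\<close> finally restricts s.\<close>

lemma singular_vector_W:
  assumes e: "\<And>n. n \<ge> 0 \<Longrightarrow> wp eW n v = 0" and x: "\<And>n. n \<ge> 0 \<Longrightarrow> wp xW n v = 0"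
    and h: "\<And>n. n \<ge> 1 \<Longrightarrow> wp hW n v = 0" "wp hW 0 v = of_int s *\<^sub>C v"
    and y: "\<And>n. n \<ge> 1 \<Longrightarrow> wp yW n v = 0" and f: "wp fW 1 v = 0" and v: "v \<noteq> 0"
  shows "(\<exists>r. v = r *\<^sub>C (vS \<otimes> ex s)) \<and> of_int s * (of_int s - 2 * K - 2) = (0 :: complex)"
proof -
  obtain a where a: "v = a \<otimes> ex s"
  proof (rule contract_left_line[of v "ex s"])
    fix \<phi> :: "('l, 'f) tensor \<Rightarrow> complex" assume \<phi>: "clinear \<phi>"
    note lin = clinear_simps[OF clinear_contract_left[OF \<phi>]]
    have c: "nprod P b n (contract_left \<phi> v) = contract_left \<phi> (wp (vS \<otimes> b) n v)" for b n
      by (rule clinear_tensor_ext[of "\<lambda>v. nprod P b n (contract_left \<phi> v)"])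
        (simp_all add: clinear_compose[OF H.P.lin_right clinear_contract_left[OF \<phi>]]
          clinear_compose[OF clinear_contract_left[OF \<phi>] WV.lin_right] W_right contract_left_tensor[OF \<phi>] H.P.np_simps)
    have hv: "wp (vS \<otimes> H.st H.\<mu> 0) n v = (1 / 2) *\<^sub>C wp hW n v" for n
      by (simp add: hW_def WV.np_simps scaleC_scaleC scaleC_one)
    show "\<exists>r. contract_left \<phi> v = r *\<^sub>C ex s"
      by (rule H.singular_vector_P) (simp_all add: H.Xm_def H.Um_def c hv h e[unfolded eW_def] lin scaleC_scaleC)
  qed
  have x0: "sp Ps n a = 0" if "n \<ge> 0" for n
  proof (rule leading_mode[of 0 Ps 1 a s, OF _ that])
    fix n :: int assume "n \<ge> 0"
    then have "wp xW n v = 0" by (rule x)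
    then show "wp (Ps \<otimes> ex 1) n (a \<otimes> ex s) = 0" using \<rho> by (auto simp: xW_def x1_def WV.np_simps a)
  qed
  then obtain w where w: "a = w \<otimes> vac F" using fermion_vacuum by blast
  have z: "nprod P (ex r) N (ex s) = 0" if "N \<ge> 0" for r N using that by (simp add: P_norm)
  have G0: "sp Gs n a = 0" if "n \<ge> 1" for n
  proof (rule leading_mode[of 1 Gs "- 1" a s, OF _ that])
    fix n :: int assume n: "n \<ge> 1"
    have 1: "wp (Ps \<otimes> nn) n (a \<otimes> ex s) = 0"
    proof (rule W_tensor_zero)
      fix r show "sp Ps r a = 0 \<or> nprod P nn (n - 1 - r) (ex s) = 0"
        using x0[of r] H.nn_ex(1)[of "n - 1 - r" s] n by (cases "r \<ge> 0") simp_all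
    qed
    have 2: "wp (dPs \<otimes> ex (- 1)) n (a \<otimes> ex s) = 0"
    proof (rule W_tensor_zero)
      fix r show "sp dPs r a = 0 \<or> nprod P (ex (- 1)) (n - 1 - r) (ex s) = 0"
        using x0[of "r - 1"] z[of "n - 1 - r"] n by (cases "r \<ge> 1"; cases "r = 0") (simp_all add: dPs_np)
    qed
    have "\<kappa> \<noteq> 0" "\<rho> \<noteq> 0" using \<kappa> \<rho> t0 by auto
    then show "wp (Gs \<otimes> ex (- 1)) n (a \<otimes> ex s) = 0"
      using y[OF n] by (simp add: yW_def y1_def WV.np_simps a 1 2)
  qed
  have Fv: "vac F \<noteq> 0" by (rule F.vac_nonzero)
  have "nprod L G n w = 0" if "n \<ge> 1" for n
    using G0[OF that] unfolding w Gs_def S.VW_left tensor_eq_0_iff using Fv by simp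
  then have "w \<in> complex_vector.span {vac L}" by (rule N.singular_vector)
  then obtain r where r: "w = r *\<^sub>C vac L" by (auto simp: complex_vector.span_singleton)
  have vr: "v = r *\<^sub>C (vS \<otimes> ex s)" by (simp add: a w r vS tensor_simps)
  have 1: "wp (Ol \<otimes> ex (- 2)) 1 (vS \<otimes> ex s) = 0"
  proof (rule W_tensor_zero)
    fix i show "sp Ol i vS = 0 \<or> nprod P (ex (- 2)) (1 - 1 - i) (ex s) = 0"
      using SV.np_vac(2)[of i Ol] z[of "- i"] by (cases "i \<ge> 0") simp_all
  qed
  have "wp fW 1 v = (- r * (of_int s * (of_int s - 2 * K - 2) / 4)) *\<^sub>C (vS \<otimes> ex (s - 2))"
    by (simp add: vr fW_def WV.np_simps 1 W_right H.QP_ex tensor_simps scaleC_scaleC)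
  moreover have "vS \<otimes> ex (s - 2) \<noteq> 0"
    by (simp add: tensor_eq_0_iff H.ex_def H.single_nonzero SV.vac_nonzero H.vac_nonzero)
  moreover have "r \<noteq> 0" using v vr by auto
  ultimately have "of_int s * (of_int s - 2 * K - 2) = (0 :: complex)" using f by simp
  then show ?thesis using vr by blast
qed

end

section \<open>The homomorphism\<close>

lemma clinear_subspace_image: "clinear f \<Longrightarrow> complex_vector.subspace S \<Longrightarrow> complex_vector.subspace (f ` S)"
  and clinear_subspace_vimage: "clinear f \<Longrightarrow> complex_vector.subspace T \<Longrightarrow> complex_vector.subspace {x. f x \<in> T}"
  unfolding complex_vector.subspace_def
  by (force simp: clinear_simps intro: image_eqI[where x = 0] simp flip: clinear_add clinear_scale)
    (simp add: clinear_simps)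

text \<open>\<open>nonresonant\<close> is the arithmetic input: for even s it excludes the second
  root of the quadratic arising from f(1).\<close>

locale osp_realization =
  realization cc L \<omega> G F \<Psi> M c d P K t \<kappa> \<rho> + U: affine_osp V K \<iota>
  for cc :: complex and L :: "'l::complex_vector vsa" and \<omega> G
    and F :: "'f::complex_vector vsa" and \<Psi>
    and M :: "'m::complex_vector vsa" and c d and P K t \<kappa> \<rho>
    and V :: "'v::complex_vector vsa" and \<iota> +
  assumes generated: "vsa_generated V (range \<iota>) = UNIV"
    and nonresonant: "even s \<Longrightarrow> of_int s \<noteq> 2 * K + 2"
begin

definition "pair a = (\<iota> a, O.gens a)"

lemma affine_pair: "affine_osp (prod_vsa V WW) K pair"
proof (intro affine_osp.intro affine_osp_axioms.intro)
  show "vsa (prod_vsa V WW)"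
    by unfold_locales (rule vertex_superalgebra_prod[OF U.vsa WV.vsa])
  show "pair a \<in> part (prod_vsa V WW) (osp12_odd a)" for a
    using U.\<iota>_part[of a] A.\<iota>_part[of a] by (simp add: pair_def)
  fix a b m n v
  have "scomm (prod_vsa V WW) (osp12_odd a) (osp12_odd b) (pair a) m (pair b) n v =
    (scomm V (osp12_odd a) (osp12_odd b) (\<iota> a) m (\<iota> b) n (fst v),
     scomm WW (osp12_odd a) (osp12_odd b) (O.gens a) m (O.gens b) n (snd v))"
    by (simp add: scomm_def pair_def prod_eq_iff)
  then show "scomm (prod_vsa V WW) (osp12_odd a) (osp12_odd b) (pair a) m (pair b) n v =
    Sum_any (\<lambda>g. Poly_Mapping.lookup (osp12_bracket a b) g *\<^sub>C nprod (prod_vsa V WW) (pair g) (m + n) v)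
      + (if m + n = 0 then (of_int m * osp12_form a b * K) *\<^sub>C v else 0)"
    unfolding U.\<iota>_comm A.\<iota>_comm
    by (cases a; cases b) (simp_all add: Sum_any_single pair_def prod_eq_iff scaleC_one)
qed

end

sublocale osp_realization \<subseteq> D: affine_osp "prod_vsa V (tensor_vsa (tensor_vsa L F) P)" K pair
  by (rule affine_pair)

context osp_realization begin

abbreviation "XX \<equiv> prod_vsa V WW"
abbreviation "graph \<equiv> D.G.total"

lemma graph_closed: "x \<in> graph \<Longrightarrow> y \<in> graph \<Longrightarrow> nprod XX x n y \<in> graph"
  and pair_graph: "pair a \<in> graph"
  unfolding D.generated_total[symmetric] by (rule D.generatedD(3) D.generated_base rangeI; assumption?)+

text \<open>The kernel of the first projection is stable under the grading operator, because the
  Sugawara vector of the pairs lies in D. It therefore contains the homogeneous components of its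
  elements, among which an extremal one can be chosen.\<close>

lemma graph_kernel_singular:
  assumes x: "x \<in> graph" "fst x = 0" "x \<noteq> 0"
  obtains n s u where "(0, u) \<in> D.G.Mon (n, s)" "u \<noteq> 0"
    "\<And>a m. m \<ge> 1 \<or> m = 0 \<and> osp12_weight a > 0 \<Longrightarrow> wp (O.gens a) m u = 0"
proof -
  define I where "I = {x \<in> graph. fst x = 0}"
  have I: "complex_vector.subspace I"
    using D.G.total_subspace by (auto simp: I_def complex_vector.subspace_def)
  have I_np: "nprod XX a m y \<in> I" if "a \<in> graph" "y \<in> I" for a m y
    using that graph_closed[of a y m] by (auto simp: I_def U.np_simps)
  have "D.Om_osp \<in> graph"
    unfolding D.Om_osp_def D.Om_sl_def
    by (intro complex_vector.subspace_diff[OF D.G.total_subspace] complex_vector.subspace_add[OF D.G.total_subspace]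
      complex_vector.subspace_scale[OF D.G.total_subspace] graph_closed pair_graph)
  then have I_grading: "D.grading y \<in> I" if "y \<in> I" for y
    unfolding D.grading_def using that
    by (intro complex_vector.subspace_add[OF I] complex_vector.subspace_scale[OF I] I_np pair_graph)
  define T where "T = {g. \<exists>y \<in> I. y \<in> D.G.Mon g \<and> y \<noteq> 0}"
  have t: "2 * K + 3 \<noteq> 0" using t_K t0 by simp
  obtain A f where A: "finite A" "\<And>g. g \<in> A \<Longrightarrow> f g \<in> D.G.Mon g" "x = (\<Sum>g\<in>A. f g)"
    using D.G.total_components[OF x(1)] by blast
  have "f g \<in> I" if "g \<in> A" for g
    by (rule D.G.total_eigen_split[OF D.clinear_grading D.grading_Mon[OF t] D.grading_inj I I_grading A(1,2) _ that])
      (use A(3) x in \<open>simp_all add: I_def\<close>)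
  moreover obtain g where "g \<in> A" "f g \<noteq> 0" using x(3) A(3) by (metis sum.neutral)
  ultimately have "g \<in> T" unfolding T_def using A(2)[of g] by blast
  \<comment> \<open>The degrees occurring in \<open>T\<close> are nonnegative, so passing to natural
    numbers loses nothing.\<close>
  then obtain g0 where g0: "g0 \<in> T" "\<And>h. h \<in> T \<Longrightarrow> nat (fst g0) \<le> nat (fst h)"
    using ex_has_least_nat[of "\<lambda>g. g \<in> T" g "\<lambda>g. nat (fst g)"] by blast
  \<comment> \<open>In fixed degree n the highest eigenvalue s is found by minimizing 2n - s, which
    is nonnegative by \<open>D.Mon_bound\<close>.\<close>
  obtain g1 where g1: "g1 \<in> T" "fst g1 = fst g0"
    "\<And>h. h \<in> T \<Longrightarrow> fst h = fst g0 \<Longrightarrow> nat (2 * fst g1 - snd g1) \<le> nat (2 * fst h - snd h)"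
    using ex_has_least_nat[of "\<lambda>g. g \<in> T \<and> fst g = fst g0" g0 "\<lambda>g. nat (2 * fst g - snd g)"] g0(1) by blast
  have T: "fst h \<ge> 0" "snd h \<le> 2 * fst h" if "h \<in> T" for h
    using that D.G.Mon_deg_neg[of h] D.Mon_bound[of _ "fst h" "snd h"] by (force simp: T_def not_less[symmetric])+
  have low: "h \<notin> T" if "fst h < fst g1 \<or> fst h = fst g1 \<and> snd h > snd g1" for h
    using that g0(2)[of h] g1(2) g1(3)[of h] T[of h] T[OF g1(1)] by fastforce
  obtain y where y: "y \<in> I" "y \<in> D.G.Mon g1" "y \<noteq> 0" using g1(1) by (auto simp: T_def)
  define u where "u = snd y"
  have yu: "y = (0, u)" using y(1) by (simp add: I_def u_def prod_eq_iff)
  have "wp (O.gens a) m u = 0" if "m \<ge> 1 \<or> m = 0 \<and> osp12_weight a > 0" for a m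
  proof -
    have 1: "nprod XX (pair a) m y \<in> I" by (rule I_np[OF pair_graph y(1)])
    have "nprod XX (pair a) m y \<in> D.G.Mon ((- m, osp12_weight a) + g1)"
      by (rule D.G.Mon_closed[OF y(2) D.gen_oOp])
    moreover have "(- m, osp12_weight a) + g1 \<notin> T" by (rule low) (use that in auto)
    ultimately have "nprod XX (pair a) m y = 0" using 1 by (auto simp: T_def)
    then show ?thesis by (simp add: yu pair_def prod_eq_iff)
  qed
  moreover have "u \<noteq> 0" using y(3) by (simp add: yu prod_eq_iff)
  ultimately show ?thesis using that[of u "fst g1" "snd g1"] y(2) yu by simp
qed

lemma graph_functional: "(0, w) \<in> graph \<Longrightarrow> w = 0"
proof (rule ccontr)
  assume w: "(0, w) \<in> graph" "w \<noteq> 0"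
  obtain n s u where u: "(0, u) \<in> D.G.Mon (n, s)" "u \<noteq> 0"
    "\<And>a m. m \<ge> 1 \<or> m = 0 \<and> osp12_weight a > 0 \<Longrightarrow> wp (O.gens a) m u = 0"
    using graph_kernel_singular[OF w(1)] w(2) by (metis fst_conv prod.inject zero_prod_def)
  have h0: "wp hW 0 u = of_int s *\<^sub>C u"
    using D.h_Mon[OF u(1)] by (simp add: pair_def prod_eq_iff)
  have "(\<exists>r. u = r *\<^sub>C (vS \<otimes> ex s)) \<and> of_int s * (of_int s - 2 * K - 2) = (0 :: complex)"
  proof (rule singular_vector_W)
    show "wp eW n u = 0" if "n \<ge> 0" for n using u(3)[of n osp_e] that by (cases "n = 0") simp_all
    show "wp xW n u = 0" if "n \<ge> 0" for n using u(3)[of n osp_x] that by (cases "n = 0") simp_all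
    show "wp hW n u = 0" if "n \<ge> 1" for n using u(3)[of n osp_h] that by simp
    show "wp yW n u = 0" if "n \<ge> 1" for n using u(3)[of n osp_y] that by simp
    show "wp fW 1 u = 0" using u(3)[of 1 osp_f] by simp
  qed (use h0 u(2) in simp_all)
  then obtain r where r: "u = r *\<^sub>C (vS \<otimes> ex s)" and s: "of_int s * (of_int s - 2 * K - 2) = (0 :: complex)" by blast
  have even: "u \<in> part WW False"
    unfolding r using W.tensor_part[OF SV.vac_even H.all_even_P, of "ex s"]
    by (intro complex_vector.subspace_scale[OF WV.part_subspace]) simp
  have "u \<in> part WW (odd s)" using D.Mon_parity u(1) by fastforce
  \<comment> \<open>The vector u is even by its explicit form, while an odd s would make it odd as
    well and hence 0.\<close>
  then have "even s" using WV.part_inter[OF even] u(2) by (cases "odd s") auto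
  then have "s = 0" using s nonresonant[of s] unfolding mult_eq_0_iff by (auto simp: algebra_simps)
  then have uv: "u = r *\<^sub>C vac WW" by (simp add: r W.VW_vac H.vacP)
  have t: "2 * K + 3 \<noteq> 0" using t_K t0 by simp
  \<comment> \<open>As a multiple of the vacuum, u has Sugawara weight 0, so the pair has degree 0.
    That part of D is spanned by the pair of vacua, whose first component is nonzero.\<close>
  have "D.grading (0, u) = 0"
    by (simp add: D.grading_def prod_eq_iff U.np_simps uv WV.np_simps WV.np_vac)
  then have "n = 0" using D.grading_Mon[OF t u(1)] u(2) \<open>s = 0\<close> by (auto simp: prod_eq_iff)
  then have "(0, u) \<in> complex_vector.span {vac XX}"
    using D.G.Mon_deg_0[OF _ u(1)] u(2) by (auto simp: prod_eq_iff)
  then show False using U.vac_nonzero u(2) by (auto simp: complex_vector.span_singleton prod_eq_iff)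
qed

section \<open>The homomorphism read off from its graph\<close>

lemma graph_total: "\<exists>w. (v, w) \<in> graph"
proof -
  have "vsa_generated V (range \<iota>) \<subseteq> fst ` graph"
  proof (rule U.generated_minimal)
    show "range \<iota> \<subseteq> fst ` graph" using pair_graph by (force simp: pair_def)
    show "vertex_subalgebra V (fst ` graph)"
      unfolding vertex_subalgebra_def
    proof (intro conjI ballI allI)
      show "complex_vector.subspace (fst ` graph)"
        by (rule clinear_subspace_image[OF clinear_fst D.G.total_subspace])
      show "vac V \<in> fst ` graph" using D.G.w_total by force
      fix a b n assume "a \<in> fst ` graph" "b \<in> fst ` graph"
      then show "nprod V a n b \<in> fst ` graph" using graph_closed by force
    qed
  qed
  then show ?thesis unfolding generated by force
qed

definition \<Phi> where "\<Phi> v = (SOME w. (v, w) \<in> graph)"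

lemma \<Phi>_graph: "(v, \<Phi> v) \<in> graph"
  unfolding \<Phi>_def by (rule someI_ex[OF graph_total])

lemma \<Phi>_eqI: "(v, w) \<in> graph \<Longrightarrow> \<Phi> v = w"
proof -
  assume "(v, w) \<in> graph"
  then have "(v, \<Phi> v) - (v, w) \<in> graph"
    using complex_vector.subspace_diff[OF D.G.total_subspace \<Phi>_graph] by blast
  then show ?thesis using graph_functional[of "\<Phi> v - w"] by (simp add: minus_prod_def)
qed

lemma clinear_\<Phi>: "clinear \<Phi>"
proof (rule clinearI)
  fix v w r
  show "\<Phi> (v + w) = \<Phi> v + \<Phi> w"
    using complex_vector.subspace_add[OF D.G.total_subspace \<Phi>_graph \<Phi>_graph, of v w]
    by (intro \<Phi>_eqI) (simp add: plus_prod_def)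
  show "\<Phi> (r *\<^sub>C v) = r *\<^sub>C \<Phi> v"
    using complex_vector.subspace_scale[OF D.G.total_subspace \<Phi>_graph, of r v]
    by (intro \<Phi>_eqI) (simp add: scaleC_prod_def)
qed

lemma \<Phi>_gens: "\<Phi> (\<iota> a) = O.gens a"
  using pair_graph[of a] by (intro \<Phi>_eqI) (simp add: pair_def)

lemma \<Phi>_vac: "\<Phi> (vac V) = vac WW"
  using D.G.w_total by (intro \<Phi>_eqI) simp

lemma \<Phi>_nprod: "\<Phi> (nprod V a n b) = wp (\<Phi> a) n (\<Phi> b)"
  using graph_closed[OF \<Phi>_graph \<Phi>_graph, of a n b] by (intro \<Phi>_eqI) simp

text \<open>D is spanned by parity-homogeneous pairs. The component of \<open>(v, \<Phi> v)\<close>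
  of the wrong parity has first component 0, hence is 0 by \<open>graph_functional\<close>.\<close>

lemma \<Phi>_part: "v \<in> part V i \<Longrightarrow> \<Phi> v \<in> part WW i"
proof -
  assume v: "v \<in> part V i"
  have "graph \<subseteq> D.homog_closure graph"
    unfolding D.G.total_def
  proof (intro complex_vector.span_minimal D.homog_closure_subspace complex_vector.subspace_span subsetI)
    fix x assume "x \<in> {v. \<exists>g. D.G.mon g v}"
    then obtain n s where "D.G.mon (n, s) x" by auto
    then show "x \<in> D.homog_closure (complex_vector.span {v. \<exists>g. D.G.mon g v})"
      using D.Mon_parity[of n s] D.G.mon_Mon[of "(n, s)" x]
      by (intro D.homog_closure_homog[of _ _ "odd s"]) (auto intro: complex_vector.span_base)
  qed
  then obtain x0 x1 where x: "x0 \<in> graph" "x0 \<in> part XX False" "x1 \<in> graph" "x1 \<in> part XX True" "(v, \<Phi> v) = x0 + x1"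
    using \<Phi>_graph[of v] unfolding D.homog_closure_def by blast
  have f: "v = fst x0 + fst x1" "\<Phi> v = snd x0 + snd x1"
    using arg_cong[OF x(5), of fst] arg_cong[OF x(5), of snd] by simp_all
  show ?thesis
  proof (cases i)
    case True
    have "fst x0 = v - fst x1" using f by simp
    then have "fst x0 \<in> part V True" using v True x(4) complex_vector.subspace_diff[OF U.part_subspace] by auto
    then have "fst x0 = 0" using x(2) U.part_inter by auto
    then have "snd x0 = 0" using graph_functional x(1) by (metis prod.collapse)
    then show ?thesis using f x(4) True by auto
  next
    case False
    have "fst x1 = v - fst x0" using f by simp
    then have "fst x1 \<in> part V False" using v False x(2) complex_vector.subspace_diff[OF U.part_subspace] by auto
    then have "fst x1 = 0" using x(4) U.part_inter by auto
    then have "snd x1 = 0" using graph_functional x(3) by (metis prod.collapse)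
    then show ?thesis using f x(2) False by auto
  qed
qed

lemma \<Phi>_hom: "vsa_hom V WW \<Phi>"
  unfolding vsa_hom_def using clinear_\<Phi> \<Phi>_part \<Phi>_vac \<Phi>_nprod by blast

lemma \<Phi>_generated: "\<Phi> ` vsa_generated V (\<iota> ` B) = vsa_generated WW (O.gens ` B)"
proof
  have "vsa_generated V (\<iota> ` B) \<subseteq> {a. \<Phi> a \<in> vsa_generated WW (O.gens ` B)}"
  proof (rule U.generated_minimal)
    show "vertex_subalgebra V {a. \<Phi> a \<in> vsa_generated WW (O.gens ` B)}"
      by (auto simp: vertex_subalgebra_def \<Phi>_nprod \<Phi>_vac WV.generatedD
        intro!: clinear_subspace_vimage[OF clinear_\<Phi>])
  qed (auto simp: \<Phi>_gens WV.generated_base)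
  then show "\<Phi> ` vsa_generated V (\<iota> ` B) \<subseteq> vsa_generated WW (O.gens ` B)" by blast
  show "vsa_generated WW (O.gens ` B) \<subseteq> \<Phi> ` vsa_generated V (\<iota> ` B)"
  proof (rule WV.generated_minimal)
    show "vertex_subalgebra WW (\<Phi> ` vsa_generated V (\<iota> ` B))"
      unfolding vertex_subalgebra_def
    proof (intro conjI ballI allI)
      show "complex_vector.subspace (\<Phi> ` vsa_generated V (\<iota> ` B))"
        by (rule clinear_subspace_image[OF clinear_\<Phi> U.generatedD(1)])
      show "vac WW \<in> \<Phi> ` vsa_generated V (\<iota> ` B)" using U.generatedD(2) \<Phi>_vac by (metis imageI)
      fix a b n assume "a \<in> \<Phi> ` vsa_generated V (\<iota> ` B)" "b \<in> \<Phi> ` vsa_generated V (\<iota> ` B)"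
      then show "wp a n b \<in> \<Phi> ` vsa_generated V (\<iota> ` B)"
        using U.generatedD(3) by (auto simp flip: \<Phi>_nprod)
    qed
    show "O.gens ` B \<subseteq> \<Phi> ` vsa_generated V (\<iota> ` B)"
      using U.generated_base by (force simp flip: \<Phi>_gens)
  qed
qed

lemma coset_omega_commutant: "coset_omega \<in> commutant WW (\<Phi> ` vsa_generated V {\<iota> osp_e, \<iota> osp_f, \<iota> osp_h}) (range \<Phi>)"
proof -
  have r: "range \<Phi> = vsa_generated WW (range O.gens)" using \<Phi>_generated[of UNIV] by (simp add: generated)
  have "\<Phi> ` vsa_generated V {\<iota> osp_e, \<iota> osp_f, \<iota> osp_h} = vsa_generated WW (O.gens ` {osp_e, osp_f, osp_h})"
    using \<Phi>_generated[of "{osp_e, osp_f, osp_h}"] by simp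
  moreover have "wp a n coset_omega = 0" if "a \<in> vsa_generated WW (O.gens ` {osp_e, osp_f, osp_h})" "n \<ge> 0" for a n
  proof (rule WV.generated_annihilates[OF _ _ that])
    fix x assume "x \<in> O.gens ` {osp_e, osp_f, osp_h}"
    then obtain b where b: "x = O.gens b" "b \<in> {osp_e, osp_f, osp_h}" by blast
    then show "x \<in> part WW False" using gen_parts by auto
    show "wp x n coset_omega = 0" if "n \<ge> 0" for n unfolding b(1) by (rule gens_coset_omega[OF b(2) that])
  qed
  ultimately show ?thesis using coset_omega_generated by (simp add: commutant_def r)
qed

end

section \<open>The vectors of the theorem in terms of the realization\<close>

context realization begin

lemma G_Psi: "G_Psi L G F \<Psi> = GP"
  unfolding G_Psi_def SV.np_vac using Gs_prod(3) by (simp add: Gs_def Ps_def)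

lemma fermion_omega: "fermion_omega F \<Psi> = F.\<omega>F"
  by (simp add: fermion_omega_def F.\<omega>F_def F.np_vac)

lemma mode_realizations:
  "wp ((vac L \<otimes> \<Psi>) \<otimes> vac P) (- 2) (vS \<otimes> b) = dPs \<otimes> b"
  "wp (a \<otimes> vac P) (- 1) (vS \<otimes> b) = a \<otimes> b"
  "wp (vS \<otimes> H.st H.\<nu> 0) n (vS \<otimes> b) = vS \<otimes> Nm n b"
  using dPs_np[of "- 1" vS] unfolding W.VW_left W_right SV.np_vac H.Nm_def
  by (simp_all add: Ps_def scaleC_one)

end

theorem theorem11p3:
  fixes p q :: int and k :: real
    and V :: "'v::complex_vector vsa" and \<iota> :: "osp12_basis \<Rightarrow> 'v"
    and L :: "'l::complex_vector vsa" and \<omega> G :: 'l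
    and F :: "'f::complex_vector vsa" and \<Psi> :: 'f
    and M :: "'m::complex_vector vsa" and c d :: 'm
    and P :: "('m, int \<Rightarrow>\<^sub>0 complex) tensor vsa"
  assumes "p \<ge> 2" and "q \<ge> 2" and "even (p - q)" and "gcd ((p - q) div 2) q = 1"
    and "k + 3 / 2 = of_int p / (2 * of_int q)"
    and "simple_affine_osp12 (of_real k) V \<iota>"
    and "simple_neveu_schwarz (c_pq p q) L \<omega> G"
    and "free_fermion F \<Psi>"
    and "heisenberg_vsa M c d"
    and "half_lattice_vsa M c d P"
  shows
    "let K = complex_of_real k;
         S = tensor_vsa L F;
         W = tensor_vsa S P;
         \<mu> = (1 / 2) *\<^sub>C d + (K / 4) *\<^sub>C c;
         \<nu> = (1 / 2) *\<^sub>C d - (K / 4) *\<^sub>C c;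
         Gm = (\<lambda>n. nprod W ((G \<otimes> vac F) \<otimes> vac P) n);
         \<Psi>m = (\<lambda>n. nprod W ((vac L \<otimes> \<Psi>) \<otimes> vac P) n);
         \<mu>m = (\<lambda>n. nprod W (vac S \<otimes> (\<mu> \<otimes> Poly_Mapping.single 0 1)) n);
         \<nu>m = (\<lambda>n. nprod W (vac S \<otimes> (\<nu> \<otimes> Poly_Mapping.single 0 1)) n);
         ex = (\<lambda>s::int. vac S \<otimes> (vac M \<otimes> Poly_Mapping.single s 1));
         \<omega>l = omega_left p q L \<omega> G F \<Psi> \<otimes> vac P;
         \<omega>r = omega_right p q L \<omega> G F \<Psi> \<otimes> vac P;
         root2 = complex_of_real (sqrt 2);
         rootk = \<i> * complex_of_real (sqrt (2 * k + 3))
     in \<exists>\<Phi>. vsa_hom V W \<Phi> \<and> (\<exists>v. \<Phi> v \<noteq> 0) \<and>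
          \<Phi> (\<iota> osp_e) = ex 2 \<and>
          \<Phi> (\<iota> osp_h) = 2 *\<^sub>C \<mu>m (- 1) (vac W) \<and>
          \<Phi> (\<iota> osp_f) =
            (K + 2) *\<^sub>C nprod W \<omega>l (- 1) (ex (- 2))
            - \<nu>m (- 1) (\<nu>m (- 1) (ex (- 2)))
            - (K + 1) *\<^sub>C \<nu>m (- 2) (ex (- 2)) \<and>
          \<Phi> (\<iota> osp_x) = root2 *\<^sub>C \<Psi>m (- 1) (ex 1) \<and>
          \<Phi> (\<iota> osp_y) = root2 *\<^sub>C
            (- (rootk / 2) *\<^sub>C Gm (- 1) (ex (- 1))
             + \<Psi>m (- 1) (\<nu>m (- 1) (ex (- 1)))
             + ((2 * K + 1) / 2) *\<^sub>C \<Psi>m (- 2) (ex (- 1))) \<and>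
          \<omega>r \<in> commutant W
            (\<Phi> ` vsa_generated V {\<iota> osp_e, \<iota> osp_f, \<iota> osp_h}) (range \<Phi>)"
proof -
  define K where "K = complex_of_real k"
  define t where "t = (of_int p / of_int q :: complex)"
  define \<kappa> where "\<kappa> = \<i> * complex_of_real (sqrt (2 * k + 3))"
  define \<rho> where "\<rho> = complex_of_real (sqrt 2)"
  have pos: "(of_int p :: real) > 0" "(of_int q :: real) > 0" using assms(1,2) by simp_all
  have c0: "(of_int p :: complex) \<noteq> 0" "(of_int q :: complex) \<noteq> 0" "(of_int p + of_int q :: complex) \<noteq> 0"
    using assms(1,2) by (simp_all flip: of_int_add)
  have tk: "2 * k + 3 = of_int p / of_int q" using assms(5) pos by (simp add: field_simps)
  have tr: "t = complex_of_real (2 * k + 3)" by (simp add: t_def tk)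
  \<comment> \<open>This matches the coefficient i sqrt(pq) of the two conformal vectors with
    \<kappa> q.\<close>
  have sqrt_t: "sqrt (2 * k + 3) = sqrt (of_int (p * q)) / of_int q"
  proof -
    have "2 * k + 3 = of_int (p * q) / (of_int q * of_int q)" using pos by (simp only: tk) simp
    then show ?thesis by (simp only: real_sqrt_divide real_sqrt_abs2) (use pos in simp)
  qed
  interpret R: osp_realization "c_pq p q" L \<omega> G F \<Psi> M c d P K t \<kappa> \<rho> V \<iota>
  proof (intro osp_realization.intro realization.intro osp_realization_axioms.intro realization_axioms.intro
      neveu_schwarz.intro fermion.intro half_lattice.intro half_lattice_axioms.intro heisenberg.intro
      affine_osp.intro affine_osp_axioms.intro vsa.intro)
    have "\<kappa> * \<kappa> = (\<i> * \<i>) * complex_of_real (sqrt (2 * k + 3) * sqrt (2 * k + 3))"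
      by (simp only: \<kappa>_def of_real_mult mult_ac)
    moreover have "sqrt (2 * k + 3) * sqrt (2 * k + 3) = 2 * k + 3"
      using pos by (intro real_sqrt_mult_self[THEN trans] abs_of_nonneg) (simp add: tk)
    ultimately show "\<kappa> * \<kappa> = - t" by (simp add: tr)
    show "c_pq p q * t = 3 * t / 2 - 3 * (t - 1)\<^sup>2"
      using c0 by (simp add: c_pq_def t_def field_simps power2_eq_square)
    show "K = (t - 3) / 2" by (simp add: K_def tr)
    show "t \<noteq> 0" using c0 by (simp add: t_def)
    show "t \<noteq> - 1" using c0 by (auto simp: t_def field_simps)
    show "\<rho> * \<rho> = 2" by (simp add: \<rho>_def flip: of_real_mult)
    show "of_int s \<noteq> 2 * K + 2" if "even s" for s
    proof
      assume s: "of_int s = 2 * K + 2"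
      obtain j where j: "s = 2 * j" using \<open>even s\<close> by (rule evenE)
      have "complex_of_real (of_int s) = complex_of_real (2 * k + 2)" using s by (simp add: K_def)
      then have "of_int s = 2 * k + 2" by (simp only: of_real_eq_iff)
      \<comment> \<open>The equation s = 2k + 2 means p/q = s + 1. Then (p - q)/2 = q s/2 with s
        even is a multiple of q, and the gcd would be q \<ge> 2.\<close>
      then have "of_int p = (of_int (q * (s + 1)) :: real)" using tk pos by (simp add: field_simps)
      then have "p = q * (s + 1)" by (simp only: of_int_eq_iff)
      then have "(p - q) div 2 = q * j" by (simp add: j algebra_simps)
      then show False using assms(2,4) by simp
    qed
  qed (use assms in \<open>simp_all add: simple_affine_osp12_def simple_vsa_def K_def\<close>)
  have Kt: "K = (t - 3) / 2" by (rule R.K)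
  have i: "\<i> * complex_of_real (sqrt (of_int (p * q))) = \<kappa> * of_int q"
    using pos by (simp add: \<kappa>_def sqrt_t)
  have pq: "of_int p = t * of_int q" using c0 by (simp add: t_def)
  have t1: "t + 1 \<noteq> 0" using R.t0(2) by (simp add: eq_neg_iff_add_eq_0)
  have den: "of_int (p + q) = (t + 1) * of_int q" by (simp add: pq algebra_simps)
  have coeffs: "of_int p / of_int (p + q) = t / (t + 1)" "of_int q / of_int (p + q) = 1 / (t + 1)"
    "\<i> * complex_of_real (sqrt (of_int (p * q))) / of_int (p + q) = \<kappa> / (t + 1)"
    "of_int (2 * q - p) / of_int (p + q) = (2 - t) / (t + 1)"
    "of_int (2 * p - q) / of_int (p + q) = (2 * t - 1) / (t + 1)"
    unfolding i den using c0 t1 by (simp_all add: pq divide_simps) (simp_all add: algebra_simps)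
  have K2: "K + 2 = (t + 1) / 2" by (simp add: Kt field_simps)
  have cancel: "u / 2 * (x / u) = x / 2" "inverse (r * u) * (r * x) = x / u" "inverse (r * u) * (x * r) = x / u"
    "inverse (r * u) * r = 1 / u" if "u \<noteq> 0" "r \<noteq> 0" for u r x :: complex
    using that by (simp_all add: field_simps)
  note h = cancel[OF t1 R.t0(1)]
  \<comment> \<open>The factor K + 2 = (t + 1)/2 cancels the common denominator t + 1 of the three
    coefficients.\<close>
  have left: "(K + 2) *\<^sub>C omega_left p q L \<omega> G F \<Psi> = R.Ol"
    unfolding omega_left_def R.Ol_def R.G_Psi R.fermion_omega R.ws_def[symmetric] R.wF_def[symmetric] coeffs K2
    by (simp only: scaleC_add_right scaleC_scaleC h(1))
  have right: "omega_right p q L \<omega> G F \<Psi> \<otimes> vac P = inverse (t * (t + 1)) *\<^sub>C R.coset_omega"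
    unfolding omega_right_def R.coset_omega_def R.G_Psi R.fermion_omega R.ws_def[symmetric] R.wF_def[symmetric] coeffs R.H.vacP
    by (simp only: scaleC_add_right scaleC_scaleC complex_vector.scale_right_diff_distrib tensor_simps h)
  \<comment> \<open>The conformal vector is a scalar multiple of \<open>coset_omega\<close>, and
    both membership in the image and annihilation are preserved by scaling.\<close>
  have com: "omega_right p q L \<omega> G F \<Psi> \<otimes> vac P \<in> commutant R.WW
      (R.\<Phi> ` vsa_generated V {\<iota> osp_e, \<iota> osp_f, \<iota> osp_h}) (range R.\<Phi>)"
    using R.coset_omega_commutant clinear_subspace_image[OF R.clinear_\<Phi> complex_vector.subspace_UNIV]
    unfolding right by (auto simp: commutant_def R.WV.np_simps complex_vector.subspace_scale)
  have gens: "R.\<Phi> (\<iota> osp_e) = R.eW" "R.\<Phi> (\<iota> osp_f) = R.fW" "R.\<Phi> (\<iota> osp_h) = R.hW"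
    "R.\<Phi> (\<iota> osp_x) = R.xW" "R.\<Phi> (\<iota> osp_y) = R.yW"
    by (simp_all add: R.\<Phi>_gens)
  have t2: "(t - 2) / 2 = (2 * K + 1) / 2" by (simp add: R.t_K)
  show ?thesis
    unfolding Let_def K_def[symmetric] \<kappa>_def[symmetric] \<rho>_def[symmetric] R.H.\<mu>_def[symmetric]
      R.H.\<nu>_def[symmetric] R.H.ex_def[symmetric] R.mode_realizations R.WV.np_vac
  proof (intro exI[of _ R.\<Phi>] conjI)
    show "\<exists>v. R.\<Phi> v \<noteq> 0" using R.\<Phi>_vac R.WV.vac_nonzero by metis
    show "R.\<Phi> (\<iota> osp_f) = (K + 2) *\<^sub>C (omega_left p q L \<omega> G F \<Psi> \<otimes> R.ex (- 2)) - R.vS \<otimes> R.Nm (- 1) (R.Nm (- 1) (R.ex (- 2)))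
        - (K + 1) *\<^sub>C (R.vS \<otimes> R.Nm (- 2) (R.ex (- 2)))"
      by (simp add: gens R.fW_def R.H.QP_def left[symmetric] tensor_simps)
  qed (use R.\<Phi>_hom com in \<open>simp_all add: gens R.eW_def R.hW_def R.xW_def R.x1_def R.yW_def R.y1_def R.Ps_def R.Gs_def t2\<close>)
qed

end
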